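(* Let $N\ge2$. There is an embedding of deformed W-algebras $$\mathcal W^{\mathrm{sub}}_{\mathfrak q,\mathfrak t}(\mathfrak{sl}(N))\hookrightarrow \mathcal W_{\mathfrak q,\mathfrak t}(\mathfrak{sl}(N))\otimes\mathcal H_2,$$ where $\mathcal W^{\mathrm{sub}}_{\mathfrak q,\mathfrak t}(\mathfrak{sl}(N))$ is given in the free field realization attached to the quiver $\mathcal Q_N^{\mathrm{sub}}$, $\mathcal W_{\mathfrak q,\mathfrak t}(\mathfrak{sl}(N))$ is given in its standard free field realization, and $\mathcal H_2$ is a rank two Heisenberg algebra. In terms of generators, $$G^-(z)\in\mathcal H_2,\qquad G^+(z)=\sum_{k=0}^{N}A_k(z)\,W_k\bigl(q_3^{(k-1)/2}z\bigr),\qquad A_k(z)\in\mathcal H_2,$$ where $W_k(z)$ is the spin $k$ current of $\mathcal W_{\mathfrak q,\mathfrak t}(\mathfrak{sl}(N))$ (with $W_0(z)=W_N(z)=1$). Under this embedding the higher generators satisfy $\mathcal K_1(z),\mathcal K_N^+(z)\in\mathcal H_2$ and (for $N\ge 3$) $$\mathcal K_2(z)=B_0(z)+B_1(z)W_1(z),\qquad B_0(z),B_1(z)\in\mathcal H_2.$$ (Here "a current belongs to an algebra" means its modes do.)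
   Context: **Parameters.** $q_1,q_2,q_3\in\mathbb C^\times$ satisfy $q_1q_2q_3=1$ and are otherwise generic ($q_1^aq_2^bq_3^c=1$ for integers only if $a=b=c$); $q=q_2^{1/2}$. $(\mathfrak q,\mathfrak t)=(q_2,q_1^{-1})$. $f^{[n]}$ denotes $f$ with $q$, $q_c$ and arrow labels replaced by their $n$-th powers. $\delta(x)=\sum_{n\in\mathbb Z}x^n$. **Seeds.** A decorated quiver has vertices that are unfrozen, frozen of type $+$ or frozen of type $-$, and arrows $a$ with labels $\kappa_a\in\mathbb C^\times$. Put $\epsilon_{ii}=0$, $\epsilon_{ij}=\#(i\to j)-\#(j\to i)$ for $i\ne j$, $C_{ij}=(q-q^{-1})c_{ij}$, $c_{ii}=(q-q^{-1})-\sum_{\ell:i\to i}(q\kappa_\ell-q^{-1}\kappa_\ell^{-1})$ for $i$ unfrozen, $c_{ii}=\mp q^{\mp1}$ for $i$ frozen of type $\pm$ (no loops), $c_{ij}=\sum_{a:i\to j}q^{-1}\kappa_a^{-1}-\sum_{a:j\to i}q\kappa_a$ for $i\ne j$. $\mathcal A_{\mathcal Q}$ is the (suitably completed) algebra generated by $X_i^{\pm1}$, $x_{i,n}$ ($n\ne0$) with $X_iX_j=q^{2\epsilon_{ij}}X_jX_i$, $[X_i,x_{j,n}]=0$, $[x_{i,n},x_{j,m}]=\frac{\delta_{n+m,0}}nC_{ij}^{[n]}$ for $n>0$ (modes of the same sign commute). $X_i(z)=X_ie^{\sum_{n>0}z^nx_{i,-n}}e^{\sum_{n>0}z^{-n}x_{i,n}}$.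 Normal ordering $:\ :$ puts $x_{i,n}$, $n>0$, to the right and on zero modes satisfies $X_i:\prod_jX_j^{n_j}:=q^{\sum_j\epsilon_{ij}n_j}:X_i\prod_jX_j^{n_j}:$. **Quiver $\mathcal Q_N^{\mathrm{sub}}$.** Frozen $0$ (type $-$), frozen $N+1$ (type $+$), unfrozen $1,\dots,N$; arrows: $i\to i+1$ (label $1$) and $i+1\to i$ (label $q_3$) for $1\le i\le N-1$; a loop of label $q_1$ at each $i=2,\dots,N$; $1\to0$ (label $q_1$); $N+1\to1$ (label $1$); $N-1$ arrows $0\to N+1$ with labels $q_3,1,q_3^{-1},\dots,q_3^{3-N}$. The zero modes $X_2,\dots,X_N$ are central. The matrix $C$ has rank $N+1$; the corresponding central combinations of the $x_{i,n}$ (one for each $n\ne0$) are set to $0$, as in a free field realization on a Heisenberg algebra of minimal rank. Roots of central zero modes may be adjoined. **The algebra $\mathcal W^{\mathrm{sub}}_{\mathfrak q,\mathfrak t}(\mathfrak{sl}(N))$** is the subalgebra of $\mathcal A_{\mathcal Q_N^{\mathrm{sub}}}$ generated by the modes of $G^-(z)=X_0(z)$ and $$G^+(z)=:X_{N+1}(z)\bigl(1+X_1(z)\cdots X_N(z)T\bigr)\bigl(1+X_1(z)\cdots X_{N-1}(z)T\bigr)\cdots\bigl(1+X_1(z)T\bigr)\cdot1:,$$ $T$ being the shift operator $Tz=q_3zT$, $T\cdot1=1$. The higher generators $\mathcal K_n(z)$ ($1\le n\le N-1$), $\mathcal K_N^+(z)$ are the currents determined by $$[G^+(z),G^-(w)]=\sum_{n=1}^{N-1}\delta(q_3^{2-n}w/z)\,\mathcal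 K_n(w)+\delta(q_2q_3^{2-N}w/z)\,\mathcal K_N^+(z).$$ **Standard realization of $\mathcal W_{\mathfrak q,\mathfrak t}(\mathfrak{sl}(N))$.** Let $\lambda_{i,k}$ ($1\le i\le N$, $k\in\mathbb Z$) satisfy $[\lambda_{i,k},\lambda_{j,l}]=-\frac1k(1-q_1^k)(1-q_2^k)\delta_{k+l,0}\,\theta_{ij}$ for $k>0$, with $\theta_{ij}=\frac{1-q_3^k}{1-q_3^{-kN}}q_3^{-kN}$ for $i<j$, $\frac{1-q_3^{-k(N-1)}}{1-q_3^{-kN}}$ for $i=j$, $\frac{1-q_3^k}{1-q_3^{-kN}}$ for $i>j$; $\lambda_{i,0}$ central; and $\sum_{i=1}^Nq_3^{-ik}\lambda_{i,k}=0$ for all $k$. Put $\Lambda_i(z)=q_3^{\,i-(N+1)/2}e^{\sum_{k>0}z^k\lambda_{i,-k}}e^{\sum_{k>0}z^{-k}\lambda_{i,k}}e^{\tau\lambda_{i,0}}$ with $\tau=\sqrt{-(\log q_1)(\log q_2)}$. The spin $k$ currents are $W_k(q_3^{(k-1)/2}z)=\sum_{1\le j_1<\cdots<j_k\le N}:\Lambda_{j_1}(z)\Lambda_{j_2}(q_3z)\cdots\Lambda_{j_k}(q_3^{k-1}z):$, and $\mathcal W_{\mathfrak q,\mathfrak t}(\mathfrak{sl}(N))$ is the algebra generated by their modes. **Rank two Heisenberg algebra**: an algebra generated by zero modes (a quantum torus) and, for each $n\neq0$, two independent oscillator modes with non-degenerate pairing between modes $n$ and $-n$. *)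

theory Defs
  imports Complex_Main "HOL-Library.Poly_Mapping"
begin

section \<open>Linear operators on a vector space with a distinguished basis\<close>

text \<open>The space with basis \<open>'b\<close> is \<open>'b \<Rightarrow>\<^sub>0 complex\<close>.  Its linear endomorphisms form
  a ring under composition; \<open>csc c\<close> is the scalar \<open>c\<close>.\<close>

abbreviation lookup :: "('a \<Rightarrow>\<^sub>0 'b::zero) \<Rightarrow> 'a \<Rightarrow> 'b" where "lookup \<equiv> Poly_Mapping.lookup"
abbreviation keys :: "('a \<Rightarrow>\<^sub>0 'b::zero) \<Rightarrow> 'a set" where "keys \<equiv> Poly_Mapping.keys"
abbreviation single :: "'a \<Rightarrow> 'b::zero \<Rightarrow> ('a \<Rightarrow>\<^sub>0 'b)" where "single \<equiv> Poly_Mapping.single"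

type_synonym 'b vec = "'b \<Rightarrow>\<^sub>0 complex"

definition scl :: "complex \<Rightarrow> 'b vec \<Rightarrow> 'b vec" where
  "scl c v = Poly_Mapping.map ((*) c) v"

lemma lookup_scl [simp]: "lookup (scl c v) b = c * lookup v b"
  by (cases "lookup v b = 0") (simp_all add: scl_def Poly_Mapping.map.rep_eq)

lemma scl_add: "scl c (u + v) = scl c u + scl c v"
  by (rule poly_mapping_eqI) (simp add: lookup_add algebra_simps)

lemma scl_scl: "scl c (scl d v) = scl (c * d) v"
  by (rule poly_mapping_eqI) (simp add: algebra_simps)

lemma scl_zero [simp]: "scl c 0 = 0" "scl 0 v = 0"
  by (rule poly_mapping_eqI, simp)+

lemma scl_one [simp]: "scl 1 v = v"
  by (rule poly_mapping_eqI) simp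

lemma scl_plus: "scl (c + d) v = scl c v + scl d v"
  by (rule poly_mapping_eqI) (simp add: lookup_add algebra_simps)

lemma scl_uminus: "scl c (- v) = - scl c v"
  by (rule poly_mapping_eqI) simp

lemma scl_diff: "scl c (u - v) = scl c u - scl c v"
  by (rule poly_mapping_eqI) (simp add: lookup_minus right_diff_distrib)

lemma scl_single: "scl c (single b d) = single b (c * d)"
  by (rule poly_mapping_eqI) (simp add: lookup_single when_def)

lemma scl_sum: "scl c (sum f A) = (\<Sum>x\<in>A. scl c (f x))"
  by (induction A rule: infinite_finite_induct) (simp_all add: scl_add)

typedef 'b lop = "{f :: 'b vec \<Rightarrow> 'b vec.
    (\<forall>u v. f (u + v) = f u + f v) \<and> (\<forall>c v. f (scl c v) = scl c (f v))}"
  morphisms app Lop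
  by (rule exI[of _ id]) simp

setup_lifting type_definition_lop

lemma lop_eqI: "(\<And>v. app a v = app b v) \<Longrightarrow> a = b"
  by (metis app_inject ext)

lemma app_add: "app a (u + v) = app a u + app a v"
  using app[of a] by simp

lemma app_scl: "app a (scl c v) = scl c (app a v)"
  using app[of a] by simp

instantiation lop :: (type) ring_1
begin

lift_definition zero_lop :: "'a lop" is "\<lambda>_. 0" by simp
lift_definition one_lop :: "'a lop" is "\<lambda>v. v" by simp
lift_definition plus_lop :: "'a lop \<Rightarrow> 'a lop \<Rightarrow> 'a lop" is "\<lambda>f g v. f v + g v"
  by (simp add: scl_add add_ac)
lift_definition uminus_lop :: "'a lop \<Rightarrow> 'a lop" is "\<lambda>f v. - f v"
  by (simp add: scl_uminus)
lift_definition minus_lop :: "'a lop \<Rightarrow> 'a lop \<Rightarrow> 'a lop" is "\<lambda>f g v. f v - g v"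
  by (simp add: scl_diff)
lift_definition times_lop :: "'a lop \<Rightarrow> 'a lop \<Rightarrow> 'a lop" is "\<lambda>f g v. f (g v)"
  by simp

instance
proof
  show "(0 :: 'a lop) \<noteq> 1"
  proof
    assume "(0 :: 'a lop) = 1"
    then have "app 0 (single undefined 1 :: 'a vec) = app 1 (single undefined 1)" by simp
    then have "(0 :: 'a vec) = single undefined 1"
      by (simp only: zero_lop.rep_eq one_lop.rep_eq)
    then show False by (metis lookup_single_eq lookup_zero zero_neq_one)
  qed
qed (rule lop_eqI;
  simp add: zero_lop.rep_eq one_lop.rep_eq plus_lop.rep_eq uminus_lop.rep_eq minus_lop.rep_eq
    times_lop.rep_eq add_ac app_add)+

end

lift_definition csc :: "complex \<Rightarrow> 'b lop" is scl
  by (simp add: scl_add scl_scl mult.commute)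

definition lin :: "('b \<Rightarrow> 'c vec) \<Rightarrow> 'b vec \<Rightarrow> 'c vec" where
  "lin f v = (\<Sum>b\<in>keys v. scl (lookup v b) (f b))"

lemma lin_superset:
  assumes "finite S" "keys v \<subseteq> S"
  shows "lin f v = (\<Sum>b\<in>S. scl (lookup v b) (f b))"
  unfolding lin_def using assms
  by (intro sum.mono_neutral_left) (auto simp: in_keys_iff)

lemma lin_add: "lin f (u + v) = lin f u + lin f v"
proof -
  let ?S = "keys u \<union> keys v"
  have "keys (u + v) \<subseteq> ?S" by (rule Poly_Mapping.keys_add)
  then show ?thesis
    by (subst (1 2 3) lin_superset[of ?S])
       (auto simp: lookup_add scl_plus sum.distrib)
qed

lemma lin_scl: "lin f (scl c v) = scl c (lin f v)"
proof -
  have "keys (scl c v) \<subseteq> keys v" by (auto simp: in_keys_iff)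
  then show ?thesis
    by (subst (1 2) lin_superset[of "keys v"]) (auto simp: scl_sum scl_scl)
qed

lemma lin_single [simp]: "lin f (single b c) = scl c (f b)"
  by (cases "c = 0") (simp_all add: lin_def)

lift_definition lopb :: "('b \<Rightarrow> 'b vec) \<Rightarrow> 'b lop" is lin
  by (simp add: lin_add lin_scl)

definition bvec :: "'b \<Rightarrow> 'b vec" where
  "bvec b = single b 1"

lemma lop_eq_basis:
  fixes a a' :: "'b lop"
  assumes "\<And>b. app a (bvec b) = app a' (bvec b)"
  shows "a = a'"
proof (rule lop_eqI)
  have app_sum: "app c (sum f B) = (\<Sum>x\<in>B. app c (f x))" for c :: "'b lop" and f :: "'b \<Rightarrow> 'b vec" and B
  proof (induction B rule: infinite_finite_induct)
    case (insert x B) then show ?case by (simp add: app_add)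
  qed (use app_scl[of c 0 0] in auto)
  fix v :: "'b vec"
  have v: "v = (\<Sum>b\<in>keys v. scl (lookup v b) (bvec b))"
    by (rule poly_mapping_eqI)
       (auto simp: lookup_sum bvec_def lookup_single when_def in_keys_iff if_distrib cong: if_cong)
  have "app c v = (\<Sum>b\<in>keys v. scl (lookup v b) (app c (bvec b)))" for c :: "'b lop"
    using arg_cong[OF v, of "app c"] by (simp only: app_sum app_scl)
  then show "app a v = app a' v" using assms by simp
qed

lemma app_lopb [simp]: "app (lopb f) (bvec b) = f b"
  by (simp add: lopb.rep_eq bvec_def)

lemmas lop_simps = zero_lop.rep_eq one_lop.rep_eq plus_lop.rep_eq minus_lop.rep_eq
  times_lop.rep_eq csc.rep_eq app_add app_scl

text \<open>\<open>a \<otimes> 1\<close> and \<open>1 \<otimes> a\<close> on the tensor product of two such spaces.\<close>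

definition tensL :: "'b lop \<Rightarrow> ('b \<times> 'c) lop" where
  "tensL a = lopb (\<lambda>(b, c). lin (\<lambda>b'. bvec (b', c)) (app a (bvec b)))"

definition tensR :: "'c lop \<Rightarrow> ('b \<times> 'c) lop" where
  "tensR a = lopb (\<lambda>(b, c). lin (\<lambda>c'. bvec (b, c')) (app a (bvec c)))"

text \<open>Infinite sums of operators all but finitely many of which vanish on any given vector.\<close>

definition osums :: "('i \<Rightarrow> 'b lop) \<Rightarrow> 'b lop \<Rightarrow> bool" where
  "osums f a \<longleftrightarrow> (\<forall>v. finite {i. app (f i) v \<noteq> 0} \<and>
     app a v = (\<Sum>i | app (f i) v \<noteq> 0. app (f i) v))"

definition osum :: "('i \<Rightarrow> 'b lop) \<Rightarrow> 'b lop" where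
  "osum f = (THE a. osums f a)"

section \<open>Algebras of operators and their completions\<close>

inductive_set alg_gen :: "'b lop set \<Rightarrow> 'b lop set" for S where
  scalar: "csc c \<in> alg_gen S"
| gen: "s \<in> S \<Longrightarrow> s \<in> alg_gen S"
| add: "a \<in> alg_gen S \<Longrightarrow> b \<in> alg_gen S \<Longrightarrow> a + b \<in> alg_gen S"
| mult: "a \<in> alg_gen S \<Longrightarrow> b \<in> alg_gen S \<Longrightarrow> a * b \<in> alg_gen S"

text \<open>With a degree on the basis, an operator has degree \<open>d\<close> if it lowers degrees by \<open>d\<close>.\<close>

definition homogeneous :: "('b \<Rightarrow> nat) \<Rightarrow> int \<Rightarrow> 'b lop \<Rightarrow> bool" where
  "homogeneous deg d a \<longleftrightarrow>
     (\<forall>b. \<forall>b'\<in>keys (app a (bvec b)). int (deg b') = int (deg b) - d)"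

definition left_ideal :: "('b \<Rightarrow> nat) \<Rightarrow> 'b lop set \<Rightarrow> nat \<Rightarrow> 'b lop set" where
  "left_ideal deg S n = {(\<Sum>(a, b)\<leftarrow>ab. a * b) | ab.
     \<forall>(a, b)\<in>set ab. a \<in> S \<and> b \<in> S \<and> (\<exists>d\<ge>int n. homogeneous deg d b)}"

text \<open>The usual completion of a graded algebra \<open>S\<close> of modes: convergent series in the topology
  whose neighbourhoods of \<open>0\<close> are the left ideals generated by the elements of degree
  \<open>\<ge> n\<close>.  This topology is intrinsic to \<open>S\<close>, so completing a subalgebra does not adjoin
  limits which converge only in the ambient algebra.\<close>

definition completion :: "('b \<Rightarrow> nat) \<Rightarrow> 'b lop set \<Rightarrow> 'b lop set" where
  "completion deg S = {a. \<exists>s :: nat \<Rightarrow> 'b lop. (\<forall>j. s j \<in> S) \<and>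
     (\<forall>n. \<forall>\<^sub>F j in sequentially. s j \<in> left_ideal deg S n) \<and> osums s a}"

definition completed_tensor ::
  "('b \<Rightarrow> nat) \<Rightarrow> ('c \<Rightarrow> nat) \<Rightarrow> 'b lop set \<Rightarrow> 'c lop set \<Rightarrow> ('b \<times> 'c) lop set" where
  "completed_tensor degb degc S T =
     completion (\<lambda>(b, c). degb b + degc c) (alg_gen (tensL ` S \<union> tensR ` T))"

definition algebra_embedding :: "('b lop \<Rightarrow> 'c lop) \<Rightarrow> 'b lop set \<Rightarrow> 'c lop set \<Rightarrow> bool" where
  "algebra_embedding \<phi> S T \<longleftrightarrow> \<phi> ` S \<subseteq> T \<and> inj_on \<phi> S \<and> (\<forall>c. \<phi> (csc c) = csc c) \<and>
     (\<forall>a\<in>S. \<forall>b\<in>S. \<phi> (a + b) = \<phi> a + \<phi> b \<and> \<phi> (a * b) = \<phi> a * \<phi> b)"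

section \<open>Currents\<close>

text \<open>\<open>f :: int \<Rightarrow> 'b lop\<close> stands for the current \<open>\<Sum>\<^sub>m f m z\<^sup>-\<^sup>m\<close>.\<close>

type_synonym 'b current = "int \<Rightarrow> 'b lop"

definition one_current :: "'b current" where
  "one_current m = (if m = 0 then 1 else 0)"

definition rescale :: "complex \<Rightarrow> 'b current \<Rightarrow> 'b current" \<comment> \<open>\<open>f(z) \<mapsto> f(az)\<close>\<close> where
  "rescale a f m = csc (a powi (- m)) * f m"

definition current_mult :: "'b current \<Rightarrow> 'b current \<Rightarrow> 'b current" \<comment> \<open>\<open>f(z)g(z)\<close>\<close> where
  "current_mult f g m = osum (\<lambda>j::int. f (m - j) * g j)"

text \<open>The second condition says that the current can be applied to any vector.  It makes
  \<^const>\<open>current_mult\<close> of currents acting on different tensor factors well defined.\<close>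

definition current_in :: "'b current \<Rightarrow> 'b lop set \<Rightarrow> bool" where
  "current_in f S \<longleftrightarrow> (\<forall>m. f m \<in> S) \<and> (\<forall>v. \<exists>M. \<forall>m\<ge>M. app (f m) v = 0)"

text \<open>\<open>expc a k\<close> is the coefficient of \<open>z\<^sup>k\<close> in \<open>exp (\<Sum>\<^sub>n\<^sub>>\<^sub>0 z\<^sup>n a\<^sub>n)\<close>, and \<open>epow a j k\<close> that in
  the \<open>j\<close>-th power of the exponent.\<close>

primrec epow :: "(nat \<Rightarrow> 'b lop) \<Rightarrow> nat \<Rightarrow> nat \<Rightarrow> 'b lop" where
  "epow a 0 k = (if k = 0 then 1 else 0)"
| "epow a (Suc j) k = (\<Sum>n=1..k. a n * epow a j (k - n))"

definition expc :: "(nat \<Rightarrow> 'b lop) \<Rightarrow> nat \<Rightarrow> 'b lop" where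
  "expc a k = (\<Sum>j\<le>k. csc (1 / fact j) * epow a j k)"

text \<open>\<open>e exp (\<Sum>\<^sub>n\<^sub>>\<^sub>0 z\<^sup>n c\<^sub>n) exp (\<Sum>\<^sub>n\<^sub>>\<^sub>0 z\<^sup>-\<^sup>n d\<^sub>n)\<close>\<close>

definition vertex_op ::
  "'b lop \<Rightarrow> (nat \<Rightarrow> 'b lop) \<Rightarrow> (nat \<Rightarrow> 'b lop) \<Rightarrow> 'b current" where
  "vertex_op e c d m =
     osum (\<lambda>k. if int k \<ge> m then e * expc c (nat (int k - m)) * expc d k else 0)"

text \<open>A list \<open>[(i\<^sub>1, a\<^sub>1), \<dots>]\<close> stands for a normally ordered product
  \<open>:F\<^bsub>i\<^sub>1\<^esub>(a\<^sub>1z) F\<^bsub>i\<^sub>2\<^esub>(a\<^sub>2z) \<dots>:\<close>; \<open>cr i n\<close>, \<open>an i n\<close> are the modes \<open>-n\<close>, \<open>n\<close> of the \<open>i\<close>-th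
  field and \<open>e\<close> the normally ordered product of the zero modes.\<close>

type_synonym fword = "(nat \<times> complex) list"

definition normal_ordered ::
  "(nat \<Rightarrow> nat \<Rightarrow> 'b lop) \<Rightarrow> (nat \<Rightarrow> nat \<Rightarrow> 'b lop) \<Rightarrow> 'b lop \<Rightarrow> fword \<Rightarrow> 'b current" where
  "normal_ordered cr an e w = vertex_op e
     (\<lambda>n. \<Sum>(i, a)\<leftarrow>w. csc (a ^ n) * cr i n) (\<lambda>n. \<Sum>(i, a)\<leftarrow>w. csc (1 / a ^ n) * an i n)"

section \<open>Fock spaces\<close>

text \<open>A basis vector \<open>(g, \<alpha>)\<close> is a zero-mode lattice point together with a monomial in variables
  \<open>y\<^bsub>r,n\<^esub>\<close>.  A fixed algebra only involves the lattice directions and the variables in its range;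
  the remaining ones are inert.  The completed Heisenberg algebras act faithfully on such spaces
  (zero modes by the regular representation, positive modes by derivations) and are identified
  with their images.\<close>

type_synonym lattice = "nat \<Rightarrow>\<^sub>0 int"
type_synonym fock = "lattice \<times> ((nat \<times> nat) \<Rightarrow>\<^sub>0 nat)"

definition fdeg :: "fock \<Rightarrow> nat" where
  "fdeg = (\<lambda>(g, \<alpha>). \<Sum>(r, n)\<in>keys \<alpha>. n * lookup \<alpha> (r, n))"

definition mulY :: "nat \<Rightarrow> nat \<Rightarrow> fock lop" where
  "mulY r n = lopb (\<lambda>(g, \<alpha>). bvec (g, \<alpha> + single (r, n) 1))"

definition derY :: "nat \<Rightarrow> nat \<Rightarrow> fock lop" where
  "derY r n = lopb (\<lambda>(g, \<alpha>). scl (of_nat (lookup \<alpha> (r, n)))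
     (bvec (g, \<alpha> - single (r, n) 1)))"

text \<open>For a bimultiplicative \<open>\<sigma>\<close> these span a quantum torus,
  \<open>torus \<sigma> g * torus \<sigma> h = \<sigma> g h torus \<sigma> (g + h)\<close>, in its regular representation.\<close>

definition torus :: "(lattice \<Rightarrow> lattice \<Rightarrow> complex) \<Rightarrow> lattice \<Rightarrow> fock lop" where
  "torus \<sigma> g = lopb (\<lambda>(h, \<alpha>). scl (\<sigma> g h) (bvec (g + h, \<alpha>)))"

text \<open>Oscillators \<open>a\<^bsub>i,-n\<^esub>\<close> and \<open>a\<^bsub>i,n\<^esub>\<close> (\<open>n > 0\<close>) expressed through \<open>R\<close> free ones.  A pairing
  \<open>[a\<^bsub>i,n\<^esub>, a\<^bsub>j,-n\<^esub>] = M n i j\<close> is the identity \<open>\<Sum>r<R. v i n r * u j n r = M n i j\<close>.\<close>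

definition osc_neg :: "nat \<Rightarrow> (nat \<Rightarrow> nat \<Rightarrow> nat \<Rightarrow> complex) \<Rightarrow> nat \<Rightarrow> nat \<Rightarrow> fock lop" where
  "osc_neg R u i n = (\<Sum>r<R. csc (u i n r) * mulY r n)"

definition osc_pos :: "nat \<Rightarrow> (nat \<Rightarrow> nat \<Rightarrow> nat \<Rightarrow> complex) \<Rightarrow> nat \<Rightarrow> nat \<Rightarrow> fock lop" where
  "osc_pos R v i n = (\<Sum>r<R. csc (v i n r) * derY r n)"

text \<open>The Heisenberg and quantum torus relations in these representations.\<close>

lemma derY_mulY:
  "derY r n * mulY s m - mulY s m * derY r n = (if r = s \<and> n = m then 1 else 0)"
proof (rule lop_eq_basis)
  fix b :: fock
  obtain g \<alpha> where b: "b = (g, \<alpha>)" by (cases b)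
  let ?x = "single (r, n) (1::nat)" and ?y = "single (s, m) (1::nat)"
  have D: "app (derY r n) (bvec (g, \<beta>)) =
      scl (of_nat (lookup \<beta> (r, n))) (bvec (g, \<beta> - ?x))" for \<beta>
    by (simp add: derY_def)
  have M: "app (mulY s m) (bvec (g, \<beta>)) = bvec (g, \<beta> + ?y)" for \<beta>
    by (simp add: mulY_def)
  have L: "app (derY r n * mulY s m - mulY s m * derY r n) (bvec b) =
     scl (of_nat (lookup (\<alpha> + ?y) (r, n))) (bvec (g, \<alpha> + ?y - ?x))
     - scl (of_nat (lookup \<alpha> (r, n))) (bvec (g, \<alpha> - ?x + ?y))"
    by (simp add: b lop_simps D M)
  have same: "\<alpha> + ?y - ?x = \<alpha> - ?x + ?y" if "lookup \<alpha> (r, n) > 0"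
    using that by (intro poly_mapping_eqI) (auto simp: lookup_add lookup_minus lookup_single when_def)
  show "app (derY r n * mulY s m - mulY s m * derY r n) (bvec b) =
      app (if r = s \<and> n = m then 1 else 0) (bvec b)"
  proof (cases "r = s \<and> n = m")
    case True
    show ?thesis
    proof (cases "lookup \<alpha> (r, n) = 0")
      case True
      then show ?thesis using \<open>r = s \<and> n = m\<close>
        unfolding L by (simp add: lookup_add lop_simps b)
    next
      case False
      then have "\<alpha> - ?x + ?y = \<alpha>" using True
        by (intro poly_mapping_eqI) (auto simp: lookup_add lookup_minus lookup_single when_def)
      then show ?thesis using True False
        unfolding L by (simp add: lookup_add lop_simps b scl_plus)
    qed
  next
    case False
    then have "lookup (\<alpha> + ?y) (r, n) = lookup \<alpha> (r, n)"
      by (auto simp: lookup_add lookup_single when_def)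
    then show ?thesis using False same
      unfolding L by (cases "lookup \<alpha> (r, n) = 0") (auto simp: lop_simps)
  qed
qed

lemma csc_central: "csc c * a = a * csc c"
  by (rule lop_eqI) (simp add: lop_simps)

lemma csc_mult: "csc c * csc d = csc (c * d)"
  by (rule lop_eqI) (simp add: lop_simps scl_scl)

lemma csc_zero: "csc 0 = 0"
  by (rule lop_eqI) (simp add: lop_simps)

lemma csc_plus: "csc (c + d) = csc c + csc d"
  by (rule lop_eqI) (simp add: lop_simps scl_plus)

lemma csc_sum: "csc (sum f A) = (\<Sum>x\<in>A. csc (f x))"
  by (induction A rule: infinite_finite_induct) (simp_all add: csc_zero csc_plus)

lemma osc_commutator:
  "osc_pos R v i n * osc_neg R u j m - osc_neg R u j m * osc_pos R v i n =
     (if n = m then csc (\<Sum>r<R. v i n r * u j n r) else 0)"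
proof -
  have "osc_pos R v i n * osc_neg R u j m - osc_neg R u j m * osc_pos R v i n =
    (\<Sum>r<R. \<Sum>s<R. csc (v i n r) * derY r n * (csc (u j m s) * mulY s m))
    - (\<Sum>r<R. \<Sum>s<R. csc (u j m s) * mulY s m * (csc (v i n r) * derY r n))"
    unfolding osc_pos_def osc_neg_def
    by (simp only: sum_product) (subst (2) sum.swap, rule refl)
  also have "\<dots> = (\<Sum>r<R. \<Sum>s<R. csc (v i n r * u j m s) *
      (derY r n * mulY s m - mulY s m * derY r n))"
    unfolding sum_subtractf[symmetric]
    by (intro sum.cong refl)
       (auto intro!: lop_eqI simp: lop_simps scl_scl scl_diff mult.commute)
  also have "\<dots> = (if n = m then csc (\<Sum>r<R. v i n r * u j n r) else 0)"
    by (auto simp: derY_mulY csc_sum if_distrib cong: if_cong)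
  finally show ?thesis .
qed

lemma torus_mult:
  assumes "\<And>g h k. \<sigma> g h * \<sigma> (g + h) k = \<sigma> h k * \<sigma> g (h + k)"
  shows "torus \<sigma> g * torus \<sigma> h = csc (\<sigma> g h) * torus \<sigma> (g + h)"
  by (rule lop_eq_basis)
     (auto simp: torus_def lop_simps scl_scl assms add.assoc split: prod.splits)

section \<open>Decorated quivers and their free fields\<close>

datatype vertex_type = Unfrozen | Frozen_plus | Frozen_minus

record quiver =
  vertices :: "nat set"
  vtype :: "nat \<Rightarrow> vertex_type"
  arrows :: "(nat \<times> nat \<times> complex) list" \<comment> \<open>source, target, label\<close>

definition labels :: "quiver \<Rightarrow> nat \<Rightarrow> nat \<Rightarrow> complex list" where
  "labels Q i j = [\<kappa>. (s, t, \<kappa>) \<leftarrow> arrows Q, s = i \<and> t = j]"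

definition eps :: "quiver \<Rightarrow> nat \<Rightarrow> nat \<Rightarrow> int" where
  "eps Q i j = (if i = j then 0
     else int (length (labels Q i j)) - int (length (labels Q j i)))"

text \<open>\<open>cmat Q q n i j\<close> and \<open>Cmat Q q n i j\<close> are \<open>c\<^sub>i\<^sub>j\<^sup>[\<^sup>n\<^sup>]\<close> and \<open>C\<^sub>i\<^sub>j\<^sup>[\<^sup>n\<^sup>]\<close>.\<close>

definition cmat :: "quiver \<Rightarrow> complex \<Rightarrow> nat \<Rightarrow> nat \<Rightarrow> nat \<Rightarrow> complex" where
  "cmat Q q n i j =
     (if i = j then
        (case vtype Q i of
           Unfrozen \<Rightarrow> (q ^ n - 1 / q ^ n)
             - (\<Sum>\<kappa>\<leftarrow>labels Q i i. q ^ n * \<kappa> ^ n - 1 / (q ^ n * \<kappa> ^ n))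
         | Frozen_plus \<Rightarrow> - (1 / q ^ n)
         | Frozen_minus \<Rightarrow> q ^ n)
      else (\<Sum>\<kappa>\<leftarrow>labels Q i j. 1 / (q ^ n * \<kappa> ^ n)) - (\<Sum>\<kappa>\<leftarrow>labels Q j i. q ^ n * \<kappa> ^ n))"

definition Cmat :: "quiver \<Rightarrow> complex \<Rightarrow> nat \<Rightarrow> nat \<Rightarrow> nat \<Rightarrow> complex" where
  "Cmat Q q n i j = (q ^ n - 1 / q ^ n) * cmat Q q n i j"

text \<open>Free field realizations by \<open>R\<close> oscillators in which the central combinations of the
  \<open>x\<^bsub>i,n\<^esub>\<close> act by \<open>0\<close>.\<close>

definition quiver_realization :: "quiver \<Rightarrow> complex \<Rightarrow> nat \<Rightarrow>
    (nat \<Rightarrow> nat \<Rightarrow> nat \<Rightarrow> complex) \<Rightarrow> (nat \<Rightarrow> nat \<Rightarrow> nat \<Rightarrow> complex) \<Rightarrow> bool" where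
  "quiver_realization Q q R u v \<longleftrightarrow> (\<forall>n>0.
     (\<forall>i\<in>vertices Q. \<forall>j\<in>vertices Q.
        (\<Sum>r<R. v i n r * u j n r) = Cmat Q q n i j / of_nat n) \<and>
     (\<forall>t. (\<forall>i\<in>vertices Q. (\<Sum>j\<in>vertices Q. Cmat Q q n i j * t j) = 0) \<longrightarrow>
        (\<forall>r<R. (\<Sum>j\<in>vertices Q. t j * u j n r) = 0)) \<and>
     (\<forall>t. (\<forall>j\<in>vertices Q. (\<Sum>i\<in>vertices Q. t i * Cmat Q q n i j) = 0) \<longrightarrow>
        (\<forall>r<R. (\<Sum>i\<in>vertices Q. t i * v i n r) = 0)))"

text \<open>The lattice point \<open>g\<close> stands for \<open>:\<Prod>\<^sub>i X\<^sub>i\<^bsup>g i\<^esup>:\<close>, whence the factor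
  \<open>X\<^sub>i :\<Prod>\<^sub>j X\<^sub>j\<^bsup>n\<^sub>j\<^esup>: = q\<^bsup>\<Sum>\<^sub>j \<epsilon>\<^sub>i\<^sub>j n\<^sub>j\<^esup> :X\<^sub>i \<Prod>\<^sub>j X\<^sub>j\<^bsup>n\<^sub>j\<^esup>:\<close>.\<close>

definition quiver_cocycle :: "quiver \<Rightarrow> complex \<Rightarrow> lattice \<Rightarrow> lattice \<Rightarrow> complex" where
  "quiver_cocycle Q q g h =
     q powi (\<Sum>i\<in>keys g. \<Sum>j\<in>keys h. eps Q i j * lookup g i * lookup h j)"

lemma quiver_cocycle_superset:
  assumes "finite A" "finite B" "keys g \<subseteq> A" "keys h \<subseteq> B"
  shows "quiver_cocycle Q q g h =
    q powi (\<Sum>i\<in>A. \<Sum>j\<in>B. eps Q i j * lookup g i * lookup h j)"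
proof -
  have "(\<Sum>i\<in>keys g. \<Sum>j\<in>keys h. eps Q i j * lookup g i * lookup h j) =
      (\<Sum>i\<in>keys g. \<Sum>j\<in>B. eps Q i j * lookup g i * lookup h j)"
    by (intro sum.cong refl sum.mono_neutral_left) (use assms in \<open>auto simp: in_keys_iff\<close>)
  also have "\<dots> = (\<Sum>i\<in>A. \<Sum>j\<in>B. eps Q i j * lookup g i * lookup h j)"
    by (intro sum.mono_neutral_left) (use assms in \<open>auto simp: in_keys_iff\<close>)
  finally show ?thesis by (simp add: quiver_cocycle_def)
qed

lemma quiver_cocycle_bimult:
  assumes "q \<noteq> 0"
  shows "quiver_cocycle Q q (g + g') h = quiver_cocycle Q q g h * quiver_cocycle Q q g' h"
    and "quiver_cocycle Q q g (h + h') = quiver_cocycle Q q g h * quiver_cocycle Q q g h'"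
proof -
  have *: "keys (a + b) \<subseteq> keys a \<union> keys b" for a b :: lattice by (rule Poly_Mapping.keys_add)
  show "quiver_cocycle Q q (g + g') h = quiver_cocycle Q q g h * quiver_cocycle Q q g' h"
    by (subst (1 2 3) quiver_cocycle_superset[of "keys g \<union> keys g'" "keys h"])
       (use * assms in \<open>auto simp: lookup_add distrib_left distrib_right sum.distrib power_int_add\<close>)
  show "quiver_cocycle Q q g (h + h') = quiver_cocycle Q q g h * quiver_cocycle Q q g h'"
    by (subst (1 2 3) quiver_cocycle_superset[of "keys g" "keys h \<union> keys h'"])
       (use * assms in \<open>auto simp: lookup_add distrib_left distrib_right sum.distrib power_int_add\<close>)
qed

lemma zero_mode_commutation:
  fixes Q :: quiver
  assumes q: "q \<noteq> 0"
  defines "X \<equiv> \<lambda>i. torus (quiver_cocycle Q q) (single i 1)"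
  shows "X i * X j = csc (q powi (2 * eps Q i j)) * (X j * X i)"
proof -
  have m: "X i * X j = csc (q powi eps Q i j) * torus (quiver_cocycle Q q) (single i 1 + single j 1)"
    for i j unfolding X_def
    by (subst torus_mult) (simp_all add: quiver_cocycle_bimult assms algebra_simps,
        simp add: quiver_cocycle_def)
  have e: "eps Q j i = - eps Q i j" by (simp add: eps_def)
  have "q powi eps Q i j = q powi (2 * eps Q i j) * q powi (eps Q j i)"
    using assms by (simp add: e flip: power_int_add)
  then show ?thesis
    by (simp add: m add.commute csc_mult flip: mult.assoc)
qed

text \<open>\<open>:X\<^bsub>i\<^sub>1\<^esub>(a\<^sub>1z) X\<^bsub>i\<^sub>2\<^esub>(a\<^sub>2z) \<dots>:\<close>\<close>

definition Xcur :: "quiver \<Rightarrow> complex \<Rightarrow> nat \<Rightarrow> (nat \<Rightarrow> nat \<Rightarrow> nat \<Rightarrow> complex) \<Rightarrow>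
    (nat \<Rightarrow> nat \<Rightarrow> nat \<Rightarrow> complex) \<Rightarrow> fword \<Rightarrow> fock current" where
  "Xcur Q q R u v w = normal_ordered (osc_neg R u) (osc_pos R v)
     (torus (quiver_cocycle Q q) (\<Sum>(i, a)\<leftarrow>w. single i 1)) w"

section \<open>The subregular algebra\<close>

definition generic_parameters :: "complex \<Rightarrow> complex \<Rightarrow> complex \<Rightarrow> bool" where
  "generic_parameters q1 q2 q3 \<longleftrightarrow> q1 * q2 * q3 = 1 \<and>
     (\<forall>a b c :: int. q1 powi a * q2 powi b * q3 powi c = 1 \<longrightarrow> a = b \<and> b = c)"

definition Qsub :: "nat \<Rightarrow> complex \<Rightarrow> complex \<Rightarrow> quiver" where
  "Qsub N q1 q3 = \<lparr>
     vertices = {0..N + 1},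
     vtype = (\<lambda>i. if i = 0 then Frozen_minus else if i = N + 1 then Frozen_plus else Unfrozen),
     arrows = [(i, i + 1, 1). i \<leftarrow> [1..<N]] @ [(i + 1, i, q3). i \<leftarrow> [1..<N]]
       @ [(i, i, q1). i \<leftarrow> [2..<N + 1]] @ [(1, 0, q1), (N + 1, 1, 1)]
       @ [(0, N + 1, q3 powi (2 - int k)). k \<leftarrow> [1..<N]]\<rparr>"

text \<open>The words occurring in the expansion of
  \<open>(1 + X\<^sub>1(z)\<cdots>X\<^sub>j(z) T) \<cdots> (1 + X\<^sub>1(z) T) \<cdot> 1\<close>.\<close>

primrec miura :: "complex \<Rightarrow> nat \<Rightarrow> fword list" where
  "miura q3 0 = [[]]"
| "miura q3 (Suc j) = miura q3 j @
     map (\<lambda>w. [(i, 1). i \<leftarrow> [1..<j + 2]] @ map (\<lambda>(i, a). (i, q3 * a)) w) (miura q3 j)"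

definition Gminus :: "nat \<Rightarrow> complex \<Rightarrow> complex \<Rightarrow> complex \<Rightarrow>
    (nat \<Rightarrow> nat \<Rightarrow> nat \<Rightarrow> complex) \<Rightarrow> (nat \<Rightarrow> nat \<Rightarrow> nat \<Rightarrow> complex) \<Rightarrow> fock current" where
  "Gminus N q q1 q3 u v = Xcur (Qsub N q1 q3) q (N + 1) u v [(0, 1)]"

definition Gplus :: "nat \<Rightarrow> complex \<Rightarrow> complex \<Rightarrow> complex \<Rightarrow>
    (nat \<Rightarrow> nat \<Rightarrow> nat \<Rightarrow> complex) \<Rightarrow> (nat \<Rightarrow> nat \<Rightarrow> nat \<Rightarrow> complex) \<Rightarrow> fock current" where
  "Gplus N q q1 q3 u v m =
     (\<Sum>w\<leftarrow>miura q3 N. Xcur (Qsub N q1 q3) q (N + 1) u v ((N + 1, 1) # w) m)"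

definition Wsub :: "nat \<Rightarrow> complex \<Rightarrow> complex \<Rightarrow> complex \<Rightarrow>
    (nat \<Rightarrow> nat \<Rightarrow> nat \<Rightarrow> complex) \<Rightarrow> (nat \<Rightarrow> nat \<Rightarrow> nat \<Rightarrow> complex) \<Rightarrow> fock lop set" where
  "Wsub N q q1 q3 u v = alg_gen (range (Gplus N q q1 q3 u v) \<union> range (Gminus N q q1 q3 u v))"

text \<open>The coefficient of \<open>z\<^sup>-\<^sup>m w\<^sup>-\<^sup>p\<close> in
  \<open>[G\<^sup>+(z), G\<^sup>-(w)] = \<Sum>\<^bsub>1\<le>n<N\<^esub> \<delta>(q\<^sub>3\<^bsup>2-n\<^esup>w/z) K\<^sub>n(w) + \<delta>(q\<^sub>2q\<^sub>3\<^bsup>2-N\<^esup>w/z) K\<^sub>N\<^sup>+(w)\<close>.\<close>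

definition higher_generators :: "nat \<Rightarrow> complex \<Rightarrow> complex \<Rightarrow> 'b current \<Rightarrow> 'b current \<Rightarrow>
    (nat \<Rightarrow> 'b current) \<Rightarrow> 'b current \<Rightarrow> bool" where
  "higher_generators N q2 q3 Gp Gm K KN \<longleftrightarrow> (\<forall>m p.
     Gp m * Gm p - Gm p * Gp m =
       (\<Sum>n=1..N - 1. csc ((q3 powi (2 - int n)) powi m) * K n (m + p))
       + csc ((q2 * q3 powi (2 - int N)) powi m) * KN (m + p))"

section \<open>The standard realization of the principal algebra\<close>

definition theta :: "nat \<Rightarrow> complex \<Rightarrow> nat \<Rightarrow> nat \<Rightarrow> nat \<Rightarrow> complex" where
  "theta N q3 k i j =
     (if i < j then (1 - q3 ^ k) / (1 - q3 powi (- int (k * N))) * q3 powi (- int (k * N))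
      else if i = j then (1 - q3 powi (- int k * (int N - 1))) / (1 - q3 powi (- int (k * N)))
      else (1 - q3 ^ k) / (1 - q3 powi (- int (k * N))))"

text \<open>Realizations by \<open>N - 1\<close> oscillators satisfying the commutation relations of the
  \<open>\<lambda>\<^bsub>i,k\<^esub>\<close> and the constraint \<open>\<Sum>\<^sub>i q\<^sub>3\<^bsup>-ik\<^esup> \<lambda>\<^bsub>i,k\<^esub> = 0\<close> for \<open>k = n\<close> and \<open>k = -n\<close>.\<close>

definition lambda_realization :: "nat \<Rightarrow> complex \<Rightarrow> complex \<Rightarrow> complex \<Rightarrow>
    (nat \<Rightarrow> nat \<Rightarrow> nat \<Rightarrow> complex) \<Rightarrow> (nat \<Rightarrow> nat \<Rightarrow> nat \<Rightarrow> complex) \<Rightarrow> bool" where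
  "lambda_realization N q1 q2 q3 u v \<longleftrightarrow> (\<forall>n>0.
     (\<forall>i\<in>{1..N}. \<forall>j\<in>{1..N}. (\<Sum>r<N - 1. v i n r * u j n r) =
        - (1 / of_nat n) * (1 - q1 ^ n) * (1 - q2 ^ n) * theta N q3 n i j) \<and>
     (\<forall>r<N - 1. (\<Sum>i=1..N. q3 powi (- int (i * n)) * v i n r) = 0) \<and>
     (\<forall>r<N - 1. (\<Sum>i=1..N. q3 powi int (i * n) * u i n r) = 0))"

text \<open>The central \<open>\<lambda>\<^bsub>i,0\<^esub>\<close> enter only through the invertible central elements
  \<open>e\<^bsup>\<tau>\<lambda>\<^bsub>i,0\<^esub>\<^esup>\<close>, which are independent up to the relation that their product is \<open>1\<close>.
  They are represented by the lattice points \<open>lam0 N i\<close> of rank \<open>N - 1\<close>.\<close>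

definition lam0 :: "nat \<Rightarrow> nat \<Rightarrow> lattice" where
  "lam0 N i = (if i < N then single i 1
     else - (\<Sum>j=1..<N. single j 1))"

text \<open>\<open>:\<Lambda>\<^bsub>i\<^sub>1\<^esub>(a\<^sub>1z) \<Lambda>\<^bsub>i\<^sub>2\<^esub>(a\<^sub>2z) \<dots>:\<close>, where \<open>s3\<close> is the chosen square root of \<open>q\<^sub>3\<close>.\<close>

definition Lcur :: "nat \<Rightarrow> complex \<Rightarrow> (nat \<Rightarrow> nat \<Rightarrow> nat \<Rightarrow> complex) \<Rightarrow>
    (nat \<Rightarrow> nat \<Rightarrow> nat \<Rightarrow> complex) \<Rightarrow> fword \<Rightarrow> fock current" where
  "Lcur N s3 u v w = normal_ordered (osc_neg (N - 1) u) (osc_pos (N - 1) v)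
     (csc (\<Prod>(i, a)\<leftarrow>w. s3 powi (2 * int i - int N - 1))
        * torus (\<lambda>_ _. 1) (\<Sum>(i, a)\<leftarrow>w. lam0 N i)) w"

text \<open>The current \<open>W\<^sub>k(z)\<close>; the rescaling undoes the shift in \<open>W\<^sub>k(q\<^sub>3\<^bsup>(k-1)/2\<^esup>z)\<close>.\<close>

definition Wcur :: "nat \<Rightarrow> complex \<Rightarrow> (nat \<Rightarrow> nat \<Rightarrow> nat \<Rightarrow> complex) \<Rightarrow>
    (nat \<Rightarrow> nat \<Rightarrow> nat \<Rightarrow> complex) \<Rightarrow> nat \<Rightarrow> fock current" where
  "Wcur N s3 u v k = rescale (s3 powi (1 - int k))
     (\<lambda>m. \<Sum>js | sorted_wrt (<) js \<and> set js \<subseteq> {1..N} \<and> length js = k.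
        Lcur N s3 u v (zip js (map (\<lambda>s. (s3\<^sup>2) ^ s) [0..<k])) m)"

definition Wprin :: "nat \<Rightarrow> complex \<Rightarrow> (nat \<Rightarrow> nat \<Rightarrow> nat \<Rightarrow> complex) \<Rightarrow>
    (nat \<Rightarrow> nat \<Rightarrow> nat \<Rightarrow> complex) \<Rightarrow> fock lop set" where
  "Wprin N s3 u v = alg_gen {Wcur N s3 u v k m | k m. 1 \<le> k \<and> k \<le> N}"

section \<open>Rank two Heisenberg algebras\<close>

text \<open>The zero modes form the quantum torus of rank \<open>d\<close> with arbitrary parameters
  \<open>p i j \<noteq> 0\<close>.  The oscillators \<open>b\<^bsub>s,-n\<^esub> = mulY s n\<close>, \<open>b\<^bsub>s,n\<^esub> = derY s n\<close> (\<open>s < 2\<close>) are normalized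
  to be dual bases; any other non-degenerate pairing is brought to this form by a linear change
  of the modes \<open>n > 0\<close>, which does not change the algebra.\<close>

definition bichar :: "nat \<Rightarrow> (nat \<Rightarrow> nat \<Rightarrow> complex) \<Rightarrow> lattice \<Rightarrow> lattice \<Rightarrow> complex" where
  "bichar d p g h = (\<Prod>i<d. \<Prod>j<d. p i j powi (lookup g i * lookup h j))"

definition heis2 :: "nat \<Rightarrow> (nat \<Rightarrow> nat \<Rightarrow> complex) \<Rightarrow> fock lop set" where
  "heis2 d p = alg_gen ({torus (bichar d p) g | g. keys g \<subseteq> {..<d}}
     \<union> {mulY s n | s n. s < 2 \<and> n > 0} \<union> {derY s n | s n. s < 2 \<and> n > 0})"

text \<open>Modes of currents such as vertex operators are infinite sums, so they lie in the completion.\<close>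

abbreviation heis2_completed :: "nat \<Rightarrow> (nat \<Rightarrow> nat \<Rightarrow> complex) \<Rightarrow> fock lop set" where
  "heis2_completed d p \<equiv> completion fdeg (heis2 d p)"

end

theory Submission
  imports Defs "HOL-Computational_Algebra.Formal_Power_Series" "HOL-Computational_Algebra.Polynomial"
    "HOL-Library.Nat_Bijection" "HOL-Library.Product_Plus" "Jordan_Normal_Form.Determinant"
begin

text \<open>Write \<open>Y\<^sub>k = X\<^sub>1 \<cdots> X\<^sub>k\<close>.  The Miura product expands into the words
  \<open>:X\<^bsub>N+1\<^esub>(z) Y\<^bsub>N+1-j\<^sub>1\<^esub>(z) Y\<^bsub>N+1-j\<^sub>2\<^esub>(q\<^sub>3z) \<dots>:\<close> with \<open>j\<^sub>1 < j\<^sub>2 < \<dots>\<close>.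
  The oscillators of \<open>Y\<^bsub>N+1-j\<^esub>\<close> can be realized as those of \<open>\<Lambda>\<^sub>j\<close> plus an element of the rank two
  Heisenberg algebra that does not depend on \<open>j\<close>: the Gram matrices agree, because what is left
  of the matrix \<open>C\<close> after splitting off the pairings of the \<open>\<lambda>\<^sub>j\<close> has rank two.  Two realizations with
  the same Gram matrix whose modes span differ by a linear change of the Fock space
  variables, and conjugation by it is the embedding.  It turns each word into
  \<open>\<Lambda>\<^bsub>j\<^sub>1\<^esub>(z) \<Lambda>\<^bsub>j\<^sub>2\<^esub>(q\<^sub>3z) \<dots>\<close> times a Heisenberg current depending only on the number \<open>k\<close> of factors,
  and the words with \<open>k\<close> factors add up to \<open>A\<^sub>k(z) W\<^sub>k(q\<^sub>3\<^bsup>(k-1)/2\<^esup>z)\<close>.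

  The contraction of such a word with \<open>G\<^sup>-\<close> is a rational function whose poles are simple and depend only on
  \<open>k\<close>: they are \<open>q\<^sub>3\<^bsup>2-n\<^esup>\<close> for \<open>k < n < N\<close>, and \<open>q\<^sub>2q\<^sub>3\<^bsup>2-N\<^esup>\<close> for \<open>k = N\<close>.  Hence only the empty word contributes
  to \<open>K\<^sub>1\<close>, only words with at most one factor to \<open>K\<^sub>2\<close>, and only the full word, for which
  \<open>\<Lambda>\<^sub>1(z) \<dots> \<Lambda>\<^sub>N(q\<^sub>3\<^bsup>N-1\<^esup>z)\<close> is trivial, to \<open>K\<^sub>N\<^sup>+\<close>.  The poles being distinct, the higher generators are
  recovered from finitely many commutators by Lagrange interpolation.\<close>

section \<open>Operators and locally finite sums\<close>

text \<open>Both algebras act on fixed spaces, so the embedding is the restriction of a bijection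
  between all operators: injectivity and multiplicativity come for free and the work lies in
  locating the image. Its elements must converge in the topology generated by the modes of the
  W-currents, which are themselves infinite sums of oscillators; hence the Heisenberg factors get
  expanded and the W-modes never are. The count N + 1 = (N - 1) + 2 of oscillators is the critical
  constraint: what remains at the vertices 0, 1 and N + 1 is a 3 by 3 matrix, and its determinant
  vanishes thanks to the labels of the arrows and q1 q2 q3 = 1. The zero modes resist a direct
  identification, since the lattice spanned by the images of the X_i has index N in the target. The
  Fock spaces have spare lattice directions and spare variables; these absorb the defect, and the
  numerical prefactors of the \<Lambda>_j come from rescaling the basis vectors by a character. The
  residues of the contractions are never computed. It suffices that they exist and depend only on
  k.\<close>

lemma app_zero [simp]: "app a 0 = 0"
  using app_scl[of a 0 0] by simp

lemma app_zero_left [simp]: "app 0 v = 0"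
  by (simp add: zero_lop.rep_eq)

lemma app_one [simp]: "app 1 v = v"
  by (simp add: one_lop.rep_eq)

lemma app_mult: "app (a * b) v = app a (app b v)"
  by (simp add: times_lop.rep_eq)

lemma app_plus: "app (a + b) v = app a v + app b v"
  by (simp add: plus_lop.rep_eq)

lemma app_csc: "app (csc c) v = scl c v"
  by (simp add: csc.rep_eq)

lemma app_sum: "app c (sum f B) = (\<Sum>x\<in>B. app c (f x))"
  by (induction B rule: infinite_finite_induct) (simp_all add: app_add)

lemma sum_app: "app (sum f B) v = (\<Sum>x\<in>B. app (f x) v)"
  by (induction B rule: infinite_finite_induct) (simp_all add: app_plus)

lemma vec_expand: "v = (\<Sum>b\<in>keys v. scl (lookup v b) (bvec b))"
  by (rule poly_mapping_eqI)
     (auto simp: lookup_sum bvec_def lookup_single when_def in_keys_iff if_distrib cong: if_cong)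

lemma app_expand: "app a v = (\<Sum>b\<in>keys v. scl (lookup v b) (app a (bvec b)))"
  by (subst vec_expand[of v]) (simp only: app_sum app_scl)

lemma keys_bvec [simp]: "keys (bvec b) = {b}"
  by (simp add: bvec_def)

lemma lookup_bvec: "lookup (bvec b) x = (if x = b then 1 else 0)"
  by (auto simp: bvec_def lookup_single when_def)

lemma csc_one [simp]: "csc 1 = 1"
  by (rule lop_eqI) (simp add: app_csc)

lemma csc_left_commute: "a * (csc c * b) = csc c * (a * b)"
  by (metis csc_central mult.assoc)

lemma csc_uminus: "csc (- c) = - csc c"
  using csc_plus[of c "- c"] by (simp add: csc_zero eq_neg_iff_add_eq_0 add.commute)

lemma csc_of_nat: "csc (of_nat n) = of_nat n"
  by (induction n) (simp_all add: csc_zero csc_plus)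

lemma csc_cancel:
  assumes "c \<noteq> 0" "csc c * a = csc c * b"
  shows "a = b"
proof -
  have "csc (1 / c) * (csc c * a) = csc (1 / c) * (csc c * b)" using assms by simp
  then show ?thesis using assms(1) by (simp only: mult.assoc[symmetric] csc_mult) simp
qed

text \<open>Scalar multiplication as a constant of its own: the rules below normalize scalars without looping,
  which \<open>csc_left_commute\<close> would not do.\<close>

definition csm :: "complex \<Rightarrow> 'b lop \<Rightarrow> 'b lop" where
  "csm c a = csc c * a"

lemma csm_simps:
  "csc c * a = csm c a" "a * csc c = csm c a"
  "a * csm c b = csm c (a * b)" "csm c a * b = csm c (a * b)"
  "csm c (csm d a) = csm (c * d) a" "csm c (csc d) = csc (c * d)"
  "csm 1 a = a" "csm 0 a = 0" "csm c 0 = 0"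
proof -
  show "csc c * a = csm c a" by (simp only: csm_def)
  show "a * csc c = csm c a" by (simp only: csm_def csc_central)
  show "a * csm c b = csm c (a * b)" unfolding csm_def by (rule csc_left_commute)
  show "csm c a * b = csm c (a * b)" by (simp only: csm_def mult.assoc)
  show "csm c (csm d a) = csm (c * d) a" by (simp only: csm_def csc_mult flip: mult.assoc)
  show "csm c (csc d) = csc (c * d)" by (simp only: csm_def csc_mult)
qed (simp_all add: csm_def csc_zero)

lemma csm_plus: "csm (c + d) a = csm c a + csm d a"
  by (simp add: csm_def csc_plus distrib_right)

lemma csm_sum: "csm c (sum f A) = (\<Sum>x\<in>A. csm c (f x))"
  by (simp add: csm_def sum_distrib_left)

text \<open>Tested on basis vectors because degree arguments apply to them; \<open>lfinD\<close>
  passes to arbitrary vectors, which are finite combinations.\<close>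

definition lfin :: "('i \<Rightarrow> 'b lop) \<Rightarrow> bool" where
  "lfin f \<longleftrightarrow> (\<forall>b. finite {i. app (f i) (bvec b) \<noteq> 0})"

lemma lfinD: "lfin f \<Longrightarrow> finite {i. app (f i) v \<noteq> 0}"
proof -
  assume "lfin f"
  then have "finite (\<Union>b\<in>keys v. {i. app (f i) (bvec b) \<noteq> 0})" by (simp add: lfin_def)
  moreover have "{i. app (f i) v \<noteq> 0} \<subseteq> (\<Union>b\<in>keys v. {i. app (f i) (bvec b) \<noteq> 0})"
  proof
    fix i assume "i \<in> {i. app (f i) v \<noteq> 0}"
    then have "(\<Sum>b\<in>keys v. scl (lookup v b) (app (f i) (bvec b))) \<noteq> 0"
      using app_expand[of "f i" v] by simp
    then obtain b where "b \<in> keys v" "scl (lookup v b) (app (f i) (bvec b)) \<noteq> 0"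
      by (meson sum.not_neutral_contains_not_neutral)
    then show "i \<in> (\<Union>b\<in>keys v. {i. app (f i) (bvec b) \<noteq> 0})"
      using scl_zero(1) by fastforce
  qed
  ultimately show ?thesis by (rule rev_finite_subset)
qed

lemma osums_lfin: "osums f a \<Longrightarrow> lfin f"
  by (simp add: osums_def lfin_def)

lemma osums_unique: "osums f a \<Longrightarrow> osums f b \<Longrightarrow> a = b"
  by (rule lop_eqI) (simp add: osums_def)

lemma osum_eqI: "osums f a \<Longrightarrow> osum f = a"
  unfolding osum_def using osums_unique by blast

lemma osums_basisI:
  assumes "lfin f"
    and "\<And>b. app a (bvec b) = (\<Sum>i | app (f i) (bvec b) \<noteq> 0. app (f i) (bvec b))"
  shows "osums f a"
  unfolding osums_def
proof (intro allI conjI)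
  fix v
  show fin: "finite {i. app (f i) v \<noteq> 0}" using assms(1) by (rule lfinD)
  let ?S = "{i. app (f i) v \<noteq> 0} \<union> (\<Union>b\<in>keys v. {i. app (f i) (bvec b) \<noteq> 0})"
  have finS: "finite ?S" using fin assms(1) by (simp add: lfin_def)
  have "app a v = (\<Sum>b\<in>keys v. scl (lookup v b) (\<Sum>i\<in>?S. app (f i) (bvec b)))"
    unfolding app_expand[of a v] assms(2)
    by (intro sum.cong refl arg_cong[where f = "scl _"] sum.mono_neutral_left finS) auto
  also have "\<dots> = (\<Sum>i\<in>?S. \<Sum>b\<in>keys v. scl (lookup v b) (app (f i) (bvec b)))"
    by (simp only: scl_sum) (rule sum.swap)
  also have "\<dots> = (\<Sum>i\<in>?S. app (f i) v)" by (simp only: app_expand[of _ v, symmetric])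
  also have "\<dots> = (\<Sum>i | app (f i) v \<noteq> 0. app (f i) v)"
    by (intro sum.mono_neutral_right finS) auto
  finally show "app a v = (\<Sum>i | app (f i) v \<noteq> 0. app (f i) v)" .
qed

lemma osums_osum: "lfin f \<Longrightarrow> osums f (osum f)"
proof -
  assume f: "lfin f"
  \<comment> \<open>The operator prescribed on the basis by the finite sums;
    \<open>osums_basisI\<close> extends the summation property to all vectors.\<close>
  have "osums f (lopb (\<lambda>b. \<Sum>i | app (f i) (bvec b) \<noteq> 0. app (f i) (bvec b)))"
    by (rule osums_basisI[OF f]) simp
  with osum_eqI[OF this] show ?thesis by simp
qed

lemma app_osum:
  assumes "lfin f" "finite S" "\<And>i. app (f i) v \<noteq> 0 \<Longrightarrow> i \<in> S"
  shows "app (osum f) v = (\<Sum>i\<in>S. app (f i) v)"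
proof -
  have "app (osum f) v = (\<Sum>i | app (f i) v \<noteq> 0. app (f i) v)"
    using osums_osum[OF assms(1)] by (simp add: osums_def)
  also have "\<dots> = (\<Sum>i\<in>S. app (f i) v)"
    using assms by (intro sum.mono_neutral_left) auto
  finally show ?thesis .
qed

text \<open>The index types may differ. On each basis vector the comparison may use any finite sets
  that cover the supports.\<close>

lemma osum_eq_basisI:
  assumes "lfin f" "lfin g"
    and "\<And>b. \<exists>S T. finite S \<and> finite T \<and> {i. app (f i) (bvec b) \<noteq> 0} \<subseteq> S
       \<and> {i. app (g i) (bvec b) \<noteq> 0} \<subseteq> T
       \<and> (\<Sum>i\<in>S. app (f i) (bvec b)) = (\<Sum>i\<in>T. app (g i) (bvec b))"
  shows "osum f = osum g"
proof (rule lop_eq_basis)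
  fix b
  obtain S T where "finite S" "finite T" "{i. app (f i) (bvec b) \<noteq> 0} \<subseteq> S"
    "{i. app (g i) (bvec b) \<noteq> 0} \<subseteq> T"
    "(\<Sum>i\<in>S. app (f i) (bvec b)) = (\<Sum>i\<in>T. app (g i) (bvec b))"
    using assms(3)[of b] by blast
  then show "app (osum f) (bvec b) = app (osum g) (bvec b)"
    by (subst app_osum[OF assms(1), of S]; (subst app_osum[OF assms(2), of T])?) auto
qed

text \<open>Summation along the fibres of \<open>h\<close>: on one basis vector every sum is finite.
  Grouping a single family along two different maps is the way identities between products of vertex
  operators are obtained below.\<close>

lemma osum_group:
  fixes f :: "'i \<Rightarrow> 'b lop" and h :: "'i \<Rightarrow> 'j"
  assumes f: "lfin f"
  shows "lfin (\<lambda>x. if h x = y then f x else 0)"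
    and "lfin (\<lambda>y. osum (\<lambda>x. if h x = y then f x else 0))"
    and "osum f = osum (\<lambda>y. osum (\<lambda>x. if h x = y then f x else 0))"
proof -
  have lf: "lfin (\<lambda>x. if h x = y then f x else 0)" for y
    unfolding lfin_def
  proof
    fix b
    show "finite {i. app (if h i = y then f i else 0) (bvec b) \<noteq> 0}"
      by (rule finite_subset[OF _ lfinD[OF f, of "bvec b"]]) auto
  qed
  show "lfin (\<lambda>x. if h x = y then f x else 0)" by (rule lf)
  have inner: "app (osum (\<lambda>x. if h x = y then f x else 0)) (bvec b)
      = (\<Sum>x | app (f x) (bvec b) \<noteq> 0 \<and> h x = y. app (f x) (bvec b))" for y b
  proof -
    have "app (osum (\<lambda>x. if h x = y then f x else 0)) (bvec b)
      = (\<Sum>x | app (f x) (bvec b) \<noteq> 0 \<and> h x = y. app (if h x = y then f x else 0) (bvec b))"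
      by (rule app_osum[OF lf]) (use lfinD[OF f, of "bvec b"] in \<open>auto split: if_splits\<close>)
    then show ?thesis by simp
  qed
  have sub: "{y. app (osum (\<lambda>x. if h x = y then f x else 0)) (bvec b) \<noteq> 0}
     \<subseteq> h ` {x. app (f x) (bvec b) \<noteq> 0}" for b
  proof
    fix y assume "y \<in> {y. app (osum (\<lambda>x. if h x = y then f x else 0)) (bvec b) \<noteq> 0}"
    then have "(\<Sum>x | app (f x) (bvec b) \<noteq> 0 \<and> h x = y. app (f x) (bvec b)) \<noteq> 0"
      by (simp add: inner)
    then obtain x where "x \<in> {x. app (f x) (bvec b) \<noteq> 0 \<and> h x = y}"
      by (meson sum.not_neutral_contains_not_neutral)
    then show "y \<in> h ` {x. app (f x) (bvec b) \<noteq> 0}" by auto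
  qed
  show outer: "lfin (\<lambda>y. osum (\<lambda>x. if h x = y then f x else 0))"
    unfolding lfin_def
    using finite_subset[OF sub] lfinD[OF f] by blast
  show "osum f = osum (\<lambda>y. osum (\<lambda>x. if h x = y then f x else 0))"
  proof (rule osum_eq_basisI[OF f outer], intro exI conjI)
    fix b
    let ?S = "{x. app (f x) (bvec b) \<noteq> 0}"
    show "finite ?S" using f by (rule lfinD)
    then show "finite (h ` ?S)" by simp
    show "?S \<subseteq> ?S" by simp
    show "{y. app (osum (\<lambda>x. if h x = y then f x else 0)) (bvec b) \<noteq> 0} \<subseteq> h ` ?S" by (rule sub)
    have "(\<Sum>i\<in>?S. app (f i) (bvec b)) = (\<Sum>y\<in>h ` ?S. \<Sum>x | x \<in> ?S \<and> h x = y. app (f x) (bvec b))"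
      using \<open>finite ?S\<close> by (rule sum.image_gen)
    then show "(\<Sum>i\<in>?S. app (f i) (bvec b)) =
        (\<Sum>y\<in>h ` ?S. app (osum (\<lambda>x. if h x = y then f x else 0)) (bvec b))"
      by (simp add: inner)
  qed
qed

lemma osum_reindex:
  assumes f: "lfin f" and h: "inj h" and z: "\<And>x. x \<notin> range h \<Longrightarrow> f x = 0"
  shows "lfin (\<lambda>i. f (h i))" "osum (\<lambda>i. f (h i)) = osum f"
proof -
  have im: "h ` {i. app (f (h i)) (bvec b) \<noteq> 0} = {x. app (f x) (bvec b) \<noteq> 0}" for b
  proof (intro equalityI subsetI)
    fix x assume "x \<in> {x. app (f x) (bvec b) \<noteq> 0}"
    moreover from this have "x \<in> range h" using z by fastforce
    ultimately show "x \<in> h ` {i. app (f (h i)) (bvec b) \<noteq> 0}" by auto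
  qed auto
  have fin: "finite {i. app (f (h i)) (bvec b) \<noteq> 0}" for b
    using im[of b] lfinD[OF f, of "bvec b"] h by (metis finite_imageD inj_on_subset subset_UNIV)
  then show l: "lfin (\<lambda>i. f (h i))" by (simp add: lfin_def)
  show "osum (\<lambda>i. f (h i)) = osum f"
  proof (rule osum_eq_basisI[OF l f], intro exI conjI)
    fix b
    let ?S = "{i. app (f (h i)) (bvec b) \<noteq> 0}"
    show "finite ?S" by (rule fin)
    then show "finite (h ` ?S)" by simp
    show "?S \<subseteq> ?S" by simp
    show "{i. app (f i) (bvec b) \<noteq> 0} \<subseteq> h ` ?S" using im by blast
    show "(\<Sum>i\<in>?S. app (f (h i)) (bvec b)) = (\<Sum>i\<in>h ` ?S. app (f i) (bvec b))"
      by (subst sum.reindex) (use h in \<open>auto intro: inj_on_subset\<close>)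
  qed
qed

lemma lfin_mult_left: "lfin f \<Longrightarrow> lfin (\<lambda>i. c * f i)"
  unfolding lfin_def
proof
  fix b assume "\<forall>b. finite {i. app (f i) (bvec b) \<noteq> 0}"
  then show "finite {i. app (c * f i) (bvec b) \<noteq> 0}"
    by (intro finite_subset[of "{i. app (c * f i) (bvec b) \<noteq> 0}" "{i. app (f i) (bvec b) \<noteq> 0}"])
       (auto simp: app_mult)
qed

lemma osum_mult_left: "lfin f \<Longrightarrow> osum (\<lambda>i. c * f i) = c * osum f"
proof (rule lop_eq_basis)
  fix b assume f: "lfin f"
  let ?S = "{i. app (f i) (bvec b) \<noteq> 0}"
  have "app (osum (\<lambda>i. c * f i)) (bvec b) = (\<Sum>i\<in>?S. app (c * f i) (bvec b))"
    by (rule app_osum[OF lfin_mult_left[OF f]]) (use lfinD[OF f] in \<open>auto simp: app_mult\<close>)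
  also have "\<dots> = app c (app (osum f) (bvec b))"
    by (subst app_osum[OF f, of ?S]) (use lfinD[OF f] in \<open>auto simp: app_mult app_sum\<close>)
  finally show "app (osum (\<lambda>i. c * f i)) (bvec b) = app (c * osum f) (bvec b)"
    by (simp add: app_mult)
qed

lemma lfin_add: "lfin f \<Longrightarrow> lfin g \<Longrightarrow> lfin (\<lambda>i. f i + g i)"
  unfolding lfin_def
proof
  fix b assume "\<forall>b. finite {i. app (f i) (bvec b) \<noteq> 0}" "\<forall>b. finite {i. app (g i) (bvec b) \<noteq> 0}"
  then have "finite ({i. app (f i) (bvec b) \<noteq> 0} \<union> {i. app (g i) (bvec b) \<noteq> 0})" by simp
  then show "finite {i. app (f i + g i) (bvec b) \<noteq> 0}"
    by (rule rev_finite_subset) (auto simp: app_plus)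
qed

lemma osum_add: "lfin f \<Longrightarrow> lfin g \<Longrightarrow> osum (\<lambda>i. f i + g i) = osum f + osum g"
proof (rule lop_eq_basis)
  fix b assume f: "lfin f" and g: "lfin g"
  let ?S = "{i. app (f i) (bvec b) \<noteq> 0} \<union> {i. app (g i) (bvec b) \<noteq> 0}"
  have fin: "finite ?S" using lfinD[OF f] lfinD[OF g] by blast
  have "app (osum (\<lambda>i. f i + g i)) (bvec b) = (\<Sum>i\<in>?S. app (f i + g i) (bvec b))"
    by (rule app_osum[OF lfin_add[OF f g] fin]) (auto simp: app_plus)
  also have "\<dots> = app (osum f) (bvec b) + app (osum g) (bvec b)"
    by (subst app_osum[OF f fin], simp, subst app_osum[OF g fin], simp)
       (simp add: app_plus sum.distrib)
  finally show "app (osum (\<lambda>i. f i + g i)) (bvec b) = app (osum f + osum g) (bvec b)"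
    by (simp add: app_plus)
qed

lemma lfin_zero [simp]: "lfin (\<lambda>i. 0)"
  by (simp add: lfin_def)

lemma osum_finite:
  assumes "finite S" "\<And>i. i \<notin> S \<Longrightarrow> f i = 0"
  shows "lfin f" "osum f = sum f S"
proof -
  have sub: "{i. app (f i) v \<noteq> 0} \<subseteq> S" for v using assms(2) by force
  show l: "lfin f" unfolding lfin_def using finite_subset[OF sub assms(1)] by blast
  show "osum f = sum f S"
    by (rule lop_eq_basis) (subst app_osum[OF l assms(1)], use sub in \<open>auto simp: sum_app\<close>)
qed

lemma lfin_sum:
  assumes "\<And>k. k \<in> K \<Longrightarrow> lfin (f k)"
  shows "lfin (\<lambda>i. \<Sum>k\<in>K. f k i)" and "osum (\<lambda>i. \<Sum>k\<in>K. f k i) = (\<Sum>k\<in>K. osum (f k))"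
proof -
  have "lfin (\<lambda>i. \<Sum>k\<in>K. f k i) \<and> osum (\<lambda>i. \<Sum>k\<in>K. f k i) = (\<Sum>k\<in>K. osum (f k))"
    using assms
  proof (induction K rule: infinite_finite_induct)
    case (insert x F)
    then show ?case by (simp add: lfin_add osum_add)
  qed (use osum_finite(2)[of "{}" "\<lambda>_. 0"] in auto)
  then show "lfin (\<lambda>i. \<Sum>k\<in>K. f k i)" and "osum (\<lambda>i. \<Sum>k\<in>K. f k i) = (\<Sum>k\<in>K. osum (f k))" by auto
qed

lemma osum_prod:
  assumes f: "lfin f" and g: "lfin g"
  shows "lfin (\<lambda>(x, y). f x * g y)" "osum (\<lambda>(x, y). f x * g y) = osum f * osum g"
proof -
  define G where "G b = {y. app (g y) (bvec b) \<noteq> 0}" for b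
  \<comment> \<open>\<open>g y\<close> acts first, so the support is fibred over the finite set
    \<open>G b\<close>: above \<open>y\<close> lies the support of \<open>f\<close> on the vector
    \<open>app (g y) (bvec b)\<close>.\<close>
  define S where "S b = (SIGMA y : G b. {x. app (f x) (app (g y) (bvec b)) \<noteq> 0})" for b
  have finG: "finite (G b)" for b unfolding G_def using g by (rule lfinD)
  have finS: "finite (S b)" for b unfolding S_def using finG lfinD[OF f] by blast
  have sub: "{p. app ((\<lambda>(x, y). f x * g y) p) (bvec b) \<noteq> 0} \<subseteq> prod.swap ` S b" for b
    by (auto simp: S_def G_def app_mult image_iff)
  show l: "lfin (\<lambda>(x, y). f x * g y)"
    unfolding lfin_def using finite_subset[OF sub] finS by blast
  show "osum (\<lambda>(x, y). f x * g y) = osum f * osum g"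
  proof (rule lop_eq_basis)
    fix b
    have "app (osum (\<lambda>(x, y). f x * g y)) (bvec b)
        = (\<Sum>p\<in>prod.swap ` S b. app ((\<lambda>(x, y). f x * g y) p) (bvec b))"
      by (rule app_osum[OF l]) (use sub finS in blast)+
    also have "\<dots> = (\<Sum>(y, x)\<in>S b. app (f x) (app (g y) (bvec b)))"
      by (subst sum.reindex) (auto simp: app_mult case_prod_unfold)
    also have "\<dots> = (\<Sum>y\<in>G b. \<Sum>x | app (f x) (app (g y) (bvec b)) \<noteq> 0. app (f x) (app (g y) (bvec b)))"
      unfolding S_def by (rule sum.Sigma[symmetric]) (use finG lfinD[OF f] in auto)
    also have "\<dots> = (\<Sum>y\<in>G b. app (osum f) (app (g y) (bvec b)))"
      by (intro sum.cong refl app_osum[OF f, symmetric]) (use lfinD[OF f] in auto)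
    also have "\<dots> = app (osum f) (app (osum g) (bvec b))"
      by (subst app_osum[OF g finG[of b]]) (auto simp: G_def app_sum)
    finally show "app (osum (\<lambda>(x, y). f x * g y)) (bvec b) = app (osum f * osum g) (bvec b)"
      by (simp add: app_mult)
  qed
qed

section \<open>Homogeneous operators\<close>

lemma homogeneous_app:
  assumes "homogeneous deg d a" "\<And>b. b \<in> keys v \<Longrightarrow> int (deg b) = D" "b \<in> keys (app a v)"
  shows "int (deg b) = D - d"
proof -
  have "b \<in> keys (\<Sum>x\<in>keys v. scl (lookup v x) (app a (bvec x)))"
    using assms(3) app_expand[of a v] by simp
  then have "lookup (\<Sum>x\<in>keys v. scl (lookup v x) (app a (bvec x))) b \<noteq> 0"
    by (simp add: in_keys_iff)
  then obtain x where x: "x \<in> keys v" "lookup (app a (bvec x)) b \<noteq> 0"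
    unfolding lookup_sum by (metis (no_types, lifting) lookup_scl mult_eq_0_iff sum.not_neutral_contains_not_neutral)
  then have "int (deg b) = int (deg x) - d"
    using assms(1) by (simp add: homogeneous_def in_keys_iff)
  then show ?thesis using assms(2) x(1) by simp
qed

lemma homogeneous_mult:
  assumes "homogeneous deg d a" "homogeneous deg d' b"
  shows "homogeneous deg (d + d') (a * b)"
  unfolding homogeneous_def
proof (intro allI ballI)
  fix x y assume y: "y \<in> keys (app (a * b) (bvec x))"
  have "int (deg z) = int (deg x) - d'" if "z \<in> keys (app b (bvec x))" for z
    using assms(2) that by (simp add: homogeneous_def)
  from homogeneous_app[OF assms(1) this, of "app b (bvec x)" y]
  show "int (deg y) = int (deg x) - (d + d')" using y by (simp add: app_mult)
qed

lemma homogeneous_zero [simp]: "homogeneous deg d 0"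
  by (simp add: homogeneous_def)

lemma homogeneous_csc [simp]: "homogeneous deg 0 (csc c)"
  by (auto simp: homogeneous_def app_csc in_keys_iff lookup_bvec split: if_splits)

lemma homogeneous_one [simp]: "homogeneous deg 0 1"
  using homogeneous_csc[of deg 1] by simp

lemma homogeneous_csc_mult: "homogeneous deg d a \<Longrightarrow> homogeneous deg d (csc c * a)"
  using homogeneous_mult[OF homogeneous_csc] by fastforce

lemma homogeneous_add: "homogeneous deg d a \<Longrightarrow> homogeneous deg d b \<Longrightarrow> homogeneous deg d (a + b)"
  unfolding homogeneous_def app_plus by (meson Poly_Mapping.keys_add Un_iff subsetD)

lemma homogeneous_sum: "(\<And>i. i \<in> I \<Longrightarrow> homogeneous deg d (f i)) \<Longrightarrow> homogeneous deg d (sum f I)"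
  by (induction I rule: infinite_finite_induct) (auto intro: homogeneous_add)

lemma homogeneous_osum:
  assumes "lfin f" "\<And>i. homogeneous deg d (f i)"
  shows "homogeneous deg d (osum f)"
  unfolding homogeneous_def
proof (intro allI ballI)
  fix x y assume "y \<in> keys (app (osum f) (bvec x))"
  also have "app (osum f) (bvec x) = app (\<Sum>i | app (f i) (bvec x) \<noteq> 0. f i) (bvec x)"
    using app_osum[OF assms(1) lfinD[OF assms(1)]] by (simp add: sum_app)
  finally have y: "y \<in> keys (app (\<Sum>i | app (f i) (bvec x) \<noteq> 0. f i) (bvec x))" .
  have "homogeneous deg d (\<Sum>i | app (f i) (bvec x) \<noteq> 0. f i)"
    by (rule homogeneous_sum) (rule assms(2))
  then show "int (deg y) = int (deg x) - d" using y unfolding homogeneous_def by blast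
qed

text \<open>Degrees of basis vectors are natural numbers and cannot drop below zero.\<close>

lemma homogeneous_vanish:
  assumes "homogeneous deg d a" "int (deg b) < d"
  shows "app a (bvec b) = 0"
proof (rule ccontr)
  assume "app a (bvec b) \<noteq> 0"
  then obtain x where "x \<in> keys (app a (bvec b))" by fastforce
  then show False using assms by (force simp: homogeneous_def)
qed

text \<open>The main source of local finiteness: the right factor acts first and kills a basis
  vector as soon as its own degree exceeds that of the vector.\<close>

lemma lfin_homogeneous:
  assumes "\<And>x. f x = A x * B x" "\<And>x. homogeneous deg (\<delta> x) (B x)"
    and "\<And>D. finite {x. f x \<noteq> 0 \<and> \<delta> x \<le> int D}"
  shows "lfin f"
  unfolding lfin_def
proof
  fix b
  have "app (f x) (bvec b) = 0" if "\<delta> x > int (deg b)" for x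
    using homogeneous_vanish[OF assms(2) that] by (simp add: assms(1) app_mult)
  then have "{x. app (f x) (bvec b) \<noteq> 0} \<subseteq> {x. f x \<noteq> 0 \<and> \<delta> x \<le> int (deg b)}"
    by (auto simp: not_le[symmetric])
  then show "finite {x. app (f x) (bvec b) \<noteq> 0}" using assms(3) finite_subset by blast
qed

section \<open>Exponentials of generating series\<close>

text \<open>The constant term is cut off because \<open>epow\<close> sums from \<open>n = 1\<close>,
  so that \<open>a 0\<close> may be anything.\<close>

definition afps :: "(nat \<Rightarrow> 'b lop) \<Rightarrow> 'b lop fps" where
  "afps a = Abs_fps (\<lambda>n. if n = 0 then 0 else a n)"

lemma epow_fps: "epow a j k = fps_nth (afps a ^ j) k"
proof (induction j arbitrary: k)
  case (Suc j)
  have "fps_nth (afps a ^ Suc j) k = (\<Sum>i=0..k. fps_nth (afps a) i * fps_nth (afps a ^ j) (k - i))"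
    by (simp add: fps_mult_nth)
  also have "\<dots> = (\<Sum>i=1..k. fps_nth (afps a) i * fps_nth (afps a ^ j) (k - i))"
    by (rule sum.mono_neutral_right) (auto simp: afps_def)
  also have "\<dots> = (\<Sum>i=1..k. a i * epow a j (k - i))"
    by (intro sum.cong refl) (auto simp: afps_def Suc)
  finally show ?case by simp
qed simp

lemma epow_eq_0: "k < j \<Longrightarrow> epow a j k = 0"
  by (induction j arbitrary: k) (auto intro!: sum.neutral)

lemma expc_0 [simp]: "expc a 0 = 1"
  by (simp add: expc_def)

lemma expc_superset: "k \<le> J \<Longrightarrow> expc a k = (\<Sum>j\<le>J. csc (1 / fact j) * epow a j k)"
  unfolding expc_def by (intro sum.mono_neutral_left) (auto simp: epow_eq_0)

text \<open>The power rule for the derivative of \<open>A ^ Suc j\<close>, read coefficientwise.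
  Over noncommuting coefficients it rests on the series commuting with its derivative, the fact
  \<open>c\<close>.\<close>

lemma epow_deriv:
  assumes comm: "\<And>m n. a m * a n = a n * a m"
  shows "csc (of_nat k) * epow a (Suc j) k =
    csc (of_nat (Suc j)) * (\<Sum>n=1..k. csc (of_nat n) * (a n * epow a j (k - n)))"
proof -
  let ?A = "afps a"
  have c: "?A * fps_deriv ?A = fps_deriv ?A * ?A"
  proof (rule fps_ext)
    fix n
    have "fps_nth (?A * fps_deriv ?A) n = (\<Sum>i=0..n. fps_nth ?A i * fps_nth (fps_deriv ?A) (n - i))"
      by (simp only: fps_mult_nth)
    also have "\<dots> = (\<Sum>i=0..n. fps_nth (fps_deriv ?A) (n - i) * fps_nth ?A i)"
      by (intro sum.cong refl) (simp add: afps_def comm flip: csc_of_nat,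
        metis (no_types, lifting) comm csc_left_commute csc_plus csc_one csc_of_nat mult.assoc of_nat_Suc)
    also have "\<dots> = (\<Sum>i=0..n. fps_nth (fps_deriv ?A) i * fps_nth ?A (n - i))"
      by (rule sum.reindex_bij_witness[of _ "\<lambda>i. n - i" "\<lambda>i. n - i"]) auto
    finally show "fps_nth (?A * fps_deriv ?A) n = fps_nth (fps_deriv ?A * ?A) n"
      by (simp only: fps_mult_nth)
  qed
  have d: "fps_deriv (?A ^ Suc j) = of_nat (Suc j) * (fps_deriv ?A * ?A ^ j)"
  proof (induction j)
    case (Suc j)
    have "fps_deriv (?A ^ Suc (Suc j)) = ?A * fps_deriv (?A ^ Suc j) + fps_deriv ?A * ?A ^ Suc j"
      by (simp only: power_Suc[of _ "Suc j"] fps_deriv_mult)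
    also have "?A * fps_deriv (?A ^ Suc j) = of_nat (Suc j) * (?A * fps_deriv ?A * ?A ^ j)"
      by (simp only: Suc mult.assoc mult_of_nat_commute)
    also have "\<dots> = of_nat (Suc j) * (fps_deriv ?A * ?A ^ Suc j)"
      by (simp only: c mult.assoc power_Suc)
    finally show ?case by (simp add: algebra_simps)
  qed simp
  show ?thesis
  proof (cases k)
    case 0
    then show ?thesis by (simp add: csc_zero)
  next
    case (Suc k')
    have "of_nat (Suc k') * fps_nth (?A ^ Suc j) (Suc k') = fps_nth (fps_deriv (?A ^ Suc j)) k'"
      by (simp only: fps_deriv_nth Suc_eq_plus1)
    also have "\<dots> = of_nat (Suc j) * fps_nth (fps_deriv ?A * ?A ^ j) k'"
      unfolding d by (simp only: fps_mult_of_nat_nth)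
    also have "fps_nth (fps_deriv ?A * ?A ^ j) k' =
        (\<Sum>i=0..k'. of_nat (Suc i) * (a (Suc i) * epow a j (k' - i)))"
      by (simp add: fps_mult_nth epow_fps afps_def mult.assoc)
    also have "\<dots> = (\<Sum>n=1..k. csc (of_nat n) * (a n * epow a j (k - n)))"
      unfolding Suc by (rule sum.reindex_bij_witness[of _ "\<lambda>i. i - 1" Suc]) (auto simp: csc_of_nat simp del: of_nat_Suc)
    finally show ?thesis by (simp only: epow_fps[of a "Suc j"] Suc csc_of_nat)
  qed
qed

text \<open>The derivative of an exponential is the derivative of the exponent times the
  exponential, read coefficientwise. Later identities are derived from this recurrence instead of
  the explicit sum over \<open>j\<close>.\<close>

lemma expc_rec:
  assumes comm: "\<And>m n. a m * a n = a n * a m"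
  shows "csc (of_nat k) * expc a k = (\<Sum>n=1..k. csc (of_nat n) * (a n * expc a (k - n)))"
proof (cases k)
  case 0
  then show ?thesis by (simp add: csc_zero)
next
  case (Suc k')
  have "csc (of_nat k) * expc a k = (\<Sum>j\<le>Suc k'. csc (1 / fact j) * (csc (of_nat k) * epow a j k))"
    by (subst expc_superset[of k "Suc k'"])
       (simp_all add: Suc csm_sum csm_simps mult_ac del: sum.atMost_Suc epow.simps of_nat_Suc)
  also have "\<dots> = (\<Sum>j\<le>k'. csc (1 / fact (Suc j)) * (csc (of_nat k) * epow a (Suc j) k))"
    by (subst sum.atMost_Suc_shift) (simp add: Suc del: epow.simps(2) fact_Suc)
  also have "\<dots> = (\<Sum>j\<le>k'. \<Sum>n=1..k. csc (of_nat n) * (a n * (csc (1 / fact j) * epow a j (k - n))))"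
  proof (intro sum.cong refl)
    fix j
    have e: "1 / fact (Suc j) * of_nat (Suc j) = (1 / fact j :: complex)"
      by (simp add: field_simps del: of_nat_Suc)
    have "csc (1 / fact (Suc j)) * (csc (of_nat k) * epow a (Suc j) k) =
      csc (1 / fact j) * (\<Sum>n=1..k. csc (of_nat n) * (a n * epow a j (k - n)))"
      by (simp only: epow_deriv[OF comm] mult.assoc[symmetric] csc_mult e)
    then show "csc (1 / fact (Suc j)) * (csc (of_nat k) * epow a (Suc j) k) =
      (\<Sum>n=1..k. csc (of_nat n) * (a n * (csc (1 / fact j) * epow a j (k - n))))"
      by (simp add: csm_simps csm_sum mult_ac del: epow.simps fact_Suc of_nat_Suc One_nat_def)
  qed
  also have "\<dots> = (\<Sum>n=1..k. csc (of_nat n) * (a n * expc a (k - n)))"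
    by (subst sum.swap) (intro sum.cong refl, subst expc_superset[of _ k'], 
        auto simp: Suc sum_distrib_left)
  finally show ?thesis .
qed

lemma epow_commute:
  assumes "\<And>n. n > 0 \<Longrightarrow> x * a n = a n * x"
  shows "x * epow a j k = epow a j k * x"
proof (induction j arbitrary: k)
  case (Suc j)
  have "x * (a n * epow a j (k - n)) = a n * epow a j (k - n) * x" if "n \<in> {1..k}" for n
    using that assms[of n] Suc[of "k - n"] by (metis (no_types, lifting) atLeastAtMost_iff less_eq_Suc_le mult.assoc One_nat_def)
  then show ?case by (simp add: sum_distrib_left sum_distrib_right del: One_nat_def)
qed simp

lemma expc_commute:
  assumes "\<And>n. n > 0 \<Longrightarrow> x * a n = a n * x"
  shows "x * expc a k = expc a k * x"
proof -
  have "x * (csc c * epow a j k) = csc c * epow a j k * x" for c j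
    using epow_commute[of x a, OF assms] by (simp add: csc_left_commute mult.assoc)
  then show ?thesis by (simp add: expc_def sum_distrib_left sum_distrib_right)
qed

lemma homogeneous_expc:
  assumes "\<And>n. n > 0 \<Longrightarrow> homogeneous deg (s * int n) (a n)"
  shows "homogeneous deg (s * int k) (expc a k)"
proof -
  have "homogeneous deg (s * int k) (epow a j k)" for j
  proof (induction j arbitrary: k)
    case (Suc j)
    have "homogeneous deg (s * int k) (a n * epow a j (k - n))" if "n \<in> {1..k}" for n
      using homogeneous_mult[OF assms[of n] Suc[of "k - n"]] that
      by (simp add: of_nat_diff algebra_simps)
    then show ?case by (auto intro: homogeneous_sum)
  qed simp
  then show ?thesis unfolding expc_def by (intro homogeneous_sum homogeneous_csc_mult)
qed

lemma expc_cong: "(\<And>n. n > 0 \<Longrightarrow> a n = b n) \<Longrightarrow> expc a k = expc b k"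
proof -
  assume *: "\<And>n. n > 0 \<Longrightarrow> a n = b n"
  have "epow a j k = epow b j k" for j
    by (induction j arbitrary: k) (auto simp: * intro!: sum.cong)
  then show ?thesis by (simp add: expc_def)
qed

lemma expc_scale: "expc (\<lambda>n. csc (s ^ n) * a n) k = csc (s ^ k) * expc a k"
proof -
  have "epow (\<lambda>n. csc (s ^ n) * a n) j k = csc (s ^ k) * epow a j k" for j
  proof (induction j arbitrary: k)
    case (Suc j)
    have "csc (s ^ n) * a n * (csc (s ^ (k - n)) * epow a j (k - n)) =
        csc (s ^ k) * (a n * epow a j (k - n))" if "n \<in> {1..k}" for n
    proof -
      have "s ^ (k - n) * s ^ n = s ^ k" using that by (simp flip: power_add)
      then show ?thesis by (simp add: csm_simps)
    qed
    then show ?case by (simp add: Suc sum_distrib_left del: One_nat_def)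
  qed simp
  then show ?thesis by (simp add: expc_def csm_simps csm_sum mult_ac)
qed

lemma expc_zero: "expc (\<lambda>n. 0 :: 'b lop) k = (if k = 0 then 1 else 0)"
proof (cases k)
  case (Suc k')
  have "epow (\<lambda>n. 0 :: 'b lop) j (Suc k') = 0" for j by (cases j) auto
  then show ?thesis by (simp add: expc_def Suc)
qed simp

text \<open>For positive \<open>k\<close> the factor \<open>k\<close> is invertible, so the
  recurrence determines every coefficient from the earlier ones.\<close>

lemma expc_eqI:
  assumes comm: "\<And>m n. a m * a n = a n * a m"
    and "X 0 = 1" and "\<And>k. csc (of_nat k) * X k = (\<Sum>n=1..k. csc (of_nat n) * (a n * X (k - n)))"
  shows "expc a k = X k"
proof (induction k rule: less_induct)
  case (less k)
  show ?case
  proof (cases "k = 0")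
    case False
    have "csc (of_nat k) * expc a k = csc (of_nat k) * X k"
      unfolding expc_rec[OF comm] assms(3)
      using False less by (intro sum.cong refl) auto
    from csc_cancel[OF _ this] False show ?thesis by simp
  qed (use assms in simp)
qed

lemma sum_triangle_swap:
  fixes f :: "nat \<Rightarrow> nat \<Rightarrow> 'a::comm_monoid_add"
  shows "(\<Sum>n=1..k. \<Sum>j\<le>k - n. f n j) = (\<Sum>j\<le>k. \<Sum>n=1..k - j. f n j)" (is "_ = ?rhs")
proof -
  have "(\<Sum>n=1..k. \<Sum>j\<le>k - n. f n j) = (\<Sum>(n, j)\<in>(SIGMA n:{1..k}. {..k - n}). f n j)"
    by (rule sum.Sigma) auto
  also have "\<dots> = (\<Sum>(j, n)\<in>(SIGMA j:{..k}. {1..k - j}). f n j)"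
    by (rule sum.reindex_bij_witness[of _ "\<lambda>(j, n). (n, j)" "\<lambda>(n, j). (j, n)"]) auto
  also have "\<dots> = ?rhs" by (rule sum.Sigma[symmetric]) auto
  finally show ?thesis .
qed

lemma sum_triangle_diag:
  fixes f :: "nat \<Rightarrow> nat \<Rightarrow> 'a::comm_monoid_add"
  shows "(\<Sum>n=1..k. \<Sum>j\<le>k - n. f n j) = (\<Sum>i\<le>k. \<Sum>n=1..i. f n (i - n))" (is "_ = ?rhs")
proof -
  have "(\<Sum>n=1..k. \<Sum>j\<le>k - n. f n j) = (\<Sum>(n, j)\<in>(SIGMA n:{1..k}. {..k - n}). f n j)"
    by (rule sum.Sigma) auto
  also have "\<dots> = (\<Sum>(i, n)\<in>(SIGMA i:{..k}. {1..i}). f n (i - n))"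
    by (rule sum.reindex_bij_witness[of _ "\<lambda>(i, n). (n, i - n)" "\<lambda>(n, j). (j + n, n)"]) auto
  also have "\<dots> = ?rhs" by (rule sum.Sigma[symmetric]) auto
  finally show ?thesis .
qed

text \<open>The Cauchy product satisfies the recurrence of the sum: in degree \<open>k\<close> the
  part coming from \<open>a\<close> carries the weight \<open>i\<close>, the part coming from
  \<open>b\<close> the weight \<open>k - i\<close>.\<close>

lemma expc_add:
  assumes a: "\<And>m n. a m * a n = a n * a m" and b: "\<And>m n. b m * b n = b n * b m"
    and ab: "\<And>m n. a m * b n = b n * a m"
  shows "expc (\<lambda>n. a n + b n) k = (\<Sum>i\<le>k. expc a i * expc b (k - i))"
proof (rule expc_eqI)
  show "(a m + b m) * (a n + b n) = (a n + b n) * (a m + b m)" for m n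
    using a[of m n] b[of m n] ab[of m n] ab[of n m] by (simp add: distrib_left distrib_right add_ac)
next
  fix k
  let ?X = "\<lambda>k. \<Sum>i\<le>k. expc a i * expc b (k - i)"
  have A: "(\<Sum>n=1..k. csc (of_nat n) * (a n * ?X (k - n))) =
      (\<Sum>i\<le>k. csc (of_nat i) * (expc a i * expc b (k - i)))"
  proof -
    have "(\<Sum>n=1..k. csc (of_nat n) * (a n * ?X (k - n))) =
      (\<Sum>n=1..k. \<Sum>j\<le>k - n. csc (of_nat n) * (a n * expc a j) * expc b (k - n - j))"
      by (simp add: sum_distrib_left mult.assoc)
    also have "\<dots> = (\<Sum>i\<le>k. \<Sum>n=1..i. csc (of_nat n) * (a n * expc a (i - n)) * expc b (k - n - (i - n)))"
      by (rule sum_triangle_diag)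
    also have "\<dots> = (\<Sum>i\<le>k. (\<Sum>n=1..i. csc (of_nat n) * (a n * expc a (i - n))) * expc b (k - i))"
      unfolding sum_distrib_right by (intro sum.cong refl) auto
    finally show ?thesis by (simp add: expc_rec[OF a, symmetric] mult.assoc del: One_nat_def)
  qed
  have B: "(\<Sum>n=1..k. csc (of_nat n) * (b n * ?X (k - n))) =
      (\<Sum>i\<le>k. csc (of_nat (k - i)) * (expc a i * expc b (k - i)))"
  proof -
    have c: "b n * expc a j = expc a j * b n" for n j by (rule expc_commute) (simp add: ab)
    have "(\<Sum>n=1..k. csc (of_nat n) * (b n * ?X (k - n))) =
      (\<Sum>n=1..k. \<Sum>j\<le>k - n. expc a j * (csc (of_nat n) * (b n * expc b (k - n - j))))"
      unfolding sum_distrib_left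
      by (intro sum.cong refl) (metis c csc_left_commute mult.assoc)
    also have "\<dots> = (\<Sum>j\<le>k. \<Sum>n=1..k - j. expc a j * (csc (of_nat n) * (b n * expc b (k - n - j))))"
      by (rule sum_triangle_swap)
    also have "\<dots> = (\<Sum>j\<le>k. expc a j * (\<Sum>n=1..k - j. csc (of_nat n) * (b n * expc b (k - j - n))))"
      unfolding sum_distrib_left by (intro sum.cong refl) (simp add: add.commute)
    finally show ?thesis by (simp only: expc_rec[OF b, symmetric] csc_left_commute)
  qed
  have "csc (of_nat k) * ?X k =
     (\<Sum>i\<le>k. csc (of_nat i) * (expc a i * expc b (k - i)) + csc (of_nat (k - i)) * (expc a i * expc b (k - i)))"
    unfolding sum_distrib_left
    by (intro sum.cong refl) (simp add: of_nat_diff flip: distrib_right csc_plus)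
  then show "csc (of_nat k) * ?X k = (\<Sum>n=1..k. csc (of_nat n) * ((a n + b n) * ?X (k - n)))"
    by (simp only: sum.distrib A[symmetric] B[symmetric] distrib_left distrib_right)
qed simp

text \<open>The commutator with \<open>d\<close> acts on creation modes as \<open>z\<close> times
  the partial derivative by \<open>c n\<close>, and this derivative of the exponential is the
  exponential shifted by \<open>n\<close> degrees.\<close>

lemma expc_derivation:
  assumes c: "\<And>m n. c m * c n = c n * c m"
    and dc: "\<And>m. m > 0 \<Longrightarrow> d * c m = c m * d + (if n = m then csc z else 0)"
    and n: "n > 0"
  shows "d * expc c l = expc c l * d + (if n \<le> l then csc z * expc c (l - n) else 0)"
proof (induction l rule: less_induct)
  case (less l)
  show ?case
  proof (cases "l = 0")
    case False
    let ?R = "\<lambda>l. if n \<le> l then csc z * expc c (l - n) else 0"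
    have "csc (of_nat l) * (d * expc c l) = (\<Sum>m=1..l. csc (of_nat m) * (d * c m * expc c (l - m)))"
      by (simp only: csc_left_commute[of d, symmetric] expc_rec[OF c] sum_distrib_left mult.assoc)
    also have "\<dots> = (\<Sum>m=1..l. csc (of_nat m) * (c m * expc c (l - m)) * d
        + csc (of_nat m) * (c m * ?R (l - m)) + (if m = n then csc (of_nat n) * ?R l else 0))"
    proof (intro sum.cong refl)
      fix m assume m: "m \<in> {1..l}"
      then have "d * c m * expc c (l - m) = c m * (d * expc c (l - m)) + (if n = m then csc z else 0) * expc c (l - m)"
        by (simp add: dc distrib_right mult.assoc)
      also have "d * expc c (l - m) = expc c (l - m) * d + ?R (l - m)"
        using m less by simp
      finally show "csc (of_nat m) * (d * c m * expc c (l - m)) = csc (of_nat m) * (c m * expc c (l - m)) * d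
        + csc (of_nat m) * (c m * ?R (l - m)) + (if m = n then csc (of_nat n) * ?R l else 0)"
        using m by (auto simp: distrib_left mult.assoc)
    qed
    also have "\<dots> = csc (of_nat l) * expc c l * d
        + (\<Sum>m=1..l. csc (of_nat m) * (c m * ?R (l - m))) + csc (of_nat n) * ?R l"
      using n by (auto simp: sum.distrib expc_rec[OF c] sum_distrib_right simp del: One_nat_def)
    also have "(\<Sum>m=1..l. csc (of_nat m) * (c m * ?R (l - m))) = csc (of_nat (l - n)) * ?R l"
    proof (cases "n \<le> l")
      case True
      have "(\<Sum>m=1..l. csc (of_nat m) * (c m * ?R (l - m))) =
          (\<Sum>m=1..l - n. csc z * (csc (of_nat m) * (c m * expc c (l - n - m))))"
        by (rule sum.mono_neutral_cong_right) (auto simp: csm_simps mult_ac diff_commute add.commute)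
      also have "\<dots> = csc (of_nat (l - n)) * ?R l"
        unfolding sum_distrib_left[symmetric] expc_rec[OF c, symmetric]
        using True by (simp add: csm_simps mult_ac)
      finally show ?thesis .
    qed (auto intro!: sum.neutral)
    finally have "csc (of_nat l) * (d * expc c l) = csc (of_nat l) * (expc c l * d + ?R l)"
      by (cases "n \<le> l") (auto simp: distrib_left mult.assoc add.assoc of_nat_diff simp flip: distrib_right csc_plus)
    from csc_cancel[OF _ this] False show ?thesis by simp
  qed (use n in simp)
qed

text \<open>Moving an exponential of annihilation modes past one of creation modes costs the
  exponential of the central commutator. \<open>F\<close> is that scalar series, specified by the
  recurrence of \<open>expc_rec\<close> for numbers; the index \<open>j\<close> is the degree that
  has been contracted.\<close>

lemma expc_contraction:
  fixes F \<zeta> :: "nat \<Rightarrow> complex"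
  assumes c: "\<And>m n. c m * c n = c n * c m" and d: "\<And>m n. d m * d n = d n * d m"
    and dc: "\<And>m n. m > 0 \<Longrightarrow> n > 0 \<Longrightarrow> d n * c m = c m * d n + (if n = m then csc (\<zeta> n) else 0)"
    and F0: "F 0 = 1" and F: "\<And>k. of_nat k * F k = (\<Sum>n=1..k. of_nat n * \<zeta> n * F (k - n))"
  shows "expc d k * expc c l = (\<Sum>j\<le>k. csc (F j) * ((if j \<le> l then expc c (l - j) else 0) * expc d (k - j)))"
proof (induction k rule: less_induct)
  case (less k)
  \<comment> \<open>The creation coefficient left after contracting degree \<open>j\<close>, with
    the default 0 once the degree \<open>l\<close> is exhausted; the default makes the exchange rule
    \<open>dt\<close> uniform in \<open>j\<close>.\<close>
  define t where "t j = (if j \<le> l then expc c (l - j) else 0)" for j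
  have dt: "d n * t j = t j * d n + csc (\<zeta> n) * t (j + n)" if "n > 0" for n j
  proof (cases "j \<le> l")
    case True
    have "d n * expc c (l - j) = expc c (l - j) * d n +
        (if n \<le> l - j then csc (\<zeta> n) * expc c (l - j - n) else 0)"
      by (rule expc_derivation[OF c _ that]) (rule dc[OF _ that])
    moreover have "n \<le> l - j \<longleftrightarrow> j + n \<le> l" using True by auto
    ultimately show ?thesis using True by (simp add: t_def)
  qed (simp add: t_def)
  have IH: "expc d k' * t 0 = (\<Sum>j\<le>k'. csc (F j) * (t j * expc d (k' - j)))" if "k' < k" for k'
    using less that by (simp add: t_def)
  have "expc d k * t 0 = (\<Sum>j\<le>k. csc (F j) * (t j * expc d (k - j)))"
  proof (cases "k = 0")
    case False
    have "csc (of_nat k) * (expc d k * t 0) = (\<Sum>n=1..k. csc (of_nat n) * (d n * (expc d (k - n) * t 0)))"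
      by (simp add: expc_rec[OF d] sum_distrib_right mult.assoc del: One_nat_def flip: mult.assoc[of "csc (of_nat k)"])
    also have "\<dots> = (\<Sum>n=1..k. \<Sum>j\<le>k - n. csc (of_nat n) * (csc (F j) * (d n * t j * expc d (k - n - j))))"
      by (intro sum.cong refl) (simp add: IH sum_distrib_left csm_simps mult_ac mult.assoc)
    also have "\<dots> = (\<Sum>n=1..k. \<Sum>j\<le>k - n. csc (F j) * (t j * (csc (of_nat n) * (d n * expc d (k - n - j)))))
        + (\<Sum>n=1..k. \<Sum>j\<le>k - n. csc (of_nat n * \<zeta> n * F j) * (t (j + n) * expc d (k - n - j)))"
      unfolding sum.distrib[symmetric]
    proof (intro sum.cong refl)
      fix n j assume "n \<in> {1..k}"
      then have "n > 0" by simp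
      show "csc (of_nat n) * (csc (F j) * (d n * t j * expc d (k - n - j))) =
        csc (F j) * (t j * (csc (of_nat n) * (d n * expc d (k - n - j)))) +
        csc (of_nat n * \<zeta> n * F j) * (t (j + n) * expc d (k - n - j))"
        unfolding dt[OF \<open>n > 0\<close>]
        by (simp add: distrib_right distrib_left csm_simps mult_ac mult.assoc)
    qed
    also have "(\<Sum>n=1..k. \<Sum>j\<le>k - n. csc (F j) * (t j * (csc (of_nat n) * (d n * expc d (k - n - j)))))
        = (\<Sum>j\<le>k. csc (F j) * (t j * (csc (of_nat (k - j)) * expc d (k - j))))"
      unfolding sum_triangle_swap expc_rec[OF d] sum_distrib_left
      by (intro sum.cong refl) (simp add: add.commute)
    also have "(\<Sum>n=1..k. \<Sum>j\<le>k - n. csc (of_nat n * \<zeta> n * F j) * (t (j + n) * expc d (k - n - j)))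
        = (\<Sum>i\<le>k. csc (of_nat i * F i) * (t i * expc d (k - i)))"
      unfolding sum_triangle_diag F csc_sum sum_distrib_right
      by (intro sum.cong refl) auto
    \<comment> \<open>The uncontracted part has the weight \<open>k - j\<close> and the contracted
      part the weight \<open>j\<close>; together they give the factor \<open>k\<close> that is
      cancelled at the end.\<close>
    also have "(\<Sum>j\<le>k. csc (F j) * (t j * (csc (of_nat (k - j)) * expc d (k - j))))
        + (\<Sum>i\<le>k. csc (of_nat i * F i) * (t i * expc d (k - i)))
        = csc (of_nat k) * (\<Sum>j\<le>k. csc (F j) * (t j * expc d (k - j)))"
      unfolding sum.distrib[symmetric] sum_distrib_left
    proof (intro sum.cong refl)
      fix j assume "j \<in> {..k}"
      then have "of_nat k * F j = F j * of_nat (k - j) + of_nat j * F j" 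
        by (simp add: of_nat_diff algebra_simps)
      then show "csc (F j) * (t j * (csc (of_nat (k - j)) * expc d (k - j))) +
         csc (of_nat j * F j) * (t j * expc d (k - j)) = csc (of_nat k) * (csc (F j) * (t j * expc d (k - j)))"
        by (simp add: csm_simps csm_plus[symmetric] mult_ac)
    qed
    finally have *: "csc (of_nat k) * (expc d k * t 0) = csc (of_nat k) * (\<Sum>j\<le>k. csc (F j) * (t j * expc d (k - j)))" .
    from csc_cancel[OF _ *] False show ?thesis by simp
  qed (simp add: F0)
  then show ?case by (simp add: t_def)
qed

section \<open>Vertex operators\<close>

lemma csc_diff: "csc (c - d) = csc c - csc d"
  using csc_plus[of c "- d"] by (simp add: csc_uminus)

text \<open>\<open>(e, c, d)\<close> are the zero mode factor, the creation and the annihilation modes of a vertex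
  operator.\<close>

locale vertex =
  fixes deg :: "'b \<Rightarrow> nat" and e :: "'b lop" and c d :: "nat \<Rightarrow> 'b lop"
  assumes deg_e: "homogeneous deg 0 e"
    and deg_c: "n > 0 \<Longrightarrow> homogeneous deg (- int n) (c n)"
    and deg_d: "n > 0 \<Longrightarrow> homogeneous deg (int n) (d n)"
    and c_comm: "c m * c n = c n * c m"
    and d_comm: "d m * d n = d n * d m"
begin

lemma deg_expc_c: "homogeneous deg (- int k) (expc c k)"
  using homogeneous_expc[of deg "-1" c] deg_c by simp

lemma deg_expc_d: "homogeneous deg (int k) (expc d k)"
  using homogeneous_expc[of deg 1 d] deg_d by simp

lemma lfin_vertex: "lfin (\<lambda>(i, k). if int k - int i = m then e * expc c i * expc d k else 0)"
proof (rule lfin_homogeneous[where deg = deg and \<delta> = "\<lambda>(i, k). int k"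
      and A = "\<lambda>(i, k). if int k - int i = m then e * expc c i else 0" and B = "\<lambda>(i, k). expc d k"])
  fix D
  show "finite {x. (case x of (i, k) \<Rightarrow> if int k - int i = m then e * expc c i * expc d k else 0) \<noteq> 0
    \<and> (case x of (i, k) \<Rightarrow> int k) \<le> int D}"
    by (rule finite_subset[of _ "{..D + nat \<bar>m\<bar>} \<times> {..D}"]) (auto split: if_splits)
qed (auto simp: deg_expc_d)

text \<open>Indexing by both degrees with fixed difference puts creation and annihilation on the
  same footing, which the regroupings below require.\<close>

lemma vertex_op_osum:
  "vertex_op e c d m = osum (\<lambda>(i, k). if int k - int i = m then e * expc c i * expc d k else 0)"
proof -
  let ?f = "\<lambda>(i, k). if int k - int i = m then e * expc c i * expc d k else 0"
  let ?h = "\<lambda>k. (nat (int k - m), k)"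
  have "osum (\<lambda>k. ?f (?h k)) = osum ?f"
  proof (rule osum_reindex(2)[OF lfin_vertex])
    show "inj ?h" by (auto simp: inj_on_def)
    show "?f x = 0" if "x \<notin> range ?h" for x
      using that by (cases x) (auto simp: image_iff)
  qed
  moreover have "(\<lambda>k. ?f (?h k)) =
      (\<lambda>k. if int k \<ge> m then e * expc c (nat (int k - m)) * expc d k else 0)"
    by (auto simp: fun_eq_iff)
  ultimately show ?thesis unfolding vertex_op_def by simp
qed

lemma deg_vertex_op: "homogeneous deg m (vertex_op e c d m)"
  unfolding vertex_op_osum
proof (rule homogeneous_osum[OF lfin_vertex])
  fix x :: "nat \<times> nat"
  obtain i k where x: "x = (i, k)" by (cases x)
  have "homogeneous deg (0 + - int i + int k) (e * expc c i * expc d k)"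
    by (intro homogeneous_mult deg_e deg_expc_c deg_expc_d)
  then show "homogeneous deg m (case x of (i, k) \<Rightarrow> if int k - int i = m then e * expc c i * expc d k else 0)"
    by (auto simp: x add.commute)
qed

end

section \<open>Normally ordered products and commutators of two vertex operators\<close>

definition quad :: "'b lop \<Rightarrow> (nat \<Rightarrow> 'b lop) \<Rightarrow> (nat \<Rightarrow> 'b lop) \<Rightarrow> (nat \<Rightarrow> 'b lop) \<Rightarrow> (nat \<Rightarrow> 'b lop)
    \<Rightarrow> (nat \<times> nat) \<times> (nat \<times> nat) \<Rightarrow> 'b lop" where
  "quad E c c' d d' = (\<lambda>((i, k), (i', k')). E * (expc c i * expc c' i') * (expc d k * expc d' k'))"

definition qdeg :: "(nat \<times> nat) \<times> (nat \<times> nat) \<Rightarrow> int" where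
  "qdeg = (\<lambda>((i, k), (i', k')). int k + int k' - int i - int i')"

text \<open>The mode \<open>m\<close> of the left factor fixes the contracted degree: a term with
  creation degree \<open>i\<close> and annihilation degree \<open>k\<close> from that factor arises
  only by contracting \<open>m - k + i\<close>, and not at all if this is negative.\<close>

definition qcoef :: "complex \<Rightarrow> (nat \<Rightarrow> complex) \<Rightarrow> int \<Rightarrow> (nat \<times> nat) \<times> (nat \<times> nat) \<Rightarrow> complex" where
  "qcoef t F m = (\<lambda>((i, k), (i', k')).
     t * (if m - int k + int i < 0 then 0 else F (nat (m - int k + int i))))"

locale vertex_pair = V: vertex deg e c d + V': vertex deg e' c' d'
  for deg :: "'b \<Rightarrow> nat" and e e' :: "'b lop" and c d c' d' +
  assumes cc': "c m * c' n = c' n * c m" and dd': "d m * d' n = d' n * d m"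
begin

lemma lfin_quad: "lfin (\<lambda>Q. if qdeg Q = m then csc (g Q) * quad E c c' d d' Q else 0)"
proof (rule lfin_homogeneous[where deg = deg and \<delta> = "\<lambda>Q. int (snd (fst Q)) + int (snd (snd Q))"
      and A = "\<lambda>((i, k), (i', k')). if qdeg ((i, k), (i', k')) = m
          then csc (g ((i, k), (i', k'))) * (E * (expc c i * expc c' i')) else 0"
      and B = "\<lambda>((i, k), (i', k')). expc d k * expc d' k'"])
  fix D
  show "finite {Q. (if qdeg Q = m then csc (g Q) * quad E c c' d d' Q else 0) \<noteq> 0
    \<and> int (snd (fst Q)) + int (snd (snd Q)) \<le> int D}"
    by (rule finite_subset[of _ "({..D + nat \<bar>m\<bar>} \<times> {..D}) \<times> ({..D + nat \<bar>m\<bar>} \<times> {..D})"])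
       (auto simp: qdeg_def split: if_splits)
qed (auto simp: quad_def mult.assoc intro!: homogeneous_mult V.deg_expc_d V'.deg_expc_d)

text \<open>Grouping the quadruples by the total degrees \<open>i + i'\<close> and
  \<open>k + k'\<close> turns each fibre into a product of two Cauchy products, which
  \<open>expc_add\<close> evaluates.\<close>

lemma vertex_op_add:
  assumes "homogeneous deg 0 E"
  shows "vertex_op E (\<lambda>n. c n + c' n) (\<lambda>n. d n + d' n) m
    = osum (\<lambda>Q. if qdeg Q = m then quad E c c' d d' Q else 0)"
proof -
  interpret S: vertex deg E "\<lambda>n. c n + c' n" "\<lambda>n. d n + d' n"
  proof
    show "(c m + c' m) * (c n + c' n) = (c n + c' n) * (c m + c' m)" for m n
      using V.c_comm[of m n] V'.c_comm[of m n] cc'[of m n] cc'[of n m] by (simp add: distrib_left distrib_right add_ac)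
    show "(d m + d' m) * (d n + d' n) = (d n + d' n) * (d m + d' m)" for m n
      using V.d_comm[of m n] V'.d_comm[of m n] dd'[of m n] dd'[of n m] by (simp add: distrib_left distrib_right add_ac)
  qed (auto intro: homogeneous_add V.deg_c V'.deg_c V.deg_d V'.deg_d assms)
  let ?f = "\<lambda>Q. if qdeg Q = m then quad E c c' d d' Q else 0"
  let ?h = "\<lambda>((i, k), (i', k')). (i + i', k + k')"
  have lf: "lfin ?f" using lfin_quad[of m "\<lambda>_. 1" E] by (simp cong: if_cong)
  have inner: "osum (\<lambda>Q. if ?h Q = (I, K) then ?f Q else 0) =
      (if int K - int I = m then E * expc (\<lambda>n. c n + c' n) I * expc (\<lambda>n. d n + d' n) K else 0)" for I K
  proof -
    let ?g = "\<lambda>(i, k). ((i, k), (I - i, K - k))"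
    have "osum (\<lambda>Q. if ?h Q = (I, K) then ?f Q else 0) =
        (\<Sum>Q\<in>?g ` ({..I} \<times> {..K}). if ?h Q = (I, K) then ?f Q else 0)"
    proof (rule osum_finite(2))
      fix Q assume Q: "Q \<notin> ?g ` ({..I} \<times> {..K})"
      have "?h Q \<noteq> (I, K)"
      proof
        assume h: "?h Q = (I, K)"
        then have "Q = ?g (fst Q)" "fst Q \<in> {..I} \<times> {..K}" by (auto split: prod.splits)
        then have "Q \<in> ?g ` ({..I} \<times> {..K})" by (rule image_eqI)
        then show False using Q by contradiction
      qed
      then show "(if ?h Q = (I, K) then ?f Q else 0) = 0" by simp
    qed simp
    also have "\<dots> = (\<Sum>(i, k)\<in>{..I} \<times> {..K}. ?f (?g (i, k)))"
      by (subst sum.reindex) (auto simp: inj_on_def intro!: sum.cong)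
    also have "\<dots> = (if int K - int I = m then
        (\<Sum>(i, k)\<in>{..I} \<times> {..K}. E * (expc c i * expc c' (I - i)) * (expc d k * expc d' (K - k))) else 0)"
      by (auto simp: qdeg_def quad_def of_nat_diff intro!: sum.cong sum.neutral)
    also have "(\<Sum>(i, k)\<in>{..I} \<times> {..K}. E * (expc c i * expc c' (I - i)) * (expc d k * expc d' (K - k)))
        = E * (\<Sum>i\<le>I. expc c i * expc c' (I - i)) * (\<Sum>k\<le>K. expc d k * expc d' (K - k))"
      by (simp only: sum_distrib_left[of E] sum_product sum.cartesian_product)
    also have "\<dots> = E * expc (\<lambda>n. c n + c' n) I * expc (\<lambda>n. d n + d' n) K"
      by (simp only: expc_add[OF V.c_comm V'.c_comm cc'] expc_add[OF V.d_comm V'.d_comm dd'])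
    finally show ?thesis .
  qed
  have "osum ?f = osum (\<lambda>y. osum (\<lambda>Q. if ?h Q = y then ?f Q else 0))"
    by (rule osum_group(3)[OF lf])
  also have "\<dots> = osum (\<lambda>(I, K). if int K - int I = m
       then E * expc (\<lambda>n. c n + c' n) I * expc (\<lambda>n. d n + d' n) K else 0)"
    by (rule arg_cong[where f = osum]) (use inner in \<open>auto simp: fun_eq_iff\<close>)
  finally show ?thesis by (simp only: S.vertex_op_osum)
qed

text \<open>Both sides are groupings of one family, indexed by a normally ordered term and a
  contracted degree \<open>j\<close>. Grouping by the term leaves a single \<open>j\<close> and
  yields \<open>qcoef\<close>; grouping by \<open>?h\<close>, which gives the contracted degree back
  to both factors, yields the product.\<close>

lemma vertex_op_mult:
  fixes F \<zeta> :: "nat \<Rightarrow> complex"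
  assumes e'c: "\<And>n. e' * c n = c n * e'" and e'd: "\<And>n. e' * d n = d n * e'"
    and E: "e * e' = csc t * E"
    and dc: "\<And>m n. m > 0 \<Longrightarrow> n > 0 \<Longrightarrow> d n * c' m = c' m * d n + (if n = m then csc (\<zeta> n) else 0)"
    and F0: "F 0 = 1" and F: "\<And>k. of_nat k * F k = (\<Sum>n=1..k. of_nat n * \<zeta> n * F (k - n))"
  shows "vertex_op e c d m * vertex_op e' c' d' p =
    osum (\<lambda>Q. if qdeg Q = m + p then csc (qcoef t F m Q) * quad E c c' d d' Q else 0)"
proof -
  let ?\<phi> = "\<lambda>(((i, k), (i', k')), j). if int (k + j) - int i = m \<and> int k' - int (i' + j) = p
     then csc (t * F j) * quad E c c' d d' ((i, k), (i', k')) else 0"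
  have lf: "lfin ?\<phi>"
  proof (rule lfin_homogeneous[where deg = deg and \<delta> = "\<lambda>x. int (snd (fst (fst x))) + int (snd (snd (fst x)))"
      and A = "\<lambda>(((i, k), (i', k')), j). if int (k + j) - int i = m \<and> int k' - int (i' + j) = p
          then csc (t * F j) * (E * (expc c i * expc c' i')) else 0"
      and B = "\<lambda>(((i, k), (i', k')), j). expc d k * expc d' k'"])
    fix D
    show "finite {x. ?\<phi> x \<noteq> 0 \<and> int (snd (fst (fst x))) + int (snd (snd (fst x))) \<le> int D}"
      by (rule finite_subset[of _ "(({..2 * D + nat \<bar>m\<bar> + nat \<bar>p\<bar>} \<times> {..D}) \<times> ({..D + nat \<bar>p\<bar>} \<times> {..D})) \<times> {..D + nat \<bar>p\<bar>}"])
         (auto split: if_splits)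
  qed (auto simp: quad_def mult.assoc intro!: homogeneous_mult V.deg_expc_d V'.deg_expc_d)
  have "osum ?\<phi> = osum (\<lambda>y. osum (\<lambda>x. if fst x = y then ?\<phi> x else 0))"
    by (rule osum_group(3)[OF lf])
  also have "\<dots> = osum (\<lambda>Q. if qdeg Q = m + p then csc (qcoef t F m Q) * quad E c c' d d' Q else 0)"
  proof (rule arg_cong[where f = osum], rule ext)
    fix y :: "(nat \<times> nat) \<times> (nat \<times> nat)"
    obtain i k i' k' where y: "y = ((i, k), (i', k'))" by (metis prod.exhaust)
    have "osum (\<lambda>x. if fst x = y then ?\<phi> x else 0) =
        (\<Sum>x\<in>{(y, nat (m - int k + int i))}. if fst x = y then ?\<phi> x else 0)"
      by (rule osum_finite(2)) (auto simp: y split: if_splits)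
    then show "osum (\<lambda>x. if fst x = y then ?\<phi> x else 0) = (if qdeg y = m + p then csc (qcoef t F m y) * quad E c c' d d' y else 0)"
      by (auto simp: y qdeg_def qcoef_def csc_zero)
  qed
  finally have rhs: "osum ?\<phi> = \<dots>" .
  let ?h = "\<lambda>(((i, k), (i', k')), j). ((i, k + j), (i' + j, k'))"
  have "osum ?\<phi> = osum (\<lambda>y. osum (\<lambda>x. if ?h x = y then ?\<phi> x else 0))"
    by (rule osum_group(3)[OF lf])
  also have "\<dots> = osum (\<lambda>(x, y). (case x of (i, k) \<Rightarrow> if int k - int i = m then e * expc c i * expc d k else 0)
      * (case y of (i, k) \<Rightarrow> if int k - int i = p then e' * expc c' i * expc d' k else 0))"
  proof (rule arg_cong[where f = osum], rule ext)
    fix y :: "(nat \<times> nat) \<times> (nat \<times> nat)"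
    obtain i k i' k' where y: "y = ((i, k), (i', k'))" by (metis prod.exhaust)
    let ?g = "\<lambda>j. (((i, k - j), (i' - j, k')), j)"
    have e'expc: "e' * expc c i = expc c i * e'" "e' * expc d k = expc d k * e'"
      by (auto intro: expc_commute simp: e'c e'd)
    have "(e * expc c i * expc d k) * (e' * expc c' i' * expc d' k') =
        e * expc c i * (expc d k * e') * expc c' i' * expc d' k'" by (simp only: mult.assoc)
    also have "\<dots> = e * (expc c i * e') * (expc d k * expc c' i') * expc d' k'"
      by (simp only: mult.assoc e'expc(2)[symmetric])
    also have "\<dots> = csc t * E * expc c i * (expc d k * expc c' i') * expc d' k'"
      by (simp only: e'expc(1)[symmetric] E[symmetric] mult.assoc)
    also have "expc d k * expc c' i' = (\<Sum>j\<le>k. csc (F j) * ((if j \<le> i' then expc c' (i' - j) else 0) * expc d (k - j)))"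
      by (rule expc_contraction[OF V'.c_comm V.d_comm dc F0 F])
    also have "csc t * E * expc c i * (\<Sum>j\<le>k. csc (F j) * ((if j \<le> i' then expc c' (i' - j) else 0) * expc d (k - j))) * expc d' k'
       = (\<Sum>j\<le>k. if j \<le> i' then csc (t * F j) * quad E c c' d d' ((i, k - j), (i' - j, k')) else 0)"
      unfolding sum_distrib_left sum_distrib_right
      by (intro sum.cong refl) (auto simp: quad_def csm_simps mult.assoc mult.commute[of t])
    finally have prod: "(e * expc c i * expc d k) * (e' * expc c' i' * expc d' k') =
      (\<Sum>j\<le>k. if j \<le> i' then csc (t * F j) * quad E c c' d d' ((i, k - j), (i' - j, k')) else 0)" .
    have "osum (\<lambda>x. if ?h x = y then ?\<phi> x else 0) =
        (\<Sum>x\<in>?g ` {..k}. if ?h x = y then ?\<phi> x else 0)"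
    proof (rule osum_finite(2))
      fix x assume x: "x \<notin> ?g ` {..k}"
      have "?h x \<noteq> y"
      proof
        assume h: "?h x = y"
        then have "x = ?g (snd x)" "snd x \<in> {..k}" by (auto simp: y split: prod.splits)
        then have "x \<in> ?g ` {..k}" by (rule image_eqI)
        then show False using x by contradiction
      qed
      then show "(if ?h x = y then ?\<phi> x else 0) = 0" by simp
    qed simp
    also have "\<dots> = (\<Sum>j\<le>k. if ?h (?g j) = y then ?\<phi> (?g j) else 0)"
      by (subst sum.reindex) (auto simp: inj_on_def)
    also have "\<dots> = (if int k - int i = m \<and> int k' - int i' = p then
       (\<Sum>j\<le>k. if j \<le> i' then csc (t * F j) * quad E c c' d d' ((i, k - j), (i' - j, k')) else 0) else 0)"
      by (auto simp: y of_nat_diff intro!: sum.cong sum.neutral)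
    finally show "osum (\<lambda>x. if ?h x = y then ?\<phi> x else 0) =
        (case y of (x, y) \<Rightarrow> (case x of (i, k) \<Rightarrow> if int k - int i = m then e * expc c i * expc d k else 0)
      * (case y of (i, k) \<Rightarrow> if int k - int i = p then e' * expc c' i * expc d' k else 0))"
      by (auto simp: y prod[symmetric])
  qed
  also have "\<dots> = vertex_op e c d m * vertex_op e' c' d' p"
    by (simp only: osum_prod(2)[OF V.lfin_vertex V'.lfin_vertex] V.vertex_op_osum V'.vertex_op_osum)
  finally show ?thesis by (simp only: rhs[symmetric])
qed

text \<open>If the two contraction factors are the expansions of one rational function of \<open>w/z\<close> with
  simple poles at \<open>w/z = 1 / a s\<close>, the commutator is a sum of delta functions.\<close>

lemma vertex_op_commutator:
  fixes F F' \<zeta> \<zeta>' :: "nat \<Rightarrow> complex" and r a :: "'s \<Rightarrow> complex"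
  assumes ec: "\<And>n. e' * c n = c n * e'" "\<And>n. e' * d n = d n * e'"
      "\<And>n. e * c' n = c' n * e" "\<And>n. e * d' n = d' n * e"
    and E: "e * e' = csc t * E" "e' * e = csc t' * E" "homogeneous deg 0 E"
    and dc: "\<And>m n. m > 0 \<Longrightarrow> n > 0 \<Longrightarrow> d n * c' m = c' m * d n + (if n = m then csc (\<zeta> n) else 0)"
      "\<And>m n. m > 0 \<Longrightarrow> n > 0 \<Longrightarrow> d' n * c m = c m * d' n + (if n = m then csc (\<zeta>' n) else 0)"
    and F: "F 0 = 1" "\<And>k. of_nat k * F k = (\<Sum>n=1..k. of_nat n * \<zeta> n * F (k - n))"
    and F': "F' 0 = 1" "\<And>k. of_nat k * F' k = (\<Sum>n=1..k. of_nat n * \<zeta>' n * F' (k - n))"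
    and S: "finite S" "\<And>s. s \<in> S \<Longrightarrow> a s \<noteq> 0"
    and residues: "\<And>j. t * (if j < 0 then 0 else F (nat j)) - t' * (if j > 0 then 0 else F' (nat (- j)))
        = (\<Sum>s\<in>S. r s * a s powi j)"
  shows "vertex_op e c d m * vertex_op e' c' d' p - vertex_op e' c' d' p * vertex_op e c d m =
    (\<Sum>s\<in>S. csc (a s powi m) * (csc (r s) *
      vertex_op E (\<lambda>n. csc (a s ^ n) * c n + c' n) (\<lambda>n. csc ((1 / a s) ^ n) * d n + d' n) (m + p)))"
proof -
  \<comment> \<open>The product in the opposite order, whose normally ordered terms are the same up
    to swapping the two halves of the index.\<close>
  interpret W: vertex_pair deg e' e c' d' c d
    by unfold_locales (simp_all add: cc' dd')
  let ?q = "quad E c c' d d'"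
  let ?G = "qcoef t F m"
  let ?G' = "\<lambda>Q. qcoef t' F' p (prod.swap Q)"
  have A: "vertex_op e c d m * vertex_op e' c' d' p = osum (\<lambda>Q. if qdeg Q = m + p then csc (?G Q) * ?q Q else 0)"
    by (rule vertex_op_mult[OF ec(1,2) E(1) dc(1) F])
  have q: "quad E c' c d' d Q = ?q (prod.swap Q)" for Q
  proof -
    have "expc c' i * expc c i' = expc c i' * expc c' i" for i i'
      by (intro expc_commute[symmetric]) (auto intro: expc_commute[symmetric] simp: cc')
    moreover have "expc d' i * expc d i' = expc d i' * expc d' i" for i i'
      by (intro expc_commute[symmetric]) (auto intro: expc_commute[symmetric] simp: dd')
    ultimately show ?thesis by (simp add: quad_def split: prod.splits)
  qed
  have lf: "lfin (\<lambda>Q. if qdeg Q = m + p then csc (g Q) * ?q Q else 0)" for g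
    by (rule lfin_quad)
  have "vertex_op e' c' d' p * vertex_op e c d m =
     osum (\<lambda>Q. if qdeg Q = p + m then csc (qcoef t' F' p Q) * quad E c' c d' d Q else 0)"
    by (rule W.vertex_op_mult[OF ec(3,4) E(2) dc(2) F'])
  also have "\<dots> = osum (\<lambda>Q. (\<lambda>Q. if qdeg Q = m + p then csc (?G' Q) * ?q Q else 0) (prod.swap Q))"
    unfolding q
    by (rule arg_cong[where f = osum]) (auto simp: fun_eq_iff qdeg_def algebra_simps)
  also have "\<dots> = osum (\<lambda>Q. if qdeg Q = m + p then csc (?G' Q) * ?q Q else 0)"
    by (rule osum_reindex(2)[OF lf]) (auto simp: inj_on_def image_iff)
  finally have B: "vertex_op e' c' d' p * vertex_op e c d m = \<dots>" .
  have K: "vertex_op E (\<lambda>n. csc (a s ^ n) * c n + c' n) (\<lambda>n. csc ((1 / a s) ^ n) * d n + d' n) (m + p)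
     = osum (\<lambda>Q. if qdeg Q = m + p then csc (case Q of ((i, k), _) \<Rightarrow> a s ^ i * (1 / a s) ^ k) * ?q Q else 0)" for s
  proof -
    interpret P: vertex_pair deg e e' "\<lambda>n. csc (a s ^ n) * c n" "\<lambda>n. csc ((1 / a s) ^ n) * d n" c' d'
    proof
      show "csc (a s ^ m) * c m * (csc (a s ^ n) * c n) = csc (a s ^ n) * c n * (csc (a s ^ m) * c m)" for m n
        using V.c_comm[of m n] by (simp add: csm_simps mult.commute)
      show "csc ((1 / a s) ^ m) * d m * (csc ((1 / a s) ^ n) * d n) = csc ((1 / a s) ^ n) * d n * (csc ((1 / a s) ^ m) * d m)" for m n
        using V.d_comm[of m n] by (simp only: csm_simps mult.commute[of "(1 / a s) ^ m"])
      show "csc (a s ^ m) * c m * c' n = c' n * (csc (a s ^ m) * c m)" for m n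
        by (simp add: csm_simps cc')
      show "csc ((1 / a s) ^ m) * d m * d' n = d' n * (csc ((1 / a s) ^ m) * d m)" for m n
        by (simp add: csm_simps dd')
    qed (auto intro: homogeneous_csc_mult V.deg_e V.deg_c V.deg_d)
    show ?thesis
      unfolding P.vertex_op_add[OF E(3)] quad_def expc_scale
      by (rule arg_cong[where f = osum])
         (auto simp: fun_eq_iff csm_simps mult.assoc mult.commute split: prod.splits)
  qed
  have "vertex_op e c d m * vertex_op e' c' d' p - vertex_op e' c' d' p * vertex_op e c d m =
     osum (\<lambda>Q. if qdeg Q = m + p then csc (?G Q) * ?q Q else 0)
     + osum (\<lambda>Q. csc (-1) * (if qdeg Q = m + p then csc (?G' Q) * ?q Q else 0))"
    unfolding A B by (simp only: osum_mult_left[OF lf] csc_uminus csc_one) simp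
  also have "\<dots> = osum (\<lambda>Q. (if qdeg Q = m + p then csc (?G Q) * ?q Q else 0)
       + csc (-1) * (if qdeg Q = m + p then csc (?G' Q) * ?q Q else 0))"
    by (intro osum_add[symmetric] lf lfin_mult_left)
  also have "\<dots> = osum (\<lambda>Q. \<Sum>s\<in>S. csc (a s powi m * r s) *
      (if qdeg Q = m + p then csc (case Q of ((i, k), _) \<Rightarrow> a s ^ i * (1 / a s) ^ k) * ?q Q else 0))"
  proof (rule arg_cong[where f = osum], rule ext)
    fix Q :: "(nat \<times> nat) \<times> (nat \<times> nat)"
    obtain i k i' k' where Q: "Q = ((i, k), (i', k'))" by (metis prod.exhaust)
    show "(if qdeg Q = m + p then csc (?G Q) * ?q Q else 0)
       + csc (-1) * (if qdeg Q = m + p then csc (?G' Q) * ?q Q else 0) = (\<Sum>s\<in>S. csc (a s powi m * r s) *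
      (if qdeg Q = m + p then csc (case Q of ((i, k), _) \<Rightarrow> a s ^ i * (1 / a s) ^ k) * ?q Q else 0))"
    proof (cases "qdeg Q = m + p")
      case True
      \<comment> \<open>The power of \<open>w/z\<close> that multiplies this term. In the opposite
        order the exponent appears as \<open>-j\<close>, so \<open>residues\<close> compares the two
        coefficients of the same power.\<close>
      define j where "j = m - int k + int i"
      have j': "p - int k' + int i' = - j" using True by (simp add: Q qdeg_def j_def)
      have "?G Q = t * (if j < 0 then 0 else F (nat j))" by (simp add: Q qcoef_def j_def)
      moreover have "?G' Q = t' * (if j > 0 then 0 else F' (nat (- j)))" by (simp add: Q qcoef_def j')
      ultimately have "?G Q - ?G' Q = (\<Sum>s\<in>S. r s * a s powi j)" using residues[of j] by (simp only:)
      also have "\<dots> = (\<Sum>s\<in>S. a s powi m * r s * (a s ^ i * (1 / a s) ^ k))"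
      proof (intro sum.cong refl)
        fix s assume "s \<in> S"
        then have "a s powi j = a s powi m * a s ^ i * (1 / a s) ^ k"
          using S(2)[of s] by (simp add: j_def power_int_add power_int_diff power_one_over field_simps)
        then show "r s * a s powi j = a s powi m * r s * (a s ^ i * (1 / a s) ^ k)" by simp
      qed
      finally have "csc (?G Q - ?G' Q) * ?q Q = (\<Sum>s\<in>S. csc (a s powi m * r s * (a s ^ i * (1 / a s) ^ k))) * ?q Q"
        by (simp only: csc_sum)
      moreover have "csc (?G Q - ?G' Q) * ?q Q = csc (?G Q) * ?q Q + csc (-1) * (csc (?G' Q) * ?q Q)"
        by (simp add: csc_uminus csc_diff left_diff_distrib)
      ultimately show ?thesis using True
        by (simp add: Q sum_distrib_right csc_mult flip: mult.assoc)
    qed (simp add: csc_zero)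
  qed
  also have "\<dots> = (\<Sum>s\<in>S. csc (a s powi m * r s) *
      vertex_op E (\<lambda>n. csc (a s ^ n) * c n + c' n) (\<lambda>n. csc ((1 / a s) ^ n) * d n + d' n) (m + p))"
    unfolding K by (subst lfin_sum(2)) (auto intro: lfin_mult_left lf simp: osum_mult_left[OF lf])
  finally show ?thesis by (simp add: csc_mult flip: mult.assoc)
qed

end


section \<open>Tensor products\<close>

lemma lin_zero [simp]: "lin f 0 = 0"
  using lin_scl[of f 0 0] by simp

lemma lin_sum: "lin f (sum g A) = (\<Sum>x\<in>A. lin f (g x))"
  by (induction A rule: infinite_finite_induct) (simp_all add: lin_add)

lemma lin_bvec [simp]: "lin f (bvec b) = f b"
  by (simp add: bvec_def)

lemma lop_eq_basis_prod:
  fixes a a' :: "('b \<times> 'c) lop"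
  assumes "\<And>x y. app a (bvec (x, y)) = app a' (bvec (x, y))"
  shows "a = a'"
  using assms by (intro lop_eq_basis) auto

definition embL :: "'c \<Rightarrow> 'b Defs.vec \<Rightarrow> ('b \<times> 'c) Defs.vec" where
  "embL c = lin (\<lambda>b. bvec (b, c))"

definition embR :: "'b \<Rightarrow> 'c Defs.vec \<Rightarrow> ('b \<times> 'c) Defs.vec" where
  "embR b = lin (\<lambda>c. bvec (b, c))"

lemma emb_bvec [simp]: "embL c (bvec b) = bvec (b, c)" "embR b (bvec c) = bvec (b, c)"
  by (simp_all add: embL_def embR_def)

lemma emb_zero [simp]: "embL c 0 = 0" "embR b 0 = 0"
  by (simp_all add: embL_def embR_def)

lemma emb_linear:
  "embL c (u + v) = embL c u + embL c v" "embR b (x + y) = embR b x + embR b y"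
  "embL c (scl a v) = scl a (embL c v)" "embR b (scl a y) = scl a (embR b y)"
  "embL c (sum g A) = (\<Sum>i\<in>A. embL c (g i))" "embR b (sum h A) = (\<Sum>i\<in>A. embR b (h i))"
  by (simp_all add: embL_def embR_def lin_add lin_scl lin_sum)

lemma lookup_emb:
  "lookup (embL c v) (x, y) = (if y = c then lookup v x else 0)"
  "lookup (embR b w) (x, y) = (if x = b then lookup w y else 0)"
  by (auto simp: embL_def embR_def lin_def lookup_sum lookup_bvec in_keys_iff if_distrib cong: if_cong)

lemma app_tensL_emb: "app (tensL a) (embL c v) = embL c (app a v)"
proof -
  have "app (tensL a) (bvec (b, c)) = embL c (app a (bvec b))" for b
    by (simp add: tensL_def embL_def)
  then have "app (tensL a) (embL c v) = (\<Sum>b\<in>keys v. scl (lookup v b) (embL c (app a (bvec b))))"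
    by (simp add: embL_def[of c] lin_def[of _ v] app_sum app_scl)
  also have "\<dots> = embL c (app a v)" by (subst app_expand) (simp add: emb_linear)
  finally show ?thesis .
qed

lemma app_tensR_emb: "app (tensR a) (embR b v) = embR b (app a v)"
proof -
  have "app (tensR a) (bvec (b, c)) = embR b (app a (bvec c))" for c
    by (simp add: tensR_def embR_def)
  then have "app (tensR a) (embR b v) = (\<Sum>c\<in>keys v. scl (lookup v c) (embR b (app a (bvec c))))"
    by (simp add: embR_def[of b] lin_def[of _ v] app_sum app_scl)
  also have "\<dots> = embR b (app a v)" by (subst app_expand) (simp add: emb_linear)
  finally show ?thesis .
qed

lemma app_tens_bvec:
  "app (tensL a) (bvec (b, c)) = embL c (app a (bvec b))"
  "app (tensR a') (bvec (b, c)) = embR b (app a' (bvec c))"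
  by (metis app_tensL_emb emb_bvec(1)) (metis app_tensR_emb emb_bvec(2))

lemma tensL_hom:
  "tensL (a * b) = tensL a * tensL b" "tensL (a + b) = tensL a + tensL b"
  "tensL (csc x) = csc x" "tensL 1 = 1" "tensL 0 = 0"
  by (rule lop_eq_basis, auto simp: app_tens_bvec app_tensL_emb app_mult app_plus app_csc emb_linear)+

lemma tensR_hom:
  "tensR (a * b) = tensR a * tensR b" "tensR (a + b) = tensR a + tensR b"
  "tensR (csc x) = csc x" "tensR 1 = 1" "tensR 0 = 0"
  by (rule lop_eq_basis, auto simp: app_tens_bvec app_tensR_emb app_mult app_plus app_csc emb_linear)+

lemma tens_sum:
  "tensL (sum f A) = (\<Sum>i\<in>A. tensL (f i))" "tensR (sum g A) = (\<Sum>i\<in>A. tensR (g i))"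
  by (induction A rule: infinite_finite_induct) (simp_all add: tensL_hom tensR_hom)

lemma tens_commute: "tensL a * tensR b = tensR b * tensL a"
proof (rule lop_eq_basis)
  fix z :: "'a \<times> 'b"
  obtain x y where z: "z = (x, y)" by (cases z)
  have R: "embR x' v = (\<Sum>c\<in>keys v. scl (lookup v c) (bvec (x', c)))" for x' :: 'a and v :: "'b Defs.vec"
    by (simp add: embR_def lin_def)
  have L: "embL y' v = (\<Sum>c\<in>keys v. scl (lookup v c) (bvec (c, y')))" for y' :: 'b and v :: "'a Defs.vec"
    by (simp add: embL_def lin_def)
  show "app (tensL a * tensR b) (bvec z) = app (tensR b * tensL a) (bvec z)"
    unfolding z app_mult app_tens_bvec
    unfolding R[of x] L[of y] app_sum app_scl app_tens_bvec
    unfolding R L scl_sum scl_scl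
    by (subst sum.swap) (simp add: mult.commute)
qed

lemma tens_commute_left: "tensR b * (tensL a * x) = tensL a * (tensR b * x)"
  by (simp only: mult.assoc[symmetric] tens_commute)

lemma embL_eq_0_iff [simp]: "embL c v = 0 \<longleftrightarrow> v = 0"
proof
  assume "embL c v = 0"
  then have "lookup (embL c v) (x, c) = 0" for x by simp
  then show "v = 0" by (intro poly_mapping_eqI) (simp add: lookup_emb)
qed simp

lemma embR_eq_0_iff [simp]: "embR b v = 0 \<longleftrightarrow> v = 0"
proof
  assume "embR b v = 0"
  then have "lookup (embR b v) (b, x) = 0" for x by simp
  then show "v = 0" by (intro poly_mapping_eqI) (simp add: lookup_emb)
qed simp

lemma tens_lfin:
  "lfin f \<Longrightarrow> lfin (\<lambda>i. tensL (f i))" "lfin g \<Longrightarrow> lfin (\<lambda>i. tensR (g i))"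
  by (auto simp: lfin_def app_tens_bvec)

lemma tens_osum:
  "lfin f \<Longrightarrow> tensL (osum f) = osum (\<lambda>i. tensL (f i))"
  "lfin g \<Longrightarrow> tensR (osum g) = osum (\<lambda>i. tensR (g i))"
proof -
  assume f: "lfin f"
  show "tensL (osum f) = osum (\<lambda>i. tensL (f i))"
  proof (rule lop_eq_basis_prod)
    fix x y
    show "app (tensL (osum f)) (bvec (x, y)) = app (osum (\<lambda>i. tensL (f i))) (bvec (x, y))"
      unfolding app_tens_bvec
      by (subst app_osum[OF tens_lfin(1)[OF f] lfinD[OF f, of "bvec x"]], simp add: app_tens_bvec,
          subst app_osum[OF f lfinD[OF f, of "bvec x"]], simp, simp add: app_tens_bvec emb_linear)
  qed
next
  assume f: "lfin g"
  show "tensR (osum g) = osum (\<lambda>i. tensR (g i))"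
  proof (rule lop_eq_basis_prod)
    fix x y
    show "app (tensR (osum g)) (bvec (x, y)) = app (osum (\<lambda>i. tensR (g i))) (bvec (x, y))"
      unfolding app_tens_bvec
      by (subst app_osum[OF tens_lfin(2)[OF f] lfinD[OF f, of "bvec y"]], simp add: app_tens_bvec,
          subst app_osum[OF f lfinD[OF f, of "bvec y"]], simp, simp add: app_tens_bvec emb_linear)
  qed
qed

definition deg_prod :: "('b \<Rightarrow> nat) \<Rightarrow> ('c \<Rightarrow> nat) \<Rightarrow> 'b \<times> 'c \<Rightarrow> nat" where
  "deg_prod degb degc = (\<lambda>(b, c). degb b + degc c)"

lemma tens_homogeneous:
  "homogeneous degb n a \<Longrightarrow> homogeneous (deg_prod degb degc) n (tensL a)"
  "homogeneous degc n b \<Longrightarrow> homogeneous (deg_prod degb degc) n (tensR b)"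
  unfolding homogeneous_def
  by (auto simp: app_tens_bvec deg_prod_def in_keys_iff lookup_emb split: if_splits)

lemma expc_tens:
  fixes c :: "nat \<Rightarrow> 'b lop" and d :: "nat \<Rightarrow> 'c lop"
  shows "expc (\<lambda>n. tensL (c n) :: ('b \<times> 'c) lop) k = tensL (expc c k)"
    and "expc (\<lambda>n. tensR (d n) :: ('b \<times> 'c) lop) k = tensR (expc d k)"
proof -
  have "epow (\<lambda>n. tensL (c n) :: ('b \<times> 'c) lop) j k = tensL (epow c j k)" for j
    by (induction j arbitrary: k) (auto simp: tensL_hom tens_sum)
  then show "expc (\<lambda>n. tensL (c n) :: ('b \<times> 'c) lop) k = tensL (expc c k)"
    by (simp add: expc_def tensL_hom tens_sum)
  have "epow (\<lambda>n. tensR (d n) :: ('b \<times> 'c) lop) j k = tensR (epow d j k)" for j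
    by (induction j arbitrary: k) (auto simp: tensR_hom tens_sum)
  then show "expc (\<lambda>n. tensR (d n) :: ('b \<times> 'c) lop) k = tensR (expc d k)"
    by (simp add: expc_def tensR_hom tens_sum)
qed

text \<open>Operators on different tensor factors have no contraction; a vertex operator whose modes
  are sums over the two factors is therefore a plain product of currents.\<close>

locale vertex_tensor = L: vertex degb e c d + R: vertex degc e' c' d'
  for degb :: "'b \<Rightarrow> nat" and degc :: "'c \<Rightarrow> nat" and e c d e' c' d'
begin

sublocale vertex_pair "deg_prod degb degc" "tensL e" "tensR e'" "\<lambda>n. tensL (c n)" "\<lambda>n. tensL (d n)"
   "\<lambda>n. tensR (c' n)" "\<lambda>n. tensR (d' n)"
  by unfold_locales
     (auto intro!: tens_homogeneous L.deg_e L.deg_c L.deg_d R.deg_e R.deg_c R.deg_d tens_commute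
       simp: L.c_comm L.d_comm R.c_comm R.d_comm simp flip: tensL_hom(1) tensR_hom(1))

lemma lfin_current_mult: "lfin (\<lambda>j. tensR (vertex_op e' c' d' (m - j)) * tensL (vertex_op e c d j))"
  and vertex_op_tensor:
  "vertex_op (tensL e * tensR e') (\<lambda>n. tensL (c n) + tensR (c' n)) (\<lambda>n. tensL (d n) + tensR (d' n)) m
   = current_mult (\<lambda>m. tensR (vertex_op e' c' d' m)) (\<lambda>m. tensL (vertex_op e c d m)) m"
proof -
  let ?q = "quad (tensL e * tensR e') (\<lambda>n. tensL (c n)) (\<lambda>n. tensR (c' n)) (\<lambda>n. tensL (d n)) (\<lambda>n. tensR (d' n))"
  let ?f = "\<lambda>Q. if qdeg Q = m then ?q Q else 0"
  let ?L = "\<lambda>j (i, k). if int k - int i = j then e * expc c i * expc d k else 0"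
  let ?R = "\<lambda>j (i, k). if int k - int i = j then e' * expc c' i * expc d' k else 0"
  \<comment> \<open>The mode carried by the left tensor factor; its fibres are the summands of
    \<open>current_mult\<close>.\<close>
  let ?h = "\<lambda>Q. int (snd (fst Q)) - int (fst (fst Q))"
  have lf: "lfin ?f" using lfin_quad[of m "\<lambda>_. 1" "tensL e * tensR e'"] by (simp cong: if_cong)
  have q: "?q ((i, k), (i', k')) = tensR (e' * expc c' i' * expc d' k') * tensL (e * expc c i * expc d k)" for i k i' k'
  proof -
    show ?thesis
      by (simp only: quad_def expc_tens mult.assoc prod.case tensL_hom tensR_hom tens_commute[symmetric]
          tens_commute_left)
  qed
  have inner: "osum (\<lambda>Q. if ?h Q = j then ?f Q else 0) =
      tensR (vertex_op e' c' d' (m - j)) * tensL (vertex_op e c d j)" for j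
  proof -
    have "tensR (vertex_op e' c' d' (m - j)) * tensL (vertex_op e c d j) =
        osum (\<lambda>y. tensR (?R (m - j) y)) * osum (\<lambda>x. tensL (?L j x))"
      by (simp only: L.vertex_op_osum R.vertex_op_osum tens_osum[OF L.lfin_vertex] tens_osum[OF R.lfin_vertex])
    also have "\<dots> = osum (\<lambda>(y, x). tensR (?R (m - j) y) * tensL (?L j x))"
      by (rule osum_prod(2)[symmetric]) (rule tens_lfin, rule R.lfin_vertex, rule tens_lfin, rule L.lfin_vertex)
    also have "\<dots> = osum (\<lambda>Q. (\<lambda>(y, x). tensR (?R (m - j) y) * tensL (?L j x)) (prod.swap Q))"
      by (rule osum_reindex(2)[symmetric], rule osum_prod(1))
         (rule tens_lfin, rule R.lfin_vertex, rule tens_lfin, rule L.lfin_vertex, auto simp: inj_on_def image_iff)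
    also have "\<dots> = osum (\<lambda>Q. if ?h Q = j then ?f Q else 0)"
      by (rule arg_cong[where f = osum]) (auto simp: fun_eq_iff q qdeg_def tensL_hom(5) tensR_hom(5))
    finally show ?thesis by simp
  qed
  from osum_group(2,3)[OF lf, of ?h]
  have *: "lfin (\<lambda>j. tensR (vertex_op e' c' d' (m - j)) * tensL (vertex_op e c d j))"
      "osum ?f = osum (\<lambda>j. tensR (vertex_op e' c' d' (m - j)) * tensL (vertex_op e c d j))"
    unfolding inner .
  show "lfin (\<lambda>j. tensR (vertex_op e' c' d' (m - j)) * tensL (vertex_op e c d j))" by (rule *)
  have "homogeneous (deg_prod degb degc) (0 + 0) (tensL e * tensR e')"
    by (intro homogeneous_mult tens_homogeneous L.deg_e R.deg_e)
  then show "vertex_op (tensL e * tensR e') (\<lambda>n. tensL (c n) + tensR (c' n)) (\<lambda>n. tensL (d n) + tensR (d' n)) m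
   = current_mult (\<lambda>m. tensR (vertex_op e' c' d' m)) (\<lambda>m. tensL (vertex_op e c d m)) m"
    by (simp add: vertex_op_add *(2) current_mult_def)
qed

end

section \<open>Completions are algebras\<close>

lemma alg_gen_zero [simp]: "0 \<in> alg_gen G"
  using alg_gen.scalar[of 0 G] by (simp add: csc_zero)

lemma alg_gen_one [simp]: "1 \<in> alg_gen G"
  using alg_gen.scalar[of 1 G] by simp

lemma alg_gen_sum: "(\<And>i. i \<in> I \<Longrightarrow> f i \<in> alg_gen G) \<Longrightarrow> sum f I \<in> alg_gen G"
  by (induction I rule: infinite_finite_induct) (auto intro: alg_gen.add)

lemma alg_gen_uminus: "a \<in> alg_gen G \<Longrightarrow> - a \<in> alg_gen G"
  using alg_gen.mult[OF alg_gen.scalar[of "-1" G]] by (fastforce simp: csc_uminus)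

lemma alg_gen_diff: "a \<in> alg_gen G \<Longrightarrow> b \<in> alg_gen G \<Longrightarrow> a - b \<in> alg_gen G"
  using alg_gen.add[OF _ alg_gen_uminus] by fastforce

lemma alg_gen_expc:
  assumes "\<And>n. n > 0 \<Longrightarrow> c n \<in> alg_gen G"
  shows "expc c k \<in> alg_gen G"
proof -
  have "epow c j k \<in> alg_gen G" for j
    by (induction j arbitrary: k) (auto intro!: alg_gen_sum alg_gen.mult assms)
  then show ?thesis unfolding expc_def by (intro alg_gen_sum alg_gen.mult alg_gen.scalar)
qed

lemma left_idealI:
  "a \<in> S \<Longrightarrow> b \<in> S \<Longrightarrow> homogeneous deg d b \<Longrightarrow> int n \<le> d \<Longrightarrow> a * b \<in> left_ideal deg S n"
  unfolding left_ideal_def by (auto intro!: exI[of _ "[(a, b)]"])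

lemma left_ideal_zero [simp]: "0 \<in> left_ideal deg S n"
  unfolding left_ideal_def by (auto intro!: exI[of _ "[]"])

lemma left_ideal_add:
  assumes "x \<in> left_ideal deg S n" "y \<in> left_ideal deg S n"
  shows "x + y \<in> left_ideal deg S n"
proof -
  obtain ab cd where "x = (\<Sum>(a, b)\<leftarrow>ab. a * b)" "y = (\<Sum>(a, b)\<leftarrow>cd. a * b)"
    "\<forall>(a, b)\<in>set ab. a \<in> S \<and> b \<in> S \<and> (\<exists>d\<ge>int n. homogeneous deg d b)"
    "\<forall>(a, b)\<in>set cd. a \<in> S \<and> b \<in> S \<and> (\<exists>d\<ge>int n. homogeneous deg d b)"
    using assms unfolding left_ideal_def by blast
  then show ?thesis unfolding left_ideal_def by (intro CollectI exI[of _ "ab @ cd"]) auto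
qed

lemma left_ideal_induct [consumes 1, case_names zero add prod]:
  assumes "x \<in> left_ideal deg S n"
    and "P 0" "\<And>x y. P x \<Longrightarrow> P y \<Longrightarrow> P (x + y)"
    and "\<And>a b d. a \<in> S \<Longrightarrow> b \<in> S \<Longrightarrow> homogeneous deg d b \<Longrightarrow> d \<ge> int n \<Longrightarrow> P (a * b)"
  shows "P x"
proof -
  obtain ab where x: "x = (\<Sum>(a, b)\<leftarrow>ab. a * b)"
    and ab: "\<forall>(a, b)\<in>set ab. a \<in> S \<and> b \<in> S \<and> (\<exists>d\<ge>int n. homogeneous deg d b)"
    using assms(1) unfolding left_ideal_def by blast
  show ?thesis unfolding x using ab
    by (induction ab) (auto intro: assms(2-4))
qed

lemma left_ideal_mono:
  assumes "m \<le> n" "x \<in> left_ideal deg S n"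
  shows "x \<in> left_ideal deg S m"
  using assms(2)
proof (induction rule: left_ideal_induct)
  case (prod a b d)
  then show ?case using assms(1) by (intro left_idealI[where d = d]) auto
qed (auto intro: left_ideal_add)

lemma left_ideal_mult_left:
  assumes "x \<in> left_ideal deg (alg_gen G) n" "a \<in> alg_gen G"
  shows "a * x \<in> left_ideal deg (alg_gen G) n"
  using assms(1)
proof (induction rule: left_ideal_induct)
  case (prod b c d)
  then have "a * b * c \<in> left_ideal deg (alg_gen G) n"
    by (intro left_idealI[where d = d] alg_gen.mult assms)
  then show ?case by (simp add: mult.assoc)
qed (auto simp: distrib_left intro: left_ideal_add)

text \<open>Right multiplication is continuous although the ideals are left ideals: a homogeneous
  factor of degree \<open>d\<close> shifts the filtration by \<open>d\<close>, and \<open>t\<close>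
  is a polynomial in homogeneous generators. \<open>D\<close> bounds the loss.\<close>

lemma left_ideal_mult_right:
  assumes G: "\<And>s. s \<in> G \<Longrightarrow> \<exists>d. homogeneous deg d s" and "t \<in> alg_gen G"
  shows "\<exists>D. \<forall>n. \<forall>x\<in>left_ideal deg (alg_gen G) (n + D). x * t \<in> left_ideal deg (alg_gen G) n"
proof -
  have hom: "\<forall>n. \<forall>x\<in>left_ideal deg (alg_gen G) (n + nat (- d)). x * t \<in> left_ideal deg (alg_gen G) n"
    if t: "t \<in> alg_gen G" "homogeneous deg d t" for t d
  proof (intro allI ballI)
    fix n x assume "x \<in> left_ideal deg (alg_gen G) (n + nat (- d))"
    then show "x * t \<in> left_ideal deg (alg_gen G) n"
    proof (induction rule: left_ideal_induct)
      case (prod a b d')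
      then have "a * (b * t) \<in> left_ideal deg (alg_gen G) n"
        by (intro left_idealI[where d = "d' + d"] alg_gen.mult homogeneous_mult t) (auto split: if_splits)
      then show ?case by (simp add: mult.assoc)
    qed (auto simp: distrib_right intro: left_ideal_add)
  qed
  show ?thesis using assms(2)
  proof (induction rule: alg_gen.induct)
    case (scalar c)
    then show ?case using hom[OF alg_gen.scalar homogeneous_csc] by blast
  next
    case (gen s)
    then show ?case using hom[OF alg_gen.gen] G by blast
  next
    case (add a b)
    then obtain D D' where D: "\<forall>n. \<forall>x\<in>left_ideal deg (alg_gen G) (n + D). x * a \<in> left_ideal deg (alg_gen G) n"
      and D': "\<forall>n. \<forall>x\<in>left_ideal deg (alg_gen G) (n + D'). x * b \<in> left_ideal deg (alg_gen G) n"
      by blast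
    have "x * (a + b) \<in> left_ideal deg (alg_gen G) n" if "x \<in> left_ideal deg (alg_gen G) (n + (D + D'))" for n x
    proof -
      have "x \<in> left_ideal deg (alg_gen G) (n + D)" "x \<in> left_ideal deg (alg_gen G) (n + D')"
        using left_ideal_mono[OF _ that] by simp_all
      then show ?thesis using D D' by (auto simp: distrib_left intro: left_ideal_add)
    qed
    then show ?case by blast
  next
    case (mult a b)
    then obtain D D' where D: "\<forall>n. \<forall>x\<in>left_ideal deg (alg_gen G) (n + D). x * a \<in> left_ideal deg (alg_gen G) n"
      and D': "\<forall>n. \<forall>x\<in>left_ideal deg (alg_gen G) (n + D'). x * b \<in> left_ideal deg (alg_gen G) n"
      by blast
    have "x * (a * b) \<in> left_ideal deg (alg_gen G) n" if "x \<in> left_ideal deg (alg_gen G) (n + (D' + D))" for n x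
      using D[rule_format, of x "n + D'"] D'[rule_format, of "x * a" n] that by (simp add: add.assoc mult.assoc)
    then show ?case by blast
  qed
qed

text \<open>Convergence does not depend on the order of the terms, so a series may be indexed by any
  set that \<open>g\<close> enumerates, with cofiniteness in place of a limit.\<close>

lemma completionI:
  fixes g :: "nat \<Rightarrow> 'i" and f :: "'i \<Rightarrow> 'b lop"
  assumes g: "bij g" and f: "\<And>i. f i \<in> S"
    and fin: "\<And>n. finite {i. f i \<notin> left_ideal deg S n}" and lf: "lfin f"
  shows "osum f \<in> completion deg S"
proof -
  have inj: "inj g" and surj: "range g = UNIV" using g by (auto simp: bij_def)
  have "finite {j. f (g j) \<notin> left_ideal deg S n}" for n
    using finite_vimageI[OF fin[of n] inj] by (simp add: vimage_def)
  moreover have "lfin (\<lambda>j. f (g j))" "osum (\<lambda>j. f (g j)) = osum f"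
    using osum_reindex[OF lf inj] surj by simp_all
  then have "osums (\<lambda>j. f (g j)) (osum f)" using osums_osum by metis
  ultimately show ?thesis
    unfolding completion_def using f
    by (intro CollectI exI[of _ "\<lambda>j. f (g j)"])
       (simp add: eventually_cofinite flip: cofinite_eq_sequentially)
qed

lemma completionE:
  fixes a :: "'b lop"
  assumes "a \<in> completion deg S"
  obtains s :: "nat \<Rightarrow> 'b lop" where "\<And>j. s j \<in> S" "\<And>n. finite {j. s j \<notin> left_ideal deg S n}" "lfin s" "a = osum s"
proof -
  obtain s :: "nat \<Rightarrow> 'b lop" where s: "\<forall>j. s j \<in> S"
      "\<forall>n. \<forall>\<^sub>F j in sequentially. s j \<in> left_ideal deg S n" "osums s a"
    using assms unfolding completion_def by blast
  then have "\<And>n. finite {j. s j \<notin> left_ideal deg S n}"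
    by (simp add: eventually_cofinite flip: cofinite_eq_sequentially)
  then show ?thesis using that[of s] s osums_lfin[OF s(3)] osum_eqI[OF s(3)] by simp
qed

lemma completion_alg_gen: "a \<in> alg_gen G \<Longrightarrow> a \<in> completion deg (alg_gen G)"
proof -
  assume a: "a \<in> alg_gen G"
  let ?f = "\<lambda>i::nat. if i = 0 then a else 0"
  have "osum ?f \<in> completion deg (alg_gen G)"
    by (rule completionI[of id])
       (auto intro: a osum_finite(1)[of "{0}"] finite_subset[of _ "{0}"] split: if_splits)
  then show ?thesis using osum_finite(2)[of "{0}" ?f] by simp
qed

lemma completion_add:
  assumes "a \<in> completion deg (alg_gen G)" "b \<in> completion deg (alg_gen G)"
  shows "a + b \<in> completion deg (alg_gen G)"
proof -
  obtain s :: "nat \<Rightarrow> _" where s: "\<And>j. s j \<in> alg_gen G" "\<And>n. finite {j. s j \<notin> left_ideal deg (alg_gen G) n}" "lfin s" "a = osum s"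
    using completionE[OF assms(1)] by blast
  obtain t :: "nat \<Rightarrow> _" where t: "\<And>j. t j \<in> alg_gen G" "\<And>n. finite {j. t j \<notin> left_ideal deg (alg_gen G) n}" "lfin t" "b = osum t"
    using completionE[OF assms(2)] by blast
  have "osum (\<lambda>j. s j + t j) \<in> completion deg (alg_gen G)"
  proof (rule completionI[of id])
    fix n
    have "{j. s j + t j \<notin> left_ideal deg (alg_gen G) n}
        \<subseteq> {j. s j \<notin> left_ideal deg (alg_gen G) n} \<union> {j. t j \<notin> left_ideal deg (alg_gen G) n}"
      by (auto intro: left_ideal_add)
    then show "finite {j. s j + t j \<notin> left_ideal deg (alg_gen G) n}"
      using s(2) t(2) finite_subset by (metis (no_types, lifting) finite_Un)
  qed (auto intro: alg_gen.add s t lfin_add)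
  then show ?thesis by (simp add: osum_add s t)
qed

text \<open>In the double series a term is small if \<open>t k\<close> is small, whatever
  \<open>s j\<close> is. For each of the finitely many remaining \<open>k\<close>, continuity of
  right multiplication makes it small for all but finitely many \<open>j\<close>.\<close>

lemma completion_mult:
  assumes G: "\<And>s. s \<in> G \<Longrightarrow> \<exists>d. homogeneous deg d s"
    and "a \<in> completion deg (alg_gen G)" "b \<in> completion deg (alg_gen G)"
  shows "a * b \<in> completion deg (alg_gen G)"
proof -
  let ?I = "left_ideal deg (alg_gen G)"
  obtain s :: "nat \<Rightarrow> _" where s: "\<And>j. s j \<in> alg_gen G" "\<And>n. finite {j. s j \<notin> ?I n}" "lfin s" "a = osum s"
    using completionE[OF assms(2)] by blast
  obtain t :: "nat \<Rightarrow> _" where t: "\<And>j. t j \<in> alg_gen G" "\<And>n. finite {j. t j \<notin> ?I n}" "lfin t" "b = osum t"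
    using completionE[OF assms(3)] by blast
  have "\<forall>k. \<exists>D. \<forall>n. \<forall>x\<in>?I (n + D). x * t k \<in> ?I n"
    by (intro allI left_ideal_mult_right[OF G t(1)])
  from choice[OF this] obtain D where D: "\<forall>k n. \<forall>x\<in>?I (n + D k). x * t k \<in> ?I n" ..
  have "osum (\<lambda>(j, k). s j * t k) \<in> completion deg (alg_gen G)"
  proof (rule completionI[OF bij_prod_decode])
    fix n
    have "{(j, k). s j * t k \<notin> ?I n} \<subseteq> (\<Union>k\<in>{k. t k \<notin> ?I n}. {j. s j \<notin> ?I (n + D k)} \<times> {k})"
      (is "?A \<subseteq> ?B")
    proof (rule subsetI, rule ccontr)
      fix p assume p: "p \<in> ?A" "p \<notin> ?B"
      obtain j k where jk: "p = (j, k)" by (cases p)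
      have "s j * t k \<in> ?I n"
      proof (cases "t k \<in> ?I n")
        case True
        then show ?thesis by (rule left_ideal_mult_left[OF _ s(1)])
      next
        case False
        then have "s j \<in> ?I (n + D k)" using p(2) by (simp add: jk)
        then show ?thesis using D by simp
      qed
      then show False using p(1) by (simp add: jk)
    qed
    moreover have "finite (\<Union>k\<in>{k. t k \<notin> ?I n}. {j. s j \<notin> ?I (n + D k)} \<times> {k})"
      using s(2) t(2) by blast
    ultimately have "finite {(j, k). s j * t k \<notin> ?I n}" by (rule finite_subset)
    then show "finite {i. (case i of (j, k) \<Rightarrow> s j * t k) \<notin> ?I n}" by (simp add: case_prod_unfold)
  qed (use s t osum_prod(1)[OF s(3) t(3)] in \<open>auto intro: alg_gen.mult\<close>)
  then show ?thesis by (simp add: osum_prod(2)[OF s(3) t(3)] s t)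
qed

lemma completion_sum:
  "(\<And>i. i \<in> I \<Longrightarrow> f i \<in> completion deg (alg_gen G)) \<Longrightarrow> sum f I \<in> completion deg (alg_gen G)"
  by (induction I rule: infinite_finite_induct) (auto intro: completion_add completion_alg_gen)

lemma homogeneous_current_vanish:
  assumes "\<And>m. homogeneous deg m (f m)"
  shows "\<exists>M. \<forall>m\<ge>M. app (f m) v = 0"
proof (intro exI allI impI)
  fix m assume m: "m \<ge> 1 + (\<Sum>b\<in>keys v. int (deg b))"
  have "app (f m) (bvec b) = 0" if "b \<in> keys v" for b
  proof (rule homogeneous_vanish[OF assms])
    have "int (deg b) \<le> (\<Sum>b\<in>keys v. int (deg b))"
      using that by (intro member_le_sum) auto
    then show "int (deg b) < m" using m by simp
  qed
  then show "app (f m) v = 0" by (subst app_expand) simp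
qed

context vertex begin

text \<open>The summand with index \<open>k\<close> ends in an annihilation coefficient of degree
  \<open>k\<close>, so it lies in the left ideal of level \<open>n\<close> as soon as
  \<open>k \<ge> n\<close>.\<close>

lemma vertex_op_in_completion:
  assumes "e \<in> alg_gen G" "\<And>n. n > 0 \<Longrightarrow> c n \<in> alg_gen G" "\<And>n. n > 0 \<Longrightarrow> d n \<in> alg_gen G"
  shows "vertex_op e c d m \<in> completion deg (alg_gen G)"
proof -
  let ?f = "\<lambda>k. if int k \<ge> m then e * expc c (nat (int k - m)) * expc d k else 0"
  have "osum ?f \<in> completion deg (alg_gen G)"
  proof (rule completionI[of id])
    show "?f k \<in> alg_gen G" for k using assms by (auto intro!: alg_gen.mult alg_gen_expc)
    show "finite {k. ?f k \<notin> left_ideal deg (alg_gen G) n}" for n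
    proof (rule finite_subset[of _ "{..<n}"])
      show "{k. ?f k \<notin> left_ideal deg (alg_gen G) n} \<subseteq> {..<n}"
      proof (rule subsetI, rule ccontr)
        fix k assume k: "k \<in> {k. ?f k \<notin> left_ideal deg (alg_gen G) n}" "k \<notin> {..<n}"
        then have "e * expc c (nat (int k - m)) * expc d k \<in> left_ideal deg (alg_gen G) n"
          using assms by (intro left_idealI[where d = "int k"] alg_gen.mult alg_gen_expc deg_expc_d) auto
        then show False using k by (simp split: if_splits)
      qed
    qed simp
    show "lfin ?f"
    proof (rule lfin_homogeneous[where deg = deg and \<delta> = int and B = "expc d"
          and A = "\<lambda>k. if int k \<ge> m then e * expc c (nat (int k - m)) else 0"])
      show "finite {k. ?f k \<noteq> 0 \<and> int k \<le> int D}" for D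
        by (rule finite_subset[of _ "{..D}"]) auto
    qed (auto simp: deg_expc_d)
  qed simp
  then show ?thesis by (simp add: vertex_op_def)
qed

lemma current_in_vertex_op:
  assumes "e \<in> alg_gen G" "\<And>n. n > 0 \<Longrightarrow> c n \<in> alg_gen G" "\<And>n. n > 0 \<Longrightarrow> d n \<in> alg_gen G"
  shows "current_in (vertex_op e c d) (completion deg (alg_gen G))"
  unfolding current_in_def
  using vertex_op_in_completion[OF assms] homogeneous_current_vanish[OF deg_vertex_op] by blast

end

section \<open>Currents in the completed tensor product\<close>

lemma csc_vertex_op:
  assumes "vertex deg e c d"
  shows "csc r * vertex_op e c d m = vertex_op (csc r * e) c d m"
proof -
  interpret vertex deg e c d by fact
  interpret r: vertex deg "csc r * e" c d
    by unfold_locales (auto intro: homogeneous_csc_mult deg_e deg_c deg_d simp: c_comm d_comm)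
  show ?thesis
    unfolding vertex_op_osum r.vertex_op_osum osum_mult_left[OF lfin_vertex, symmetric]
    by (rule arg_cong[where f = osum]) (auto simp: fun_eq_iff mult.assoc)
qed

lemma tensR_left_ideal:
  "x \<in> left_ideal degc (alg_gen T) n \<Longrightarrow>
    tensR x \<in> left_ideal (deg_prod degb degc) (alg_gen (tensL ` S \<union> tensR ` alg_gen T)) n"
proof (induction rule: left_ideal_induct)
  case (prod a b d)
  then show ?case
    unfolding tensR_hom by (intro left_idealI[where d = d] alg_gen.gen tens_homogeneous) auto
qed (auto simp: tensR_hom intro: left_ideal_add)

lemma tensR_completion:
  assumes "a \<in> completion degc (alg_gen T)"
  shows "tensR a \<in> completed_tensor degb degc S (alg_gen T)"
proof -
  obtain s :: "nat \<Rightarrow> _" where s: "\<And>j. s j \<in> alg_gen T" "\<And>n. finite {j. s j \<notin> left_ideal degc (alg_gen T) n}" "lfin s" "a = osum s"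
    using completionE[OF assms] by blast
  let ?G = "tensL ` S \<union> tensR ` alg_gen T"
  have "osum (\<lambda>j. tensR (s j)) \<in> completion (deg_prod degb degc) (alg_gen ?G)"
  proof (rule completionI[of id])
    show "finite {j. tensR (s j) \<notin> left_ideal (deg_prod degb degc) (alg_gen ?G) n}" for n
      by (rule finite_subset[OF _ s(2)[of n]]) (use tensR_left_ideal in blast)
  qed (auto intro: alg_gen.gen s tens_lfin)
  then show ?thesis by (simp add: completed_tensor_def deg_prod_def[symmetric] s tens_osum)
qed

lemma bij_int_nat: "bij (\<lambda>n. (int_decode (fst (prod_decode n)), snd (prod_decode n)))"
proof -
  have "(\<lambda>n. (int_decode (fst (prod_decode n)), snd (prod_decode n))) = map_prod int_decode id \<circ> prod_decode"
    by (auto simp: fun_eq_iff map_prod_def split: prod.splits)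
  moreover have "bij (map_prod int_decode (id :: nat \<Rightarrow> nat))"
    by (rule o_bij[of "map_prod int_encode id"]) (auto simp: fun_eq_iff)
  ultimately show ?thesis using bij_prod_decode by (simp add: bij_comp)
qed

text \<open>The modes \<open>F j\<close> belong to \<open>S\<close>, but those of the vertex
  operator only to a completion, so the latter are expanded: the series runs over \<open>j\<close>
  and the annihilation degree \<open>k\<close>. Outside the ideal of level \<open>n\<close> both are
  less than \<open>n\<close>, and \<open>k \<ge> m - j\<close> bounds \<open>j\<close> from
  below.\<close>

lemma current_mult_vertex_op:
  fixes F :: "'b current"
  assumes v: "vertex degc e c d"
    and T: "e \<in> alg_gen T" "\<And>n. n > 0 \<Longrightarrow> c n \<in> alg_gen T" "\<And>n. n > 0 \<Longrightarrow> d n \<in> alg_gen T"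
    and F: "\<And>j. F j \<in> S" "\<And>j. homogeneous degb j (F j)"
  shows "lfin (\<lambda>j. tensR (vertex_op e c d (m - j)) * tensL (F j))"
    and "current_mult (\<lambda>m. tensR (vertex_op e c d m)) (\<lambda>m. tensL (F m)) m
      \<in> completed_tensor degb degc S (alg_gen T)"
proof -
  interpret vertex degc e c d by (rule v)
  let ?G = "tensL ` S \<union> tensR ` alg_gen T"
  let ?f = "\<lambda>(j, k). if int k \<ge> m - j
    then tensR (e * expc c (nat (int k - (m - j))) * expc d k) * tensL (F j) else 0"
  have vanish: "app (?f (j, k)) (bvec (x, y)) = 0" if "j > int (degb x) \<or> k > degc y" for j k x y
    using that
  proof
    assume "j > int (degb x)"
    then have "app (F j) (bvec x) = 0" by (intro homogeneous_vanish[OF F(2)])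
    then show ?thesis by (simp add: app_mult app_tens_bvec)
  next
    assume "k > degc y"
    then have "app (expc d k) (bvec y) = 0" by (intro homogeneous_vanish[OF deg_expc_d]) simp
    then show ?thesis
      by (simp only: prod.case tens_commute[symmetric]) (simp add: app_mult app_tens_bvec)
  qed
  have lf: "lfin ?f"
    unfolding lfin_def
  proof
    fix z :: "'b \<times> 'a"
    show "finite {i. app (?f i) (bvec z) \<noteq> 0}"
    proof (rule finite_subset[of _ "{m - int (degc (snd z))..int (degb (fst z))} \<times> {..degc (snd z)}"])
      show "{i. app (?f i) (bvec z) \<noteq> 0} \<subseteq> {m - int (degc (snd z))..int (degb (fst z))} \<times> {..degc (snd z)}"
      proof
        fix i assume "i \<in> {i. app (?f i) (bvec z) \<noteq> 0}"
        moreover obtain j k where i: "i = (j, k)" by (cases i)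
        moreover obtain x y where z: "z = (x, y)" by (cases z)
        ultimately have ne: "app (?f (j, k)) (bvec (x, y)) \<noteq> 0" by simp
        then have "\<not> (j > int (degb x) \<or> k > degc y)" using vanish by blast
        moreover have "int k \<ge> m - j" using ne by (auto split: if_splits)
        ultimately show "i \<in> {m - int (degc (snd z))..int (degb (fst z))} \<times> {..degc (snd z)}"
          by (auto simp: i z)
      qed
    qed simp
  qed
  have inner: "osum (\<lambda>x. if fst x = j then ?f x else 0) = tensR (vertex_op e c d (m - j)) * tensL (F j)" for j
  proof -
    let ?g = "\<lambda>k. if int k \<ge> m - j then e * expc c (nat (int k - (m - j))) * expc d k else 0"
    have lg: "lfin ?g"
    proof (rule lfin_homogeneous[where deg = degc and \<delta> = int and B = "expc d"
          and A = "\<lambda>k. if int k \<ge> m - j then e * expc c (nat (int k - (m - j))) else 0"])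
      show "finite {k. ?g k \<noteq> 0 \<and> int k \<le> int D}" for D
        by (rule finite_subset[of _ "{..D}"]) auto
    qed (auto simp: deg_expc_d)
    have "osum (\<lambda>x. if fst x = j then ?f x else 0) = osum (\<lambda>k. if fst (j, k) = j then ?f (j, k) else 0)"
      by (rule osum_reindex(2)[OF osum_group(1)[OF lf], symmetric]) (auto simp: inj_on_def)
    also have "\<dots> = osum (\<lambda>k. tensL (F j) * tensR (?g k))"
      by (rule arg_cong[where f = osum]) (auto simp: fun_eq_iff tensR_hom(5) tens_commute)
    also have "\<dots> = tensL (F j) * tensR (vertex_op e c d (m - j))"
      by (simp only: osum_mult_left[OF tens_lfin(2)[OF lg]] tens_osum(2)[OF lg] vertex_op_def)
    finally show ?thesis by (simp add: tens_commute)
  qed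
  show "lfin (\<lambda>j. tensR (vertex_op e c d (m - j)) * tensL (F j))"
    using osum_group(2)[OF lf, of fst] unfolding inner .
  have "osum ?f = current_mult (\<lambda>m. tensR (vertex_op e c d m)) (\<lambda>m. tensL (F m)) m"
    using osum_group(3)[OF lf, of fst] unfolding inner current_mult_def .
  moreover have "osum ?f \<in> completion (deg_prod degb degc) (alg_gen ?G)"
  proof (rule completionI[OF bij_int_nat _ _ lf])
    have G: "tensR x \<in> alg_gen ?G" if "x \<in> alg_gen T" for x
      using that by (intro alg_gen.gen) auto
    have G': "tensL (F j) \<in> alg_gen ?G" for j
      using F by (intro alg_gen.gen) auto
    note mem = alg_gen.mult alg_gen_expc T G G'
    show "?f i \<in> alg_gen ?G" for i by (cases i) (auto intro!: mem)
    fix n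
    have "?f (j, k) \<in> left_ideal (deg_prod degb degc) (alg_gen ?G) n" if "j \<ge> int n \<or> k \<ge> n" for j k
      using that
    proof
      assume "j \<ge> int n"
      then show ?thesis
        by (auto intro!: left_idealI[where d = j] mem tens_homogeneous F)
    next
      assume k: "k \<ge> n"
      \<comment> \<open>Operators on different factors commute, so the annihilation coefficient can
        be brought to the right end, where its degree counts.\<close>
      have "tensR (e * expc c i * expc d k) * tensL (F j) = tensL (F j) * tensR (e * expc c i) * tensR (expc d k)" for i
        by (simp only: tens_commute[symmetric] tens_commute_left tensR_hom mult.assoc)
      moreover have "tensL (F j) * tensR (e * expc c i) * tensR (expc d k)
          \<in> left_ideal (deg_prod degb degc) (alg_gen ?G) n" for i
        using k by (intro left_idealI[where d = "int k"] mem tens_homogeneous deg_expc_d) auto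
      ultimately show ?thesis by simp
    qed
    then have *: "j < int n \<and> k < n" if "?f (j, k) \<notin> left_ideal (deg_prod degb degc) (alg_gen ?G) n" for j k
      using that by (meson not_le)
    have **: "int k \<ge> m - j" if "?f (j, k) \<notin> left_ideal (deg_prod degb degc) (alg_gen ?G) n" for j k
      using that by (cases "int k \<ge> m - j") simp_all
    have "{i. ?f i \<notin> left_ideal (deg_prod degb degc) (alg_gen ?G) n} \<subseteq> {m - int n..int n} \<times> {..n}"
    proof
      fix i assume "i \<in> {i. ?f i \<notin> left_ideal (deg_prod degb degc) (alg_gen ?G) n}"
      moreover obtain j k where i: "i = (j, k)" by (cases i)
      ultimately have "?f (j, k) \<notin> left_ideal (deg_prod degb degc) (alg_gen ?G) n" by simp
      from *[OF this] **[OF this] show "i \<in> {m - int n..int n} \<times> {..n}" by (auto simp: i)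
    qed
    then show "finite {i. ?f i \<notin> left_ideal (deg_prod degb degc) (alg_gen ?G) n}"
      by (rule finite_subset) simp
  qed
  ultimately show "current_mult (\<lambda>m. tensR (vertex_op e c d m)) (\<lambda>m. tensL (F m)) m
      \<in> completed_tensor degb degc S (alg_gen T)"
    by (simp add: completed_tensor_def deg_prod_def)
qed

section \<open>Conjugation by a linear isomorphism\<close>

locale vec_iso =
  fixes f :: "'b Defs.vec \<Rightarrow> 'c Defs.vec" and g :: "'c Defs.vec \<Rightarrow> 'b Defs.vec"
  assumes f_add: "f (u + v) = f u + f v" and f_scl: "f (scl x v) = scl x (f v)"
    and gf [simp]: "g (f v) = v" and fg [simp]: "f (g w) = w"
begin

definition conj :: "'b lop \<Rightarrow> 'c lop" where
  "conj a = Lop (\<lambda>w. f (app a (g w)))"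

lemma g_add: "g (u + v) = g u + g v"
  by (metis f_add fg gf)

lemma g_scl: "g (scl x v) = scl x (g v)"
  by (metis f_scl fg gf)

lemma app_conj: "app (conj a) w = f (app a (g w))"
  unfolding conj_def by (subst Lop_inverse) (auto simp: f_add f_scl g_add g_scl app_add app_scl)

lemma f_zero [simp]: "f 0 = 0"
  using f_scl[of 0 0] by simp

lemma f_eq_0_iff [simp]: "f v = 0 \<longleftrightarrow> v = 0"
  by (metis f_zero gf)

lemma conj_eqI:
  assumes "\<And>b. app c (f (bvec b)) = f (app a (bvec b))"
  shows "conj a = c"
proof (rule lop_eqI)
  fix w
  have f_sum: "f (sum h A) = (\<Sum>i\<in>A. f (h i))" for h :: "'b \<Rightarrow> 'b Defs.vec" and A
    by (induction A rule: infinite_finite_induct) (simp_all add: f_add)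
  have "app c (f v) = f (app a v)" for v
    by (subst vec_expand[of v], subst app_expand[of a]) (simp only: f_sum f_scl app_sum app_scl assms)
  from this[of "g w"] show "app (conj a) w = app c w" by (simp add: app_conj)
qed

lemma conj_hom:
  "conj (a * b) = conj a * conj b" "conj (a + b) = conj a + conj b" "conj (csc x) = csc x"
  "conj 1 = 1" "conj 0 = 0"
  by (rule lop_eqI, simp add: app_conj app_mult app_plus app_csc f_add f_scl)+

lemma conj_sum: "conj (sum h A) = (\<Sum>i\<in>A. conj (h i))"
  by (induction A rule: infinite_finite_induct) (simp_all add: conj_hom)

lemma inj_conj: "inj conj"
proof (rule injI)
  fix a b assume "conj a = conj b"
  then have "f (app a (g (f v))) = f (app b (g (f v)))" for v by (metis app_conj)
  then have "app a v = app b v" for v by (metis gf)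
  then show "a = b" by (rule lop_eqI)
qed

lemma conj_osum:
  assumes "lfin h"
  shows "lfin (\<lambda>i. conj (h i))" "conj (osum h) = osum (\<lambda>i. conj (h i))"
proof -
  have eq: "{i. app (conj (h i)) w \<noteq> 0} = {i. app (h i) (g w) \<noteq> 0}" for w
    by (simp add: app_conj)
  show l: "lfin (\<lambda>i. conj (h i))" unfolding lfin_def eq using lfinD[OF assms] by blast
  have f_sum: "f (sum k A) = (\<Sum>i\<in>A. f (k i))" for k and A :: "'a set"
    by (induction A rule: infinite_finite_induct) (simp_all add: f_add)
  show "conj (osum h) = osum (\<lambda>i. conj (h i))"
  proof (rule lop_eqI)
    fix w
    have "app (osum (\<lambda>i. conj (h i))) w = (\<Sum>i | app (h i) (g w) \<noteq> 0. app (conj (h i)) w)"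
      by (rule app_osum[OF l lfinD[OF assms]]) (simp add: app_conj)
    also have "\<dots> = f (app (osum h) (g w))"
      by (subst app_osum[OF assms lfinD[OF assms]]) (simp_all add: app_conj f_sum)
    finally show "app (conj (osum h)) w = app (osum (\<lambda>i. conj (h i))) w"
      by (simp add: app_conj)
  qed
qed

lemma conj_expc: "conj (expc c k) = expc (\<lambda>n. conj (c n)) k"
proof -
  have "conj (epow c j k) = epow (\<lambda>n. conj (c n)) j k" for j
    by (induction j arbitrary: k) (auto simp: conj_hom conj_sum)
  then show ?thesis by (simp add: expc_def conj_hom conj_sum)
qed

lemma conj_vertex_op:
  assumes "vertex deg e c d"
  shows "conj (vertex_op e c d m) = vertex_op (conj e) (\<lambda>n. conj (c n)) (\<lambda>n. conj (d n)) m"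
proof -
  interpret vertex deg e c d by fact
  let ?g = "\<lambda>k. if int k \<ge> m then e * expc c (nat (int k - m)) * expc d k else 0"
  have lg: "lfin ?g"
  proof (rule lfin_homogeneous[where deg = deg and \<delta> = int and B = "expc d"
        and A = "\<lambda>k. if int k \<ge> m then e * expc c (nat (int k - m)) else 0"])
    show "finite {k. ?g k \<noteq> 0 \<and> int k \<le> int D}" for D
      by (rule finite_subset[of _ "{..D}"]) auto
  qed (auto simp: deg_expc_d)
  show ?thesis
    unfolding vertex_op_def conj_osum(2)[OF lg]
    by (rule arg_cong[where f = osum]) (auto simp: fun_eq_iff conj_hom conj_expc)
qed

end

lemma vec_iso_lop:
  assumes "p * p' = 1" "p' * p = 1"
  shows "vec_iso (app p) (app p')" and "vec_iso.conj (app p) (app p') a = p * a * p'"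
proof -
  interpret vec_iso "app p" "app p'"
    by unfold_locales (simp_all add: app_add app_scl assms flip: app_mult)
  show "vec_iso (app p) (app p')" by unfold_locales
  show "conj a = p * a * p'" by (rule lop_eqI) (simp add: app_conj app_mult)
qed

lemma vec_iso_relabel:
  assumes \<beta>: "bij \<beta>" and \<chi>: "\<And>b. \<chi> b \<noteq> 0"
  shows "vec_iso (lin (\<lambda>b. scl (\<chi> b) (bvec (\<beta> b))))
    (lin (\<lambda>b. scl (1 / \<chi> (inv_into UNIV \<beta> b)) (bvec (inv_into UNIV \<beta> b))))"
proof
  have lin_ext: "F v = v" if "\<And>u v. F (u + v) = F u + F v" "\<And>c v. F (scl c v) = scl c (F v)"
      "\<And>b. F (bvec b) = bvec b" for F :: "'x Defs.vec \<Rightarrow> 'x Defs.vec" and v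
  proof -
    have "F 0 = 0" using that(2)[of 0 0] by simp
    then have "F (sum h A) = (\<Sum>i\<in>A. F (h i))" for h :: "'x \<Rightarrow> 'x Defs.vec" and A
      by (induction A rule: infinite_finite_induct) (simp_all add: that)
    then show ?thesis by (subst (1 2) vec_expand[of v]) (simp only: that)
  qed
  note inv = bij_inv_eq_iff[OF \<beta>] bij_is_inj[OF \<beta>] bij_is_surj[OF \<beta>]
  let ?f = "lin (\<lambda>b. scl (\<chi> b) (bvec (\<beta> b)))"
  let ?g = "lin (\<lambda>b. scl (1 / \<chi> (inv_into UNIV \<beta> b)) (bvec (inv_into UNIV \<beta> b)))"
  show "?g (?f v) = v" for v
    by (rule lin_ext[of "\<lambda>v. ?g (?f v)"])
       (simp_all add: lin_add lin_scl scl_scl inv \<chi> inv_f_f[OF bij_is_inj[OF \<beta>]])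
  show "?f (?g v) = v" for v
    by (rule lin_ext[of "\<lambda>v. ?f (?g v)"])
       (simp_all add: lin_add lin_scl scl_scl inv \<chi> surj_f_inv_f[OF bij_is_surj[OF \<beta>]])
qed (simp_all add: lin_add lin_scl)

section \<open>Linear changes of variables in Fock space\<close>

lemma app_mulY: "app (mulY r n) (bvec (g, \<alpha>)) = bvec (g, \<alpha> + single (r, n) 1)"
  by (simp add: mulY_def)

lemma app_derY: "app (derY r n) (bvec (g, \<alpha>)) =
    scl (of_nat (lookup \<alpha> (r, n))) (bvec (g, \<alpha> - single (r, n) 1))"
  by (simp add: derY_def)

lemma app_torus: "app (torus \<sigma> g) (bvec (h, \<alpha>)) = scl (\<sigma> g h) (bvec (g + h, \<alpha>))"
  by (simp add: torus_def)

lemma mulY_commute: "mulY r n * mulY s m = mulY s m * mulY r n"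
proof (rule lop_eq_basis)
  fix b :: fock
  show "app (mulY r n * mulY s m) (bvec b) = app (mulY s m * mulY r n) (bvec b)"
    by (cases b) (simp add: app_mult app_mulY add_ac)
qed

lemma derY_commute: "derY r n * derY s m = derY s m * derY r n"
proof (rule lop_eq_basis)
  fix b :: fock
  obtain g \<alpha> where b: "b = (g, \<alpha>)" by (cases b)
  have "\<alpha> - single (s, m) 1 - single (r, n) (1::nat) = \<alpha> - single (r, n) 1 - single (s, m) 1"
    by (rule poly_mapping_eqI) (simp add: lookup_minus)
  then show "app (derY r n * derY s m) (bvec b) = app (derY s m * derY r n) (bvec b)"
    by (auto simp: b app_mult app_derY app_scl scl_scl lookup_minus lookup_single when_def mult.commute)
qed

lemma torus_mulY: "torus \<sigma> g * mulY r n = mulY r n * torus \<sigma> g"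
proof (rule lop_eq_basis)
  fix b :: fock
  show "app (torus \<sigma> g * mulY r n) (bvec b) = app (mulY r n * torus \<sigma> g) (bvec b)"
    by (cases b) (simp add: app_mult app_mulY app_torus app_scl)
qed

lemma torus_derY: "torus \<sigma> g * derY r n = derY r n * torus \<sigma> g"
proof (rule lop_eq_basis)
  fix b :: fock
  show "app (torus \<sigma> g * derY r n) (bvec b) = app (derY r n * torus \<sigma> g) (bvec b)"
    by (cases b) (simp add: app_mult app_derY app_torus app_scl scl_scl mult.commute)
qed

lemma monomial_induct [case_names zero add]:
  fixes \<alpha> :: "'x \<Rightarrow>\<^sub>0 nat"
  assumes "P 0" "\<And>\<alpha> x. P \<alpha> \<Longrightarrow> P (\<alpha> + single x 1)"
  shows "P \<alpha>"
proof (induction "\<Sum>x\<in>keys \<alpha>. lookup \<alpha> x" arbitrary: \<alpha> rule: less_induct)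
  case (less \<alpha>)
  show ?case
  proof (cases "\<alpha> = 0")
    case False
    then obtain x where x: "x \<in> keys \<alpha>" by fastforce
    let ?\<beta> = "\<alpha> - single x 1"
    have \<alpha>: "\<alpha> = ?\<beta> + single x 1"
      using x by (intro poly_mapping_eqI) (auto simp: lookup_add lookup_minus lookup_single when_def in_keys_iff)
    have "(\<Sum>y\<in>keys ?\<beta>. lookup ?\<beta> y) = (\<Sum>y\<in>keys \<alpha>. lookup ?\<beta> y)"
      by (rule sum.mono_neutral_left) (auto simp: in_keys_iff lookup_minus)
    also have "\<dots> < (\<Sum>y\<in>keys \<alpha>. lookup \<alpha> y)"
      using x by (intro sum_strict_mono_ex1) (auto simp: lookup_minus lookup_single in_keys_iff intro!: bexI[of _ x])
    finally show ?thesis using less assms(2) \<alpha> by metis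
  qed (simp add: assms(1))
qed

text \<open>The vectors without oscillators generate the Fock space under the \<open>mulY\<close>.
  If \<open>E\<close> can be moved past each \<open>mulY\<close>, its vanishing spreads from these
  vectors to all monomials.\<close>

lemma fock_lop_eq_0I:
  fixes E :: "fock lop"
  assumes vac: "\<And>g. app E (bvec (g, 0)) = 0" and ind: "\<And>r n. \<exists>B. E * mulY r n = B * E"
  shows "E = 0"
proof (rule lop_eq_basis)
  fix b :: fock
  obtain g \<alpha> where b: "b = (g, \<alpha>)" by (cases b)
  have "app E (bvec (g, \<alpha>)) = 0"
  proof (induction \<alpha> rule: monomial_induct)
    case (add \<alpha> x)
    obtain r n where x: "x = (r, n)" by (cases x)
    obtain B where "E * mulY r n = B * E" using ind by blast
    then have "app (E * mulY r n) (bvec (g, \<alpha>)) = app (B * E) (bvec (g, \<alpha>))" by simp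
    then show ?case using add by (simp add: app_mult app_mulY x)
  qed (rule vac)
  then show "app E (bvec b) = app 0 (bvec b)" by (simp add: b)
qed

text \<open>Under addition of lattice points and of exponents the Fock space is a commutative
  algebra, the group algebra of the lattice with polynomial variables adjoined; multiplication by
  \<open>Yvar (r, n)\<close> is \<open>mulY r n\<close>.\<close>

definition Yvar :: "nat \<times> nat \<Rightarrow> fock Defs.vec" where
  "Yvar x = bvec (0, single x 1)"

lemma bvec_mult: "bvec (g, \<alpha>) * bvec (h, \<beta>) = (bvec (g + h, \<alpha> + \<beta>) :: fock Defs.vec)"
  by (simp add: bvec_def mult_single)

lemma scl_mult: "scl c u * (v :: fock Defs.vec) = scl c (u * v)"
proof -
  have s: "scl c w = single 0 c * w" for w :: "fock Defs.vec"
  proof -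
    have "single 0 c * w = (\<Sum>b\<in>keys w. single 0 c * scl (lookup w b) (bvec b))"
      by (subst vec_expand[of w]) (simp only: sum_distrib_left)
    also have "\<dots> = (\<Sum>b\<in>keys w. scl c (scl (lookup w b) (bvec b)))"
      by (intro sum.cong refl) (simp add: bvec_def scl_single mult_single)
    also have "\<dots> = scl c w" by (subst (2) vec_expand[of w]) (simp only: scl_sum)
    finally show ?thesis by simp
  qed
  show ?thesis by (simp only: s mult.assoc)
qed

definition mono_subst :: "(nat \<times> nat \<Rightarrow> fock Defs.vec) \<Rightarrow> ((nat \<times> nat) \<Rightarrow>\<^sub>0 nat) \<Rightarrow> fock Defs.vec" where
  "mono_subst img \<alpha> = (\<Prod>x\<in>keys \<alpha>. img x ^ lookup \<alpha> x)"

lemma mono_subst_add_single: "mono_subst img (\<alpha> + single x 1) = img x * mono_subst img \<alpha>"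
proof -
  have sup: "mono_subst img \<beta> = (\<Prod>y\<in>insert x (keys \<alpha>). img y ^ lookup \<beta> y)"
    if "keys \<beta> \<subseteq> insert x (keys \<alpha>)" for \<beta>
    unfolding mono_subst_def using that by (intro prod.mono_neutral_left) (auto simp: in_keys_iff)
  have k: "keys (\<alpha> + single x 1) \<subseteq> insert x (keys \<alpha>)"
    using Poly_Mapping.keys_add[of \<alpha> "single x 1"] by auto
  have "mono_subst img (\<alpha> + single x 1) =
     (\<Prod>y\<in>insert x (keys \<alpha>). img y ^ lookup \<alpha> y * img y ^ lookup (single x 1) y)"
    by (simp only: sup[OF k] lookup_add power_add)
  also have "\<dots> = mono_subst img \<alpha> * (\<Prod>y\<in>insert x (keys \<alpha>). img y ^ lookup (single x 1) y)"
    using sup[OF subset_insertI] by (simp only: prod.distrib)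
  also have "(\<Prod>y\<in>insert x (keys \<alpha>). img y ^ lookup (single x 1) y) =
      (\<Prod>y\<in>insert x (keys \<alpha>). if y = x then img x else 1)"
    by (intro prod.cong refl) (auto simp: lookup_single when_def)
  also have "\<dots> = img x" by simp
  finally show ?thesis by (simp add: mult.commute)
qed

text \<open>The algebra endomorphism substituting linear forms for the first \<open>R\<close>
  variables of each mode \<open>n\<close>; multiplicativity is what gives the exchange rule with
  \<open>mulY\<close>.\<close>

lemma subst_exists:
  fixes IMG :: "nat \<Rightarrow> nat \<Rightarrow> nat \<Rightarrow> complex" and R :: nat
  shows "\<exists>p :: fock lop. (\<forall>g. app p (bvec (g, 0)) = bvec (g, 0)) \<and>
    (\<forall>r n. p * mulY r n = (if r < R then \<Sum>s<R. csc (IMG n s r) * mulY s n else mulY r n) * p)"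
proof -
  define img where "img x = (case x of (r, n) \<Rightarrow>
      if r < R then \<Sum>s<R. scl (IMG n s r) (Yvar (s, n)) else Yvar (r, n))" for x
  define p where "p = lopb (\<lambda>(g, \<alpha>). bvec (g, 0) * mono_subst img \<alpha>)"
  have p: "app p (bvec (g, \<alpha>)) = bvec (g, 0) * mono_subst img \<alpha>" for g \<alpha> by (simp add: p_def)
  have Y: "Yvar (r, n) * v = app (mulY r n) v" for r n v
  proof -
    have "Yvar (r, n) * v = (\<Sum>b\<in>keys v. scl (lookup v b) (Yvar (r, n) * bvec b))"
      by (subst vec_expand[of v]) (simp only: sum_distrib_left scl_mult mult.commute[of "Yvar (r, n)"])
    also have "\<dots> = (\<Sum>b\<in>keys v. scl (lookup v b) (app (mulY r n) (bvec b)))"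
      by (intro sum.cong refl) (auto simp: Yvar_def bvec_mult app_mulY add.commute split: prod.splits)
    also have "\<dots> = app (mulY r n) v" by (simp only: app_expand[symmetric])
    finally show ?thesis .
  qed
  have "p * mulY r n = (if r < R then \<Sum>s<R. csc (IMG n s r) * mulY s n else mulY r n) * p" for r n
  proof (rule lop_eq_basis)
    fix b :: fock
    obtain g \<alpha> where b: "b = (g, \<alpha>)" by (cases b)
    have "app (p * mulY r n) (bvec b) = img (r, n) * app p (bvec b)"
      by (simp only: b app_mult app_mulY p mono_subst_add_single mult_ac)
    also have "\<dots> = app (if r < R then \<Sum>s<R. csc (IMG n s r) * mulY s n else mulY r n) (app p (bvec b))"
      by (simp add: img_def sum_distrib_right scl_mult Y sum_app app_mult app_csc)
    finally show "app (p * mulY r n) (bvec b) =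
        app ((if r < R then \<Sum>s<R. csc (IMG n s r) * mulY s n else mulY r n) * p) (bvec b)"
      by (simp only: app_mult)
  qed
  moreover have "app p (bvec (g, 0)) = bvec (g, 0)" for g by (simp add: p mono_subst_def)
  ultimately show ?thesis by blast
qed

definition cre :: "nat \<Rightarrow> (nat \<Rightarrow> nat \<Rightarrow> complex) \<Rightarrow> nat \<Rightarrow> fock lop" where
  "cre R f n = (\<Sum>r<R. csc (f n r) * mulY r n)"

definition ann :: "nat \<Rightarrow> (nat \<Rightarrow> nat \<Rightarrow> complex) \<Rightarrow> nat \<Rightarrow> fock lop" where
  "ann R f n = (\<Sum>r<R. csc (f n r) * derY r n)"

text \<open>Creation modes transform by \<open>M\<close> and annihilation modes by its inverse
  acting on the other side, so that all pairings are preserved.\<close>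

lemma change_of_variables:
  fixes M M' :: "nat \<Rightarrow> nat \<Rightarrow> nat \<Rightarrow> complex"
  assumes MM': "\<And>n r t. r < R \<Longrightarrow> t < R \<Longrightarrow> (\<Sum>s<R. M n r s * M' n s t) = (if r = t then 1 else 0)"
    and M'M: "\<And>n r t. r < R \<Longrightarrow> t < R \<Longrightarrow> (\<Sum>s<R. M' n r s * M n s t) = (if r = t then 1 else 0)"
  obtains p p' :: "fock lop" where "p * p' = 1" "p' * p = 1"
    "\<And>f n. p * cre R f n * p' = cre R (\<lambda>n s. \<Sum>r<R. M n s r * f n r) n"
    "\<And>f n. p * ann R f n * p' = ann R (\<lambda>n s. \<Sum>r<R. f n r * M' n r s) n"
    "\<And>\<sigma> g. p * torus \<sigma> g * p' = torus \<sigma> g"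
proof -
  define I where "I M r n = (if r < R then \<Sum>s<R. csc (M n s r) * mulY s n else mulY r n)"
    for M :: "nat \<Rightarrow> nat \<Rightarrow> nat \<Rightarrow> complex" and r n
  obtain p where p0: "\<And>g. app p (bvec (g, 0)) = bvec (g, 0)" and p: "\<And>r n. p * mulY r n = I M r n * p"
    using subst_exists[of R M] unfolding I_def by blast
  obtain p' where p'0: "\<And>g. app p' (bvec (g, 0)) = bvec (g, 0)" and p': "\<And>r n. p' * mulY r n = I M' r n * p'"
    using subst_exists[of R M'] unfolding I_def by blast
  \<comment> \<open>The composite of the two substitutions commutes with every variable and fixes
    the vacua, hence it is the identity.\<close>
  have inverse: "x' * x = 1" if x0: "\<And>g. app x (bvec (g, 0)) = bvec (g, 0)" and x: "\<And>r n. x * mulY r n = I A r n * x"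
    and x'0: "\<And>g. app x' (bvec (g, 0)) = bvec (g, 0)" and x': "\<And>r n. x' * mulY r n = I A' r n * x'"
    and A: "\<And>n r t. r < R \<Longrightarrow> t < R \<Longrightarrow> (\<Sum>s<R. A' n r s * A n s t) = (if r = t then 1 else 0)" for x x' A A'
  proof -
    have *: "x' * x * mulY r n = mulY r n * (x' * x)" for r n
    proof (cases "r < R")
      case True
      have "x' * x * mulY r n = x' * (I A r n * x)" by (simp only: x mult.assoc)
      also have "\<dots> = (\<Sum>s<R. csc (A n s r) * (x' * mulY s n * x))"
        by (simp add: True I_def sum_distrib_left sum_distrib_right csm_simps mult.assoc)
      also have "\<dots> = (\<Sum>s<R. csc (A n s r) * (I A' s n * (x' * x)))" by (simp only: x' mult.assoc)
      also have "\<dots> = (\<Sum>s<R. \<Sum>t<R. csc (A' n t s * A n s r) * (mulY t n * (x' * x)))"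
        by (intro sum.cong refl)
           (simp add: I_def sum_distrib_left sum_distrib_right csm_simps mult.assoc csm_sum mult.commute)
      also have "\<dots> = (\<Sum>t<R. csc (\<Sum>s<R. A' n t s * A n s r) * (mulY t n * (x' * x)))"
        by (subst sum.swap) (simp add: csc_sum sum_distrib_right)
      also have "\<dots> = (\<Sum>t<R. if t = r then mulY r n * (x' * x) else 0)"
        by (intro sum.cong refl) (simp add: A True csc_zero)
      finally show ?thesis using True by simp
    next
      case False
      then show ?thesis using x[of r n] x'[of r n] by (simp add: I_def mult.assoc) (simp add: mult.assoc[symmetric])
    qed
    have "x' * x - 1 = 0"
    proof (rule fock_lop_eq_0I)
      show "app (x' * x - 1) (bvec (g, 0)) = 0" for g
        by (simp add: minus_lop.rep_eq app_mult x0 x'0)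
      show "\<exists>B. (x' * x - 1) * mulY r n = B * (x' * x - 1)" for r n
        using * by (intro exI[of _ "mulY r n"]) (simp add: algebra_simps)
    qed
    then show ?thesis by simp
  qed
  have pp': "p * p' = 1" by (rule inverse[OF p'0 p' p0 p MM'])
  have p'p: "p' * p = 1" by (rule inverse[OF p0 p p'0 p' M'M])
  show ?thesis
  proof (rule that[OF pp' p'p])
    have mul: "p * mulY r n * p' = I M r n" for r n
      by (simp add: p mult.assoc pp')
    show "p * cre R f n * p' = cre R (\<lambda>n s. \<Sum>r<R. M n s r * f n r) n" for f n
    proof -
      have "p * cre R f n * p' = (\<Sum>r<R. csc (f n r) * (p * mulY r n * p'))"
        by (simp add: cre_def sum_distrib_left sum_distrib_right csm_simps mult.assoc)
      also have "\<dots> = (\<Sum>r<R. \<Sum>s<R. csc (M n s r * f n r) * mulY s n)"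
        unfolding mul by (intro sum.cong refl) (simp add: I_def csm_simps csm_sum mult.commute)
      also have "\<dots> = cre R (\<lambda>n s. \<Sum>r<R. M n s r * f n r) n"
        by (subst sum.swap) (simp add: cre_def csc_sum sum_distrib_right)
      finally show ?thesis .
    qed
    \<comment> \<open>Both sides kill the vacua and have the same commutator with every substituted
      variable, by \<open>M'M\<close>; so their difference is zero by
      \<open>fock_lop_eq_0I\<close>.\<close>
    have der: "p * derY r n = (\<Sum>s<R. csc (M' n r s) * derY s n) * p" if "r < R" for r n
    proof -
      define \<Delta> where "\<Delta> = (\<Sum>s<R. csc (M' n r s) * derY s n)"
      have D: "derY s n * mulY t m = mulY t m * derY s n + csc (if s = t \<and> n = m then 1 else 0)" for s t m
        using derY_mulY[of s n t m] by (auto simp: csc_zero algebra_simps)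
      have \<Delta>: "\<Delta> * I M t m = I M t m * \<Delta> + csc (if r = t \<and> n = m then 1 else 0)" for t m
      proof (cases "t < R")
        case True
        have "\<Delta> * I M t m = (\<Sum>s<R. \<Sum>s'<R. csc (M' n r s * M m s' t) * (derY s n * mulY s' m))"
          using True by (simp add: \<Delta>_def I_def sum_product csm_simps mult.commute)
        also have "\<dots> = (\<Sum>s<R. \<Sum>s'<R. csc (M' n r s * M m s' t) * (mulY s' m * derY s n))
             + (\<Sum>s<R. \<Sum>s'<R. csc (M' n r s * M m s' t * (if s = s' \<and> n = m then 1 else 0)))"
          by (simp add: D distrib_left sum.distrib csc_mult)
        also have "(\<Sum>s<R. \<Sum>s'<R. csc (M' n r s * M m s' t) * (mulY s' m * derY s n)) = I M t m * \<Delta>"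
          using True by (subst sum.swap) (simp add: \<Delta>_def I_def sum_product csm_simps mult.commute)
        also have "(\<Sum>s<R. \<Sum>s'<R. csc (M' n r s * M m s' t * (if s = s' \<and> n = m then 1 else 0)))
           = csc (if n = m then \<Sum>s<R. M' n r s * M n s t else 0)"
          by (auto simp: csc_sum csc_zero if_distrib cong: if_cong)
        also have "(if n = m then \<Sum>s<R. M' n r s * M n s t else 0) = (if r = t \<and> n = m then 1 else 0)"
          using M'M[OF \<open>r < R\<close> True, of n] by auto
        finally show ?thesis .
      next
        case False
        have "\<Delta> * mulY t m = (\<Sum>s<R. csc (M' n r s) * (derY s n * mulY t m))"
          by (simp add: \<Delta>_def sum_distrib_right mult.assoc)
        also have "\<dots> = (\<Sum>s<R. csc (M' n r s) * (mulY t m * derY s n))"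
          using False by (intro sum.cong refl) (auto simp: D csc_zero)
        also have "\<dots> = mulY t m * \<Delta>" by (simp add: \<Delta>_def sum_distrib_left csm_simps)
        finally show ?thesis using False \<open>r < R\<close> by (auto simp: I_def csc_zero)
      qed
      have "p * derY r n - \<Delta> * p = 0"
      proof (rule fock_lop_eq_0I)
        have "app (derY s n) (bvec (g, 0)) = 0" for s g by (simp add: app_derY)
        then show "app (p * derY r n - \<Delta> * p) (bvec (g, 0)) = 0" for g
          by (simp add: minus_lop.rep_eq app_mult p0 \<Delta>_def sum_app app_csc)
        show "\<exists>B. (p * derY r n - \<Delta> * p) * mulY t m = B * (p * derY r n - \<Delta> * p)" for t m
        proof (intro exI[of _ "I M t m"])
          have "(p * derY r n - \<Delta> * p) * mulY t m = p * (derY r n * mulY t m) - \<Delta> * (p * mulY t m)"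
            by (simp add: algebra_simps)
          also have "p * (derY r n * mulY t m) = p * mulY t m * derY r n + csc (if r = t \<and> n = m then 1 else 0) * p"
            by (simp add: D distrib_left csc_central mult.assoc)
          also have "\<Delta> * (p * mulY t m) = I M t m * \<Delta> * p + csc (if r = t \<and> n = m then 1 else 0) * p"
            by (simp only: p mult.assoc[symmetric] \<Delta> distrib_right)
          finally show "(p * derY r n - \<Delta> * p) * mulY t m = I M t m * (p * derY r n - \<Delta> * p)"
            by (simp add: p algebra_simps)
        qed
      qed
      then show ?thesis by (simp add: \<Delta>_def)
    qed
    show "p * ann R f n * p' = ann R (\<lambda>n s. \<Sum>r<R. f n r * M' n r s) n" for f n
    proof -
      have "p * ann R f n * p' = (\<Sum>r<R. csc (f n r) * (p * derY r n * p'))"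
        by (simp add: ann_def sum_distrib_left sum_distrib_right csm_simps mult.assoc)
      also have "\<dots> = (\<Sum>r<R. csc (f n r) * (\<Sum>s<R. csc (M' n r s) * derY s n))"
        by (intro sum.cong refl) (simp add: der mult.assoc pp')
      also have "\<dots> = (\<Sum>r<R. \<Sum>s<R. csc (f n r * M' n r s) * derY s n)"
        by (simp add: csm_simps csm_sum mult.commute)
      also have "\<dots> = ann R (\<lambda>n s. \<Sum>r<R. f n r * M' n r s) n"
        by (subst sum.swap) (simp add: ann_def csc_sum sum_distrib_right)
      finally show ?thesis .
    qed
    show "p * torus \<sigma> g * p' = torus \<sigma> g" for \<sigma> g
    proof -
      have T: "torus \<sigma> g * I M r n = I M r n * torus \<sigma> g" for r n
        by (auto simp: I_def sum_distrib_left sum_distrib_right csm_simps torus_mulY)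
      have "p * torus \<sigma> g - torus \<sigma> g * p = 0"
      proof (rule fock_lop_eq_0I)
        show "app (p * torus \<sigma> g - torus \<sigma> g * p) (bvec (h, 0)) = 0" for h
          by (simp add: minus_lop.rep_eq app_mult p0 app_torus app_scl)
        show "\<exists>B. (p * torus \<sigma> g - torus \<sigma> g * p) * mulY r n = B * (p * torus \<sigma> g - torus \<sigma> g * p)" for r n
        proof (intro exI[of _ "I M r n"])
          have "(p * torus \<sigma> g - torus \<sigma> g * p) * mulY r n = p * mulY r n * torus \<sigma> g - torus \<sigma> g * (p * mulY r n)"
            by (simp add: algebra_simps torus_mulY)
          also have "\<dots> = I M r n * (p * torus \<sigma> g - torus \<sigma> g * p)"
            by (simp only: p mult.assoc[symmetric] T right_diff_distrib)
          finally show "(p * torus \<sigma> g - torus \<sigma> g * p) * mulY r n = I M r n * (p * torus \<sigma> g - torus \<sigma> g * p)" .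
        qed
      qed
      then have "p * torus \<sigma> g = torus \<sigma> g * p" by simp
      then show ?thesis by (simp add: mult.assoc pp')
    qed
  qed
qed

section \<open>Vertex operators on Fock space\<close>

lemma fdeg_superset:
  assumes "finite S" "keys \<alpha> \<subseteq> S"
  shows "fdeg (g, \<alpha>) = (\<Sum>x\<in>S. snd x * lookup \<alpha> x)"
  unfolding fdeg_def using assms
  by (simp add: case_prod_unfold) (rule sum.mono_neutral_left, auto simp: in_keys_iff)

lemma fdeg_add_single: "fdeg (g, \<alpha> + single (r, n) 1) = fdeg (h, \<alpha>) + n"
proof -
  let ?S = "insert (r, n) (keys \<alpha>)"
  have "keys (\<alpha> + single (r, n) 1) \<subseteq> ?S" using Poly_Mapping.keys_add[of \<alpha> "single (r, n) 1"] by auto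
  then have "fdeg (g, \<alpha> + single (r, n) 1) = (\<Sum>x\<in>?S. snd x * lookup (\<alpha> + single (r, n) 1) x)"
    by (intro fdeg_superset) auto
  also have "\<dots> = (\<Sum>x\<in>?S. snd x * lookup \<alpha> x) + (\<Sum>x\<in>?S. if x = (r, n) then n else 0)"
    unfolding sum.distrib[symmetric]
    by (intro sum.cong refl) (auto simp: lookup_add lookup_single when_def algebra_simps)
  also have "(\<Sum>x\<in>?S. snd x * lookup \<alpha> x) = fdeg (h, \<alpha>)" by (rule fdeg_superset[symmetric]) auto
  also have "(\<Sum>x\<in>?S. if x = (r, n) then n else 0) = n" by simp
  finally show ?thesis .
qed

lemma homogeneous_mulY: "homogeneous fdeg (- int n) (mulY r n)"
  unfolding homogeneous_def
proof (intro allI ballI)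
  fix b b' assume b': "b' \<in> keys (app (mulY r n) (bvec b))"
  obtain g \<alpha> where b: "b = (g, \<alpha>)" by (cases b)
  show "int (fdeg b') = int (fdeg b) - - int n"
    using b' fdeg_add_single[of g \<alpha> r n g] by (simp add: b app_mulY)
qed

lemma homogeneous_derY: "homogeneous fdeg (int n) (derY r n)"
  unfolding homogeneous_def
proof (intro allI ballI)
  fix b b' assume b': "b' \<in> keys (app (derY r n) (bvec b))"
  obtain g \<alpha> where b: "b = (g, \<alpha>)" by (cases b)
  have nz: "lookup \<alpha> (r, n) \<noteq> 0" and b'': "b' = (g, \<alpha> - single (r, n) 1)"
    using b' by (auto simp: b app_derY in_keys_iff lookup_bvec split: if_splits)
  have "\<alpha> - single (r, n) 1 + single (r, n) 1 = \<alpha>"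
    using nz by (intro poly_mapping_eqI) (auto simp: lookup_add lookup_minus lookup_single when_def)
  then show "int (fdeg b') = int (fdeg b) - int n"
    using fdeg_add_single[of g "\<alpha> - single (r, n) 1" r n g] by (simp add: b b'')
qed

lemma homogeneous_torus: "homogeneous fdeg 0 (torus \<sigma> g)"
  unfolding homogeneous_def
proof (intro allI ballI)
  fix b b' assume b': "b' \<in> keys (app (torus \<sigma> g) (bvec b))"
  obtain h \<alpha> where b: "b = (h, \<alpha>)" by (cases b)
  show "int (fdeg b') = int (fdeg b) - 0"
    using b' by (auto simp: b app_torus in_keys_iff lookup_bvec fdeg_def split: if_splits)
qed

lemma cre_commute: "cre R f m * cre R f' n = cre R f' n * cre R f m"
  unfolding cre_def sum_product
  by (subst sum.swap) (simp add: csm_simps mulY_commute[of _ n] mult.commute)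

lemma ann_commute: "ann R f m * ann R f' n = ann R f' n * ann R f m"
  unfolding ann_def sum_product
  by (subst sum.swap) (simp add: csm_simps derY_commute[of _ n] mult.commute)

lemma torus_cre: "torus \<sigma> g * cre R f n = cre R f n * torus \<sigma> g"
  by (simp add: cre_def sum_distrib_left sum_distrib_right csm_simps torus_mulY)

lemma torus_ann: "torus \<sigma> g * ann R f n = ann R f n * torus \<sigma> g"
  by (simp add: ann_def sum_distrib_left sum_distrib_right csm_simps torus_derY)

lemma ann_cre: "ann R h n * cre R f m =
    cre R f m * ann R h n + (if n = m then csc (\<Sum>r<R. h n r * f n r) else 0)"
  using osc_commutator[of R "\<lambda>_. h" 0 n "\<lambda>_. f" 0 m]
  by (simp add: osc_pos_def osc_neg_def ann_def cre_def algebra_simps)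

lemma vertex_fock: "vertex fdeg (csc x * torus \<sigma> g) (cre R f) (ann R h)"
proof
  show "homogeneous fdeg 0 (csc x * torus \<sigma> g)"
    by (intro homogeneous_csc_mult homogeneous_torus)
  show "homogeneous fdeg (- int n) (cre R f n)" for n
    unfolding cre_def by (intro homogeneous_sum homogeneous_csc_mult homogeneous_mulY)
  show "homogeneous fdeg (int n) (ann R h n)" for n
    unfolding ann_def by (intro homogeneous_sum homogeneous_csc_mult homogeneous_derY)
qed (rule cre_commute ann_commute)+

lemma sum_list_csc_osc:
  "(\<Sum>(i, a)\<leftarrow>w. csc (a ^ n) * osc_neg R u i n) = cre R (\<lambda>n r. \<Sum>(i, a)\<leftarrow>w. a ^ n * u i n r) n"
  "(\<Sum>(i, a)\<leftarrow>w. csc (1 / a ^ n) * osc_pos R v i n) = ann R (\<lambda>n r. \<Sum>(i, a)\<leftarrow>w. (1 / a) ^ n * v i n r) n"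
  by (induction w)
     (auto simp: cre_def ann_def osc_neg_def osc_pos_def csc_zero csc_plus csm_plus distrib_right sum.distrib
       sum_distrib_left csc_mult power_one_over simp flip: mult.assoc)

lemma normal_ordered_osc:
  "normal_ordered (osc_neg R u) (osc_pos R v) e w =
    vertex_op e (cre R (\<lambda>n r. \<Sum>(i, a)\<leftarrow>w. a ^ n * u i n r)) (ann R (\<lambda>n r. \<Sum>(i, a)\<leftarrow>w. (1 / a) ^ n * v i n r))"
  by (simp only: normal_ordered_def sum_list_csc_osc)

lemma cre_cong: "(\<And>r. r < R \<Longrightarrow> f n r = f' n r) \<Longrightarrow> cre R f n = cre R f' n"
  by (simp add: cre_def)

lemma ann_cong: "(\<And>r. r < R \<Longrightarrow> f n r = f' n r) \<Longrightarrow> ann R f n = ann R f' n"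
  by (simp add: ann_def)

lemma vertex_op_cong:
  assumes "\<And>n. n > 0 \<Longrightarrow> c n = c' n" "\<And>n. n > 0 \<Longrightarrow> d n = d' n"
  shows "vertex_op e c d = vertex_op e c' d'"
proof -
  have "expc c = expc c'" "expc d = expc d'"
    using expc_cong[of c c'] expc_cong[of d d'] assms by (auto simp: fun_eq_iff)
  then show ?thesis by (intro ext) (simp only: vertex_op_def)
qed

lemma vertex_op_zero: "vertex_op e (\<lambda>n. 0) (\<lambda>n. 0) m = (if m = 0 then e else 0)"
proof -
  have "vertex_op e (\<lambda>n. 0) (\<lambda>n. 0) m = (\<Sum>k\<in>{0::nat}. if int k \<ge> m then e * expc (\<lambda>n. 0) (nat (int k - m)) * expc (\<lambda>n. 0) k else 0)"
    unfolding vertex_op_def by (rule osum_finite(2)) (auto simp: expc_zero)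
  also have "\<dots> = (if m = 0 then e else 0)" by (auto simp: expc_zero)
  finally show ?thesis .
qed

lemma torus_zero: "(\<And>h. \<sigma> 0 h = 1) \<Longrightarrow> torus \<sigma> 0 = 1"
  by (rule lop_eq_basis) (auto simp: app_torus)

section \<open>Relabelling the Fock basis\<close>

text \<open>The lattice map is only required to be bijective, as the one used below is not additive
  everywhere. The scalars \<open>\<chi>\<close> rescale basis vectors, so that a torus element
  acquires the factor \<open>\<chi> g\<close>; this produces the prefactors of the
  \<open>\<Lambda>_j\<close>.\<close>

locale relabel =
  fixes \<iota>1 \<iota>2 :: "nat \<Rightarrow> nat" and \<theta>1 \<theta>2 :: "lattice \<Rightarrow> lattice" and \<chi> :: "lattice \<Rightarrow> complex"
  assumes inj1: "inj \<iota>1" and inj2: "inj \<iota>2" and disj: "\<iota>1 r \<noteq> \<iota>2 s"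
    and cover: "r \<in> range \<iota>1 \<union> range \<iota>2" and bij_\<theta>: "bij (\<lambda>g. (\<theta>1 g, \<theta>2 g))" and \<chi>: "\<chi> g \<noteq> 0"
begin

definition \<kappa>1 :: "nat \<times> nat \<Rightarrow> nat \<times> nat" where "\<kappa>1 x = (\<iota>1 (fst x), snd x)"
definition \<kappa>2 :: "nat \<times> nat \<Rightarrow> nat \<times> nat" where "\<kappa>2 x = (\<iota>2 (fst x), snd x)"

lemma inj_\<kappa>: "inj \<kappa>1" "inj \<kappa>2"
  by (rule injI, simp add: \<kappa>1_def \<kappa>2_def prod_eq_iff inj_eq[OF inj1] inj_eq[OF inj2])+

definition \<beta> :: "fock \<Rightarrow> fock \<times> fock" where
  "\<beta> b = ((\<theta>1 (fst b), Poly_Mapping.map_key \<kappa>1 (snd b)), (\<theta>2 (fst b), Poly_Mapping.map_key \<kappa>2 (snd b)))"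

lemma lookup_map_key:
  "lookup (Poly_Mapping.map_key \<kappa>1 \<alpha>) x = lookup \<alpha> (\<kappa>1 x)"
  "lookup (Poly_Mapping.map_key \<kappa>2 \<alpha>) x = lookup \<alpha> (\<kappa>2 x)"
  by (simp_all only: map_key.rep_eq inj_\<kappa> if_True o_apply)

lemma cover_\<kappa>: "(\<exists>y. x = \<kappa>1 y) \<or> (\<exists>y. x = \<kappa>2 y)"
proof (cases "fst x \<in> range \<iota>1")
  case True
  then obtain r where "fst x = \<iota>1 r" by (rule rangeE)
  then have "x = \<kappa>1 (r, snd x)" by (simp add: \<kappa>1_def prod_eq_iff)
  then show ?thesis by (intro disjI1 exI)
next
  case False
  then have "fst x \<in> range \<iota>2" using cover[of "fst x"] by (simp only: Un_iff simp_thms)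
  then obtain r where "fst x = \<iota>2 r" by (rule rangeE)
  then have "x = \<kappa>2 (r, snd x)" by (simp add: \<kappa>2_def prod_eq_iff)
  then show ?thesis by (intro disjI2 exI)
qed

lemma bij_\<beta>: "bij \<beta>"
proof (rule bijI)
  show "inj \<beta>"
  proof (rule injI)
    fix x y assume xy: "\<beta> x = \<beta> y"
    have "fst x = fst y" using xy inj_eq[OF bij_is_inj[OF bij_\<theta>], of "fst x" "fst y"] by (simp add: \<beta>_def)
    moreover have "lookup (snd x) z = lookup (snd y) z" for z
    proof -
      have "Poly_Mapping.map_key \<kappa>1 (snd x) = Poly_Mapping.map_key \<kappa>1 (snd y)"
        "Poly_Mapping.map_key \<kappa>2 (snd x) = Poly_Mapping.map_key \<kappa>2 (snd y)"
        using xy by (simp_all add: \<beta>_def)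
      then have "lookup (snd x) (\<kappa>1 w) = lookup (snd y) (\<kappa>1 w)" "lookup (snd x) (\<kappa>2 w) = lookup (snd y) (\<kappa>2 w)" for w
        by (metis lookup_map_key(1)) (metis \<open>Poly_Mapping.map_key \<kappa>2 (snd x) = Poly_Mapping.map_key \<kappa>2 (snd y)\<close> lookup_map_key(2))
      then show ?thesis using cover_\<kappa>[of z] by blast
    qed
    ultimately show "x = y" by (simp add: prod_eq_iff poly_mapping_eqI)
  qed
  show "surj \<beta>"
  proof (rule surjI)
    fix y :: "fock \<times> fock"
    obtain a \<alpha>1 b \<alpha>2 where y: "y = ((a, \<alpha>1), (b, \<alpha>2))" by (metis prod.exhaust)
    define \<alpha> where "\<alpha> = (\<Sum>x\<in>keys \<alpha>1. single (\<kappa>1 x) (lookup \<alpha>1 x)) + (\<Sum>x\<in>keys \<alpha>2. single (\<kappa>2 x) (lookup \<alpha>2 x))"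
    have d: "\<kappa>1 x \<noteq> \<kappa>2 z" "\<kappa>2 z \<noteq> \<kappa>1 x" for x z using disj by (simp_all add: \<kappa>1_def \<kappa>2_def disj disj[symmetric])
    have l1: "lookup \<alpha> (\<kappa>1 z) = lookup \<alpha>1 z" for z
      by (simp add: \<alpha>_def lookup_add lookup_sum lookup_single when_def d inj_eq[OF inj_\<kappa>(1)] in_keys_iff)
    have l2: "lookup \<alpha> (\<kappa>2 z) = lookup \<alpha>2 z" for z
      by (simp add: \<alpha>_def lookup_add lookup_sum lookup_single when_def d inj_eq[OF inj_\<kappa>(2)] in_keys_iff)
    have "\<beta> (inv_into UNIV (\<lambda>g. (\<theta>1 g, \<theta>2 g)) (a, b), \<alpha>) = y"
      using surj_f_inv_f[OF bij_is_surj[OF bij_\<theta>], of "(a, b)"]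
      by (auto simp: \<beta>_def y intro!: poly_mapping_eqI simp: lookup_map_key l1 l2)
    then show "\<beta> (SOME x. \<beta> x = y) = y" by (rule someI)
  qed
qed

abbreviation rel where "rel \<equiv> lin (\<lambda>b. scl (\<chi> (fst b)) (bvec (\<beta> b)))"

abbreviation unrel where "unrel \<equiv> lin (\<lambda>b. scl (1 / \<chi> (fst (inv_into UNIV \<beta> b))) (bvec (inv_into UNIV \<beta> b)))"

sublocale vec_iso rel unrel
  using vec_iso_relabel[OF bij_\<beta>, of "\<lambda>b. \<chi> (fst b)"] \<chi> by simp

lemma map_key_add_single:
  "Poly_Mapping.map_key \<kappa>1 (\<alpha> + single (\<iota>1 r, n) 1) = Poly_Mapping.map_key \<kappa>1 \<alpha> + single (r, n) 1"
  "Poly_Mapping.map_key \<kappa>2 (\<alpha> + single (\<iota>2 r, n) 1) = Poly_Mapping.map_key \<kappa>2 \<alpha> + single (r, n) 1"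
  "Poly_Mapping.map_key \<kappa>1 (\<alpha> + single (\<iota>2 r, n) 1) = Poly_Mapping.map_key \<kappa>1 \<alpha>"
  "Poly_Mapping.map_key \<kappa>2 (\<alpha> + single (\<iota>1 r, n) 1) = Poly_Mapping.map_key \<kappa>2 \<alpha>"
  "Poly_Mapping.map_key \<kappa>1 (\<alpha> - single (\<iota>1 r, n) 1) = Poly_Mapping.map_key \<kappa>1 \<alpha> - single (r, n) 1"
  "Poly_Mapping.map_key \<kappa>2 (\<alpha> - single (\<iota>2 r, n) 1) = Poly_Mapping.map_key \<kappa>2 \<alpha> - single (r, n) 1"
  "Poly_Mapping.map_key \<kappa>1 (\<alpha> - single (\<iota>2 r, n) 1) = Poly_Mapping.map_key \<kappa>1 \<alpha>"
  "Poly_Mapping.map_key \<kappa>2 (\<alpha> - single (\<iota>1 r, n) 1) = Poly_Mapping.map_key \<kappa>2 \<alpha>"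
  for \<alpha> :: "(nat \<times> nat) \<Rightarrow>\<^sub>0 nat"
  by (rule poly_mapping_eqI, simp add: lookup_map_key lookup_add lookup_minus lookup_single when_def
      \<kappa>1_def \<kappa>2_def prod_eq_iff inj_eq[OF inj1] inj_eq[OF inj2] disj disj[symmetric])+

lemma conj_mulY: "conj (mulY (\<iota>1 r) n) = tensL (mulY r n)" "conj (mulY (\<iota>2 r) n) = tensR (mulY r n)"
  by (rule conj_eqI, clarsimp simp: app_mulY app_scl \<beta>_def app_tens_bvec map_key_add_single[simplified])+

lemma conj_derY: "conj (derY (\<iota>1 r) n) = tensL (derY r n)" "conj (derY (\<iota>2 r) n) = tensR (derY r n)"
  by (rule conj_eqI, clarsimp simp: app_derY app_scl scl_scl \<beta>_def app_tens_bvec lin_scl emb_linear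
      map_key_add_single[simplified] lookup_map_key \<kappa>1_def \<kappa>2_def mult.commute)+

text \<open>Additivity enters only for translation by the given \<open>g\<close>, which is available
  on the zero modes of the quiver.\<close>

lemma conj_torus:
  assumes "\<And>h. \<theta>1 (g + h) = \<theta>1 g + \<theta>1 h" "\<And>h. \<theta>2 (g + h) = \<theta>2 g + \<theta>2 h"
    and "\<And>h. \<chi> (g + h) = \<chi> g * \<chi> h" and "\<And>h. \<sigma> g h = \<tau> (\<theta>2 g) (\<theta>2 h)"
  shows "conj (torus \<sigma> g) = tensL (csc (\<chi> g) * torus (\<lambda>_ _. 1) (\<theta>1 g)) * tensR (torus \<tau> (\<theta>2 g))"
  by (rule conj_eqI)
     (clarsimp simp: app_torus app_scl scl_scl \<beta>_def app_mult app_csc app_tens_bvec lin_scl emb_linear assms mult_ac)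

end

section \<open>Linear algebra of Gram matrices\<close>

lemma square_inverse_commute:
  fixes A B :: "nat \<Rightarrow> nat \<Rightarrow> 'a::field"
  assumes "\<And>r t. r < R \<Longrightarrow> t < R \<Longrightarrow> (\<Sum>s<R. A r s * B s t) = (if r = t then 1 else 0)"
    and "r < R" "t < R"
  shows "(\<Sum>s<R. B r s * A s t) = (if r = t then 1 else 0)"
proof -
  let ?A = "mat R R (\<lambda>(r, s). A r s)" and ?B = "mat R R (\<lambda>(r, s). B r s)"
  have "?A * ?B = 1\<^sub>m R"
    by (rule eq_matI) (simp_all add: scalar_prod_def assms(1) flip: lessThan_atLeast0)
  then have "?B * ?A = 1\<^sub>m R"
    by (rule mat_mult_left_right_inverse[rotated 2]) simp_all
  then have "(?B * ?A) $$ (r, t) = 1\<^sub>m R $$ (r, t)" by simp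
  then show ?thesis using assms(2,3) by (simp add: scalar_prod_def flip: lessThan_atLeast0)
qed

text \<open>Associativity of a fourfold matrix product whose index sets are of different
  kinds.\<close>

lemma sum_mult_sum_swap:
  fixes A :: "'i \<Rightarrow> 'a::comm_semiring_0"
  shows "(\<Sum>s\<in>S. (\<Sum>i\<in>I. A i * B i s) * (\<Sum>j\<in>J. C j s * D j)) =
    (\<Sum>i\<in>I. \<Sum>j\<in>J. A i * (\<Sum>s\<in>S. B i s * C j s) * D j)"
proof -
  have "(\<Sum>s\<in>S. (\<Sum>i\<in>I. A i * B i s) * (\<Sum>j\<in>J. C j s * D j)) =
      (\<Sum>s\<in>S. \<Sum>i\<in>I. \<Sum>j\<in>J. A i * (B i s * C j s) * D j)"
    unfolding sum_product by (simp add: mult_ac)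
  also have "\<dots> = (\<Sum>i\<in>I. \<Sum>j\<in>J. \<Sum>s\<in>S. A i * (B i s * C j s) * D j)"
    by (subst sum.swap, intro sum.cong refl, subst sum.swap, rule refl)
  finally show ?thesis by (simp add: sum_distrib_left sum_distrib_right)
qed

text \<open>With \<open>P\<close> and \<open>Q\<close> inverting the second realization, take
  \<open>M = P V\<close> and \<open>M' = U Q\<close>. Then \<open>M M' = P (V U) Q\<close>, which
  equality of the Gram matrices turns into \<open>(P V') (U' Q)\<close>, the identity. The matrices
  being square, \<open>M'\<close> is also a left inverse.\<close>

lemma gram_intertwiner:
  fixes U V U' V' :: "'j \<Rightarrow> nat \<Rightarrow> 'a::field"
  assumes gram: "\<And>i j. i \<in> J \<Longrightarrow> j \<in> J \<Longrightarrow> (\<Sum>r<R. V i r * U j r) = (\<Sum>r<R. V' i r * U' j r)"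
    and P: "\<And>r s. r < R \<Longrightarrow> s < R \<Longrightarrow> (\<Sum>i\<in>J. P r i * V' i s) = (if r = s then 1 else 0)"
    and Q: "\<And>r s. r < R \<Longrightarrow> s < R \<Longrightarrow> (\<Sum>j\<in>J. U' j r * Q j s) = (if r = s then 1 else 0)"
  obtains M M' :: "nat \<Rightarrow> nat \<Rightarrow> 'a" where
    "\<And>r t. r < R \<Longrightarrow> t < R \<Longrightarrow> (\<Sum>s<R. M r s * M' s t) = (if r = t then 1 else 0)"
    "\<And>r t. r < R \<Longrightarrow> t < R \<Longrightarrow> (\<Sum>s<R. M' r s * M s t) = (if r = t then 1 else 0)"
    "\<And>j s. j \<in> J \<Longrightarrow> s < R \<Longrightarrow> (\<Sum>r<R. M s r * U j r) = U' j s"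
    "\<And>i s. i \<in> J \<Longrightarrow> s < R \<Longrightarrow> (\<Sum>r<R. V i r * M' r s) = V' i s"
proof -
  define M where "M s r = (\<Sum>i\<in>J. P s i * V i r)" for s r
  define M' where "M' r s = (\<Sum>j\<in>J. U j r * Q j s)" for r s
  have "(\<Sum>s<R. M r s * M' s t) = (if r = t then 1 else 0)" if "r < R" "t < R" for r t
  proof -
    have "(\<Sum>s<R. M r s * M' s t) = (\<Sum>i\<in>J. \<Sum>j\<in>J. P r i * (\<Sum>s<R. V i s * U j s) * Q j t)"
      unfolding M_def M'_def by (rule sum_mult_sum_swap)
    also have "\<dots> = (\<Sum>i\<in>J. \<Sum>j\<in>J. P r i * (\<Sum>s<R. V' i s * U' j s) * Q j t)"
      by (intro sum.cong refl) (simp add: gram)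
    also have "\<dots> = (\<Sum>s<R. (\<Sum>i\<in>J. P r i * V' i s) * (\<Sum>j\<in>J. U' j s * Q j t))"
      by (rule sum_mult_sum_swap[symmetric])
    also have "\<dots> = (\<Sum>s<R. if s = r then (if s = t then 1 else 0) else 0)"
      using that by (intro sum.cong refl) (simp add: P Q)
    finally show ?thesis using that by simp
  qed
  note MM' = this
  show ?thesis
  proof (rule that[OF MM' square_inverse_commute[of R M M', OF MM']])
    fix j s assume j: "j \<in> J" "s < R"
    have "(\<Sum>r<R. M s r * U j r) = (\<Sum>i\<in>J. P s i * (\<Sum>r<R. V i r * U j r))"
      unfolding M_def sum_distrib_left sum_distrib_right by (subst sum.swap) (simp add: mult.assoc)
    also have "\<dots> = (\<Sum>i\<in>J. P s i * (\<Sum>r<R. V' i r * U' j r))"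
      using j by (intro sum.cong refl) (simp add: gram)
    also have "\<dots> = (\<Sum>r<R. (\<Sum>i\<in>J. P s i * V' i r) * U' j r)"
      unfolding sum_distrib_left sum_distrib_right by (subst sum.swap) (simp add: mult.assoc)
    also have "\<dots> = (\<Sum>r<R. if r = s then U' j r else 0)"
      using j by (intro sum.cong refl) (simp add: P)
    finally show "(\<Sum>r<R. M s r * U j r) = U' j s" using j by simp
  next
    fix i s assume i: "i \<in> J" "s < R"
    have "(\<Sum>r<R. V i r * M' r s) = (\<Sum>j\<in>J. (\<Sum>r<R. V i r * U j r) * Q j s)"
      unfolding M'_def sum_distrib_left sum_distrib_right by (subst sum.swap) (simp add: mult.assoc)
    also have "\<dots> = (\<Sum>j\<in>J. (\<Sum>r<R. V' i r * U' j r) * Q j s)"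
      using i by (intro sum.cong refl) (simp add: gram)
    also have "\<dots> = (\<Sum>r<R. V' i r * (\<Sum>j\<in>J. U' j r * Q j s))"
      unfolding sum_distrib_left sum_distrib_right by (subst sum.swap) (simp add: mult.assoc)
    also have "\<dots> = (\<Sum>r<R. if r = s then V' i r else 0)"
      using i by (intro sum.cong refl) (simp add: Q)
    finally show "(\<Sum>r<R. V i r * M' r s) = V' i s" using i by simp
  qed auto
qed

definition spanned :: "'j set \<Rightarrow> nat \<Rightarrow> ('j \<Rightarrow> nat \<Rightarrow> complex) \<Rightarrow> (nat \<Rightarrow> complex) \<Rightarrow> bool" where
  "spanned J R W x \<longleftrightarrow> (\<exists>c. \<forall>r<R. x r = (\<Sum>j\<in>J. c j * W j r))"

lemma spanned_member: "finite J \<Longrightarrow> j \<in> J \<Longrightarrow> spanned J R W (W j)"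
proof -
  assume "finite J" "j \<in> J"
  then have "(\<Sum>i\<in>J. (if i = j then 1 else 0) * W i r) = W j r" for r
    by (subst sum.cong[OF refl, of J _ "\<lambda>i. if i = j then W i r else 0"]) auto
  then show ?thesis unfolding spanned_def by (intro exI[of _ "\<lambda>i. if i = j then 1 else 0"]) simp
qed

lemma spanned_add: "spanned J R W x \<Longrightarrow> spanned J R W y \<Longrightarrow> spanned J R W (\<lambda>r. x r + y r)"
  unfolding spanned_def
proof (elim exE)
  fix c d assume "\<forall>r<R. x r = (\<Sum>j\<in>J. c j * W j r)" "\<forall>r<R. y r = (\<Sum>j\<in>J. d j * W j r)"
  then show "\<exists>c. \<forall>r<R. x r + y r = (\<Sum>j\<in>J. c j * W j r)"
    by (intro exI[of _ "\<lambda>j. c j + d j"]) (simp add: distrib_right sum.distrib)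
qed

lemma spanned_scale: "spanned J R W x \<Longrightarrow> spanned J R W (\<lambda>r. a * x r)"
  unfolding spanned_def
proof (elim exE)
  fix c assume "\<forall>r<R. x r = (\<Sum>j\<in>J. c j * W j r)"
  then show "\<exists>c. \<forall>r<R. a * x r = (\<Sum>j\<in>J. c j * W j r)"
    by (intro exI[of _ "\<lambda>j. a * c j"]) (simp add: sum_distrib_left mult.assoc)
qed

lemma spanned_zero: "spanned J R W (\<lambda>r. 0)"
  unfolding spanned_def by (intro exI[of _ "\<lambda>_. 0"]) simp

lemma spanned_sum:
  "(\<And>i. i \<in> I \<Longrightarrow> spanned J R W (x i)) \<Longrightarrow> spanned J R W (\<lambda>r. \<Sum>i\<in>I. x i r)"
  by (induction I rule: infinite_finite_induct) (simp_all add: spanned_zero spanned_add)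

lemma spanned_cong: "spanned J R W x \<Longrightarrow> (\<And>r. r < R \<Longrightarrow> y r = x r) \<Longrightarrow> spanned J R W y"
  unfolding spanned_def by auto

lemma spanned_basis_coeffs:
  assumes "\<And>s. s < R \<Longrightarrow> spanned J R W (\<lambda>r. if r = s then 1 else 0)"
  shows "\<exists>c. \<forall>s<R. \<forall>r<R. (\<Sum>j\<in>J. c s j * W j r) = (if s = r then 1 else 0)"
proof -
  have "\<forall>s. \<exists>c. s < R \<longrightarrow> (\<forall>r<R. (if r = s then 1 else 0) = (\<Sum>j\<in>J. c j * W j r))"
    using assms unfolding spanned_def by blast
  from choice[OF this] obtain c where
    "\<forall>s. s < R \<longrightarrow> (\<forall>r<R. (if r = s then 1 else 0) = (\<Sum>j\<in>J. c s j * W j r))" ..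
  then have "(\<Sum>j\<in>J. c s j * W j r) = (if s = r then 1 else 0)" if "s < R" "r < R" for s r
    using that by (metis (full_types))
  then show ?thesis by blast
qed

text \<open>A \<open>3 \<times> 3\<close> Gram matrix of rank two is realized in the plane: split off the first vector and
  factorize the Schur complement.\<close>

lemma rank_two_realization:
  fixes g :: "nat \<Rightarrow> nat \<Rightarrow> complex"
  defines "m \<equiv> \<lambda>i j. g i j - g i 0 * g 0 j / g 0 0"
  assumes g: "g 0 0 \<noteq> 0" and det: "m 1 1 * m 2 2 = m 1 2 * m 2 1"
    and nz: "m 1 1 \<noteq> 0 \<or> m 2 2 \<noteq> 0"
  shows "\<exists>u v :: nat \<Rightarrow> nat \<Rightarrow> complex. (\<forall>i<3. \<forall>j<3. (\<Sum>s<2. v i s * u j s) = g i j)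
    \<and> (\<forall>s<2. spanned {..<3} 2 u (\<lambda>r. if r = s then 1 else 0))
    \<and> (\<forall>s<2. spanned {..<3} 2 v (\<lambda>r. if r = s then 1 else 0))"
proof -
  \<comment> \<open>The pivot of the rank one complement. In the application its position depends on
    \<open>N\<close>.\<close>
  obtain k where k: "k = 1 \<or> k = 2" "m k k \<noteq> 0" using nz by blast
  define u where "u j s = (if s = 0 then g 0 j else m k j / m k k)" for j s :: nat
  define v where "v i s = (if s = 0 then g i 0 / g 0 0 else m i k)" for i s :: nat
  have m0: "m 0 j = 0" "m i 0 = 0" for i j using g by (simp_all add: m_def)
  have rk: "m i j * m k k = m i k * m k j" if "i < 3" "j < 3" for i j
  proof -
    have "i = 0 \<or> i = 1 \<or> i = 2" "j = 0 \<or> j = 1 \<or> j = 2" using that by linarith+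
    then show ?thesis using k(1) det m0 by (auto simp: mult.commute)
  qed
  have two: "(\<Sum>s<2. f s) = f 0 + f 1" for f :: "nat \<Rightarrow> complex" by (simp add: numeral_2_eq_2)
  have "(\<Sum>s<2. v i s * u j s) = g i j" if "i < 3" "j < 3" for i j
  proof -
    have "(\<Sum>s<2. v i s * u j s) = g i 0 * g 0 j / g 0 0 + m i k * m k j / m k k"
      by (simp add: two u_def v_def)
    also have "m i k * m k j / m k k = m i j" using rk[OF that] k(2) by (simp add: field_simps)
    finally show ?thesis by (simp add: m_def)
  qed
  moreover have u: "spanned {..<3} 2 u (\<lambda>r. if r = s then 1 else 0)" if "s < 2" for s
  proof -
    have e0: "spanned {..<3} 2 u (\<lambda>r. if r = 0 then 1 else 0)"
      by (rule spanned_cong[OF spanned_scale[OF spanned_member[of "{..<3}" 0], of _ _ "1 / g 0 0"]])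
         (use g m0 in \<open>auto simp: u_def\<close>)
    have "spanned {..<3} 2 u (\<lambda>r. u k r + (- g 0 k) * (if r = 0 then 1 else 0))"
      by (intro spanned_add spanned_scale e0 spanned_member) (use k in auto)
    then have e1: "spanned {..<3} 2 u (\<lambda>r. if r = 1 then 1 else 0)"
      by (rule spanned_cong) (use k in \<open>auto simp: u_def less_2_cases_iff\<close>)
    show ?thesis using that e0 e1 by (auto simp: less_2_cases_iff)
  qed
  moreover have v: "spanned {..<3} 2 v (\<lambda>r. if r = s then 1 else 0)" if "s < 2" for s
  proof -
    have e0: "spanned {..<3} 2 v (\<lambda>r. if r = 0 then 1 else 0)"
      by (rule spanned_cong[OF spanned_member[of "{..<3}" 0]])
         (use g m0 in \<open>auto simp: v_def\<close>)
    have "spanned {..<3} 2 v (\<lambda>r. (1 / m k k) * (v k r + (- g k 0 / g 0 0) * (if r = 0 then 1 else 0)))"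
      by (intro spanned_add spanned_scale e0 spanned_member) (use k in auto)
    then have e1: "spanned {..<3} 2 v (\<lambda>r. if r = 1 then 1 else 0)"
      by (rule spanned_cong) (use k in \<open>auto simp: v_def less_2_cases_iff\<close>)
    show ?thesis using that e0 e1 by (auto simp: less_2_cases_iff)
  qed
  ultimately show ?thesis by blast
qed

section \<open>Two-sided expansions of rational functions\<close>

definition geom :: "complex \<Rightarrow> complex fps" where
  "geom a = Abs_fps (\<lambda>n. a ^ n)"

lemma fps_nth_one_minus_mult:
  "fps_nth ((1 - fps_const c * fps_X) * G) n = fps_nth G n - (if n = 0 then 0 else c * fps_nth G (n - 1))"
  for G :: "complex fps"
proof -
  have "(1 - fps_const c * fps_X) * G = G - fps_const c * (fps_X * G)" by (simp add: algebra_simps)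
  then show ?thesis by simp
qed

lemma geom_inverse: "(1 - fps_const a * fps_X) * geom a = 1"
proof (rule fps_ext)
  fix n show "fps_nth ((1 - fps_const a * fps_X) * geom a) n = fps_nth 1 n"
    unfolding fps_nth_one_minus_mult by (cases n) (simp_all add: geom_def)
qed

lemma fps_deriv_geom: "fps_deriv (geom a) = fps_const a * geom a * geom a"
proof (rule fps_ext)
  fix n
  have "fps_nth (geom a * geom a) n = (\<Sum>i=0..n. a ^ i * a ^ (n - i))"
    by (simp add: fps_mult_nth geom_def)
  also have "\<dots> = (\<Sum>i=0..n. a ^ n)" by (intro sum.cong refl) (simp flip: power_add)
  finally show "fps_nth (fps_deriv (geom a)) n = fps_nth (fps_const a * geom a * geom a) n"
    by (simp only: mult.assoc fps_mult_left_const_nth) (simp add: geom_def algebra_simps)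
qed

definition ratio :: "'s set \<Rightarrow> ('s \<Rightarrow> complex) \<Rightarrow> ('s \<Rightarrow> complex) \<Rightarrow> complex fps" where
  "ratio S a b = (\<Prod>s\<in>S. (1 - fps_const (b s) * fps_X) * geom (a s))"

lemma ratio_0: "fps_nth (ratio S a b) 0 = 1"
  unfolding ratio_def by (induction S rule: infinite_finite_induct) (simp_all add: geom_def)

text \<open>The logarithmic derivative of one factor is a difference of two geometric series, with
  differences of powers of \<open>a s\<close> and \<open>b s\<close> as coefficients. Hence
  \<open>ratio\<close> is the scalar exponential that \<open>expc_contraction\<close> asks
  for.\<close>

lemma ratio_recurrence:
  assumes "finite S"
    and "\<And>n. n > 0 \<Longrightarrow> of_nat n * \<zeta> n = (\<Sum>s\<in>S. a s ^ n - b s ^ n)"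
  shows "of_nat k * fps_nth (ratio S a b) k = (\<Sum>n=1..k. of_nat n * \<zeta> n * fps_nth (ratio S a b) (k - n))"
proof -
  have one: "fps_deriv ((1 - fps_const b * fps_X) * geom a) =
      (fps_const a * geom a - fps_const b * geom b) * ((1 - fps_const b * fps_X) * geom a)" for a b
  proof -
    have "(fps_const a * geom a - fps_const b * geom b) * ((1 - fps_const b * fps_X) * geom a) =
       fps_const a * geom a * geom a * (1 - fps_const b * fps_X)
        - fps_const b * ((1 - fps_const b * fps_X) * geom b) * geom a" by (simp add: algebra_simps)
    then show ?thesis by (simp only: geom_inverse) (simp add: fps_deriv_geom algebra_simps)
  qed
  let ?G = "\<Sum>s\<in>S. fps_const (a s) * geom (a s) - fps_const (b s) * geom (b s)"
  have d: "fps_deriv (ratio S a b) = ?G * ratio S a b"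
    using assms(1) unfolding ratio_def
  proof (induction S rule: finite_induct)
    case (insert x F)
    then show ?case
      by (simp only: prod.insert[OF insert(1,2)] sum.insert[OF insert(1,2)], subst fps_deriv_mult,
          simp only: one) (simp only: insert.IH algebra_simps)
  qed simp
  have G: "fps_nth ?G n = of_nat (Suc n) * \<zeta> (Suc n)" for n
    by (simp add: assms(2) fps_sum_nth geom_def del: of_nat_Suc)
  show ?thesis
  proof (cases k)
    case (Suc k')
    have "of_nat k * fps_nth (ratio S a b) k = fps_nth (?G * ratio S a b) k'"
      by (simp only: d[symmetric] fps_deriv_nth Suc Suc_eq_plus1)
    also have "\<dots> = (\<Sum>i=0..k'. of_nat (Suc i) * \<zeta> (Suc i) * fps_nth (ratio S a b) (k' - i))"
      by (simp only: fps_mult_nth G)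
    also have "\<dots> = (\<Sum>n=1..k. of_nat n * \<zeta> n * fps_nth (ratio S a b) (k - n))"
      unfolding Suc by (rule sum.reindex_bij_witness[of _ "\<lambda>i. i - 1" Suc]) auto
    finally show ?thesis .
  qed simp
qed

text \<open>Both series expand the same rational function of \<open>x\<close>, at zero and at
  infinity: \<open>(1 / \<tau>) (1 - \<tau>\<^sup>2 a x) / (1 - a x)\<close> equals
  \<open>\<tau> (1 - 1 / (\<tau>\<^sup>2 a x)) / (1 - 1 / (a x))\<close>. Their difference is a sum
  of delta functions at the simple poles. In the induction a new pole amounts to a first order
  recurrence for the coefficients \<open>H\<close>.\<close>

lemma two_sided_residues:
  fixes a :: "'s \<Rightarrow> complex" and \<tau> :: complex
  assumes "finite S" "\<And>s. s \<in> S \<Longrightarrow> a s \<noteq> 0" "inj_on a S" "\<tau> \<noteq> 0"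
  shows "\<exists>r. \<forall>j::int. (1 / \<tau>) ^ card S * (if j < 0 then 0 else fps_nth (ratio S a (\<lambda>s. \<tau>\<^sup>2 * a s)) (nat j))
     - \<tau> ^ card S * (if j > 0 then 0 else fps_nth (ratio S (\<lambda>s. 1 / a s) (\<lambda>s. 1 / (\<tau>\<^sup>2 * a s))) (nat (- j)))
     = (\<Sum>s\<in>S. r s * a s powi j)"
  using assms(1-3)
proof (induction S rule: finite_induct)
  case empty
  have "(if j < 0 then 0 else fps_nth (ratio {} a b) (nat j)) = (if j > 0 then 0 else fps_nth (ratio {} a' b') (nat (- j)))"
    for j and a b a' b' :: "'s \<Rightarrow> complex"
    by (auto simp: ratio_def)
  then show ?case by simp
next
  case (insert x S)
  let ?A = "a x"
  have A: "?A \<noteq> 0" and ne: "\<And>s. s \<in> S \<Longrightarrow> a s \<noteq> 0" "\<And>s. s \<in> S \<Longrightarrow> a s \<noteq> ?A" and \<tau>: "\<tau> \<noteq> 0"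
    using insert assms(4) by (auto simp: inj_on_def)
  define f g where "f S j = (if j < 0 then 0 else fps_nth (ratio S a (\<lambda>s. \<tau>\<^sup>2 * a s)) (nat j))"
    and "g S j = (if j > 0 then 0 else fps_nth (ratio S (\<lambda>s. 1 / a s) (\<lambda>s. 1 / (\<tau>\<^sup>2 * a s))) (nat (- j)))"
    for S and j :: int
  define H where "H S j = (1 / \<tau>) ^ card S * f S j - \<tau> ^ card S * g S j" for S j
  obtain r where r: "\<And>j. H S j = (\<Sum>s\<in>S. r s * a s powi j)"
    using insert unfolding H_def f_def g_def by (auto simp: inj_on_def)
  have rec: "fps_nth (ratio (insert x S) a' b') n - (if n = 0 then 0 else a' x * fps_nth (ratio (insert x S) a' b') (n - 1))
     = fps_nth (ratio S a' b') n - (if n = 0 then 0 else b' x * fps_nth (ratio S a' b') (n - 1))" for a' b' n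
  proof -
    have "(1 - fps_const (a' x) * fps_X) * ratio (insert x S) a' b' =
        (1 - fps_const (a' x) * fps_X) * geom (a' x) * ((1 - fps_const (b' x) * fps_X) * ratio S a' b')"
      using insert by (simp add: ratio_def mult_ac)
    also have "\<dots> = (1 - fps_const (b' x) * fps_X) * ratio S a' b'" by (simp only: geom_inverse mult_1)
    finally have "fps_nth ((1 - fps_const (a' x) * fps_X) * ratio (insert x S) a' b') n =
        fps_nth ((1 - fps_const (b' x) * fps_X) * ratio S a' b') n" by simp
    then show ?thesis by (simp only: fps_nth_one_minus_mult)
  qed
  have f: "f (insert x S) j - ?A * f (insert x S) (j - 1) = f S j - \<tau>\<^sup>2 * ?A * f S (j - 1)" for j
    using rec[of a "\<lambda>s. \<tau>\<^sup>2 * a s" "nat j"] by (auto simp: f_def nat_diff_distrib)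
  have g0: "g (insert x S) (j - 1) - 1 / ?A * g (insert x S) j = g S (j - 1) - 1 / (\<tau>\<^sup>2 * ?A) * g S j" for j
  proof -
    have "nat (- (j - 1)) - 1 = nat (- j)" if "j \<le> 0" using that by simp
    then show ?thesis
      using rec[of "\<lambda>s. 1 / a s" "\<lambda>s. 1 / (\<tau>\<^sup>2 * a s)" "nat (- (j - 1))"]
      by (cases "j = 1"; cases "j \<le> 0") (auto simp: g_def)
  qed
  have g: "g (insert x S) j - ?A * g (insert x S) (j - 1) = (1 / \<tau>\<^sup>2) * (g S j - \<tau>\<^sup>2 * ?A * g S (j - 1))" for j
  proof -
    have "g (insert x S) j - ?A * g (insert x S) (j - 1) = - ?A * (g (insert x S) (j - 1) - 1 / ?A * g (insert x S) j)"
      using A by (simp add: field_simps)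
    also have "\<dots> = (1 / \<tau>\<^sup>2) * (g S j - \<tau>\<^sup>2 * ?A * g S (j - 1))"
      unfolding g0 using A \<tau> by (simp add: field_simps)
    finally show ?thesis .
  qed
  have H: "H (insert x S) j - ?A * H (insert x S) (j - 1) = 1 / \<tau> * (H S j - \<tau>\<^sup>2 * ?A * H S (j - 1))" for j
  proof -
    have c: "card (insert x S) = Suc (card S)" using insert by simp
    have "H (insert x S) j - ?A * H (insert x S) (j - 1) =
       (1 / \<tau>) ^ Suc (card S) * (f (insert x S) j - ?A * f (insert x S) (j - 1))
       - \<tau> ^ Suc (card S) * (g (insert x S) j - ?A * g (insert x S) (j - 1))"
      unfolding H_def c by (simp add: algebra_simps)
    also have "\<dots> = 1 / \<tau> * (H S j - \<tau>\<^sup>2 * ?A * H S (j - 1))"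
      unfolding f g H_def using \<tau> by (simp add: field_simps power2_eq_square)
    finally show ?thesis .
  qed
  \<comment> \<open>The residue at an old pole is multiplied by the value there of the new factor,
    whose denominator is nonzero because the poles are distinct.\<close>
  define r' where "r' s = 1 / \<tau> * r s * (1 - \<tau>\<^sup>2 * ?A / a s) / (1 - ?A / a s)" for s
  define D where "D j = H (insert x S) j - (\<Sum>s\<in>S. r' s * a s powi j)" for j
  have step: "D j = ?A * D (j - 1)" for j
  proof -
    have "H S j - \<tau>\<^sup>2 * ?A * H S (j - 1) = (\<Sum>s\<in>S. r s * (1 - \<tau>\<^sup>2 * ?A / a s) * a s powi j)"
      unfolding r sum_distrib_left sum_subtractf[symmetric]
      by (intro sum.cong refl) (use ne in \<open>simp add: power_int_diff field_simps\<close>)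
    then have "1 / \<tau> * (H S j - \<tau>\<^sup>2 * ?A * H S (j - 1)) =
        (\<Sum>s\<in>S. 1 / \<tau> * (r s * (1 - \<tau>\<^sup>2 * ?A / a s) * a s powi j))"
      by (simp only: sum_distrib_left)
    also have "\<dots> = (\<Sum>s\<in>S. r' s * a s powi j - ?A * (r' s * a s powi (j - 1)))"
    proof (intro sum.cong refl)
      fix s assume s: "s \<in> S"
      have nz: "1 - ?A / a s \<noteq> 0" using ne[OF s] by (simp add: field_simps)
      have "r' s * a s powi j - ?A * (r' s * a s powi (j - 1)) = r' s * (1 - ?A / a s) * a s powi j"
        using ne[OF s] by (simp add: power_int_diff field_simps)
      also have "r' s * (1 - ?A / a s) = 1 / \<tau> * (r s * (1 - \<tau>\<^sup>2 * ?A / a s))"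
        using nz by (simp add: r'_def)
      finally show "1 / \<tau> * (r s * (1 - \<tau>\<^sup>2 * ?A / a s) * a s powi j) =
          r' s * a s powi j - ?A * (r' s * a s powi (j - 1))" by (simp only: mult.assoc)
    qed
    finally have "H (insert x S) j - ?A * H (insert x S) (j - 1) =
        (\<Sum>s\<in>S. r' s * a s powi j) - (\<Sum>s\<in>S. ?A * (r' s * a s powi (j - 1)))"
      unfolding H[of j] by (simp only: sum_subtractf)
    then show ?thesis by (simp add: D_def sum_distrib_left algebra_simps)
  qed
  \<comment> \<open>Once the old poles are subtracted, the homogeneous recurrence remains. Its
    solutions are geometric progressions in both directions, and the value at 0 is the new
    residue.\<close>
  have D: "D j = D 0 * ?A powi j" for j
  proof (induction j rule: int_induct[where k = 0])
    case (step1 i)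
    then show ?case using step[of "i + 1"] A by (simp add: power_int_add)
  next
    case (step2 i)
    then have "?A * D (i - 1) = D 0 * ?A powi i" using step[of i] by simp
    then show ?case using A by (simp add: power_int_diff field_simps)
  qed simp
  have "H (insert x S) j = (\<Sum>s\<in>insert x S. (if s = x then D 0 else r' s) * a s powi j)" for j
  proof -
    have "(\<Sum>s\<in>S. (if s = x then D 0 else r' s) * a s powi j) = (\<Sum>s\<in>S. r' s * a s powi j)"
      using insert by (intro sum.cong refl) auto
    then show ?thesis using D[of j] insert by (simp add: D_def algebra_simps)
  qed
  then show ?case unfolding H_def f_def g_def by (intro exI[of _ "\<lambda>s. if s = x then D 0 else r' s"]) simp
qed

lemma delta_expansion:
  fixes a :: "'s \<Rightarrow> complex" and \<tau> :: complex and \<zeta> \<zeta>' :: "nat \<Rightarrow> complex"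
  assumes S: "finite S" "\<And>s. s \<in> S \<Longrightarrow> a s \<noteq> 0" "inj_on a S" "\<tau> \<noteq> 0"
    and \<zeta>: "\<And>n. n > 0 \<Longrightarrow> of_nat n * \<zeta> n = (\<Sum>s\<in>S. a s ^ n - (\<tau>\<^sup>2 * a s) ^ n)"
    and \<zeta>': "\<And>n. n > 0 \<Longrightarrow> of_nat n * \<zeta>' n = (\<Sum>s\<in>S. (1 / a s) ^ n - (1 / (\<tau>\<^sup>2 * a s)) ^ n)"
  obtains F F' r where "F 0 = 1" "\<And>k. of_nat k * F k = (\<Sum>n=1..k. of_nat n * \<zeta> n * F (k - n))"
    "F' 0 = 1" "\<And>k. of_nat k * F' k = (\<Sum>n=1..k. of_nat n * \<zeta>' n * F' (k - n))"
    "\<And>j. (1 / \<tau>) ^ card S * (if j < 0 then 0 else F (nat j))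
       - \<tau> ^ card S * (if j > 0 then 0 else F' (nat (- j))) = (\<Sum>s\<in>S. r s * a s powi j)"
proof -
  obtain r where r: "\<forall>j::int. (1 / \<tau>) ^ card S * (if j < 0 then 0 else fps_nth (ratio S a (\<lambda>s. \<tau>\<^sup>2 * a s)) (nat j))
     - \<tau> ^ card S * (if j > 0 then 0 else fps_nth (ratio S (\<lambda>s. 1 / a s) (\<lambda>s. 1 / (\<tau>\<^sup>2 * a s))) (nat (- j)))
     = (\<Sum>s\<in>S. r s * a s powi j)"
    using two_sided_residues[OF S] by blast
  show ?thesis
    by (rule that[OF ratio_0 ratio_recurrence[OF S(1) \<zeta>] ratio_0 ratio_recurrence[OF S(1) \<zeta>'] r[rule_format]])
qed

section \<open>The Gram matrix of the subregular quiver\<close>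

lemma genericD:
  assumes "generic_parameters q1 q2 q3"
  shows "q1 \<noteq> 0" "q2 \<noteq> 0" "q3 \<noteq> 0" "q1 * q2 * q3 = 1"
    and "n > 0 \<Longrightarrow> q1 ^ n \<noteq> 1" "n > 0 \<Longrightarrow> q2 ^ n \<noteq> 1" "n > 0 \<Longrightarrow> q3 ^ n \<noteq> 1"
    and "q3 powi i = q3 powi j \<longleftrightarrow> i = j" "q3 powi i \<noteq> q2 * q3 powi j"
proof -
  have p: "q1 * q2 * q3 = 1"
    and g: "\<And>a b c :: int. q1 powi a * q2 powi b * q3 powi c = 1 \<Longrightarrow> a = b \<and> b = c"
    using assms by (simp_all add: generic_parameters_def)
  show "q1 * q2 * q3 = 1" by (rule p)
  show nz: "q1 \<noteq> 0" "q2 \<noteq> 0" "q3 \<noteq> 0" using p by auto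
  show "n > 0 \<Longrightarrow> q1 ^ n \<noteq> 1" using g[of "int n" 0 0] by auto
  show "n > 0 \<Longrightarrow> q2 ^ n \<noteq> 1" using g[of 0 "int n" 0] by auto
  show "n > 0 \<Longrightarrow> q3 ^ n \<noteq> 1" using g[of 0 0 "int n"] by auto
  show "q3 powi i = q3 powi j \<longleftrightarrow> i = j"
    using g[of 0 0 "i - j"] nz by (auto simp: power_int_diff)
  show "q3 powi i \<noteq> q2 * q3 powi j"
    using g[of 0 1 "j - i"] nz by (auto simp: power_int_diff)
qed

lemma concat_map_single:
  "concat (map (\<lambda>x. if x = c \<and> P then [f x] else []) [a..<b]) = (if a \<le> c \<and> c < b \<and> P then [f c] else [])"
  by (induction b) (auto simp: le_Suc_eq)

lemma concat_map_const:
  "concat (map (\<lambda>x. if P then [f x] else []) xs) = (if P then map f xs else [])"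
  by (induction xs) auto

lemma labels_Qsub:
  "labels (Qsub N q1 q3) i j =
    (if 1 \<le> i \<and> i < N \<and> j = i + 1 then [1] else [])
    @ (if 1 \<le> j \<and> j < N \<and> i = j + 1 then [q3] else [])
    @ (if 2 \<le> i \<and> i < N + 1 \<and> j = i then [q1] else [])
    @ (if i = 1 \<and> j = 0 then [q1] else []) @ (if i = N + 1 \<and> j = 1 then [1] else [])
    @ (if i = 0 \<and> j = N + 1 then map (\<lambda>k. q3 powi (2 - int k)) [1..<N] else [])"
proof -
  have "concat (map (\<lambda>x. if x = i \<and> x + 1 = j then [1::complex] else []) [1..<N]) = (if 1 \<le> i \<and> i < N \<and> j = i + 1 then [1] else [])"
    using concat_map_single[of i "j = i + 1" "\<lambda>_. 1" 1 N] by (auto cong: conj_cong)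
  moreover have "concat (map (\<lambda>x. if x + 1 = i \<and> x = j then [q3] else []) [1..<N]) = (if 1 \<le> j \<and> j < N \<and> i = j + 1 then [q3] else [])"
    using concat_map_single[of j "i = j + 1" "\<lambda>_. q3" 1 N] by (auto cong: conj_cong simp: conj_commute eq_commute)
  moreover have "concat (map (\<lambda>x. if x = i \<and> x = j then [q1] else []) [2..<N + 1]) = (if 2 \<le> i \<and> i < N + 1 \<and> j = i then [q1] else [])"
    using concat_map_single[of i "j = i" "\<lambda>_. q1" 2 "N + 1"] by (auto cong: conj_cong simp: eq_commute)
  moreover have "concat (map (\<lambda>x. if 0 = i \<and> N + 1 = j then [q3 powi (2 - int x)] else []) [1..<N])
      = (if i = 0 \<and> j = N + 1 then map (\<lambda>k. q3 powi (2 - int k)) [1..<N] else [])"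
    by (subst concat_map_const) auto
  ultimately show ?thesis
    by (auto simp: labels_def Qsub_def comp_def simp del: upt_Suc)
qed

lemma vtype_Qsub:
  "vtype (Qsub N q1 q3) i = (if i = 0 then Frozen_minus else if i = N + 1 then Frozen_plus else Unfrozen)"
  by (simp add: Qsub_def)

lemma eps_Qsub:
  assumes "N \<ge> 2"
  shows "eps (Qsub N q1 q3) i j =
    (if i = 1 \<and> j = 0 then 1 else if i = 0 \<and> j = 1 then -1
     else if i = N + 1 \<and> j = 1 then 1 else if i = 1 \<and> j = N + 1 then -1
     else if i = 0 \<and> j = N + 1 then int N - 1 else if i = N + 1 \<and> j = 0 then 1 - int N else 0)"
  using assms by (auto simp: eps_def labels_Qsub)

lemma cmat_Qsub:
  assumes N: "N \<ge> 2"
  shows "cmat (Qsub N q1 q3) q n 0 0 = q ^ n"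
    "cmat (Qsub N q1 q3) q n (N + 1) (N + 1) = - (1 / q ^ n)"
    "cmat (Qsub N q1 q3) q n 1 1 = q ^ n - 1 / q ^ n"
    "cmat (Qsub N q1 q3) q n 0 1 = - (q ^ n * q1 ^ n)"
    "cmat (Qsub N q1 q3) q n 1 0 = 1 / (q ^ n * q1 ^ n)"
    "cmat (Qsub N q1 q3) q n (N + 1) 1 = 1 / q ^ n"
    "cmat (Qsub N q1 q3) q n 1 (N + 1) = - (q ^ n)"
    "cmat (Qsub N q1 q3) q n 0 (N + 1) = (\<Sum>k\<in>{1..<N}. 1 / (q ^ n * (q3 powi (2 - int k)) ^ n))"
    "cmat (Qsub N q1 q3) q n (N + 1) 0 = - (\<Sum>k\<in>{1..<N}. q ^ n * (q3 powi (2 - int k)) ^ n)"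
    "2 \<le> i \<Longrightarrow> i \<le> N \<Longrightarrow> cmat (Qsub N q1 q3) q n i i = q ^ n - 1 / q ^ n - (q ^ n * q1 ^ n - 1 / (q ^ n * q1 ^ n))"
    "1 \<le> i \<Longrightarrow> i < N \<Longrightarrow> cmat (Qsub N q1 q3) q n i (Suc i) = 1 / q ^ n - q ^ n * q3 ^ n"
    "1 \<le> i \<Longrightarrow> i < N \<Longrightarrow> cmat (Qsub N q1 q3) q n (Suc i) i = 1 / (q ^ n * q3 ^ n) - q ^ n"
    "2 \<le> i \<Longrightarrow> i \<le> N \<Longrightarrow> cmat (Qsub N q1 q3) q n 0 i = 0"
    "2 \<le> i \<Longrightarrow> i \<le> N \<Longrightarrow> cmat (Qsub N q1 q3) q n i 0 = 0"
    "2 \<le> i \<Longrightarrow> i \<le> N \<Longrightarrow> cmat (Qsub N q1 q3) q n (N + 1) i = 0"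
    "2 \<le> i \<Longrightarrow> i \<le> N \<Longrightarrow> cmat (Qsub N q1 q3) q n i (N + 1) = 0"
    "1 \<le> i \<Longrightarrow> i \<le> N \<Longrightarrow> 1 \<le> j \<Longrightarrow> j \<le> N \<Longrightarrow> i \<noteq> j \<Longrightarrow> j \<noteq> Suc i \<Longrightarrow> i \<noteq> Suc j \<Longrightarrow> cmat (Qsub N q1 q3) q n i j = 0"
  using N by (simp_all add: cmat_def labels_Qsub vtype_Qsub comp_def interv_sum_list_conv_sum_set_nat
      sum_negf del: upt_Suc) auto

text \<open>The sums over the \<open>N - 1\<close> arrows from 0 to \<open>N + 1\<close>, which give
  the two entries of \<open>C\<close> between these vertices.\<close>

lemma geometric_sums:
  fixes y :: complex
  assumes "y \<noteq> 0" "y \<noteq> 1" "N \<ge> 1"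
  shows "(\<Sum>k\<in>{1..<N}. y powi (int k - 2)) = (y - y ^ N) / (y\<^sup>2 * (1 - y))"
    and "(\<Sum>k\<in>{1..<N}. y powi (2 - int k)) = y\<^sup>2 * (y ^ N - y) / (y ^ N * (y - 1))"
proof -
  have "(\<Sum>k\<in>{1..<N}. y powi (int k - 2)) * (y\<^sup>2 * (1 - y)) = y - y ^ N"
    using assms(3)
  proof (induction N rule: dec_induct)
    case (step n)
    have "y powi (int n - 2) * y\<^sup>2 = y ^ n" using assms by (simp add: power_int_diff)
    then have "y powi (int n - 2) * (y\<^sup>2 * (1 - y)) = y ^ n * (1 - y)" by (simp only: mult.assoc[symmetric])
    moreover have "(\<Sum>k\<in>{1..<Suc n}. y powi (int k - 2)) * (y\<^sup>2 * (1 - y)) =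
        (\<Sum>k\<in>{1..<n}. y powi (int k - 2)) * (y\<^sup>2 * (1 - y)) + y powi (int n - 2) * (y\<^sup>2 * (1 - y))"
      using step by (simp add: distrib_right)
    ultimately have "(\<Sum>k\<in>{1..<Suc n}. y powi (int k - 2)) * (y\<^sup>2 * (1 - y)) = y - y ^ n + y ^ n * (1 - y)"
      by (simp only: step.IH)
    then show ?case by (simp add: algebra_simps)
  qed simp
  then show "(\<Sum>k\<in>{1..<N}. y powi (int k - 2)) = (y - y ^ N) / (y\<^sup>2 * (1 - y))"
    using assms by (simp add: eq_divide_eq)
  have "(\<Sum>k\<in>{1..<N}. y powi (2 - int k)) * (y ^ N * (y - 1)) = y\<^sup>2 * (y ^ N - y)"
    using assms(3)
  proof (induction N rule: dec_induct)
    case (step n)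
    have p: "y powi (2 - int n) * y ^ n = y\<^sup>2" using assms by (simp add: power_int_diff)
    have "(\<Sum>k\<in>{1..<Suc n}. y powi (2 - int k)) * (y ^ Suc n * (y - 1)) =
        y * ((\<Sum>k\<in>{1..<n}. y powi (2 - int k)) * (y ^ n * (y - 1))) + (y powi (2 - int n) * y ^ n) * y * (y - 1)"
      using step by (simp add: algebra_simps)
    also have "\<dots> = y\<^sup>2 * (y ^ Suc n - y)"
      unfolding step.IH p by (simp add: algebra_simps power2_eq_square)
    finally show ?case .
  qed simp
  then show "(\<Sum>k\<in>{1..<N}. y powi (2 - int k)) = y\<^sup>2 * (y ^ N - y) / (y ^ N * (y - 1))"
    using assms by (simp add: eq_divide_eq)
qed

lemma theta_eq:
  fixes q3 :: complex
  assumes "q3 \<noteq> 0" "N \<ge> 1"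
  shows "theta N q3 k i j = (let y = q3 ^ k; Y = y ^ N in
    if i < j then (1 - y) / (Y - 1) else if i = j then (Y - y) / (Y - 1) else Y * (1 - y) / (Y - 1))"
proof (cases "(q3 ^ k) ^ N = 1")
  case False
  have Y: "q3 powi (- int (k * N)) = 1 / (q3 ^ k) ^ N"
    by (simp only: power_int_minus power_int_of_nat power_mult inverse_eq_divide)
  have "q3 powi (- int k * (int N - 1)) = q3 ^ k / (q3 ^ k) ^ N"
  proof -
    have "- int k * (int N - 1) = int k - int (k * N)" by (simp add: algebra_simps)
    then have "q3 powi (- int k * (int N - 1)) = q3 powi int k / q3 powi int (k * N)"
      using power_int_diff[of q3 "int k" "int (k * N)"] assms(1) by (simp only: simp_thms)
    then show ?thesis by (simp only: power_int_of_nat power_mult)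
  qed
  moreover have "(1 - y) / (1 - 1 / Z) * (1 / Z) = (1 - y) / (Z - 1)"
    "(1 - y / Z) / (1 - 1 / Z) = (Z - y) / (Z - 1)" "(1 - y) / (1 - 1 / Z) = Z * (1 - y) / (Z - 1)"
    if "Z \<noteq> 0" "Z \<noteq> 1" for y Z :: complex
    using that by (simp_all add: divide_simps)
  ultimately show ?thesis using False assms(1)
    by (simp only: theta_def Y Let_def power_not_zero simp_thms)
next
  \<comment> \<open>Here all denominators are 0, and both sides are 0 by the convention for
    division.\<close>
  case True
  have "q3 powi (- int (k * N)) = 1"
    by (simp only: power_int_minus power_int_of_nat power_mult True inverse_1)
  then show ?thesis using True by (simp add: theta_def Let_def)
qed

text \<open>The images of the oscillators \<open>x\<^bsub>i\<^esub>\<close> in the tensor product: \<open>x\<^sub>1 + \<dots> + x\<^bsub>j\<^esub>\<close> becomes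
  \<open>\<lambda>\<^bsub>N+1-j\<^esub>\<close> plus an oscillator of the rank two Heisenberg algebra, which does not depend on \<open>j\<close>.\<close>

definition left_part :: "nat \<Rightarrow> (nat \<Rightarrow> nat \<Rightarrow> complex) \<Rightarrow> nat \<Rightarrow> nat \<Rightarrow> complex" where
  "left_part N l i r = (if i = 1 then l N r else if 2 \<le> i \<and> i \<le> N then l (N + 1 - i) r - l (N + 2 - i) r else 0)"

definition right_part :: "nat \<Rightarrow> (nat \<Rightarrow> nat \<Rightarrow> complex) \<Rightarrow> nat \<Rightarrow> nat \<Rightarrow> complex" where
  "right_part N x i s = (if i = 0 then x 0 s else if i = 1 then x 1 s else if i = N + 1 then x 2 s else 0)"

definition both_parts :: "nat \<Rightarrow> (nat \<Rightarrow> nat \<Rightarrow> complex) \<Rightarrow> (nat \<Rightarrow> nat \<Rightarrow> complex) \<Rightarrow> nat \<Rightarrow> nat \<Rightarrow> complex" where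
  "both_parts N l x i r = (if r < N - 1 then left_part N l i r else right_part N x i (r - (N - 1)))"

lemma sum_split_last_two:
  fixes f :: "nat \<Rightarrow> 'a::comm_monoid_add"
  assumes "N \<ge> 1"
  shows "(\<Sum>r<N + 1. f r) = (\<Sum>r<N - 1. f r) + (\<Sum>s<2. f (N - 1 + s))"
proof -
  obtain K where "N = Suc K" using assms by (cases N) auto
  then show ?thesis by (simp add: numeral_2_eq_2 add_ac)
qed

lemma sum_left_part:
  assumes "1 \<le> k" "k \<le> N"
  shows "(\<Sum>j=1..k. left_part N l j r) = l (N + 1 - k) r"
  using assms
proof (induction k rule: dec_induct)
  case (step k)
  then have "N + 1 - Suc k = N - k" "N + 2 - Suc k = N + 1 - k" by auto
  with step show ?case by (simp add: left_part_def)
qed (simp add: left_part_def)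

lemma sum_right_part:
  assumes "1 \<le> k" "k \<le> N"
  shows "(\<Sum>j=1..k. right_part N x j r) = x 1 r"
  using assms by (induction k rule: dec_induct) (auto simp: right_part_def)

text \<open>The relation between the lambdas separates the two parts: adding the partial sums
  \<open>x_1 + ... + x_j\<close> with the weights \<open>w\<close> annihilates the lambdas and
  leaves a nonzero multiple of the common right part. Subtracting that part isolates each
  lambda.\<close>

lemma both_parts_spanned:
  fixes l x :: "nat \<Rightarrow> nat \<Rightarrow> complex"
  assumes N: "N \<ge> 2"
    and l: "\<And>s. s < N - 1 \<Longrightarrow> spanned {1..N} (N - 1) l (\<lambda>r. if r = s then 1 else 0)"
    and x: "\<And>s. s < 2 \<Longrightarrow> spanned {..<3} 2 x (\<lambda>r. if r = s then 1 else 0)"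
    and w: "\<And>r. r < N - 1 \<Longrightarrow> (\<Sum>i=1..N. w i * l i r) = 0" "(\<Sum>i=1..N. w i) \<noteq> 0"
    and s: "s < N + 1"
  shows "spanned {0..N + 1} (N + 1) (both_parts N l x) (\<lambda>r. if r = s then 1 else 0)"
proof -
  let ?sp = "spanned {0..N + 1} (N + 1) (both_parts N l x)"
  let ?L = "\<lambda>f r. if r < N - 1 then f r else (0::complex)"
  let ?R = "\<lambda>f r. if r < N - 1 then 0 else (f (r - (N - 1)) :: complex)"
  have y: "?sp (\<lambda>r. ?L (l i) r + ?R (x 1) r)" if i: "i \<in> {1..N}" for i
  proof -
    have "?sp (\<lambda>r. \<Sum>j=1..N + 1 - i. both_parts N l x j r)"
      using i by (intro spanned_sum spanned_member) auto
    then show ?thesis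
    proof (rule spanned_cong)
      fix r
      have k: "1 \<le> N + 1 - i" "N + 1 - i \<le> N" "N + 1 - (N + 1 - i) = i" using i by auto
      show "?L (l i) r + ?R (x 1) r = (\<Sum>j=1..N + 1 - i. both_parts N l x j r)"
        using sum_left_part[OF k(1,2)] sum_right_part[OF k(1,2)] k(3) by (simp add: both_parts_def)
    qed
  qed
  have R1: "?sp (?R (x 1))"
  proof -
    have "?sp (\<lambda>r. 1 / (\<Sum>i=1..N. w i) * (\<Sum>i=1..N. w i * (?L (l i) r + ?R (x 1) r)))"
      by (intro spanned_scale spanned_sum y)
    then show ?thesis
    proof (rule spanned_cong)
      fix r
      have "(\<Sum>i=1..N. w i * (?L (l i) r + ?R (x 1) r)) = ?L (\<lambda>r. \<Sum>i=1..N. w i * l i r) r + (\<Sum>i=1..N. w i) * ?R (x 1) r"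
        by (simp add: sum_distrib_right)
      then show "?R (x 1) r = 1 / (\<Sum>i=1..N. w i) * (\<Sum>i=1..N. w i * (?L (l i) r + ?R (x 1) r))"
        using w by simp
    qed
  qed
  have R: "?sp (?R (x j))" if "j < 3" for j
  proof -
    consider "j = 0" | "j = 1" | "j = 2" using \<open>j < 3\<close> by linarith
    then show ?thesis
    proof cases
      case 1
      show ?thesis unfolding 1
        by (rule spanned_cong[OF spanned_member[of "{0..N + 1}" 0]])
           (auto simp: both_parts_def left_part_def right_part_def)
    next
      case 2
      show ?thesis unfolding 2 by (rule R1)
    next
      case 3
      show ?thesis unfolding 3
        by (rule spanned_cong[OF spanned_member[of "{0..N + 1}" "N + 1"]])
           (use N in \<open>auto simp: both_parts_def left_part_def right_part_def\<close>)
    qed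
  qed
  have L: "?sp (?L (l i))" if "i \<in> {1..N}" for i
    by (rule spanned_cong[OF spanned_add[OF y[OF that] spanned_scale[OF R1, of "-1"]]]) simp
  show ?thesis
  proof (cases "s < N - 1")
    case True
    obtain c where c: "\<forall>r<N - 1. (if r = s then 1 else 0) = (\<Sum>j\<in>{1..N}. c j * l j r)"
      using l[OF True] unfolding spanned_def by blast
    have "?sp (\<lambda>r. \<Sum>j\<in>{1..N}. c j * ?L (l j) r)" by (intro spanned_sum spanned_scale L)
    then show ?thesis
    proof (rule spanned_cong)
      fix r assume "r < N + 1"
      show "(if r = s then 1 else 0) = (\<Sum>j\<in>{1..N}. c j * ?L (l j) r)"
      proof (cases "r < N - 1")
        case r: True
        then have "(if r = s then 1 else 0) = (\<Sum>j\<in>{1..N}. c j * l j r)" using c by blast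
        with r show ?thesis by simp
      qed (use True in auto)
    qed
  next
    case False
    then have s2: "s - (N - 1) < 2" using s N by auto
    obtain c where c: "\<forall>r<2. (if r = s - (N - 1) then 1 else 0) = (\<Sum>j\<in>{..<3}. c j * x j r)"
      using x[OF s2] unfolding spanned_def by blast
    have "?sp (\<lambda>r. \<Sum>j\<in>{..<3}. c j * ?R (x j) r)" by (intro spanned_sum spanned_scale R) auto
    then show ?thesis
    proof (rule spanned_cong)
      fix r assume r: "r < N + 1"
      show "(if r = s then 1 else 0) = (\<Sum>j\<in>{..<3}. c j * ?R (x j) r)"
      proof (cases "r < N - 1")
        case True
        then show ?thesis using False by auto
      next
        case r': False
        then have "r - (N - 1) < 2" using r N by auto
        then have "(if r - (N - 1) = s - (N - 1) then 1 else 0) = (\<Sum>j\<in>{..<3}. c j * x j (r - (N - 1)))"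
          using c by blast
        moreover have "r - (N - 1) = s - (N - 1) \<longleftrightarrow> r = s" using r' False by auto
        ultimately show ?thesis using r' by simp
      qed
    qed
  qed
qed

text \<open>Consecutive differences of the \<open>vl\<close> pair with the \<open>ul\<close> in a
  bidiagonal matrix, which can be inverted explicitly. This is a factorization of the identity into
  square matrices of size \<open>N - 1\<close>, one made from \<open>vl\<close> and one from
  \<open>ul\<close>, so each family spans.\<close>

lemma lambda_spanned:
  fixes ul vl :: "nat \<Rightarrow> nat \<Rightarrow> complex"
  assumes step: "\<And>a b. 1 \<le> a \<Longrightarrow> a < N \<Longrightarrow> 1 \<le> b \<Longrightarrow> b \<le> N \<Longrightarrow>
      (\<Sum>r<N - 1. vl a r * ul b r) - (\<Sum>r<N - 1. vl (a + 1) r * ul b r)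
        = D * ((if a = b then y else 0) - (if b = a + 1 then 1 else 0))"
    and D: "D \<noteq> 0" "y \<noteq> 0" and s: "s < N - 1"
  shows "spanned {1..N} (N - 1) ul (\<lambda>r. if r = s then 1 else 0)"
    and "spanned {1..N} (N - 1) vl (\<lambda>r. if r = s then 1 else 0)"
proof -
  define A where "A a r = vl (a + 1) r - vl (a + 2) r" for a r
  \<comment> \<open>The inverse of the bidiagonal matrix with entries \<open>D * y\<close> and
    \<open>- D\<close>: a geometric progression in \<open>1 / y\<close>.\<close>
  define C where "C r b = (\<Sum>j=1..b + 1. 1 / (D * y ^ (b + 2 - j)) * ul j r)" for r b
  have AC: "(\<Sum>r<N - 1. A a r * C r b) = (if a = b then 1 else 0)" if "a < N - 1" "b < N - 1" for a b
  proof -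
    have "(\<Sum>r<N - 1. A a r * C r b) = (\<Sum>j=1..b + 1. 1 / (D * y ^ (b + 2 - j)) * (\<Sum>r<N - 1. A a r * ul j r))"
      unfolding C_def sum_distrib_left by (subst sum.swap) (simp add: mult_ac)
    also have "\<dots> = (\<Sum>j=1..b + 1. 1 / (D * y ^ (b + 2 - j)) * (D * ((if j = a + 1 then y else 0) - (if j = a + 2 then 1 else 0))))"
    proof (intro sum.cong refl)
      fix j assume j: "j \<in> {1..b + 1}"
      have "(\<Sum>r<N - 1. A a r * ul j r) = D * ((if j = a + 1 then y else 0) - (if j = a + 2 then 1 else 0))"
      proof -
        have "(\<Sum>r<N - 1. A a r * ul j r) = (\<Sum>r<N - 1. vl (a + 1) r * ul j r) - (\<Sum>r<N - 1. vl (a + 1 + 1) r * ul j r)"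
          by (simp add: A_def left_diff_distrib sum_subtractf)
        also have "\<dots> = D * ((if a + 1 = j then y else 0) - (if j = a + 1 + 1 then 1 else 0))"
          by (rule step) (use that j in auto)
        finally show ?thesis by auto
      qed
      then show "1 / (D * y ^ (b + 2 - j)) * (\<Sum>r<N - 1. A a r * ul j r) =
        1 / (D * y ^ (b + 2 - j)) * (D * ((if j = a + 1 then y else 0) - (if j = a + 2 then 1 else 0)))"
        by (simp only:)
    qed
    also have "\<dots> = (\<Sum>j=1..b + 1. (if j = a + 1 then y / y ^ (b + 2 - j) else 0) - (if j = a + 2 then 1 / y ^ (b + 2 - j) else 0))"
      using D by (intro sum.cong refl) auto
    also have "\<dots> = (if a \<le> b then y / y ^ (b + 1 - a) else 0) - (if a + 1 \<le> b then 1 / y ^ (b - a) else 0)"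
    proof -
      have delta: "(\<Sum>j=1..b + 1. if j = c then f j else 0) = (if c \<in> {1..b + 1} then f c else 0)"
        for c and f :: "nat \<Rightarrow> complex" by (rule sum.delta) simp
      have "a + 1 \<in> {1..b + 1} \<longleftrightarrow> a \<le> b" "a + 2 \<in> {1..b + 1} \<longleftrightarrow> a + 1 \<le> b"
        "b + 2 - (a + 1) = b + 1 - a" "b + 2 - (a + 2) = b - a" by auto
      then show ?thesis by (simp only: sum_subtractf delta)
    qed
    also have "\<dots> = (if a = b then 1 else 0)"
      using D by (cases a b rule: linorder_cases) (auto simp: Suc_diff_le)
    finally show ?thesis .
  qed
  have CA: "(\<Sum>a<N - 1. C r a * A a t) = (if r = t then 1 else 0)" if "r < N - 1" "t < N - 1" for r t
    by (rule square_inverse_commute[OF AC that])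
  have "spanned {1..N} (N - 1) ul (\<lambda>r. \<Sum>a<N - 1. A a s * (\<Sum>j=1..a + 1. 1 / (D * y ^ (a + 2 - j)) * ul j r))"
    by (intro spanned_sum spanned_scale spanned_member) auto
  then show "spanned {1..N} (N - 1) ul (\<lambda>r. if r = s then 1 else 0)"
    by (rule spanned_cong) (simp add: CA[OF _ s, symmetric] C_def mult.commute)
  have "spanned {1..N} (N - 1) vl (\<lambda>r. \<Sum>a<N - 1. C s a * (vl (a + 1) r + (-1) * vl (a + 2) r))"
    by (intro spanned_sum spanned_scale spanned_add spanned_member) auto
  then show "spanned {1..N} (N - 1) vl (\<lambda>r. if r = s then 1 else 0)"
  proof (rule spanned_cong)
    fix r assume "r < N - 1"
    then show "(if r = s then 1 else 0) = (\<Sum>a<N - 1. C s a * (vl (a + 1) r + (-1) * vl (a + 2) r))"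
      using CA[OF s, of r] by (auto simp: A_def)
  qed
qed

text \<open>The Schur complement of the Gram matrix of \<open>x\<^sub>0\<close>, the common part of the \<open>x\<^sub>1 + \<dots> + x\<^bsub>j\<^esub>\<close> and
  \<open>x\<^bsub>N+1\<^esub>\<close> has rank one; here \<open>y = q\<^sub>3\<^sup>n\<close> and \<open>Y = y\<^sup>N\<close>.\<close>

lemma schur_complement:
  fixes Q A y Y :: complex
  assumes "Q \<noteq> 0" "y \<noteq> 0" "Y \<noteq> 0" "y \<noteq> 1" "Y \<noteq> 1" and A: "A = 1 / (Q\<^sup>2 * y)"
    and S: "S = (y - Y) / (y\<^sup>2 * (1 - y))" and S': "S' = y\<^sup>2 * (Y - y) / (Y * (y - 1))"
    and E: "E = Q - 1 / Q - Q * (1 - A) * ((Y - y) / (Y - 1))"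
  defines "m11 \<equiv> E - 1 / (Q * A) * (- (Q * A)) / Q" and "m12 \<equiv> - Q - 1 / (Q * A) * (S / Q) / Q"
    and "m21 \<equiv> 1 / Q - (- (Q * S')) * (- (Q * A)) / Q" and "m22 \<equiv> - (1 / Q) - (- (Q * S')) * (S / Q) / Q"
  shows "m11 * m22 = m12 * m21" and "m22 = (Y - 1) * (Y - y\<^sup>2) / (Q * Y * (1 - y)\<^sup>2)"
    and "m11 = Q * (y - 1 + A * (Y - y)) / (Y - 1)"
proof -
  have A0: "A \<noteq> 0" using assms by simp
  have ne: "1 - y \<noteq> 0" "y - 1 \<noteq> 0" "Y - 1 \<noteq> 0" using assms by auto
  have SS: "S' * S = (Y - y)\<^sup>2 / (Y * (1 - y)\<^sup>2)"
  proof -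
    have "S' * S = y\<^sup>2 * (Y - y) * (y - Y) / (Y * (y - 1) * (y\<^sup>2 * (1 - y)))"
      unfolding S S' by simp
    also have "\<dots> = (y\<^sup>2 * (Y - y)\<^sup>2) / (y\<^sup>2 * (Y * (1 - y)\<^sup>2))"
    proof -
      have "y\<^sup>2 * (Y - y) * (y - Y) = - (y\<^sup>2 * (Y - y)\<^sup>2)"
        "Y * (y - 1) * (y\<^sup>2 * (1 - y)) = - (y\<^sup>2 * (Y * (1 - y)\<^sup>2))"
        by (simp_all add: power2_eq_square algebra_simps)
      then show ?thesis by (simp only: minus_divide_divide)
    qed
    finally show ?thesis using assms by simp
  qed
  have "m22 = (S' * S - 1) / Q" using assms(1) by (simp add: m22_def field_simps)
  also have "S' * S - 1 = ((Y - y)\<^sup>2 - Y * (1 - y)\<^sup>2) / (Y * (1 - y)\<^sup>2)"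
    unfolding SS using assms ne by (simp add: field_simps)
  also have "(Y - y)\<^sup>2 - Y * (1 - y)\<^sup>2 = (Y - 1) * (Y - y\<^sup>2)"
    by (simp add: power2_eq_square algebra_simps)
  finally show m22: "m22 = (Y - 1) * (Y - y\<^sup>2) / (Q * Y * (1 - y)\<^sup>2)" by (simp add: mult_ac)
  have "m11 = Q - Q * (1 - A) * ((Y - y) / (Y - 1))" using A0 assms(1) by (simp add: m11_def E field_simps)
  also have "\<dots> = Q * (Y - 1 - (1 - A) * (Y - y)) / (Y - 1)" using ne(3) by (simp add: field_simps)
  also have "Y - 1 - (1 - A) * (Y - y) = y - 1 + A * (Y - y)" by (simp add: algebra_simps)
  finally show m11: "m11 = Q * (y - 1 + A * (Y - y)) / (Y - 1)" .
  have "1 / (Q * A) = Q * y" using assms(1,2) by (simp add: A field_simps power2_eq_square)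
  then have "m12 = - Q - Q * y * (S / Q) / Q" by (simp only: m12_def)
  also have "\<dots> = - Q - y * S / Q" using assms(1) by (simp add: field_simps)
  also have "y * S = (y - Y) / (y * (1 - y))" using assms(2) by (simp add: S power2_eq_square)
  also have "- Q - (y - Y) / (y * (1 - y)) / Q = - Q * (1 + A * ((y - Y) / (1 - y)))"
    using assms(1,2) ne by (simp add: A field_simps power2_eq_square)
  also have "1 + A * ((y - Y) / (1 - y)) = (y - 1 + A * (Y - y)) / (y - 1)"
    using ne by (simp add: divide_simps) (simp add: algebra_simps)
  finally have m12: "m12 = - Q * ((y - 1 + A * (Y - y)) / (y - 1))" .
  have "m21 = 1 / Q - (Q * A) * S'" using assms(1) by (simp add: m21_def field_simps)
  also have "Q * A = 1 / (Q * y)" using assms(1,2) by (simp add: A field_simps power2_eq_square)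
  also have "1 / (Q * y) * S' = y * (Y - y) / (Y * (y - 1)) / Q"
    using assms(1,2) by (simp add: S' power2_eq_square)
  also have "1 / Q - y * (Y - y) / (Y * (y - 1)) / Q = (1 - y * (Y - y) / (Y * (y - 1))) / Q"
    by (simp only: diff_divide_distrib)
  also have "1 - y * (Y - y) / (Y * (y - 1)) = (y\<^sup>2 - Y) / (Y * (y - 1))"
    using assms(3) ne by (simp add: divide_simps) (simp add: algebra_simps power2_eq_square)
  finally have m21: "m21 = (y\<^sup>2 - Y) / (Y * (y - 1)) / Q" .
  \<comment> \<open>The numerator shared by \<open>m11\<close> and \<open>m12\<close>; keeping it
    opaque reduces the last comparison to a formal identity of fractions.\<close>
  define u where "u = y - 1 + A * (Y - y)"
  have "m11 * m22 = u * (Y - y\<^sup>2) / (Y * (1 - y)\<^sup>2)"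
    unfolding m11 m22 u_def[symmetric] using assms(1) ne by simp
  also have "(1 - y)\<^sup>2 = (y - 1)\<^sup>2" by (rule power2_commute)
  finally have lhs: "m11 * m22 = u * (Y - y\<^sup>2) / (Y * (y - 1)\<^sup>2)" .
  have gen: "- Q * (v / b) * (- w / (Y * b) / Q) = v * w / (Y * b\<^sup>2)" for v w b :: complex
    using assms(1) by (simp add: power2_eq_square)
  have "m21 = - (Y - y\<^sup>2) / (Y * (y - 1)) / Q" by (simp only: m21 minus_diff_eq)
  then have "m12 * m21 = - Q * (u / (y - 1)) * (- (Y - y\<^sup>2) / (Y * (y - 1)) / Q)"
    by (simp only: m12 u_def)
  then show "m11 * m22 = m12 * m21" by (simp only: lhs gen)
qed

text \<open>Supplies the nonzero total weight for \<open>both_parts_spanned\<close>; the weights are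
  powers of \<open>y\<close> or of \<open>1 / y\<close>, from the constraint on the lambdas.\<close>

lemma geometric_sum_nonzero:
  fixes z :: complex
  assumes "z \<noteq> 0" "z ^ N \<noteq> 1"
  shows "(\<Sum>i=1..N. z ^ i) \<noteq> 0"
proof -
  have "(1 - z) * (\<Sum>i=1..N. z ^ i) = z * (1 - z ^ N)"
  proof (induction N)
    case (Suc N)
    have "(1 - z) * (\<Sum>i=1..Suc N. z ^ i) = (1 - z) * (\<Sum>i=1..N. z ^ i) + (1 - z) * (z * z ^ N)"
      by (simp add: distrib_left)
    also have "\<dots> = z * (1 - z ^ N) + (1 - z) * (z * z ^ N)" by (simp only: Suc)
    also have "\<dots> = z * (1 - z ^ Suc N)" by (simp add: algebra_simps)
    finally show ?case .
  qed simp
  then show ?thesis using assms by auto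
qed

text \<open>In the rows and columns 2, ..., N the matrix \<open>C\<close> is already the Gram matrix
  of the left parts. The Heisenberg part only has to realize what remains at the vertices 0, 1 and
  \<open>N + 1\<close>, namely \<open>C\<close> with the pairing of \<open>\<lambda>_N\<close> with
  itself subtracted at the vertex 1.\<close>

lemma target_gram:
  fixes N n :: nat
  assumes N: "N \<ge> 2" and gen: "generic_parameters q1 q2 q3" and q: "q\<^sup>2 = q2"
    and lam: "lambda_realization N q1 q2 q3 ul vl" and n: "n > 0"
  shows "\<exists>xu xv :: nat \<Rightarrow> nat \<Rightarrow> complex.
    (\<forall>i\<in>{0..N + 1}. \<forall>j\<in>{0..N + 1}.
      (\<Sum>r<N + 1. both_parts N (\<lambda>a. vl a n) xv i r * both_parts N (\<lambda>a. ul a n) xu j r)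
        = Cmat (Qsub N q1 q3) q n i j / of_nat n) \<and>
    (\<forall>s<N + 1. spanned {0..N + 1} (N + 1) (both_parts N (\<lambda>a. ul a n) xu) (\<lambda>r. if r = s then 1 else 0)) \<and>
    (\<forall>s<N + 1. spanned {0..N + 1} (N + 1) (both_parts N (\<lambda>a. vl a n) xv) (\<lambda>r. if r = s then 1 else 0))"
proof -
  note nz = genericD(1-3)[OF gen]
  define Q A y Y where "Q = q ^ n" and "A = q1 ^ n" and "y = q3 ^ n" and "Y = y ^ N"
  define \<kappa> where "\<kappa> = Q - 1 / Q"
  define D where "D = - (1 / of_nat n) * (1 - q1 ^ n) * (1 - q2 ^ n)"
  define G where "G a b = (\<Sum>r<N - 1. vl a n r * ul b n r)" for a b
  let ?C = "\<lambda>i j. Cmat (Qsub N q1 q3) q n i j / of_nat n"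
  have Q2: "q2 ^ n = Q\<^sup>2" unfolding Q_def q[symmetric] by (simp only: power_mult[symmetric] mult.commute)
  have Q0: "Q \<noteq> 0" using nz(2) q by (auto simp: Q_def)
  have y0: "y \<noteq> 0" "y \<noteq> 1" using nz(3) genericD(7)[OF gen n] by (simp_all add: y_def)
  have Y0: "Y \<noteq> 0" "Y \<noteq> 1"
    using y0 genericD(7)[OF gen, of "n * N"] n N by (simp_all add: Y_def y_def power_mult)
  have "(q1 * q2 * q3) ^ n = 1" using genericD(4)[OF gen] by simp
  then have AQy: "A * Q\<^sup>2 * y = 1" by (simp add: A_def y_def Q2 power_mult_distrib)
  then have A0: "A \<noteq> 0" by auto
  have A_eq: "A = 1 / (Q\<^sup>2 * y)" using AQy Q0 y0(1) by (simp add: field_simps)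
  have A1: "A \<noteq> 1" using genericD(5)[OF gen n] by (simp add: A_def)
  have Q21: "Q\<^sup>2 \<noteq> 1" using genericD(6)[OF gen n] by (simp add: Q2)
  have \<kappa>0: "\<kappa> \<noteq> 0" using Q21 Q0 by (simp add: \<kappa>_def field_simps power2_eq_square)
  have n0: "of_nat n \<noteq> (0::complex)" using n by simp
  have D_eq: "D = \<kappa> / of_nat n * (Q * (1 - A))"
    using Q0 n0 by (simp add: D_def Q2 \<kappa>_def A_def[symmetric] field_simps power2_eq_square)
  have D0: "D \<noteq> 0" using \<kappa>0 n0 Q0 A1 by (simp add: D_eq)
  have QA: "1 / (Q * y) = Q * A" "Q * y = 1 / (Q * A)" "Q * A * y = 1 / Q"
  proof -
    have "Q * A * (Q * y) = 1" using AQy by (simp add: power2_eq_square mult_ac)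
    then show "1 / (Q * y) = Q * A" "Q * y = 1 / (Q * A)" "Q * A * y = 1 / Q"
      using Q0 y0 A0 by (simp_all add: divide_eq_eq eq_divide_eq mult_ac)
  qed
  \<comment> \<open>\<open>K1\<close>, \<open>K2\<close> and \<open>K3\<close> are the diagonal,
    lower and upper entries of the tridiagonal block of \<open>C\<close>; they become multiples of
    \<open>D\<close> through \<open>AQy\<close>, that is \<open>q1 * q2 * q3 = 1\<close>.\<close>
  have K1: "D * (y + 1) = \<kappa> / of_nat n * (Q - 1 / Q - (Q * A - 1 / (Q * A)))"
  proof -
    have "Q * (1 - A) * (y + 1) = Q - Q * A * y - (Q * A - Q * y)" by (simp add: algebra_simps)
    then have "D * (y + 1) = \<kappa> / of_nat n * (Q - Q * A * y - (Q * A - Q * y))"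
      unfolding D_eq by (simp only: mult.assoc)
    then show ?thesis by (simp only: QA(2,3))
  qed
  have K2: "- D = \<kappa> / of_nat n * (1 / (Q * y) - Q)"
    unfolding D_eq QA(1) by (simp add: algebra_simps)
  have K3: "- (D * y) = \<kappa> / of_nat n * (1 / Q - Q * y)"
    unfolding D_eq QA(3)[symmetric] by (simp add: algebra_simps)
  have G: "G a b = D * (if a < b then (1 - y) / (Y - 1) else if a = b then (Y - y) / (Y - 1) else Y * (1 - y) / (Y - 1))"
    if "a \<in> {1..N}" "b \<in> {1..N}" for a b
  proof -
    have "G a b = D * theta N q3 n a b"
      using lam n that unfolding lambda_realization_def G_def D_def by blast
    then show ?thesis using theta_eq[OF nz(3), of N n a b] N by (simp add: Let_def y_def Y_def)
  qed
  \<comment> \<open>The pairings of the lambdas fill the whole matrix, but their row differences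
    live next to the diagonal, as the quiver demands.\<close>
  have step: "G a b - G (a + 1) b = D * ((if a = b then y else 0) - (if b = a + 1 then 1 else 0))"
    if "1 \<le> a" "a < N" "1 \<le> b" "b \<le> N" for a b
  proof -
    have 1: "(1 - y) / (Y - 1) - (Y - y) / (Y - 1) = -1" "(Y - y) / (Y - 1) - Y * (1 - y) / (Y - 1) = y"
      using Y0 by (simp_all add: divide_simps) (simp add: algebra_simps)
    have 2: "D * u - D * v = D * w" if "u - v = w" for u v w using that by (simp flip: right_diff_distrib)
    consider "b = a" | "b = a + 1" | "a + 1 < b" | "b < a" by linarith
    then show ?thesis
    proof cases
      case a: 1
      then have "G a b - G (a + 1) b = D * ((Y - y) / (Y - 1)) - D * (Y * (1 - y) / (Y - 1))" using that by (simp add: G)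
      then show ?thesis using a 2[OF 1(2)] by simp
    next
      case a: 2
      then have "G a b - G (a + 1) b = D * ((1 - y) / (Y - 1)) - D * ((Y - y) / (Y - 1))" using that by (simp add: G)
      then show ?thesis using a 2[OF 1(1)] by simp
    qed (use that in \<open>simp_all add: G\<close>)
  qed
  define idx where "idx i = (if i = 0 then 0 else if i = 1 then 1 else N + 1)" for i :: nat
  define g where "g i j = (if i = 1 \<and> j = 1 then ?C 1 1 - G N N else ?C (idx i) (idx j))" for i j :: nat
  define S S' E where "S = (y - Y) / (y\<^sup>2 * (1 - y))" and "S' = y\<^sup>2 * (Y - y) / (Y * (y - 1))"
    and "E = Q - 1 / Q - Q * (1 - A) * ((Y - y) / (Y - 1))"
  have powi: "(q3 powi k) ^ n = y powi k" for k :: int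
    by (simp add: y_def power_int_power power_int_power' mult.commute)
  have sums: "(\<Sum>k\<in>{1..<N}. 1 / (Q * (q3 powi (2 - int k)) ^ n)) = S / Q"
      "(\<Sum>k\<in>{1..<N}. Q * (q3 powi (2 - int k)) ^ n) = Q * S'"
  proof -
    have "1 / (Q * y powi (2 - int k)) = y powi (int k - 2) / Q" for k
      using power_int_minus[of y "2 - int k"] by (simp add: field_simps)
    then show "(\<Sum>k\<in>{1..<N}. 1 / (Q * (q3 powi (2 - int k)) ^ n)) = S / Q"
      using geometric_sums(1)[OF y0, of N] N unfolding powi S_def Y_def by (simp flip: sum_divide_distrib)
    show "(\<Sum>k\<in>{1..<N}. Q * (q3 powi (2 - int k)) ^ n) = Q * S'"
      using geometric_sums(2)[OF y0, of N] N unfolding powi S'_def Y_def by (simp flip: sum_distrib_left)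
  qed
  note cm = cmat_Qsub[OF N, where ?q1.0 = q1 and ?q3.0 = q3 and q = q and n = n, folded Q_def A_def y_def \<kappa>_def, unfolded sums]
  have C: "?C i j = \<kappa> / of_nat n * cmat (Qsub N q1 q3) q n i j" for i j
    by (simp add: Cmat_def Q_def \<kappa>_def)
  have g_vals: "g 0 0 = \<kappa> / of_nat n * Q" "g 0 1 = \<kappa> / of_nat n * (- (Q * A))" "g 0 2 = \<kappa> / of_nat n * (S / Q)"
    "g 1 0 = \<kappa> / of_nat n * (1 / (Q * A))" "g 1 1 = \<kappa> / of_nat n * E" "g 1 2 = \<kappa> / of_nat n * (- Q)"
    "g 2 0 = \<kappa> / of_nat n * (- (Q * S'))" "g 2 1 = \<kappa> / of_nat n * (1 / Q)" "g 2 2 = \<kappa> / of_nat n * (- (1 / Q))"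
  proof -
    show "g 1 1 = \<kappa> / of_nat n * E"
    proof -
      have "g 1 1 = \<kappa> / of_nat n * \<kappa> - D * ((Y - y) / (Y - 1))"
        using N by (simp add: g_def C G cm(3)[folded \<kappa>_def, simplified] \<kappa>_def)
      also have "\<dots> = \<kappa> / of_nat n * (\<kappa> - Q * (1 - A) * ((Y - y) / (Y - 1)))"
        unfolding D_eq by (simp only: right_diff_distrib[of "\<kappa> / of_nat n"] mult.assoc)
      finally show ?thesis by (simp add: E_def \<kappa>_def)
    qed
    have gC: "g i j = \<kappa> / of_nat n * cmat (Qsub N q1 q3) q n (idx i) (idx j)" if "\<not> (i = 1 \<and> j = 1)" for i j
      using that by (simp only: g_def C if_False)
    have idx: "idx 0 = 0" "idx 1 = 1" "idx 2 = N + 1" by (simp_all add: idx_def)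
    show "g 0 0 = \<kappa> / of_nat n * Q" using gC[of 0 0] unfolding idx cm(1) by simp
    show "g 0 1 = \<kappa> / of_nat n * (- (Q * A))" using gC[of 0 1] unfolding idx cm(4) by simp
    show "g 0 2 = \<kappa> / of_nat n * (S / Q)" using gC[of 0 2] unfolding idx cm(8) by simp
    show "g 1 0 = \<kappa> / of_nat n * (1 / (Q * A))" using gC[of 1 0] unfolding idx cm(5) by simp
    show "g 1 2 = \<kappa> / of_nat n * (- Q)" using gC[of 1 2] unfolding idx cm(7) by simp
    show "g 2 0 = \<kappa> / of_nat n * (- (Q * S'))" using gC[of 2 0] unfolding idx cm(9) by simp
    show "g 2 1 = \<kappa> / of_nat n * (1 / Q)" using gC[of 2 1] unfolding idx cm(6) by simp
    show "g 2 2 = \<kappa> / of_nat n * (- (1 / Q))" using gC[of 2 2] unfolding idx cm(2) by simp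
  qed
  have scale: "z * a - z * b * (z * c) / (z * Q) = z * (a - b * c / Q)" if "z \<noteq> 0" for z a b c
  proof -
    have "z * b * (z * c) / (z * Q) = z * (b * c / Q)" using that by simp
    then show ?thesis by (simp only: right_diff_distrib)
  qed
  have z: "\<kappa> / of_nat n \<noteq> 0" using \<kappa>0 n0 by simp
  define m where "m i j = g i j - g i 0 * g 0 j / g 0 0" for i j
  have m: "m 1 1 = \<kappa> / of_nat n * (E - 1 / (Q * A) * (- (Q * A)) / Q)"
      "m 1 2 = \<kappa> / of_nat n * (- Q - 1 / (Q * A) * (S / Q) / Q)"
      "m 2 1 = \<kappa> / of_nat n * (1 / Q - (- (Q * S')) * (- (Q * A)) / Q)"
      "m 2 2 = \<kappa> / of_nat n * (- (1 / Q) - (- (Q * S')) * (S / Q) / Q)"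
    unfolding m_def g_vals by (rule scale[OF z])+
  note sc = schur_complement[OF Q0 y0(1) Y0(1) y0(2) Y0(2) A_eq S_def S'_def E_def]
  have det: "m 1 1 * m 2 2 = m 1 2 * m 2 1"
    unfolding m using sc(1) by (simp only: mult.assoc mult.left_commute)
  \<comment> \<open>\<open>m 2 2\<close> has the factor \<open>Y - y\<^sup>2\<close>, which by
    genericity vanishes only for \<open>N = 2\<close>. In that case \<open>m 1 1\<close> is used: it
    could vanish only if \<open>q2 ^ n = -1\<close>, and then
    \<open>q2 ^ (n * 2) = 1\<close>.\<close>
  have nonzero: "m 1 1 \<noteq> 0 \<or> m 2 2 \<noteq> 0"
  proof (cases "N = 2")
    case True
    have "y - 1 + A * (Y - y) = (y - 1) * (1 + A * y)" by (simp add: Y_def True power2_eq_square algebra_simps)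
    moreover have "1 + A * y \<noteq> 0"
    proof
      assume "1 + A * y = 0"
      then have "A * y = - 1" by (simp add: eq_neg_iff_add_eq_0 add.commute)
      moreover have "A * Q\<^sup>2 * y = A * y * Q\<^sup>2" by (simp only: mult_ac)
      ultimately have "- Q\<^sup>2 = 1" using AQy by simp
      then have "- (- Q\<^sup>2) = - 1" by (simp only:)
      then have "Q\<^sup>2 = - 1" by simp
      then have "q2 ^ (n * 2) = 1" by (simp add: power_mult Q2)
      then show False using genericD(6)[OF gen, of "n * 2"] n by simp
    qed
    ultimately have "m 1 1 \<noteq> 0" unfolding m sc(3) using z Q0 y0 Y0 by simp
    then show ?thesis ..
  next
    case False
    have "Y \<noteq> y\<^sup>2"
    proof
      assume "Y = y\<^sup>2"
      moreover have "y ^ (N - 2) * y\<^sup>2 = y ^ (N - 2 + 2)" by (simp only: power_add)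
      moreover have "N - 2 + 2 = N" using N by simp
      ultimately have "y ^ (N - 2) * y\<^sup>2 = y\<^sup>2" by (simp only: Y_def)
      then have "y ^ (N - 2) = 1" using y0(1) by simp
      then have "q3 ^ (n * (N - 2)) = 1" by (simp only: y_def power_mult)
      then show False using genericD(7)[OF gen, of "n * (N - 2)"] n N False by simp
    qed
    then have "m 2 2 \<noteq> 0" unfolding m sc(2) using z Q0 y0 Y0 by simp
    then show ?thesis ..
  qed
  have g00: "g 0 0 \<noteq> 0" unfolding g_vals using z Q0 by simp
  obtain xu xv where x: "\<forall>i<3. \<forall>j<3. (\<Sum>s<2. xv i s * xu j s) = g i j"
    and xs: "\<forall>s<2. spanned {..<3} 2 xu (\<lambda>r. if r = s then 1 else 0)"
      "\<forall>s<2. spanned {..<3} 2 xv (\<lambda>r. if r = s then 1 else 0)"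
    using rank_two_realization[of g, OF g00 det[unfolded m_def] nonzero[unfolded m_def]] by blast
  have ls: "spanned {1..N} (N - 1) (\<lambda>a. ul a n) (\<lambda>r. if r = s then 1 else 0)"
      "spanned {1..N} (N - 1) (\<lambda>a. vl a n) (\<lambda>r. if r = s then 1 else 0)" if "s < N - 1" for s
    using lambda_spanned[of N "\<lambda>a. vl a n" "\<lambda>a. ul a n" D y, OF step[unfolded G_def] D0 y0(1) that] by blast+
  have wu: "(\<Sum>i=1..N. y ^ i * ul i n r) = 0" if "r < N - 1" for r
  proof -
    have "q3 powi int (i * n) = y ^ i" for i
      by (simp only: power_int_of_nat y_def mult.commute[of i] power_mult)
    moreover have "(\<Sum>i=1..N. q3 powi int (i * n) * ul i n r) = 0"
      using lam n that unfolding lambda_realization_def by blast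
    ultimately show ?thesis by (simp only:)
  qed
  have wv: "(\<Sum>i=1..N. (1 / y) ^ i * vl i n r) = 0" if "r < N - 1" for r
  proof -
    have "q3 powi (- int (i * n)) = (1 / y) ^ i" for i
      by (simp only: power_int_minus power_int_of_nat y_def mult.commute[of i] power_mult power_one_over inverse_eq_divide)
    moreover have "(\<Sum>i=1..N. q3 powi (- int (i * n)) * vl i n r) = 0"
      using lam n that unfolding lambda_realization_def by blast
    ultimately show ?thesis by (simp only:)
  qed
  have spu: "\<forall>s<N + 1. spanned {0..N + 1} (N + 1) (both_parts N (\<lambda>a. ul a n) xu) (\<lambda>r. if r = s then 1 else 0)"
    using both_parts_spanned[OF N ls(1) xs(1)[rule_format] wu geometric_sum_nonzero] y0 Y0 unfolding Y_def by blast
  have "(1 / y) ^ N \<noteq> 1" using Y0 unfolding Y_def by (simp add: power_one_over)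
  then have spv: "\<forall>s<N + 1. spanned {0..N + 1} (N + 1) (both_parts N (\<lambda>a. vl a n) xv) (\<lambda>r. if r = s then 1 else 0)"
    using both_parts_spanned[OF N ls(2) xs(2)[rule_format] wv geometric_sum_nonzero] y0 by force
  have gram: "(\<Sum>r<N + 1. both_parts N (\<lambda>a. vl a n) xv i r * both_parts N (\<lambda>a. ul a n) xu j r) = ?C i j"
    if ij: "i \<in> {0..N + 1}" "j \<in> {0..N + 1}" for i j
  proof -
    define LL where "LL = (\<Sum>r<N - 1. left_part N (\<lambda>a. vl a n) i r * left_part N (\<lambda>a. ul a n) j r)"
    define RR where "RR = (\<Sum>s<2. right_part N xv i s * right_part N xu j s)"
    have split: "(\<Sum>r<N + 1. both_parts N (\<lambda>a. vl a n) xv i r * both_parts N (\<lambda>a. ul a n) xu j r) = LL + RR"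
    proof -
      have "both_parts N l x k (N - 1 + s) = right_part N x k s" for l x k s
        unfolding both_parts_def by (simp only: add_diff_cancel_left' not_add_less1 if_False)
      moreover have "both_parts N l x k r = left_part N l k r" if "r < N - 1" for l x k r
        using that by (simp only: both_parts_def if_True)
      ultimately show ?thesis using N by (subst sum_split_last_two) (simp_all add: LL_def RR_def del: One_nat_def)
    qed
    have RR: "RR = (if i \<in> {0, 1, N + 1} \<and> j \<in> {0, 1, N + 1} then
        g (if i = 0 then 0 else if i = 1 then 1 else 2) (if j = 0 then 0 else if j = 1 then 1 else 2) else 0)"
      using x N by (auto simp: RR_def right_part_def)
    have mid: "i \<in> {0, 1, N + 1} \<or> 2 \<le> i \<and> i \<le> N" "j \<in> {0, 1, N + 1} \<or> 2 \<le> j \<and> j \<le> N" using ij by auto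
    have sumdiff: "(\<Sum>r<N - 1. vl a n r * (ul b n r - ul b' n r)) = G a b - G a b'"
      "(\<Sum>r<N - 1. (vl a n r - vl a' n r) * ul b n r) = G a b - G a' b"
      "(\<Sum>r<N - 1. (vl a n r - vl a' n r) * (ul b n r - ul b' n r)) = (G a b - G a' b) - (G a b' - G a' b')" for a a' b b'
      by (simp_all add: G_def left_diff_distrib right_diff_distrib sum_subtractf)
    show ?thesis
    proof (cases "2 \<le> i \<and> i \<le> N")
      case i: True
      then have RR0: "RR = 0" using N by (auto simp: RR)
      define a where "a = N + 1 - i"
      then have a: "N + 1 - i = a" "N + 2 - i = a + 1" "1 \<le> a" "a < N" "i = N + 1 - a" using i N by auto
      show ?thesis
      proof (cases "2 \<le> j \<and> j \<le> N")
        case j: True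
        define b where "b = N + 1 - j"
        then have b: "N + 1 - j = b" "N + 2 - j = b + 1" "1 \<le> b" "b < N" "j = N + 1 - b" using j N by auto
        have "LL = (G a b - G (a + 1) b) - (G a (b + 1) - G (a + 1) (b + 1))"
          unfolding LL_def left_part_def using i j a b by (simp add: sumdiff Suc_eq_plus1[symmetric] del: One_nat_def)
        also have "\<dots> = D * ((if a = b then y else 0) - (if b = a + 1 then 1 else 0))
            - D * ((if a = b + 1 then y else 0) - (if b + 1 = a + 1 then 1 else 0))"
          using a b by (simp only: step)
        finally have LL: "LL = \<dots>" .
        consider "j = i" | "j = Suc i" | "i = Suc j" | "i \<noteq> j" "j \<noteq> Suc i" "i \<noteq> Suc j" by blast
        then show ?thesis
        proof cases
          case 1
          then have "a = b" by (simp add: a_def b_def)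
          then have "LL = D * (y + 1)" using LL by (simp add: algebra_simps)
          then show ?thesis unfolding split RR0 K1 C using 1 i cm(10)[of i] by (simp add: \<kappa>_def)
        next
          case 2
          then have "a = b + 1" "a \<noteq> b" "b \<noteq> a + 1" using i j by (auto simp: a_def b_def)
          then have "LL = - (D * y)" using LL by simp
          then show ?thesis unfolding split RR0 K3 C using 2 i j cm(11)[of i] by simp
        next
          case 3
          then have "b = a + 1" "a \<noteq> b" "a \<noteq> b + 1" using i j by (auto simp: a_def b_def)
          then have "LL = - D" using LL by simp
          then show ?thesis unfolding split RR0 K2 C using 3 i j cm(12)[of j] by simp
        next
          case 4
          then have "a \<noteq> b" "a \<noteq> b + 1" "b \<noteq> a + 1" using i j by (auto simp: a_def b_def)
          then have "LL = 0" using LL by simp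
          then show ?thesis unfolding split RR0 C using 4 i j cm(17)[of i j] by simp
        qed
      next
        case j: False
        show ?thesis
        proof (cases "j = 1")
          case True
          \<comment> \<open>The vertex 1 carries \<open>\<lambda>_N\<close> itself and not a
            difference, so a single differencing takes place.\<close>
          have "LL = G a N - G (a + 1) N"
            unfolding LL_def left_part_def using i True a N by (simp add: sumdiff Suc_eq_plus1[symmetric] del: One_nat_def)
          also have "\<dots> = D * ((if a = N then y else 0) - (if N = a + 1 then 1 else 0))"
            using a N by (intro step) auto
          finally have LL: "LL = \<dots>" .
          show ?thesis
          proof (cases "i = 2")
            case i2: True
            then have "N = a + 1" using a by simp
            then have "LL = - D" using LL by simp
            then show ?thesis unfolding split RR0 K2 C using True i2 i N cm(12)[of 1] by (simp add: numeral_2_eq_2)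
          next
            case i2: False
            then have "N \<noteq> a + 1" "a \<noteq> N" using a i by auto
            then have "LL = 0" using LL by simp
            then show ?thesis unfolding split RR0 C using True i2 i N cm(17)[of i 1] by simp
          qed
        next
          case j1: False
          then have j': "j = 0 \<or> j = N + 1" using j ij by auto
          then have "LL = 0" using N by (auto simp: LL_def left_part_def)
          then show ?thesis unfolding split RR0 C using j' i cm(14)[of i] cm(16)[of i] by auto
        qed
      qed
    next
      case i: False
      show ?thesis
      proof (cases "2 \<le> j \<and> j \<le> N")
        case j: True
        then have RR0: "RR = 0" using N by (auto simp: RR)
        define b where "b = N + 1 - j"
        then have b: "N + 1 - j = b" "N + 2 - j = b + 1" "1 \<le> b" "b < N" "j = N + 1 - b" using j N by auto
        show ?thesis
        proof (cases "i = 1")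
          case True
          \<comment> \<open>A column difference, to which \<open>step\<close> does not apply; the
            closed form of \<open>G\<close> is used instead.\<close>
          have LL: "LL = G N b - G N (b + 1)"
            unfolding LL_def left_part_def using j True b N by (simp add: sumdiff Suc_eq_plus1[symmetric] del: One_nat_def)
          show ?thesis
          proof (cases "j = 2")
            case j2: True
            then have "N = b + 1" using b by simp
            then have "LL = D * (Y * (1 - y) / (Y - 1) - (Y - y) / (Y - 1))"
              using LL b by (simp add: G right_diff_distrib)
            also have "Y * (1 - y) / (Y - 1) - (Y - y) / (Y - 1) = - y"
              using Y0 by (simp add: divide_simps) (simp add: algebra_simps)
            finally have "LL = - (D * y)" by simp
            then show ?thesis unfolding split RR0 K3 C using True j2 N cm(11)[of 1] by (simp add: numeral_2_eq_2)
          next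
            case j2: False
            then have "b + 1 < N" using b j by auto
            then have "LL = 0" using LL b by (simp add: G)
            then show ?thesis unfolding split RR0 C using True j2 j N cm(17)[of 1 j] by simp
          qed
        next
          case i1: False
          then have i': "i = 0 \<or> i = N + 1" using i ij by auto
          then have "LL = 0" using N by (auto simp: LL_def left_part_def)
          then show ?thesis unfolding split RR0 C using i' j cm(13)[of j] cm(15)[of j] by auto
        qed
      next
        case j: False
        have "i \<in> {0, 1, N + 1}" "j \<in> {0, 1, N + 1}" using mid i j by auto
        moreover have "LL = (if i = 1 \<and> j = 1 then G N N else 0)"
          using i j N by (auto simp: LL_def left_part_def G_def)
        ultimately show ?thesis using N unfolding split RR by (auto simp: g_def idx_def)
      qed
    qed
  qed
  show ?thesis using gram spu spv by blast
qed

section \<open>The zero mode lattices\<close>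

text \<open>The exponents with respect to \<open>Y_j = X_1 ... X_j\<close>. Since \<open>X_j\<close>
  is the quotient of \<open>Y_j\<close> by \<open>Y_{j-1}\<close>, the monomial with exponents
  \<open>g\<close> contains \<open>Y_j\<close> with exponent \<open>g j - g (j + 1)\<close>.\<close>

definition incr :: "nat \<Rightarrow> (nat \<Rightarrow> int) \<Rightarrow> nat \<Rightarrow> int" where
  "incr N g j = (if j < N then g j - g (Suc j) else g N)"

lemma sum_incr:
  assumes "1 \<le> j" "j \<le> N"
  shows "(\<Sum>l=j..N. incr N g l) = g j"
  using assms(2)
proof (induction j rule: inc_induct)
  case (step n)
  have "(\<Sum>l=n..N. incr N g l) = incr N g n + (\<Sum>l=Suc n..N. incr N g l)"
    using step by (intro sum.atLeast_Suc_atMost) auto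
  then show ?case using step by (simp add: incr_def)
qed (simp add: incr_def)

text \<open>The map \<open>(theta1, theta2)\<close> of lattices is additive on the zero modes of the quiver, on which
  the coordinate \<open>N + 2\<close> vanishes: \<open>X\<^sub>1 \<cdots> X\<^sub>j\<close> goes to \<open>(lam0 (N + 1 - j), e\<^sub>1)\<close>, \<open>X\<^sub>0\<close> to \<open>e\<^sub>0\<close> and
  \<open>X\<^bsub>N+1\<^esub>\<close> to \<open>e\<^sub>2\<close>.  Their images span a sublattice of index \<open>N\<close>, and the residue of the
  inert coordinate \<open>N + 2\<close> runs through its cosets, so that the map is bijective.\<close>

definition theta1_fun :: "nat \<Rightarrow> (nat \<Rightarrow> int) \<Rightarrow> nat \<Rightarrow> int" where
  "theta1_fun N g i = (if i = 0 then g (N + 2) div int N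
     else if i < N then incr N g (N + 1 - i) - incr N g 1 + (if i = 1 then g (N + 2) mod int N else 0)
     else g (N + 3 + 2 * (i - N)))"

text \<open>The inert coordinates from \<open>N + 3\<close> on are dealt out alternately, even
  offsets to the left factor and odd ones to the right factor, so that every coordinate of both
  factors is reached.\<close>

definition theta2_fun :: "nat \<Rightarrow> (nat \<Rightarrow> int) \<Rightarrow> nat \<Rightarrow> int" where
  "theta2_fun N g i = (if i < 2 then g i else if i = 2 then g (N + 1) else g (N + 4 + 2 * (i - 3)))"

definition theta1 :: "nat \<Rightarrow> lattice \<Rightarrow> lattice" where
  "theta1 N g = Abs_poly_mapping (theta1_fun N (lookup g))"

definition theta2 :: "nat \<Rightarrow> lattice \<Rightarrow> lattice" where
  "theta2 N g = Abs_poly_mapping (theta2_fun N (lookup g))"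

lemma lookup_bounded: "\<exists>M. \<forall>k>M. lookup (g :: nat \<Rightarrow>\<^sub>0 int) k = 0"
proof -
  obtain M where "\<forall>k\<in>keys g. k \<le> M" using finite_keys[of g] by (metis finite_nat_set_iff_bounded_le)
  then have "lookup g k = 0" if "k > M" for k using that by (meson in_keys_iff not_less)
  then show ?thesis by blast
qed

lemma lookup_Abs_bounded:
  fixes f :: "nat \<Rightarrow> int"
  assumes "\<And>k. k > M \<Longrightarrow> f k = (0::int)"
  shows "lookup (Abs_poly_mapping f) = f"
proof -
  have "finite {k. f k \<noteq> 0}"
    by (rule finite_subset[of _ "{..M}"]) (use assms in \<open>force simp: not_le[symmetric]\<close>, simp)
  then show ?thesis by (simp add: Abs_poly_mapping_inverse)
qed

lemma lookup_theta:
  "lookup (theta1 N g) = theta1_fun N (lookup g)" "lookup (theta2 N g) = theta2_fun N (lookup g)"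
proof -
  obtain M where M: "\<forall>k>M. lookup g k = 0" using lookup_bounded by blast
  show "lookup (theta1 N g) = theta1_fun N (lookup g)" unfolding theta1_def
    by (rule lookup_Abs_bounded[of "M + N"]) (use M in \<open>auto simp: theta1_fun_def\<close>)
  show "lookup (theta2 N g) = theta2_fun N (lookup g)" unfolding theta2_def
    by (rule lookup_Abs_bounded[of "M + 2"]) (use M in \<open>auto simp: theta2_fun_def\<close>)
qed

text \<open>Integer quotient and remainder are not additive, but they do not notice a summand whose
  coordinate \<open>N + 2\<close> is 0.\<close>

lemma theta_add:
  assumes "lookup g (N + 2) = 0"
  shows "theta1 N (g + h) = theta1 N g + theta1 N h" "theta2 N (g + h) = theta2 N g + theta2 N h"
  by (rule poly_mapping_eqI, use assms in \<open>auto simp: lookup_theta theta1_fun_def theta2_fun_def incr_def lookup_add\<close>)+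

text \<open>The left component fixes the exponents of the \<open>Y_j\<close> up to a common constant
  and a remainder, the right component fixes their sum. For two preimages, \<open>N\<close> times
  the discrepancy of the constants is therefore a difference of two remainders; being smaller than
  \<open>N\<close> in absolute value, it is 0.\<close>

lemma inj_theta:
  assumes N: "N \<ge> 2"
  shows "inj (\<lambda>g. (theta1 N g, theta2 N g))"
proof (rule injI)
  fix g h assume eq: "(theta1 N g, theta2 N g) = (theta1 N h, theta2 N h)"
  have t1: "theta1_fun N (lookup g) i = theta1_fun N (lookup h) i"
    and t2: "theta2_fun N (lookup g) i = theta2_fun N (lookup h) i" for i
    using eq by (metis lookup_theta(1) prod.inject) (use eq in \<open>metis lookup_theta(2) prod.inject\<close>)
  let ?d = "\<lambda>j. incr N (lookup g) j - incr N (lookup h) j"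
  let ?r = "\<lambda>g. lookup g (N + 2) mod int N"
  have d: "?d j = ?d 1" if "2 \<le> j" "j < N" for j
    using t1[of "N + 1 - j"] that by (auto simp: theta1_fun_def split: if_splits)
  have dN: "?d N = ?d 1 - (?r g - ?r h)"
    using t1[of 1] N by (simp add: theta1_fun_def)
  have low: "lookup g 0 = lookup h 0" "lookup g 1 = lookup h 1" "lookup g (N + 1) = lookup h (N + 1)"
    using t2[of 0] t2[of 1] t2[of 2] by (simp_all add: theta2_fun_def)
  have "(\<Sum>j=1..N. ?d j) = lookup g 1 - lookup h 1"
    using sum_incr[of 1 N] N by (simp add: sum_subtractf)
  then have "(\<Sum>j=1..N. ?d j) = 0" using low by simp
  moreover have "(\<Sum>j=1..N. ?d j) = (\<Sum>j=1..N. ?d 1 - (if j = N then ?r g - ?r h else 0))"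
  proof (intro sum.cong refl)
    fix j assume "j \<in> {1..N}"
    then have "j = 1 \<or> 2 \<le> j \<and> j < N \<or> j = N" by auto
    then consider "j = 1" | "2 \<le> j" "j < N" | "j = N" by blast
    then show "?d j = ?d 1 - (if j = N then ?r g - ?r h else 0)"
      using N d[of j] dN by cases auto
  qed
  moreover have "(\<Sum>j=1..N. ?d 1 - (if j = N then ?r g - ?r h else 0)) = int N * ?d 1 - (?r g - ?r h)"
    using N by (simp add: sum_subtractf)
  ultimately have Nd: "int N * ?d 1 = ?r g - ?r h" by simp
  have "0 \<le> ?r g" "?r g < int N" "0 \<le> ?r h" "?r h < int N" using N by simp_all
  then have "\<bar>int N * ?d 1\<bar> < int N * 1" unfolding Nd by linarith
  then have "\<bar>?d 1\<bar> < 1" using N by (simp only: abs_mult) (simp add: mult_less_cancel_left)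
  then have d1: "?d 1 = 0" by linarith
  then have r: "?r g = ?r h" using Nd by simp
  have d0: "incr N (lookup g) j = incr N (lookup h) j" if "1 \<le> j" "j \<le> N" for j
  proof -
    have "j = 1 \<or> 2 \<le> j \<and> j < N \<or> j = N" using that by auto
    then consider "j = 1" | "2 \<le> j" "j < N" | "j = N" by blast
    then have "?d j = 0" using d[of j] dN d1 r by cases auto
    then show ?thesis by simp
  qed
  have "lookup g j = lookup h j" for j
  proof -
    consider "j = 0" | "1 \<le> j" "j \<le> N" | "j = N + 1" | "j = N + 2" | "N + 3 \<le> j" by linarith
    then show ?thesis
    proof cases
      case 2
      then have "(\<Sum>l=j..N. incr N (lookup g) l) = (\<Sum>l=j..N. incr N (lookup h) l)"
        by (intro sum.cong refl d0) auto
      then show ?thesis using 2 by (simp add: sum_incr)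
    next
      case 4
      have "lookup g (N + 2) div int N = lookup h (N + 2) div int N"
        using t1[of 0] by (simp add: theta1_fun_def)
      with r have "lookup g (N + 2) = lookup h (N + 2)" by (metis mult_div_mod_eq)
      with 4 show ?thesis by simp
    next
      case 5
      then obtain k where k: "j = N + 3 + k" using le_Suc_ex by blast
      show ?thesis
      proof (cases "even k")
        case True
        then obtain l where "k = 2 * l" by blast
        then show ?thesis using t1[of "N + l"] N by (simp add: theta1_fun_def k)
      next
        case False
        then obtain l where "k = 2 * l + 1" using oddE by blast
        then show ?thesis using t2[of "3 + l"] by (simp add: theta2_fun_def k add_ac)
      qed
    qed (use low in simp_all)
  qed
  then show "g = h" by (rule poly_mapping_eqI)
qed

lemma surj_theta:
  assumes N: "N \<ge> 2"
  shows "surj (\<lambda>g. (theta1 N g, theta2 N g))"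
  unfolding surj_def
proof (intro allI)
  fix ab :: "lattice \<times> lattice"
  obtain a b where ab: "ab = (a, b)" by (cases ab)
  define s where "s = lookup b 1 - (\<Sum>i=1..N - 1. lookup a i)"
  \<comment> \<open>\<open>m1\<close> is \<open>s / N\<close> rounded up and \<open>\<rho>\<close>
    the excess, so that \<open>N * m1 - \<rho> = s\<close> with
    \<open>0 \<le> \<rho> < N\<close>.\<close>
  define m1 where "m1 = - ((- s) div int N)"
  define \<rho> where "\<rho> = (- s) mod int N"
  have \<rho>: "0 \<le> \<rho>" "\<rho> < int N" using N by (simp_all add: \<rho>_def)
  have s: "int N * m1 - \<rho> = s"
  proof -
    have "int N * ((- s) div int N) + (- s) mod int N = - s" by simp
    then show ?thesis unfolding m1_def \<rho>_def mult_minus_right by linarith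
  qed
  define m where "m j = (if j = 1 then m1 else lookup a (N + 1 - j) + m1 - (if j = N then \<rho> else 0))" for j
  define f where "f j = (if j = 0 then lookup b 0 else if j \<le> N then \<Sum>l=j..N. m l
      else if j = N + 1 then lookup b 2 else if j = N + 2 then lookup a 0 * int N + \<rho>
      else if even (j - (N + 3)) then lookup a (N + (j - (N + 3)) div 2)
      else lookup b (3 + (j - (N + 3)) div 2))" for j
  obtain M where M: "\<forall>k>M. lookup a k = 0" using lookup_bounded by blast
  obtain M' where M': "\<forall>k>M'. lookup b k = 0" using lookup_bounded by blast
  define g where "g = Abs_poly_mapping f"
  have g: "lookup g = f" unfolding g_def
    by (rule lookup_Abs_bounded[of "2 * (M + M' + N) + 4"]) (use M M' in \<open>auto simp: f_def\<close>)
  have incr: "incr N f j = m j" if "1 \<le> j" "j \<le> N" for j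
    using that N by (auto simp: incr_def f_def sum.atLeast_Suc_atMost)
  have f1: "f 1 = lookup b 1"
  proof -
    have "(\<Sum>l=1..N. m l) = m1 + (\<Sum>l=2..N. m l)"
      using N by (simp add: sum.atLeast_Suc_atMost m_def numeral_2_eq_2)
    also have "(\<Sum>l=2..N. m l) = (\<Sum>l=2..N. lookup a (N + 1 - l)) + (\<Sum>l=2..N. m1) - (\<Sum>l=2..N. if l = N then \<rho> else 0)"
      unfolding sum.distrib[symmetric] sum_subtractf[symmetric] by (intro sum.cong refl) (auto simp: m_def)
    also have "(\<Sum>l=2..N. lookup a (N + 1 - l)) = (\<Sum>i=1..N - 1. lookup a i)"
      by (rule sum.reindex_bij_witness[of _ "\<lambda>i. N + 1 - i" "\<lambda>l. N + 1 - l"]) auto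
    finally have "(\<Sum>l=1..N. m l) = int N * m1 - \<rho> + (\<Sum>i=1..N - 1. lookup a i)"
      using N by (simp add: of_nat_diff algebra_simps)
    then show ?thesis using N unfolding s by (simp add: f_def s_def)
  qed
  have "theta1_fun N f i = lookup a i" for i
  proof -
    consider "i = 0" | "1 \<le> i" "i < N" | "N \<le> i" by linarith
    then show ?thesis
    proof cases
      case 1
      then show ?thesis using \<rho> N by (simp add: theta1_fun_def f_def)
    next
      case 2
      have "f (N + 2) mod int N = \<rho>" using \<rho> N by (simp add: f_def)
      then show ?thesis using 2 N by (auto simp: theta1_fun_def incr m_def)
    next
      case 3
      then show ?thesis using N by (simp add: theta1_fun_def f_def)
    qed
  qed
  then have 1: "theta1 N g = a" by (intro poly_mapping_eqI) (simp add: lookup_theta g)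
  have "theta2_fun N f i = lookup b i" for i
  proof -
    consider "i = 0" | "i = 1" | "i = 2" | "3 \<le> i" by linarith
    then show ?thesis using f1 by cases (auto simp: theta2_fun_def f_def)
  qed
  then have 2: "theta2 N g = b" by (intro poly_mapping_eqI) (simp add: lookup_theta g)
  show "\<exists>g. ab = (theta1 N g, theta2 N g)" by (rule exI[of _ g]) (simp add: 1 2 ab)
qed

text \<open>The character with the value \<open>s3 powi (2 * j - N - 1)\<close> on
  \<open>X_1 ... X_{N+1-j}\<close>, which is the prefactor of \<open>\<Lambda>_j\<close>, and with
  the value 1 on \<open>X_0\<close> and \<open>X_{N+1}\<close>.\<close>

definition zero_scale :: "nat \<Rightarrow> complex \<Rightarrow> lattice \<Rightarrow> complex" where
  "zero_scale N s3 g = s3 powi ((int N - 1) * lookup g 1 - 2 * (\<Sum>j=2..N. lookup g j))"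

lemma zero_scale_add:
  "s3 \<noteq> 0 \<Longrightarrow> zero_scale N s3 (g + h) = zero_scale N s3 g * zero_scale N s3 h"
  by (simp add: zero_scale_def lookup_add sum.distrib algebra_simps flip: power_int_add)

text \<open>The variables below \<open>N - 1\<close> are those of the lambdas and the next two those
  of the Heisenberg algebra; all further variables are inert and alternate between the
  factors.\<close>

definition iota1 :: "nat \<Rightarrow> nat \<Rightarrow> nat" where
  "iota1 N r = (if r < N - 1 then r else N + 1 + 2 * (r - (N - 1)))"

definition iota2 :: "nat \<Rightarrow> nat \<Rightarrow> nat" where
  "iota2 N r = (if r < 2 then N - 1 + r else N + 2 + 2 * (r - 2))"

lemma relabel_theta:
  assumes N: "N \<ge> 2" and s3: "s3 \<noteq> 0"
  shows "relabel (iota1 N) (iota2 N) (theta1 N) (theta2 N) (zero_scale N s3)"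
proof
  show "inj (iota1 N)" using N by (auto simp: inj_def iota1_def)
  show "inj (iota2 N)" using N by (auto simp: inj_def iota2_def)
  show "iota1 N r \<noteq> iota2 N s" for r s
    unfolding iota1_def iota2_def using N by (auto split: if_splits) presburger+
  show "r \<in> range (iota1 N) \<union> range (iota2 N)" for r
  proof -
    consider "r < N - 1" | "r = N - 1" | "r = N" | k where "r = N + 1 + 2 * k" | k where "r = N + 2 + 2 * k"
    proof -
      assume *: "r < N - 1 \<Longrightarrow> thesis" "r = N - 1 \<Longrightarrow> thesis" "r = N \<Longrightarrow> thesis"
        "\<And>k. r = N + 1 + 2 * k \<Longrightarrow> thesis" "\<And>k. r = N + 2 + 2 * k \<Longrightarrow> thesis"
      have "r < N - 1 \<or> r = N - 1 \<or> r = N \<or> r = N + 1 + 2 * ((r - (N + 1)) div 2) \<or> r = N + 2 + 2 * ((r - (N + 1)) div 2)"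
        using N by presburger
      then show thesis using * by blast
    qed
    then show ?thesis
    proof cases
      case 1
      then have "r = iota1 N r" by (simp add: iota1_def)
      then show ?thesis by blast
    next
      case 2
      then have "r = iota2 N 0" by (simp add: iota2_def)
      then show ?thesis by blast
    next
      case 3
      then have "r = iota2 N 1" using N by (simp add: iota2_def)
      then show ?thesis by blast
    next
      case (4 k)
      then have "r = iota1 N (N - 1 + k)" by (simp add: iota1_def)
      then show ?thesis by blast
    next
      case (5 k)
      then have "r = iota2 N (2 + k)" by (simp add: iota2_def)
      then show ?thesis by blast
    qed
  qed
  show "bij (\<lambda>g. (theta1 N g, theta2 N g))"
    using inj_theta[OF N] surj_theta[OF N] by (simp add: bij_def)
  show "zero_scale N s3 g \<noteq> 0" for g using s3 by (simp add: zero_scale_def)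
qed

text \<open>The form \<open>eps\<close> on the directions \<open>X_0\<close>,
  \<open>X_1 ... X_j\<close> and \<open>X_{N+1}\<close>, numbered 0, 1, 2. It is independent of
  \<open>j\<close> because \<open>X_2, ..., X_N\<close> are central.\<close>

definition heis_param :: "nat \<Rightarrow> complex \<Rightarrow> nat \<Rightarrow> nat \<Rightarrow> complex" where
  "heis_param N q i j = q powi (if i = 1 \<and> j = 0 then 1 else if i = 0 \<and> j = 1 then -1
     else if i = 2 \<and> j = 1 then 1 else if i = 1 \<and> j = 2 then -1
     else if i = 0 \<and> j = 2 then int N - 1 else if i = 2 \<and> j = 0 then 1 - int N else 0)"

lemma bichar_theta2:
  assumes N: "N \<ge> 2" and q: "q \<noteq> 0"
  shows "quiver_cocycle (Qsub N q1 q3) q g h = bichar 3 (heis_param N q) (theta2 N g) (theta2 N h)"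
proof -
  let ?e = "eps (Qsub N q1 q3)"
  let ?A = "keys g \<union> {0, 1, N + 1}" and ?B = "keys h \<union> {0, 1, N + 1}"
  have "(\<Sum>i\<in>?A. \<Sum>j\<in>?B. ?e i j * lookup g i * lookup h j) = (\<Sum>i\<in>?A. \<Sum>j\<in>{0, 1, N + 1}. ?e i j * lookup g i * lookup h j)"
    by (intro sum.cong refl sum.mono_neutral_right) (auto simp: eps_Qsub[OF N])
  also have "\<dots> = (\<Sum>i\<in>{0, 1, N + 1}. \<Sum>j\<in>{0, 1, N + 1}. ?e i j * lookup g i * lookup h j)"
    using N by (intro sum.mono_neutral_right) (auto simp: eps_Qsub[OF N])
  also have "\<dots> = lookup g 1 * lookup h 0 - lookup g 0 * lookup h 1 + lookup g (N + 1) * lookup h 1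
      - lookup g 1 * lookup h (N + 1) + (int N - 1) * (lookup g 0 * lookup h (N + 1) - lookup g (N + 1) * lookup h 0)"
    using N by (simp add: eps_Qsub[OF N] algebra_simps)
  finally have e: "(\<Sum>i\<in>?A. \<Sum>j\<in>?B. ?e i j * lookup g i * lookup h j) = \<dots>" .
  have fin: "finite ?A" "finite ?B" by simp_all
  note l = quiver_cocycle_superset[OF fin Un_upper1 Un_upper1, of "Qsub N q1 q3" q, unfolded e]
  have three: "(\<Prod>i<3. f i) = f 0 * f 1 * f 2" for f :: "nat \<Rightarrow> complex"
    by (simp add: numeral_3_eq_3 numeral_2_eq_2)
  have l2: "lookup (theta2 N g) 0 = lookup g 0" "lookup (theta2 N g) 1 = lookup g 1" "lookup (theta2 N g) 2 = lookup g (N + 1)" for g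
    by (simp_all add: lookup_theta theta2_fun_def)
  have p: "heis_param N q 0 0 = 1" "heis_param N q 1 1 = 1" "heis_param N q 2 2 = 1" "heis_param N q 1 0 = q powi 1"
    "heis_param N q 0 1 = q powi (-1)" "heis_param N q 2 1 = q powi 1" "heis_param N q 1 2 = q powi (-1)"
    "heis_param N q 0 2 = q powi (int N - 1)" "heis_param N q 2 0 = q powi (1 - int N)"
    by (simp_all add: heis_param_def)
  have r: "bichar 3 (heis_param N q) (theta2 N g) (theta2 N h) = q powi (lookup g 1 * lookup h 0 - lookup g 0 * lookup h 1 + lookup g (N + 1) * lookup h 1
      - lookup g 1 * lookup h (N + 1) + (int N - 1) * (lookup g 0 * lookup h (N + 1) - lookup g (N + 1) * lookup h 0))"
    unfolding bichar_def three l2 p power_int_mult[symmetric] using q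
    by (simp only: power_int_1_left mult_1 mult_1_right power_int_add[symmetric] simp_thms) (rule arg_cong, simp add: algebra_simps)
  show ?thesis by (simp only: l r)
qed

section \<open>The words of the Miura expansion\<close>

definition scale_word :: "complex \<Rightarrow> fword \<Rightarrow> fword" where
  "scale_word b w = map (\<lambda>(i, a). (i, b * a)) w"

definition unit_word :: "nat \<Rightarrow> fword" where
  "unit_word k = map (\<lambda>i. (i, 1)) [1..<k + 1]"

lemma scale_word_simps:
  "scale_word b [] = []" "scale_word b ((i, a) # w) = (i, b * a) # scale_word b w"
  "scale_word b (w @ w') = scale_word b w @ scale_word b w'" "fst ` set (scale_word b w) = fst ` set w"
  by (simp_all add: scale_word_def image_image case_prod_unfold)

lemma scale_word_sums:
  "(\<Sum>(i, a)\<leftarrow>scale_word b w. f i a) = (\<Sum>(i, a)\<leftarrow>w. f i (b * a))"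
  "(\<Prod>(i, a)\<leftarrow>scale_word b w. g i a) = (\<Prod>(i, a)\<leftarrow>w. g i (b * a))"
  by (induction w) (auto simp: scale_word_simps)

lemma unit_word_sum: "(\<Sum>(i, a)\<leftarrow>unit_word k. f i a) = (\<Sum>i=1..k. f i 1 :: complex)"
  by (induction k) (simp_all add: unit_word_def)

lemma fst_unit_word: "fst ` set (unit_word k) = {1..k}"
  by (auto simp: unit_word_def image_iff)

text \<open>The word of \<open>:Y\<^bsub>N+1-j\<^sub>1\<^esub>(z) Y\<^bsub>N+1-j\<^sub>2\<^esub>(q\<^sub>3z) \<dots>:\<close> with \<open>Y\<^sub>k = X\<^sub>1 \<cdots> X\<^sub>k\<close>.\<close>

primrec yword :: "nat \<Rightarrow> complex \<Rightarrow> nat list \<Rightarrow> fword" where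
  "yword N q3 [] = []"
| "yword N q3 (j # js) = unit_word (N + 1 - j) @ scale_word q3 (yword N q3 js)"

definition lword :: "complex \<Rightarrow> nat list \<Rightarrow> fword" where
  "lword q3 js = zip js (map (\<lambda>s. q3 ^ s) [0..<length js])"

lemma lword_simps:
  "lword q3 [] = []" "lword q3 (j # js) = (j, 1) # scale_word q3 (lword q3 js)"
proof -
  have "map (\<lambda>s. q3 ^ s) [0..<Suc k] = 1 # map (\<lambda>x. q3 * x) (map (\<lambda>s. q3 ^ s) [0..<k])" for k
    by (simp only: map_upt_Suc) simp
  then show "lword q3 (j # js) = (j, 1) # scale_word q3 (lword q3 js)"
    by (simp add: lword_def scale_word_def zip_map2 comp_def case_prod_unfold del: upt_Suc)
qed (simp add: lword_def)

definition strict_lists :: "nat \<Rightarrow> nat \<Rightarrow> nat list set" where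
  "strict_lists a b = {js. sorted_wrt (<) js \<and> set js \<subseteq> {a..b}}"

lemma strict_lists_step:
  assumes "a \<le> b"
  shows "strict_lists a b = strict_lists (Suc a) b \<union> (#) a ` strict_lists (Suc a) b"
proof (intro equalityI subsetI)
  fix js assume js: "js \<in> strict_lists a b"
  show "js \<in> strict_lists (Suc a) b \<union> (#) a ` strict_lists (Suc a) b"
  proof (cases js)
    case (Cons j ks)
    have le: "a \<le> j" and lt: "\<forall>k\<in>set ks. j < k" and rest: "sorted_wrt (<) ks" "set ks \<subseteq> {a..b}" "j \<le> b"
      using js by (auto simp: Cons strict_lists_def)
    have ks: "ks \<in> strict_lists (Suc a) b" using le lt rest by (force simp: strict_lists_def)
    show ?thesis
    proof (cases "j = a")
      case True
      then show ?thesis using ks by (simp add: Cons)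
    next
      case False
      then have "js \<in> strict_lists (Suc a) b" using le lt rest by (force simp: Cons strict_lists_def)
      then show ?thesis by simp
    qed
  qed (simp add: strict_lists_def)
next
  fix js assume "js \<in> strict_lists (Suc a) b \<union> (#) a ` strict_lists (Suc a) b"
  then show "js \<in> strict_lists a b" using assms by (force simp: strict_lists_def)
qed

lemma finite_strict_lists: "finite (strict_lists a b)"
proof (rule finite_subset)
  show "strict_lists a b \<subseteq> {js. set js \<subseteq> {a..b} \<and> distinct js}"
    by (auto simp: strict_lists_def strict_sorted_iff)
  show "finite {js. set js \<subseteq> {a..b} \<and> distinct js}" by (rule finite_subset_distinct) simp
qed

text \<open>The leftmost factor either contributes 1 or puts \<open>Y_{k+1}(z)\<close> in front and
  shifts all later arguments by \<open>q3\<close>. As \<open>Y_k\<close> has the index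
  \<open>N + 1 - k\<close>, a new factor has the smallest index so far, whence increasing
  lists.\<close>

lemma sum_miura:
  fixes F :: "fword \<Rightarrow> 'a::comm_monoid_add"
  assumes "k \<le> N"
  shows "(\<Sum>w\<leftarrow>miura q3 k. F w) = (\<Sum>js\<in>strict_lists (N + 1 - k) N. F (yword N q3 js))"
  using assms
proof (induction k arbitrary: F)
  case 0
  have "strict_lists (Suc N) N = {[]}" by (auto simp: strict_lists_def)
  then show ?case by simp
next
  case (Suc k)
  let ?a = "N - k"
  let ?S = "strict_lists (Suc ?a) N"
  have a: "Suc ?a = N + 1 - k" "N + 1 - Suc k = ?a" "?a \<le> N" using Suc.prems by auto
  have len: "N + 1 - ?a = k + 1" using Suc.prems by simp
  have yw: "yword N q3 (?a # js) = unit_word (k + 1) @ scale_word q3 (yword N q3 js)" for js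
    by (simp only: yword.simps len)
  have "(\<Sum>w\<leftarrow>miura q3 (Suc k). F w) = (\<Sum>w\<leftarrow>miura q3 k. F w)
      + (\<Sum>w\<leftarrow>miura q3 k. F (unit_word (k + 1) @ scale_word q3 w))"
    by (simp add: comp_def unit_word_def scale_word_def del: upt_Suc)
  also have "\<dots> = (\<Sum>js\<in>?S. F (yword N q3 js)) + (\<Sum>js\<in>?S. F (yword N q3 (?a # js)))"
    using Suc.prems unfolding a yw
    by (simp only: Suc.IH[of F] Suc.IH[of "\<lambda>w. F (unit_word (k + 1) @ scale_word q3 w)"] Suc_leD)
  also have "(\<Sum>js\<in>?S. F (yword N q3 (?a # js))) = (\<Sum>js\<in>(#) ?a ` ?S. F (yword N q3 js))"
    by (subst sum.reindex) (auto simp del: yword.simps)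
  also have "(\<Sum>js\<in>?S. F (yword N q3 js)) + \<dots> = (\<Sum>js\<in>?S \<union> (#) ?a ` ?S. F (yword N q3 js))"
    by (rule sum.union_disjoint[symmetric])
       (auto simp: finite_strict_lists, auto simp: strict_lists_def)
  finally show ?case unfolding a strict_lists_step[OF a(3)] .
qed

lemma sum_list_scale:
  fixes c :: complex
  shows "(\<Sum>(i, a)\<leftarrow>w. c * h a * f i) = c * (\<Sum>(i, a)\<leftarrow>w. h a * f i)"
  by (induction w) (auto simp: algebra_simps)

text \<open>Each block \<open>X_1 ... X_{N+1-j}\<close> telescopes to \<open>\<lambda>_j\<close>,
  and the multiplicative weight \<open>h\<close> turns the shift by \<open>q3\<close> into the
  factor \<open>c\<close>.\<close>

lemma yword_left_part:
  fixes h :: "complex \<Rightarrow> complex"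
  assumes h: "\<And>a. h (q3 * a) = c * h a" "h 1 = 1" and js: "set js \<subseteq> {1..N}"
  shows "(\<Sum>(i, a)\<leftarrow>yword N q3 js. h a * left_part N l i r) = (\<Sum>(i, a)\<leftarrow>lword q3 js. h a * l i r)"
  using js
proof (induction js)
  case (Cons j js)
  note sh = sum_list_scale[of c h]
  have j: "1 \<le> N + 1 - j" "N + 1 - j \<le> N" "N + 1 - (N + 1 - j) = j" using Cons.prems by auto
  have "(\<Sum>i=1..N + 1 - j. h 1 * left_part N l i r) = l j r"
    using sum_left_part[OF j(1,2), of l r] unfolding j(3) by (simp add: h(2))
  then show ?case using Cons
    by (simp add: lword_simps scale_word_sums unit_word_sum h sh del: One_nat_def)
qed (simp add: lword_simps)

text \<open>Of each block only \<open>X_1\<close> has a right part, so the result depends on the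
  number of blocks alone.\<close>

lemma yword_right_part:
  fixes h :: "complex \<Rightarrow> complex"
  assumes h: "\<And>a. h (q3 * a) = c * h a" "h 1 = 1" and js: "set js \<subseteq> {1..N}"
  shows "(\<Sum>(i, a)\<leftarrow>yword N q3 js. h a * right_part N x i r) = (\<Sum>t<length js. c ^ t) * x 1 r"
  using js
proof (induction js)
  case (Cons j js)
  note sh = sum_list_scale[of c h]
  have j: "1 \<le> N + 1 - j" "N + 1 - j \<le> N" using Cons.prems by auto
  have "(\<Sum>i=1..N + 1 - j. h 1 * right_part N x i r) = x 1 r"
    using sum_right_part[OF j(1,2), of x r] by (simp add: h(2))
  moreover have "(\<Sum>t<Suc (length js). c ^ t) = 1 + c * (\<Sum>t<length js. c ^ t)"
    by (simp add: sum.lessThan_Suc_shift sum_distrib_left del: sum.lessThan_Suc)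
  moreover from calculation have "(\<Sum>(i, a)\<leftarrow>yword N q3 (j # js). h a * right_part N x i r)
      = x 1 r + c * ((\<Sum>t<length js. c ^ t) * x 1 r)"
    using Cons by (simp add: scale_word_sums unit_word_sum h sh del: One_nat_def)
  ultimately show ?case by (simp only: length_Cons) (simp add: algebra_simps del: sum.lessThan_Suc)
qed simp

definition word_lattice :: "fword \<Rightarrow> lattice" where
  "word_lattice w = (\<Sum>(i, a)\<leftarrow>w. single i 1)"

lemma word_lattice_simps:
  "word_lattice [] = 0" "word_lattice (w @ w') = word_lattice w + word_lattice w'"
  "word_lattice (scale_word b w) = word_lattice w" "word_lattice [(i, a)] = single i 1"
  by (simp_all add: word_lattice_def scale_word_sums)

lemma yword_vertices: "set js \<subseteq> {1..N} \<Longrightarrow> fst ` set (yword N q3 js) \<subseteq> {1..N}"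
  by (induction js) (auto simp: image_Un scale_word_simps fst_unit_word)

lemma lookup_word_lattice: "i \<notin> fst ` set w \<Longrightarrow> lookup (word_lattice w) i = 0"
  by (induction w) (auto simp: word_lattice_def lookup_add lookup_single)

lemma theta_zero: "theta1 N 0 = 0" "theta2 N 0 = 0"
  by (rule poly_mapping_eqI, simp add: lookup_theta theta1_fun_def theta2_fun_def incr_def)+

lemma zero_scale_zero: "zero_scale N s3 0 = 1"
  by (simp add: zero_scale_def)

lemma theta_Y:
  assumes N: "N \<ge> 2" and j: "j \<in> {1..N}" and s3: "s3 \<noteq> 0"
  defines "g \<equiv> word_lattice (unit_word (N + 1 - j))"
  shows "theta1 N g = lam0 N j" "theta2 N g = single 1 1"
    "zero_scale N s3 g = s3 powi (2 * int j - int N - 1)"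
proof -
  have g: "lookup g i = (if 1 \<le> i \<and> i \<le> N + 1 - j then 1 else 0)" for i
  proof -
    have "lookup (word_lattice (unit_word k)) i = (if 1 \<le> i \<and> i \<le> k then 1 else 0)" for k
      by (induction k) (auto simp: word_lattice_def unit_word_def lookup_add lookup_single when_def)
    then show ?thesis by (simp add: g_def)
  qed
  have incr: "incr N (lookup g) i = (if i = N + 1 - j then 1 else 0)" if "1 \<le> i" "i \<le> N" for i
    using that j by (auto simp: incr_def g)
  show "theta1 N g = lam0 N j"
  proof (rule poly_mapping_eqI)
    fix i
    have l: "lookup (lam0 N j) i = (if j < N then (if i = j then 1 else 0) else (if i \<in> {1..<N} then - 1 else 0))"
      by (auto simp: lam0_def lookup_single when_def lookup_sum)
    consider "i = 0" | "1 \<le> i" "i < N" | "N \<le> i" by linarith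
    then show "lookup (theta1 N g) i = lookup (lam0 N j) i"
    proof cases
      case 1
      then show ?thesis using N j unfolding l lookup_theta theta1_fun_def by (simp add: g)
    next
      case 2
      have "incr N (lookup g) (N + 1 - i) = (if i = j then 1 else 0)" using incr[of "N + 1 - i"] 2 j by auto
      moreover have "incr N (lookup g) 1 = (if j = N then 1 else 0)" using incr[of 1] N j by auto
      moreover have "lookup g (N + 2) = 0" using j by (simp add: g)
      moreover have "j \<le> N" using j by simp
      ultimately show ?thesis using 2 by (simp add: l lookup_theta theta1_fun_def)
    next
      case 3
      then show ?thesis using N j unfolding l lookup_theta theta1_fun_def by (simp add: g)
    qed
  qed
  show "theta2 N g = single 1 1"
    using N j by (intro poly_mapping_eqI) (auto simp: lookup_theta theta2_fun_def g lookup_single when_def)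
  have "(\<Sum>i=2..N. lookup g i) = (\<Sum>i=2..N + 1 - j. 1)"
    using j by (intro sum.mono_neutral_cong_right) (auto simp: g)
  moreover have "(\<Sum>i=2..N + 1 - j. 1) = int N - int j" using j by (simp add: of_nat_diff)
  moreover have "lookup g 1 = 1" using j by (auto simp: g)
  ultimately have "(int N - 1) * lookup g 1 - 2 * (\<Sum>i=2..N. lookup g i) = 2 * int j - int N - 1"
    by (simp only:) simp
  then show "zero_scale N s3 g = s3 powi (2 * int j - int N - 1)" by (simp only: zero_scale_def)
qed

lemma theta_yword:
  assumes N: "N \<ge> 2" and s3: "s3 \<noteq> 0" and js: "set js \<subseteq> {1..N}"
  shows "theta1 N (word_lattice (yword N q3 js)) = (\<Sum>(i, a)\<leftarrow>lword q3 js. lam0 N i) \<and>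
    theta2 N (word_lattice (yword N q3 js)) = single 1 (int (length js)) \<and>
    zero_scale N s3 (word_lattice (yword N q3 js)) = (\<Prod>(i, a)\<leftarrow>lword q3 js. s3 powi (2 * int i - int N - 1))"
  using js
proof (induction js)
  case (Cons j js)
  let ?g = "word_lattice (unit_word (N + 1 - j))"
  have split: "word_lattice (yword N q3 (j # js)) = ?g + word_lattice (yword N q3 js)"
    by (simp only: yword.simps word_lattice_simps)
  have j: "j \<in> {1..N}" and js: "set js \<subseteq> {1..N}" using Cons.prems by simp_all
  note IH = Cons.IH[OF js, THEN conjunct1] Cons.IH[OF js, THEN conjunct2, THEN conjunct1]
    Cons.IH[OF js, THEN conjunct2, THEN conjunct2]
  have "lookup ?g (N + 2) = 0" by (rule lookup_word_lattice) (use j in \<open>auto simp: fst_unit_word\<close>)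
  note add = theta_add[OF this] zero_scale_add[OF s3]
  note Y = theta_Y[OF N j s3]
  show ?case
    unfolding split add Y IH by (simp add: lword_simps scale_word_sums single_add)
qed (simp_all add: word_lattice_simps lword_simps theta_zero zero_scale_zero)

section \<open>The intertwiner\<close>

definition word_coeff :: "(nat \<Rightarrow> complex \<Rightarrow> complex) \<Rightarrow> (nat \<Rightarrow> nat \<Rightarrow> nat \<Rightarrow> complex) \<Rightarrow> fword \<Rightarrow> nat \<Rightarrow> nat \<Rightarrow> complex" where
  "word_coeff h x w n r = (\<Sum>(i, a)\<leftarrow>w. h n a * x i n r)"

abbreviation (input) pos :: "nat \<Rightarrow> complex \<Rightarrow> complex" where "pos n a \<equiv> a ^ n"
abbreviation (input) neg :: "nat \<Rightarrow> complex \<Rightarrow> complex" where "neg n a \<equiv> (1 / a) ^ n"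

lemma Xcur_vertex_op:
  "Xcur Q q R u v w = vertex_op (torus (quiver_cocycle Q q) (word_lattice w))
     (cre R (word_coeff pos u w)) (ann R (word_coeff neg v w))"
  by (simp add: Xcur_def normal_ordered_osc word_lattice_def word_coeff_def[abs_def])

lemma Lcur_vertex_op:
  "Lcur N s3 u v w = vertex_op (csc (\<Prod>(i, a)\<leftarrow>w. s3 powi (2 * int i - int N - 1)) * torus (\<lambda>_ _. 1) (\<Sum>(i, a)\<leftarrow>w. lam0 N i))
     (cre (N - 1) (word_coeff pos u w)) (ann (N - 1) (word_coeff neg v w))"
  by (simp add: Lcur_def normal_ordered_osc word_coeff_def[abs_def])

lemma sum_word_coeff:
  "(\<Sum>r<R. c r * word_coeff h x w n r) = (\<Sum>(i, a)\<leftarrow>w. h n a * (\<Sum>r<R. c r * x i n r))"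
  "(\<Sum>r<R. word_coeff h x w n r * c r) = (\<Sum>(i, a)\<leftarrow>w. h n a * (\<Sum>r<R. x i n r * c r))"
  by (induction w) (auto simp: word_coeff_def distrib_left distrib_right sum.distrib sum_distrib_left mult_ac)

lemma realization_exists:
  assumes N: "N \<ge> 2" and gen: "generic_parameters q1 q2 q3" and q: "q\<^sup>2 = q2"
    and Q: "quiver_realization (Qsub N q1 q3) q (N + 1) u v"
    and lam: "lambda_realization N q1 q2 q3 ul vl"
  shows "\<exists>xu xv M M'. (\<forall>n r t. r < N + 1 \<longrightarrow> t < N + 1 \<longrightarrow> (\<Sum>s<N + 1. M n r s * M' n s t) = (if r = t then 1 else 0))
    \<and> (\<forall>n r t. r < N + 1 \<longrightarrow> t < N + 1 \<longrightarrow> (\<Sum>s<N + 1. M' n r s * M n s t) = (if r = t then 1 else 0))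
    \<and> (\<forall>n>0. \<forall>j\<in>{0..N + 1}. \<forall>s<N + 1. (\<Sum>r<N + 1. M n s r * u j n r) = both_parts N (\<lambda>a. ul a n) (xu n) j s)
    \<and> (\<forall>n>0. \<forall>i\<in>{0..N + 1}. \<forall>s<N + 1. (\<Sum>r<N + 1. v i n r * M' n r s) = both_parts N (\<lambda>a. vl a n) (xv n) i s)"
proof -
  define P where "P n xu xv M M' \<longleftrightarrow>
      (\<forall>r t. r < N + 1 \<longrightarrow> t < N + 1 \<longrightarrow> (\<Sum>s<N + 1. M r s * M' s t) = (if r = t then 1 else 0))
    \<and> (\<forall>r t. r < N + 1 \<longrightarrow> t < N + 1 \<longrightarrow> (\<Sum>s<N + 1. M' r s * M s t) = (if r = t then 1 else 0))
    \<and> (n > 0 \<longrightarrow> (\<forall>j\<in>{0..N + 1}. \<forall>s<N + 1. (\<Sum>r<N + 1. M s r * u j n r) = both_parts N (\<lambda>a. ul a n) xu j s))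
    \<and> (n > 0 \<longrightarrow> (\<forall>i\<in>{0..N + 1}. \<forall>s<N + 1. (\<Sum>r<N + 1. v i n r * M' r s) = both_parts N (\<lambda>a. vl a n) xv i s))"
    for n xu xv and M M' :: "nat \<Rightarrow> nat \<Rightarrow> complex"
  \<comment> \<open>The data of one mode are packed into a quadruple so that a single choice
    collects them over all \<open>n\<close>.\<close>
  have "\<exists>X. P n (fst X) (fst (snd X)) (fst (snd (snd X))) (snd (snd (snd X)))" for n
  proof (cases "n = 0")
    \<comment> \<open>There are no oscillators of mode 0, but the change of variables asks for an
      invertible matrix there as well; the identity will do.\<close>
    case True
    have "(\<Sum>s<N + 1. (if r = s then 1 else 0) * (if s = t then 1 else 0)) = (if r = t then 1 else (0::complex))"
      if "r < N + 1" for r t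
    proof -
      have "(\<Sum>s<N + 1. (if r = s then 1 else 0) * (if s = t then 1 else 0)) =
          (\<Sum>s<N + 1. if s = r then (if r = t then 1 else (0::complex)) else 0)"
        by (intro sum.cong refl) auto
      then show ?thesis using that by simp
    qed
    then show ?thesis using True
      by (intro exI[of _ "(\<lambda>_ _. 0, \<lambda>_ _. 0, \<lambda>r s. if r = s then 1 else 0, \<lambda>r s. if r = s then 1 else 0)"])
         (simp add: P_def)
  next
    case False
    then have n: "n > 0" by simp
    obtain xu xv where
      gram: "\<forall>i\<in>{0..N + 1}. \<forall>j\<in>{0..N + 1}.
        (\<Sum>r<N + 1. both_parts N (\<lambda>a. vl a n) xv i r * both_parts N (\<lambda>a. ul a n) xu j r)
        = Cmat (Qsub N q1 q3) q n i j / of_nat n"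
      and su: "\<forall>s<N + 1. spanned {0..N + 1} (N + 1) (both_parts N (\<lambda>a. ul a n) xu) (\<lambda>r. if r = s then 1 else 0)"
      and sv: "\<forall>s<N + 1. spanned {0..N + 1} (N + 1) (both_parts N (\<lambda>a. vl a n) xv) (\<lambda>r. if r = s then 1 else 0)"
      using target_gram[OF N gen q lam n] by blast
    obtain cu where cu: "\<forall>s<N + 1. \<forall>r<N + 1. (\<Sum>j\<in>{0..N + 1}. cu s j * both_parts N (\<lambda>a. ul a n) xu j r) = (if s = r then 1 else 0)"
      using spanned_basis_coeffs[of "N + 1" "{0..N + 1}" "both_parts N (\<lambda>a. ul a n) xu"] su by blast
    obtain cv where cv: "\<forall>s<N + 1. \<forall>r<N + 1. (\<Sum>j\<in>{0..N + 1}. cv s j * both_parts N (\<lambda>a. vl a n) xv j r) = (if s = r then 1 else 0)"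
      using spanned_basis_coeffs[of "N + 1" "{0..N + 1}" "both_parts N (\<lambda>a. vl a n) xv"] sv by blast
    have g: "(\<Sum>r<N + 1. v i n r * u j n r) = (\<Sum>r<N + 1. both_parts N (\<lambda>a. vl a n) xv i r * both_parts N (\<lambda>a. ul a n) xu j r)"
      if "i \<in> {0..N + 1}" "j \<in> {0..N + 1}" for i j
    proof -
      have "(\<Sum>r<N + 1. v i n r * u j n r) = Cmat (Qsub N q1 q3) q n i j / of_nat n"
        using Q n that unfolding quiver_realization_def by (simp add: Qsub_def)
      then show ?thesis using gram that by simp
    qed
    have cv': "(\<Sum>j\<in>{0..N + 1}. cv r j * both_parts N (\<lambda>a. vl a n) xv j s) = (if r = s then 1 else 0)"
      if "r < N + 1" "s < N + 1" for r s using cv that by blast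
    have cu': "(\<Sum>j\<in>{0..N + 1}. both_parts N (\<lambda>a. ul a n) xu j r * cu s j) = (if r = s then 1 else 0)"
      if "r < N + 1" "s < N + 1" for r s
    proof -
      have "(\<Sum>j\<in>{0..N + 1}. cu s j * both_parts N (\<lambda>a. ul a n) xu j r) = (if s = r then 1 else 0)" using cu that by blast
      then show ?thesis by (simp only: mult.commute[of "both_parts N (\<lambda>a. ul a n) xu _ r"] eq_commute[of r s])
    qed
    obtain M M' where "\<And>r t. r < N + 1 \<Longrightarrow> t < N + 1 \<Longrightarrow> (\<Sum>s<N + 1. M r s * M' s t) = (if r = t then 1 else 0)"
        "\<And>r t. r < N + 1 \<Longrightarrow> t < N + 1 \<Longrightarrow> (\<Sum>s<N + 1. M' r s * M s t) = (if r = t then 1 else 0)"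
        "\<And>j s. j \<in> {0..N + 1} \<Longrightarrow> s < N + 1 \<Longrightarrow> (\<Sum>r<N + 1. M s r * u j n r) = both_parts N (\<lambda>a. ul a n) xu j s"
        "\<And>i s. i \<in> {0..N + 1} \<Longrightarrow> s < N + 1 \<Longrightarrow> (\<Sum>r<N + 1. v i n r * M' r s) = both_parts N (\<lambda>a. vl a n) xv i s"
      using gram_intertwiner[where J = "{0..N + 1}" and R = "N + 1" and V = "\<lambda>i. v i n" and U = "\<lambda>j. u j n"
          and V' = "both_parts N (\<lambda>a. vl a n) xv" and U' = "both_parts N (\<lambda>a. ul a n) xu" and P = cv and Q = "\<lambda>j s. cu s j",
          OF g cv' cu'] by blast
    then show ?thesis
      by (intro exI[of _ "(xu, xv, M, M')"]) (simp add: P_def)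
  qed
  then have "\<forall>n. \<exists>X. P n (fst X) (fst (snd X)) (fst (snd (snd X))) (snd (snd (snd X)))" by blast
  from choice[OF this] obtain X where
    X: "\<forall>n. P n (fst (X n)) (fst (snd (X n))) (fst (snd (snd (X n)))) (snd (snd (snd (X n))))" ..
  show ?thesis
    by (intro exI[of _ "\<lambda>n. fst (X n)"] exI[of _ "\<lambda>n. fst (snd (X n))"]
        exI[of _ "\<lambda>n. fst (snd (snd (X n)))"] exI[of _ "\<lambda>n. snd (snd (snd (X n)))"])
       (use X in \<open>simp add: P_def\<close>)
qed

text \<open>\<open>p\<close> is recorded through its effect on the modes \<open>n > 0\<close> of
  words over the vertices of the quiver, which is where the two realizations are known to
  correspond.\<close>

locale intertwiner =
  fixes N :: nat and q q1 q2 q3 s3 :: complex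
    and u v ul vl xu xv :: "nat \<Rightarrow> nat \<Rightarrow> nat \<Rightarrow> complex" and p p' :: "fock lop"
  assumes N: "N \<ge> 2" and gen: "generic_parameters q1 q2 q3" and q2: "q\<^sup>2 = q2" and s3: "s3\<^sup>2 = q3"
    and gram: "n > 0 \<Longrightarrow> i \<in> {0..N + 1} \<Longrightarrow> j \<in> {0..N + 1} \<Longrightarrow>
      (\<Sum>r<N + 1. v i n r * u j n r) = Cmat (Qsub N q1 q3) q n i j / of_nat n"
    and lu: "n > 0 \<Longrightarrow> r < N - 1 \<Longrightarrow> (\<Sum>i=1..N. q3 powi int (i * n) * ul i n r) = 0"
    and lv: "n > 0 \<Longrightarrow> r < N - 1 \<Longrightarrow> (\<Sum>i=1..N. q3 powi (- int (i * n)) * vl i n r) = 0"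
    and pp': "p * p' = 1" and p'p: "p' * p = 1"
    and p_cre: "n > 0 \<Longrightarrow> fst ` set w \<subseteq> {0..N + 1} \<Longrightarrow> p * cre (N + 1) (word_coeff pos u w) n * p' =
      cre (N + 1) (word_coeff pos (\<lambda>i n. both_parts N (\<lambda>a. ul a n) (xu n) i) w) n"
    and p_ann: "n > 0 \<Longrightarrow> fst ` set w \<subseteq> {0..N + 1} \<Longrightarrow> p * ann (N + 1) (word_coeff neg v w) n * p' =
      ann (N + 1) (word_coeff neg (\<lambda>i n. both_parts N (\<lambda>a. vl a n) (xv n) i) w) n"
    and p_torus: "p * torus \<sigma> g * p' = torus \<sigma> g"
begin

lemma nonzero: "q1 \<noteq> 0" "q2 \<noteq> 0" "q3 \<noteq> 0" "q \<noteq> 0" "s3 \<noteq> 0"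
  using genericD(1-3)[OF gen] q2 s3 by auto

sublocale relabel "iota1 N" "iota2 N" "theta1 N" "theta2 N" "zero_scale N s3"
  by (rule relabel_theta[OF N nonzero(5)])

text \<open>Change of variables followed by relabelling. As a conjugation of all operators it is an
  injective homomorphism before any subalgebra is considered.\<close>

definition \<phi> :: "fock lop \<Rightarrow> (fock \<times> fock) lop" where
  "\<phi> a = conj (p * a * p')"

lemma \<phi>_hom: "\<phi> (a * b) = \<phi> a * \<phi> b" "\<phi> (a + b) = \<phi> a + \<phi> b" "\<phi> (csc c) = csc c"
proof -
  have "p * (a * b) * p' = p * a * (p' * p) * b * p'" by (simp add: p'p mult.assoc)
  then show "\<phi> (a * b) = \<phi> a * \<phi> b" by (simp add: \<phi>_def conj_hom(1)[symmetric] mult.assoc)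
  show "\<phi> (a + b) = \<phi> a + \<phi> b" by (simp add: \<phi>_def conj_hom distrib_left distrib_right)
  show "\<phi> (csc c) = csc c" by (simp add: \<phi>_def conj_hom csc_central[symmetric] pp' mult.assoc)
qed

lemma \<phi>_sum: "\<phi> (sum f I) = (\<Sum>i\<in>I. \<phi> (f i))"
proof -
  have "\<phi> 0 = 0" by (simp add: \<phi>_def conj_hom)
  then show ?thesis by (induction I rule: infinite_finite_induct) (simp_all add: \<phi>_hom)
qed

lemma inj_\<phi>: "inj \<phi>"
proof (rule injI)
  fix a b assume "\<phi> a = \<phi> b"
  then have "p * a * p' = p * b * p'" unfolding \<phi>_def by (rule injD[OF inj_conj])
  then have "p' * (p * a * p') * p = p' * (p * b * p') * p" by simp
  then have "(p' * p) * a * (p' * p) = (p' * p) * b * (p' * p)" by (simp only: mult.assoc)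
  then show "a = b" by (simp add: p'p)
qed

definition right_zero :: "fword \<Rightarrow> fock lop" where
  "right_zero w = torus (bichar 3 (heis_param N q)) (theta2 N (word_lattice w))"

definition left_cur :: "fword \<Rightarrow> fock current" where
  "left_cur w = vertex_op (csc (zero_scale N s3 (word_lattice w)) * torus (\<lambda>_ _. 1) (theta1 N (word_lattice w)))
     (cre (N - 1) (word_coeff pos (\<lambda>i n. left_part N (\<lambda>a. ul a n) i) w))
     (ann (N - 1) (word_coeff neg (\<lambda>i n. left_part N (\<lambda>a. vl a n) i) w))"

definition right_cur :: "fword \<Rightarrow> fock current" where
  "right_cur w = vertex_op (right_zero w)
     (cre 2 (word_coeff pos (\<lambda>i n. right_part N (xu n) i) w))
     (ann 2 (word_coeff neg (\<lambda>i n. right_part N (xv n) i) w))"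

lemma both_parts_split:
  "r < N - 1 \<Longrightarrow> word_coeff h (\<lambda>i n. both_parts N (l n) (x n) i) w n r = word_coeff h (\<lambda>i n. left_part N (l n) i) w n r"
  "word_coeff h (\<lambda>i n. both_parts N (l n) (x n) i) w n (N - 1 + s) = word_coeff h (\<lambda>i n. right_part N (x n) i) w n s"
proof -
  have "both_parts N l x k (N - 1 + s) = right_part N x k s" for l x k s
    unfolding both_parts_def by (simp only: add_diff_cancel_left' not_add_less1 if_False)
  then show "word_coeff h (\<lambda>i n. both_parts N (l n) (x n) i) w n (N - 1 + s) = word_coeff h (\<lambda>i n. right_part N (x n) i) w n s"
    by (simp only: word_coeff_def)
qed (simp add: word_coeff_def both_parts_def)

lemma conj_cre:
  "conj (cre (N + 1) (word_coeff h (\<lambda>i n. both_parts N (l n) (x n) i) w) n) =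
    tensL (cre (N - 1) (word_coeff h (\<lambda>i n. left_part N (l n) i) w) n)
    + tensR (cre 2 (word_coeff h (\<lambda>i n. right_part N (x n) i) w) n)"
proof -
  have m: "conj (mulY r n) = tensL (mulY r n)" if "r < N - 1" for r
    using conj_mulY(1)[of r n] that by (simp add: iota1_def)
  have m': "conj (mulY (N - 1 + s) n) = tensR (mulY s n)" if "s < 2" for s
    using conj_mulY(2)[of s n] that by (simp add: iota2_def)
  show ?thesis
    unfolding cre_def sum_split_last_two[OF order.trans[OF one_le_numeral N], of "\<lambda>r. csc (_ r) * mulY r n"] conj_hom conj_sum tens_sum tensL_hom tensR_hom
    by (intro arg_cong2[of _ _ _ _ "(+)"] sum.cong refl) (simp_all only: lessThan_iff both_parts_split m m')
qed

lemma conj_ann: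
  "conj (ann (N + 1) (word_coeff h (\<lambda>i n. both_parts N (l n) (x n) i) w) n) =
    tensL (ann (N - 1) (word_coeff h (\<lambda>i n. left_part N (l n) i) w) n)
    + tensR (ann 2 (word_coeff h (\<lambda>i n. right_part N (x n) i) w) n)"
proof -
  have m: "conj (derY r n) = tensL (derY r n)" if "r < N - 1" for r
    using conj_derY(1)[of r n] that by (simp add: iota1_def)
  have m': "conj (derY (N - 1 + s) n) = tensR (derY s n)" if "s < 2" for s
    using conj_derY(2)[of s n] that by (simp add: iota2_def)
  show ?thesis
    unfolding ann_def sum_split_last_two[OF order.trans[OF one_le_numeral N], of "\<lambda>r. csc (_ r) * derY r n"] conj_hom conj_sum tens_sum tensL_hom tensR_hom
    by (intro arg_cong2[of _ _ _ _ "(+)"] sum.cong refl) (simp_all only: lessThan_iff both_parts_split m m')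
qed

lemma vertex_left: "vertex fdeg (csc c * torus \<sigma> g) (cre R f) (ann R f')"
  by (rule vertex_fock)

lemma vertex_torus: "vertex fdeg (torus \<sigma> g) (cre R f) (ann R f')"
  using vertex_fock[of 1 \<sigma> g R f f'] by simp

lemma word_lattice_inert: "fst ` set w \<subseteq> {0..N + 1} \<Longrightarrow> lookup (word_lattice w) (N + 2) = 0"
  by (rule lookup_word_lattice) auto

text \<open>Both conjugations carry a vertex operator to the vertex operator of the conjugated
  modes. Afterwards each mode is a sum over the two tensor factors and the zero mode a product, so
  \<open>vertex_tensor\<close> splits the current.\<close>

lemma \<phi>_Xcur:
  assumes w: "fst ` set w \<subseteq> {0..N + 1}"
  shows "\<phi> (Xcur (Qsub N q1 q3) q (N + 1) u v w m) =
    current_mult (\<lambda>m. tensR (right_cur w m)) (\<lambda>m. tensL (left_cur w m)) m"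
    and "lfin (\<lambda>j. tensR (right_cur w (m - j)) * tensL (left_cur w j))"
proof -
  let ?\<sigma> = "quiver_cocycle (Qsub N q1 q3) q" and ?g = "word_lattice w"
  let ?U = "word_coeff pos (\<lambda>i n. both_parts N (\<lambda>a. ul a n) (xu n) i) w"
  let ?V = "word_coeff neg (\<lambda>i n. both_parts N (\<lambda>a. vl a n) (xv n) i) w"
  interpret P: vec_iso "app p" "app p'" by (rule vec_iso_lop[OF pp' p'p])
  have Pc: "P.conj a = p * a * p'" for a by (rule vec_iso_lop(2)[OF pp' p'p])
  have "p * Xcur (Qsub N q1 q3) q (N + 1) u v w m * p' =
     vertex_op (torus ?\<sigma> ?g) (\<lambda>n. p * cre (N + 1) (word_coeff pos u w) n * p')
       (\<lambda>n. p * ann (N + 1) (word_coeff neg v w) n * p') m"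
    unfolding Xcur_vertex_op Pc[symmetric] P.conj_vertex_op[OF vertex_torus] unfolding Pc p_torus ..
  also have "\<dots> = vertex_op (torus ?\<sigma> ?g) (cre (N + 1) ?U) (ann (N + 1) ?V) m"
    by (rule fun_cong[OF vertex_op_cong]) (rule p_cre[OF _ w], assumption, rule p_ann[OF _ w], assumption)
  finally have "\<phi> (Xcur (Qsub N q1 q3) q (N + 1) u v w m) =
      vertex_op (conj (torus ?\<sigma> ?g)) (\<lambda>n. conj (cre (N + 1) ?U n)) (\<lambda>n. conj (ann (N + 1) ?V n)) m"
    unfolding \<phi>_def by (simp only: conj_vertex_op[OF vertex_torus])
  moreover have "conj (torus ?\<sigma> ?g) = tensL (csc (zero_scale N s3 ?g) * torus (\<lambda>_ _. 1) (theta1 N ?g)) * tensR (right_zero w)"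
    unfolding right_zero_def
    by (rule conj_torus) (simp_all only: theta_add[OF word_lattice_inert[OF w]] zero_scale_add[OF nonzero(5)] bichar_theta2[OF N nonzero(4)])
  ultimately have eq: "\<phi> (Xcur (Qsub N q1 q3) q (N + 1) u v w m) =
    vertex_op (tensL (csc (zero_scale N s3 ?g) * torus (\<lambda>_ _. 1) (theta1 N ?g)) * tensR (right_zero w))
     (\<lambda>n. tensL (cre (N - 1) (word_coeff pos (\<lambda>i n. left_part N (\<lambda>a. ul a n) i) w) n)
        + tensR (cre 2 (word_coeff pos (\<lambda>i n. right_part N (xu n) i) w) n))
     (\<lambda>n. tensL (ann (N - 1) (word_coeff neg (\<lambda>i n. left_part N (\<lambda>a. vl a n) i) w) n)
        + tensR (ann 2 (word_coeff neg (\<lambda>i n. right_part N (xv n) i) w) n)) m"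
    by (simp only: conj_cre conj_ann)
  interpret T: vertex_tensor fdeg fdeg "csc (zero_scale N s3 ?g) * torus (\<lambda>_ _. 1) (theta1 N ?g)"
    "cre (N - 1) (word_coeff pos (\<lambda>i n. left_part N (\<lambda>a. ul a n) i) w)"
    "ann (N - 1) (word_coeff neg (\<lambda>i n. left_part N (\<lambda>a. vl a n) i) w)"
    "right_zero w"
    "cre 2 (word_coeff pos (\<lambda>i n. right_part N (xu n) i) w)"
    "ann 2 (word_coeff neg (\<lambda>i n. right_part N (xv n) i) w)"
    unfolding vertex_tensor_def right_zero_def by (intro conjI vertex_left vertex_torus)
  show "\<phi> (Xcur (Qsub N q1 q3) q (N + 1) u v w m) =
    current_mult (\<lambda>m. tensR (right_cur w m)) (\<lambda>m. tensL (left_cur w m)) m"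
    unfolding eq T.vertex_op_tensor left_cur_def right_cur_def ..
  show "lfin (\<lambda>j. tensR (right_cur w (m - j)) * tensL (left_cur w j))"
    unfolding left_cur_def right_cur_def by (rule T.lfin_current_mult)
qed

text \<open>The words of \<open>:X\<^bsub>N+1\<^esub>(bz) Y\<^bsub>N+1-j\<^sub>1\<^esub>(bz) \<dots>:\<close>, possibly followed by \<open>X\<^sub>0(z)\<close>.\<close>

definition gword :: "complex \<Rightarrow> nat list \<Rightarrow> fword \<Rightarrow> fword" where
  "gword b js tail = scale_word b ((N + 1, 1) # yword N q3 js) @ tail"

lemma gword_vertices:
  "set js \<subseteq> {1..N} \<Longrightarrow> tail \<in> {[], [(0, 1)]} \<Longrightarrow> fst ` set (gword b js tail) \<subseteq> {0..N + 1}"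
  using yword_vertices[of js N q3] by (auto simp: gword_def scale_word_simps image_Un)

text \<open>The vertices \<open>N + 1\<close> and 0 have no left part; only the Miura blocks
  survive.\<close>

lemma gword_left:
  assumes h: "\<And>n a b. h n (a * b) = h n a * h n b" "\<And>n. h n 1 = 1"
    and js: "set js \<subseteq> {1..N}" and tail: "tail \<in> {[], [(0, 1)]}"
  shows "word_coeff h (\<lambda>i n. left_part N (l n) i) (gword b js tail) n r
    = h n b * word_coeff h (\<lambda>i n. l n i) (lword q3 js) n r"
proof -
  have z: "left_part N (l n) 0 r = 0" "left_part N (l n) (Suc N) r = 0" using N by (simp_all add: left_part_def)
  note sh = sum_list_scale[of "h n b" "h n"]
  show ?thesis
    using yword_left_part[of "h n" q3 "h n q3" js N "l n" r] h js tail z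
    by (auto simp: sh word_coeff_def gword_def scale_word_simps scale_word_sums)
qed

lemma gword_right:
  assumes h: "\<And>n a b. h n (a * b) = h n a * h n b" "\<And>n. h n 1 = 1"
    and js: "set js \<subseteq> {1..N}"
  shows "word_coeff h (\<lambda>i n. right_part N (x n) i) (gword b js tail) n r
    = h n b * (x n 2 r + (\<Sum>t<length js. h n q3 ^ t) * x n 1 r) + word_coeff h (\<lambda>i n. right_part N (x n) i) tail n r"
proof -
  have z: "right_part N (x n) (Suc N) r = x n 2 r" using N by (simp add: right_part_def)
  note sh = sum_list_scale[of "h n b" "h n"]
  show ?thesis
    using yword_right_part[of "h n" q3 "h n q3" js N "x n" r] h js z
    by (auto simp: sh word_coeff_def gword_def scale_word_simps scale_word_sums distrib_left)
qed

lemma pos_neg_mult: "pos n (a * b) = pos n a * pos n b" "pos n 1 = 1" "neg n (a * b) = neg n a * neg n b" "neg n 1 = 1"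
  by (simp_all add: power_mult_distrib power_divide)

lemma gword_lattice:
  assumes js: "set js \<subseteq> {1..N}"
  shows "theta1 N (word_lattice (gword b js tail)) = (\<Sum>(i, a)\<leftarrow>lword q3 js. lam0 N i) + theta1 N (word_lattice tail)"
    "theta2 N (word_lattice (gword b js tail)) = single 2 1 + single 1 (int (length js)) + theta2 N (word_lattice tail)"
    "zero_scale N s3 (word_lattice (gword b js tail)) = (\<Prod>(i, a)\<leftarrow>lword q3 js. s3 powi (2 * int i - int N - 1)) * zero_scale N s3 (word_lattice tail)"
proof -
  have wl: "word_lattice (gword b js tail) = single (N + 1) 1 + (word_lattice (yword N q3 js) + word_lattice tail)"
    by (simp add: gword_def word_lattice_simps add.assoc) (simp add: word_lattice_def)
  have z: "lookup (single (N + 1) (1::int)) (N + 2) = 0" "lookup (word_lattice (yword N q3 js)) (N + 2) = 0"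
    by (simp add: lookup_single) (rule lookup_word_lattice, use yword_vertices[OF js, of q3] in auto)
  have e: "theta1 N (single (N + 1) 1) = 0" "theta2 N (single (N + 1) 1) = single 2 1" "zero_scale N s3 (single (N + 1) 1) = 1"
  proof -
    show "theta1 N (single (N + 1) 1) = 0"
      using N by (intro poly_mapping_eqI) (auto simp: lookup_theta theta1_fun_def incr_def lookup_single when_def)
    show "theta2 N (single (N + 1) 1) = single 2 1"
      using N by (intro poly_mapping_eqI) (auto simp: lookup_theta theta2_fun_def lookup_single when_def)
    show "zero_scale N s3 (single (N + 1) 1) = 1"
      using N by (simp add: zero_scale_def lookup_single when_def)
  qed
  note Y = theta_yword[OF N nonzero(5) js, of q3]
  show "theta1 N (word_lattice (gword b js tail)) = (\<Sum>(i, a)\<leftarrow>lword q3 js. lam0 N i) + theta1 N (word_lattice tail)"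
    "theta2 N (word_lattice (gword b js tail)) = single 2 1 + single 1 (int (length js)) + theta2 N (word_lattice tail)"
    "zero_scale N s3 (word_lattice (gword b js tail)) = (\<Prod>(i, a)\<leftarrow>lword q3 js. s3 powi (2 * int i - int N - 1)) * zero_scale N s3 (word_lattice tail)"
    unfolding wl theta_add[OF z(1)] theta_add[OF z(2)] zero_scale_add[OF nonzero(5)] e by (simp_all add: Y add.assoc)
qed

lemma tail_lattice:
  assumes "tail \<in> {[], [(0, 1)]}"
  shows "theta1 N (word_lattice tail) = 0" "zero_scale N s3 (word_lattice tail) = 1"
    "theta2 N (word_lattice tail) = (if tail = [] then 0 else single 0 1)"
proof -
  have l: "lookup (word_lattice [(0, 1)]) i = (if i = 0 then 1 else 0)" for i
    by (simp only: word_lattice_simps lookup_single when_def eq_commute[of 0])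
  have "theta1 N (word_lattice [(0, 1)]) = 0"
    using N by (intro poly_mapping_eqI) (auto simp: lookup_theta theta1_fun_def incr_def l)
  moreover have "theta2 N (word_lattice [(0, 1)]) = single 0 1"
    by (intro poly_mapping_eqI) (simp only: lookup_theta, auto simp: theta2_fun_def l lookup_single when_def simp del: single_one)
  moreover have "zero_scale N s3 (word_lattice [(0, 1)]) = 1"
    by (simp add: zero_scale_def l)
  ultimately show "theta1 N (word_lattice tail) = 0" "zero_scale N s3 (word_lattice tail) = 1"
    "theta2 N (word_lattice tail) = (if tail = [] then 0 else single 0 1)"
    using assms by (auto simp: word_lattice_simps(1) theta_zero zero_scale_zero simp del: single_one)
qed

lemma left_cur_Lcur:
  assumes js: "set js \<subseteq> {1..N}" and tail: "tail \<in> {[], [(0, 1)]}"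
  shows "left_cur (gword 1 js tail) = Lcur N s3 ul vl (lword q3 js)"
proof -
  have "word_coeff pos (\<lambda>i n. left_part N (\<lambda>a. ul a n) i) (gword 1 js tail) = word_coeff pos ul (lword q3 js)"
    "word_coeff neg (\<lambda>i n. left_part N (\<lambda>a. vl a n) i) (gword 1 js tail) = word_coeff neg vl (lword q3 js)"
    using gword_left[where h = pos and l = "\<lambda>n a. ul a n" and b = 1, OF pos_neg_mult(1,2) js tail]
      gword_left[where h = neg and l = "\<lambda>n a. vl a n" and b = 1, OF pos_neg_mult(3,4) js tail] by (auto simp: fun_eq_iff)
  then show ?thesis
    by (simp only: left_cur_def Lcur_vertex_op gword_lattice[OF js] tail_lattice[OF tail] add_0_right mult_1_right)
qed

text \<open>For the full word the modes are multiples of the constrained combination of the lambdas,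
  the points \<open>lam0\<close> add up to 0, and the exponents of \<open>s3\<close> cancel. As no
  mode is left, the argument \<open>b\<close> is irrelevant to the left factor.\<close>

lemma left_cur_trivial:
  assumes js: "js = [] \<or> js = [1..<N + 1]" and tail: "tail \<in> {[], [(0, 1)]}"
  shows "left_cur (gword b js tail) = one_current"
proof -
  have js': "set js \<subseteq> {1..N}" using js by auto
  have lw: "lword q3 [1..<N + 1] = map (\<lambda>i. (i, q3 ^ (i - 1))) [1..<N + 1]"
    by (rule nth_equalityI) (auto simp: lword_def simp del: upt_Suc)
  have upt: "sum_list (map f [1..<N + 1]) = sum f {1..N}" for f :: "nat \<Rightarrow> 'x::comm_monoid_add"
    by (simp only: interv_sum_list_conv_sum_set_nat set_upt atLeastLessThanSuc_atLeastAtMost Suc_eq_plus1[symmetric])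
  have zu: "word_coeff pos ul (lword q3 js) n r = 0" if "n > 0" "r < N - 1" for n r
  proof (cases "js = []")
    case False
    have "word_coeff pos ul (lword q3 js) n r = (\<Sum>i=1..N. (q3 ^ (i - 1)) ^ n * ul i n r)"
      using js False unfolding word_coeff_def by (simp only: lw map_map o_def prod.case upt simp_thms)
    also have "\<dots> = (\<Sum>i=1..N. 1 / q3 ^ n * (q3 powi int (i * n) * ul i n r))"
    proof (intro sum.cong refl)
      fix i assume "i \<in> {1..N}"
      then obtain k where i: "i = Suc k" by (cases i) auto
      have "q3 powi int (i * n) = q3 ^ n * (q3 ^ k) ^ n"
        by (simp only: i power_int_of_nat mult_Suc power_add power_mult)
      then show "(q3 ^ (i - 1)) ^ n * ul i n r = 1 / q3 ^ n * (q3 powi int (i * n) * ul i n r)"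
        using nonzero(3) by (simp add: i)
    qed
    also have "\<dots> = 0" using lu[OF that] by (simp only: sum_distrib_left[symmetric] mult_zero_right)
    finally show ?thesis .
  qed (simp add: word_coeff_def lword_simps)
  have zv: "word_coeff neg vl (lword q3 js) n r = 0" if "n > 0" "r < N - 1" for n r
  proof (cases "js = []")
    case False
    have "word_coeff neg vl (lword q3 js) n r = (\<Sum>i=1..N. (1 / q3 ^ (i - 1)) ^ n * vl i n r)"
      using js False unfolding word_coeff_def by (simp only: lw map_map o_def prod.case upt simp_thms)
    also have "\<dots> = (\<Sum>i=1..N. q3 ^ n * (q3 powi (- int (i * n)) * vl i n r))"
    proof (intro sum.cong refl)
      fix i assume "i \<in> {1..N}"
      then obtain k where i: "i = Suc k" by (cases i) auto
      have "q3 powi (- int (i * n)) = 1 / (q3 ^ n * (q3 ^ k) ^ n)"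
        by (simp only: i power_int_minus power_int_of_nat inverse_eq_divide mult_Suc power_add power_mult)
      then show "(1 / q3 ^ (i - 1)) ^ n * vl i n r = q3 ^ n * (q3 powi (- int (i * n)) * vl i n r)"
        using nonzero(3) by (simp add: i power_one_over)
    qed
    also have "\<dots> = 0" using lv[OF that] by (simp only: sum_distrib_left[symmetric] mult_zero_right)
    finally show ?thesis .
  qed (simp add: word_coeff_def lword_simps)
  have e: "(\<Sum>(i, a)\<leftarrow>lword q3 js. lam0 N i) = 0"
    "(\<Prod>(i, a)\<leftarrow>lword q3 js. s3 powi (2 * int i - int N - 1)) = 1"
  proof -
    have "(\<Sum>i=1..N. lam0 N i) = 0"
    proof -
      have "{1..N} = insert N {1..<N}" using N by auto
      then have "(\<Sum>i=1..N. lam0 N i) = lam0 N N + (\<Sum>i\<in>{1..<N}. lam0 N i)" by simp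
      also have "(\<Sum>i\<in>{1..<N}. lam0 N i) = (\<Sum>i\<in>{1..<N}. single i 1)"
        by (intro sum.cong refl) (simp add: lam0_def)
      finally show ?thesis by (simp add: lam0_def)
    qed
    moreover have "sum_list (map (\<lambda>i. lam0 N i) [1..<N + 1]) = (\<Sum>i=1..N. lam0 N i)" by (rule upt)
    ultimately have "(\<Sum>(i, a)\<leftarrow>lword q3 [1..<N + 1]. lam0 N i) = 0"
      by (simp only: lw map_map o_def prod.case)
    then show "(\<Sum>(i, a)\<leftarrow>lword q3 js. lam0 N i) = 0" using js by (auto simp: lword_simps)
    have "(\<Prod>i\<leftarrow>[1..<k + 1]. s3 powi (2 * int i - int N - 1)) = s3 powi (int k * (int k - int N))" for k
      using nonzero(5) by (induction k) (simp_all add: algebra_simps flip: power_int_add)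
    from this[of N] have "(\<Prod>(i, a)\<leftarrow>lword q3 [1..<N + 1]. s3 powi (2 * int i - int N - 1)) = 1"
      by (simp only: lw map_map o_def prod.case) simp
    then show "(\<Prod>(i, a)\<leftarrow>lword q3 js. s3 powi (2 * int i - int N - 1)) = 1" using js by (auto simp: lword_simps)
  qed
  have "left_cur (gword b js tail) = vertex_op (torus (\<lambda>_ _. 1) 0) (\<lambda>n. 0) (\<lambda>n. 0)"
    unfolding left_cur_def gword_lattice[OF js'] tail_lattice[OF tail] e
    by (simp only: csc_one mult_1 add_0_right, rule vertex_op_cong)
       (simp_all add: cre_def ann_def gword_left[OF pos_neg_mult(1,2) js' tail] gword_left[OF pos_neg_mult(3,4) js' tail]
         zu zv csc_zero)
  also have "\<dots> = one_current" by (auto simp: fun_eq_iff vertex_op_zero one_current_def torus_zero)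
  finally show ?thesis .
qed

text \<open>The right part of a Miura block is the same for all blocks. This is what lets the words
  of one length share a Heisenberg coefficient.\<close>

lemma right_cur_length:
  assumes "set js \<subseteq> {1..N}" "set ks \<subseteq> {1..N}" "length js = length ks"
  shows "right_cur (gword b js tail) = right_cur (gword b ks tail)"
proof -
  have "word_coeff pos (\<lambda>i n. right_part N (xu n) i) (gword b js tail) = word_coeff pos (\<lambda>i n. right_part N (xu n) i) (gword b ks tail)"
    "word_coeff neg (\<lambda>i n. right_part N (xv n) i) (gword b js tail) = word_coeff neg (\<lambda>i n. right_part N (xv n) i) (gword b ks tail)"
    using assms by (auto simp: fun_eq_iff gword_right[OF pos_neg_mult(1,2)] gword_right[OF pos_neg_mult(3,4)])
  then show ?thesis by (simp only: right_cur_def right_zero_def gword_lattice assms)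
qed

lemma current_mult_one: "current_mult (\<lambda>m. tensR (B m)) (\<lambda>m. tensL (one_current m)) m = tensR (B m)"
proof -
  have "current_mult (\<lambda>m. tensR (B m)) (\<lambda>m. tensL (one_current m)) m = (\<Sum>j\<in>{0}. tensR (B (m - j)) * tensL (one_current j))"
    unfolding current_mult_def by (rule osum_finite(2)) (auto simp: one_current_def tensL_hom)
  then show ?thesis by (simp add: one_current_def tensL_hom)
qed

end

section \<open>The higher generators\<close>

text \<open>The coefficients of the Lagrange polynomial at the node \<open>a s\<close>.\<close>

lemma delta_coefficients:
  fixes a :: "'s \<Rightarrow> complex"
  assumes S: "finite S" and inj: "inj_on a S" and s: "s \<in> S"
  shows "\<exists>(c :: nat \<Rightarrow> complex) d. \<forall>x\<in>S. (\<Sum>i\<le>d. c i * a x ^ i) = (if x = s then 1 else 0)"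
proof -
  define L where "L = (\<Prod>y\<in>S - {s}. smult (1 / (a s - a y)) [:- a y, 1:])"
  have L: "poly L (a x) = (\<Prod>y\<in>S - {s}. (a x - a y) / (a s - a y))" for x
    by (simp add: L_def poly_prod diff_divide_distrib)
  have "poly L (a x) = (if x = s then 1 else 0)" if x: "x \<in> S" for x
  proof (cases "x = s")
    case True
    have "a s - a y \<noteq> 0" if "y \<in> S - {s}" for y using inj s that by (auto simp: inj_on_def)
    then show ?thesis unfolding L by (simp add: True prod.neutral)
  next
    case False
    then have "(\<Prod>y\<in>S - {s}. (a x - a y) / (a s - a y)) = 0"
      by (intro prod_zero) (use S x in auto)
    then show ?thesis using False by (simp add: L)
  qed
  then show ?thesis by (intro exI[of _ "coeff L"] exI[of _ "degree L"]) (simp add: poly_altdef)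
qed

lemma word_coeff_cong:
  "(\<And>i. i \<in> fst ` set w \<Longrightarrow> x i n r = y i n r) \<Longrightarrow> word_coeff h x w n r = word_coeff h y w n r"
  by (induction w) (auto simp: word_coeff_def)

lemma cre_ann_linear:
  "csc (c n) * cre R f n + cre R f' n = cre R (\<lambda>n r. c n * f n r + f' n r) n"
  "csc (c n) * ann R f n + ann R f' n = ann R (\<lambda>n r. c n * f n r + f' n r) n"
  by (simp_all add: cre_def ann_def sum_distrib_left csc_plus csc_mult[symmetric] distrib_right mult.assoc sum.distrib)

lemma bichar_words:
  "bichar 3 (heis_param N q) (single 2 1 + single 1 (int k)) (single 0 1) = q powi (int k + 1 - int N)"
  "bichar 3 (heis_param N q) (single 0 1) (single 2 1 + single 1 (int k)) = q powi (int N - 1 - int k)"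
  if q: "q \<noteq> 0"
proof -
  have l: "lookup (single 2 1 + single 1 (int k)) i = (if i = 2 then 1 else if i = 1 then int k else 0)" for i :: nat
    by (simp add: lookup_add lookup_single when_def)
  have l0: "lookup (single 0 (1::int)) i = (if i = (0::nat) then 1 else 0)" for i
    by (simp only: lookup_single when_def eq_commute[of 0])
  have three: "{..<3::nat} = {0, 1, 2}" by auto
  show "bichar 3 (heis_param N q) (single 2 1 + single 1 (int k)) (single 0 1) = q powi (int k + 1 - int N)"
    using q unfolding bichar_def l l0 three
    by (simp add: heis_param_def power_int_add power_int_diff)
  show "bichar 3 (heis_param N q) (single 0 1) (single 2 1 + single 1 (int k)) = q powi (int N - 1 - int k)"
    using q unfolding bichar_def l l0 three
    by (simp add: heis_param_def power_int_add power_int_diff power_int_minus divide_inverse power_inverse)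
qed

section \<open>Poles of the contraction with X_0\<close>

context intertwiner begin

abbreviation X :: "fword \<Rightarrow> fock current" where
  "X w \<equiv> Xcur (Qsub N q1 q3) q (N + 1) u v w"

lemma gword_coeff:
  assumes "\<And>n a b. h n (a * b) = h n a * h n b" "\<And>n. h n 1 = 1"
  shows "word_coeff h x (gword b js tail) n r = h n b * word_coeff h x (gword 1 js []) n r + word_coeff h x tail n r"
proof -
  note sh = sum_list_scale[of "h n b" "h n"]
  show ?thesis using assms
    by (simp add: sh word_coeff_def gword_def scale_word_simps scale_word_sums distrib_left)
qed

text \<open>For \<open>k < N\<close> the Miura blocks cancel the first \<open>k\<close> of the
  \<open>N - 1\<close> factors due to the arrows from 0 to \<open>N + 1\<close>, and for
  \<open>k = N - 1\<close> no pole is left. For \<open>k = N\<close> there is one block too many; it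
  yields a factor with zero and pole exchanged.\<close>

definition poles :: "nat \<Rightarrow> nat set" where
  "poles k = (if k < N then {Suc k..<N} else {N})"

definition rho :: "nat \<Rightarrow> complex" where
  "rho n = (if n < N then q3 powi (2 - int n) else q2 * q3 powi (2 - int N))"

lemma rho_nonzero: "rho n \<noteq> 0"
  using nonzero by (simp add: rho_def)

lemma inj_rho: "inj_on rho {1..N}"
proof (rule inj_onI)
  fix m n assume "m \<in> {1..N}" "n \<in> {1..N}" and eq: "rho m = rho n"
  then consider "m < N" "n < N" | "m < N" "n = N" | "m = N" "n < N" | "m = N" "n = N" by fastforce
  then show "m = n"
    using eq genericD(8,9)[OF gen] genericD(9)[OF gen, THEN not_sym] by cases (auto simp: rho_def)
qed

text \<open>\<open>X_0\<close> pairs only with the vertices 0, 1 and \<open>N + 1\<close>, so its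
  row and column of \<open>C\<close> have the shape of a \<open>right_part\<close>. The pairing of a
  whole word with \<open>X_0\<close> is then an instance of \<open>gword_right\<close>, with a dummy
  coordinate \<open>s\<close>.\<close>

lemma Cmat_frozen:
  assumes "i \<in> {0..N + 1}"
  shows "Cmat (Qsub N q1 q3) q n i 0 / of_nat n =
      right_part N (\<lambda>k _. Cmat (Qsub N q1 q3) q n (if k = 2 then N + 1 else k) 0 / of_nat n) i s"
    "Cmat (Qsub N q1 q3) q n 0 i / of_nat n =
      right_part N (\<lambda>k _. Cmat (Qsub N q1 q3) q n 0 (if k = 2 then N + 1 else k) / of_nat n) i s"
proof -
  consider "i = 0" | "i = 1" | "2 \<le> i" "i \<le> N" | "i = N + 1" using assms by fastforce
  then show "Cmat (Qsub N q1 q3) q n i 0 / of_nat n =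
      right_part N (\<lambda>k _. Cmat (Qsub N q1 q3) q n (if k = 2 then N + 1 else k) 0 / of_nat n) i s"
    "Cmat (Qsub N q1 q3) q n 0 i / of_nat n =
      right_part N (\<lambda>k _. Cmat (Qsub N q1 q3) q n 0 (if k = 2 then N + 1 else k) / of_nat n) i s"
    using N by (cases; simp add: right_part_def Cmat_def cmat_Qsub[OF N])+
qed

abbreviation (input) zpow :: "nat \<Rightarrow> nat \<Rightarrow> complex" where
  "zpow n j \<equiv> (q3 powi (2 - int j)) ^ n"

lemma zpow_Suc: "zpow n (Suc t) = q3 ^ n * neg n q3 ^ t"
proof -
  have "q3 powi (2 - int (Suc t)) = q3 / q3 ^ t"
    using nonzero(3) by (simp add: power_int_diff)
  then show ?thesis by (simp add: power_divide power_mult[symmetric] mult.commute)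
qed

lemma sum_zpow:
  "(\<Sum>t<k. neg n q3 ^ t) * q3 ^ n = (\<Sum>j=1..k. zpow n j)"
  "(\<Sum>t<k. pos n q3 ^ t) * (1 / q3 ^ n) = (\<Sum>j=1..k. 1 / zpow n j)"
proof -
  have "(\<Sum>j=1..k. f j) = (\<Sum>t<k. f (Suc t) :: complex)" for f
    by (rule sum.reindex_bij_witness[of _ Suc "\<lambda>j. j - 1"]) auto
  note r = this
  show "(\<Sum>t<k. neg n q3 ^ t) * q3 ^ n = (\<Sum>j=1..k. zpow n j)"
    unfolding r zpow_Suc by (simp add: sum_distrib_left mult.commute)
  show "(\<Sum>t<k. pos n q3 ^ t) * (1 / q3 ^ n) = (\<Sum>j=1..k. 1 / zpow n j)"
    unfolding r zpow_Suc by (simp add: sum_divide_distrib power_divide)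
qed

text \<open>A block \<open>X_1 ... X_k\<close> meets \<open>X_0\<close> only through
  \<open>X_1\<close>. The block at position \<open>j\<close> of the word contributes the negative of
  the term \<open>zpow n j\<close>, while \<open>X_{N+1}\<close> contributes these terms for
  \<open>j < N\<close>.\<close>

lemma contractions:
  assumes js: "set js \<subseteq> {1..N}" and n: "n > 0"
  shows "of_nat n * (\<Sum>r<N + 1. word_coeff neg v (gword 1 js []) n r * word_coeff pos u [(0, 1)] n r)
      = (1 - q2 ^ n) * ((\<Sum>j\<in>{1..<N}. zpow n j) - (\<Sum>j=1..length js. zpow n j))"
    "of_nat n * (\<Sum>r<N + 1. word_coeff neg v [(0, 1)] n r * word_coeff pos u (gword 1 js []) n r)
      = (1 - 1 / q2 ^ n) * ((\<Sum>j\<in>{1..<N}. 1 / zpow n j) - (\<Sum>j=1..length js. 1 / zpow n j))"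
proof -
  let ?C = "Cmat (Qsub N q1 q3) q n" and ?w = "gword 1 js []"
  define x where "x n k s = Cmat (Qsub N q1 q3) q n (if k = 2 then N + 1 else k) 0 / of_nat n" for n k and s :: nat
  define x' where "x' n k s = Cmat (Qsub N q1 q3) q n 0 (if k = 2 then N + 1 else k) / of_nat n" for n k and s :: nat
  have w: "i \<in> {0..N + 1}" if "i \<in> fst ` set ?w" for i using gword_vertices[OF js, of "[]" 1] that by blast
  have Q: "q ^ n * q ^ n = q2 ^ n" by (simp only: q2[symmetric] power2_eq_square power_mult_distrib)
  have p: "q2 ^ n * q3 ^ n * q1 ^ n = 1"
    using genericD(4)[OF gen] by (simp only: power_mult_distrib[symmetric]) (simp add: mult_ac)
  have c10: "?C 1 0 = (q2 ^ n - 1) * q3 ^ n"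
  proof -
    have "1 / (q ^ n * q1 ^ n) = q ^ n * q3 ^ n"
      using p nonzero unfolding Q[symmetric] by (simp add: field_simps)
    note e = this
    show ?thesis unfolding Cmat_def cmat_Qsub(5)[OF N] e Q[symmetric] using nonzero by (simp add: field_simps)
  qed
  have c01: "?C 0 1 = - ((1 - 1 / q2 ^ n) * (1 / q3 ^ n))"
  proof -
    have "q ^ n * q1 ^ n = 1 / (q ^ n * q3 ^ n)"
      using p nonzero unfolding Q[symmetric] by (simp add: field_simps)
    note e = this
    show ?thesis unfolding Cmat_def cmat_Qsub(4)[OF N] e Q[symmetric] using nonzero by (simp add: field_simps)
  qed
  have cN0: "?C (N + 1) 0 = (1 - q2 ^ n) * (\<Sum>j\<in>{1..<N}. zpow n j)"
    using nonzero unfolding Cmat_def cmat_Qsub(9)[OF N] Q[symmetric] sum_distrib_left[symmetric] by (simp add: field_simps)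
  have c0N: "?C 0 (N + 1) = (1 - 1 / q2 ^ n) * (\<Sum>j\<in>{1..<N}. 1 / zpow n j)"
  proof -
    have "(\<Sum>j\<in>{1..<N}. 1 / (q ^ n * zpow n j)) = 1 / q ^ n * (\<Sum>j\<in>{1..<N}. 1 / zpow n j)"
      by (simp add: sum_distrib_left)
    then show ?thesis using nonzero unfolding Cmat_def cmat_Qsub(8)[OF N] Q[symmetric] by (simp add: field_simps)
  qed
  have x: "x n 2 0 = ?C (N + 1) 0 / of_nat n" "x n 1 0 = ?C 1 0 / of_nat n"
      "x' n 2 0 = ?C 0 (N + 1) / of_nat n" "x' n 1 0 = ?C 0 1 / of_nat n" by (simp_all add: x_def x'_def)
  have alg: "of_nat n * (a / of_nat n + t * (b / of_nat n)) = a + t * b" for a b t :: complex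
    using n by (simp add: field_simps)
  have "(\<Sum>r<N + 1. word_coeff neg v ?w n r * word_coeff pos u [(0, 1)] n r)
      = word_coeff neg (\<lambda>i n s. \<Sum>r<N + 1. v i n r * u 0 n r) ?w n 0"
    unfolding sum_word_coeff by (simp add: word_coeff_def)
  also have "\<dots> = word_coeff neg (\<lambda>i n. right_part N (x n) i) ?w n 0"
    by (rule word_coeff_cong) (simp only: gram[OF n w] atLeast0AtMost atMost_iff zero_le Cmat_frozen(1)[OF w, where s = 0] x_def[abs_def])
  also have "\<dots> = x n 2 0 + (\<Sum>t<length js. neg n q3 ^ t) * x n 1 0"
    by (subst gword_right[where h = neg, OF pos_neg_mult(3,4) js]) (simp add: word_coeff_def)
  finally have "(\<Sum>r<N + 1. word_coeff neg v ?w n r * word_coeff pos u [(0, 1)] n r) = \<dots>" .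
  note s = this
  show "of_nat n * (\<Sum>r<N + 1. word_coeff neg v ?w n r * word_coeff pos u [(0, 1)] n r)
      = (1 - q2 ^ n) * ((\<Sum>j\<in>{1..<N}. zpow n j) - (\<Sum>j=1..length js. zpow n j))"
    unfolding s x alg cN0 c10 sum_zpow(1)[symmetric] by (simp add: algebra_simps)
  have "(\<Sum>r<N + 1. word_coeff neg v [(0, 1)] n r * word_coeff pos u ?w n r)
      = word_coeff pos (\<lambda>i n s. \<Sum>r<N + 1. v 0 n r * u i n r) ?w n 0"
    unfolding sum_word_coeff by (simp add: word_coeff_def)
  also have "\<dots> = word_coeff pos (\<lambda>i n. right_part N (x' n) i) ?w n 0"
    by (rule word_coeff_cong) (simp only: gram[OF n _ w] atLeast0AtMost atMost_iff zero_le Cmat_frozen(2)[OF w, where s = 0] x'_def[abs_def])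
  also have "\<dots> = x' n 2 0 + (\<Sum>t<length js. pos n q3 ^ t) * x' n 1 0"
    by (subst gword_right[where h = pos, OF pos_neg_mult(1,2) js]) (simp add: word_coeff_def)
  finally have "(\<Sum>r<N + 1. word_coeff neg v [(0, 1)] n r * word_coeff pos u ?w n r) = \<dots>" .
  note s' = this
  show "of_nat n * (\<Sum>r<N + 1. word_coeff neg v [(0, 1)] n r * word_coeff pos u ?w n r)
      = (1 - 1 / q2 ^ n) * ((\<Sum>j\<in>{1..<N}. 1 / zpow n j) - (\<Sum>j=1..length js. 1 / zpow n j))"
    unfolding s' x alg c0N c01 sum_zpow(2)[symmetric] by (simp add: algebra_simps diff_divide_distrib)
qed

text \<open>Its square is the ratio of the parameters of zero and pole in each factor; the exchange
  of zero and pole for \<open>k = N\<close> inverts it.\<close>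

definition tau :: "nat \<Rightarrow> complex" where
  "tau k = (if k < N then q else 1 / q)"

lemma sum_poles:
  fixes f :: "nat \<Rightarrow> complex"
  assumes "k \<le> N"
  shows "(\<Sum>j\<in>{1..<N}. f j) - (\<Sum>j=1..k. f j) = (if k < N then (\<Sum>j\<in>poles k. f j) else - f N)"
proof (cases "k < N")
  case True
  then have "{1..<N} = {1..k} \<union> {Suc k..<N}" by auto
  then have "(\<Sum>j\<in>{1..<N}. f j) = (\<Sum>j=1..k. f j) + (\<Sum>j\<in>{Suc k..<N}. f j)"
    by (simp only:) (rule sum.union_disjoint, auto)
  then show ?thesis using True by (simp add: poles_def)
next
  case False
  then have "{1..k} = insert N {1..<N}" using assms N by auto
  then show ?thesis using False by simp
qed

text \<open>For \<open>k = N\<close> the leftover term has the opposite sign: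
  \<open>- (1 - q2 ^ n) * z ^ n\<close> is the contribution of the pole parameter
  \<open>q2 * z\<close> and the zero parameter \<open>z\<close>, with
  \<open>z = q3 powi (2 - N)\<close>.\<close>

lemma pole_contractions:
  assumes k: "k \<le> N"
  shows "(1 - q2 ^ n) * ((\<Sum>j\<in>{1..<N}. zpow n j) - (\<Sum>j=1..k. zpow n j))
      = (\<Sum>s\<in>poles k. rho s ^ n - ((tau k)\<^sup>2 * rho s) ^ n)"
    "(1 - 1 / q2 ^ n) * ((\<Sum>j\<in>{1..<N}. 1 / zpow n j) - (\<Sum>j=1..k. 1 / zpow n j))
      = (\<Sum>s\<in>poles k. (1 / rho s) ^ n - (1 / ((tau k)\<^sup>2 * rho s)) ^ n)"
proof -
  have small: "rho s = q3 powi (2 - int s)" "tau k = q" if "s \<in> poles k" "k < N" for s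
    using that by (auto simp: rho_def tau_def poles_def)
  have big: "poles k = {N}" "rho N = q2 * q3 powi (2 - int N)" "(tau k)\<^sup>2 * rho N = q3 powi (2 - int N)" if "\<not> k < N"
    using that nonzero by (auto simp: rho_def tau_def poles_def q2 power_divide)
  show "(1 - q2 ^ n) * ((\<Sum>j\<in>{1..<N}. zpow n j) - (\<Sum>j=1..k. zpow n j))
      = (\<Sum>s\<in>poles k. rho s ^ n - ((tau k)\<^sup>2 * rho s) ^ n)"
  proof (cases "k < N")
    case True
    have "(\<Sum>s\<in>poles k. rho s ^ n - ((tau k)\<^sup>2 * rho s) ^ n) = (\<Sum>s\<in>poles k. (1 - q2 ^ n) * zpow n s)"
      using True by (intro sum.cong refl) (simp only: small q2, simp add: power_mult_distrib algebra_simps)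
    then show ?thesis unfolding sum_poles[OF k] using True by (simp add: sum_distrib_left)
  next
    case False
    show ?thesis unfolding sum_poles[OF k] using False
      by (simp add: big(1,3)) (simp add: big(2) power_mult_distrib algebra_simps)
  qed
  show "(1 - 1 / q2 ^ n) * ((\<Sum>j\<in>{1..<N}. 1 / zpow n j) - (\<Sum>j=1..k. 1 / zpow n j))
      = (\<Sum>s\<in>poles k. (1 / rho s) ^ n - (1 / ((tau k)\<^sup>2 * rho s)) ^ n)"
  proof (cases "k < N")
    case True
    have "(\<Sum>s\<in>poles k. (1 / rho s) ^ n - (1 / ((tau k)\<^sup>2 * rho s)) ^ n) = (\<Sum>s\<in>poles k. (1 - 1 / q2 ^ n) * (1 / zpow n s))"
      using True by (intro sum.cong refl) (simp only: small q2, simp add: power_mult_distrib power_divide diff_divide_distrib)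
    then show ?thesis unfolding sum_poles[OF k] using True by (simp add: sum_distrib_left)
  next
    case False
    show ?thesis unfolding sum_poles[OF k] using False
      by (simp add: big(1,3)) (simp add: big(2) power_mult_distrib power_divide diff_divide_distrib)
  qed
qed

text \<open>The zero modes contribute exactly the normalization under which, by
  \<open>two_sided_residues\<close>, the two orders of multiplication expand one rational function.
  For \<open>k = N\<close> the exponent \<open>N - 1 - k\<close> is -1, matching a single pole with
  inverted \<open>tau\<close>.\<close>

lemma cocycle_words:
  assumes js: "set js \<subseteq> {1..N}" and k: "length js \<le> N"
  shows "quiver_cocycle (Qsub N q1 q3) q (word_lattice (gword 1 js [])) (word_lattice [(0, 1)]) = (1 / tau (length js)) ^ card (poles (length js))"
    "quiver_cocycle (Qsub N q1 q3) q (word_lattice [(0, 1)]) (word_lattice (gword 1 js [])) = tau (length js) ^ card (poles (length js))"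
proof -
  have g: "theta2 N (word_lattice (gword 1 js [])) = single 2 1 + single 1 (int (length js))"
    by (simp add: gword_lattice(2)[OF js] tail_lattice)
  have g0: "theta2 N (word_lattice [(0, 1)]) = single 0 1"
    using tail_lattice(3)[of "[(0, 1)]"] by (simp del: single_one)
  have e: "q powi (int N - 1 - int (length js)) = tau (length js) ^ card (poles (length js))"
    "q powi (int (length js) + 1 - int N) = (1 / tau (length js)) ^ card (poles (length js))"
  proof -
    show 1: "q powi (int N - 1 - int (length js)) = tau (length js) ^ card (poles (length js))"
    proof (cases "length js < N")
      case True
      then have "int N - 1 - int (length js) = int (N - Suc (length js))" by simp
      then have "q powi (int N - 1 - int (length js)) = q ^ (N - Suc (length js))" by (simp only: power_int_of_nat)
      then show ?thesis using True by (simp add: tau_def poles_def)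
    next
      case False
      then have p: "poles (length js) = {N}" "tau (length js) = 1 / q" by (simp_all add: poles_def tau_def)
      have "int N - 1 - int (length js) = - 1" using False k by simp
      then show ?thesis unfolding p by (simp add: power_int_minus inverse_eq_divide)
    qed
    have "int (length js) + 1 - int N = - (int N - 1 - int (length js))" by simp
    then have "q powi (int (length js) + 1 - int N) = inverse (q powi (int N - 1 - int (length js)))"
      by (simp only: power_int_minus)
    then show "q powi (int (length js) + 1 - int N) = (1 / tau (length js)) ^ card (poles (length js))"
      by (simp add: 1 power_divide inverse_eq_divide)
  qed
  show "quiver_cocycle (Qsub N q1 q3) q (word_lattice (gword 1 js [])) (word_lattice [(0, 1)]) = (1 / tau (length js)) ^ card (poles (length js))"
    "quiver_cocycle (Qsub N q1 q3) q (word_lattice [(0, 1)]) (word_lattice (gword 1 js [])) = tau (length js) ^ card (poles (length js))"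
    by (simp_all only: bichar_theta2[OF N nonzero(4)] g g0 bichar_words[OF nonzero(4)] e)
qed

text \<open>The residues are chosen before the word: contractions and zero mode factors depend on
  the length alone. This uniformity allows words of equal length to be summed to a W-current
  afterwards.\<close>

lemma word_commutator:
  assumes k: "k \<le> N"
  shows "\<exists>r. \<forall>js m p. set js \<subseteq> {1..N} \<longrightarrow> length js = k \<longrightarrow>
    X (gword 1 js []) m * X [(0, 1)] p - X [(0, 1)] p * X (gword 1 js []) m =
    (\<Sum>s\<in>poles k. csc (rho s powi m) * (csc (r s) * X (gword (rho s) js [(0, 1)]) (m + p)))"
proof -
  define \<zeta> where "\<zeta> n = 1 / of_nat n * (\<Sum>s\<in>poles k. rho s ^ n - ((tau k)\<^sup>2 * rho s) ^ n)" for n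
  define \<zeta>' where "\<zeta>' n = 1 / of_nat n * (\<Sum>s\<in>poles k. (1 / rho s) ^ n - (1 / ((tau k)\<^sup>2 * rho s)) ^ n)" for n
  have fin: "finite (poles k)" by (simp add: poles_def)
  have sub: "poles k \<subseteq> {1..N}" using N by (auto simp: poles_def)
  have tau: "tau k \<noteq> 0" using nonzero by (simp add: tau_def)
  have z: "of_nat n * \<zeta> n = (\<Sum>s\<in>poles k. rho s ^ n - ((tau k)\<^sup>2 * rho s) ^ n)"
    "of_nat n * \<zeta>' n = (\<Sum>s\<in>poles k. (1 / rho s) ^ n - (1 / ((tau k)\<^sup>2 * rho s)) ^ n)" if "n > 0" for n
    using that by (simp_all add: \<zeta>_def \<zeta>'_def)
  obtain F F' r where F: "F 0 = 1" "\<And>k. of_nat k * F k = (\<Sum>n=1..k. of_nat n * \<zeta> n * F (k - n))"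
      and F': "F' 0 = 1" "\<And>k. of_nat k * F' k = (\<Sum>n=1..k. of_nat n * \<zeta>' n * F' (k - n))"
      and res: "\<And>j. (1 / tau k) ^ card (poles k) * (if j < 0 then 0 else F (nat j))
       - tau k ^ card (poles k) * (if j > 0 then 0 else F' (nat (- j))) = (\<Sum>s\<in>poles k. r s * rho s powi j)"
    by (rule delta_expansion[OF fin rho_nonzero inj_on_subset[OF inj_rho sub] tau z(1) z(2)]) (assumption | rule that)+
  have "X (gword 1 js []) m * X [(0, 1)] p - X [(0, 1)] p * X (gword 1 js []) m =
    (\<Sum>s\<in>poles k. csc (rho s powi m) * (csc (r s) * X (gword (rho s) js [(0, 1)]) (m + p)))"
    if js: "set js \<subseteq> {1..N}" and len: "length js = k" for js m p
  proof -
    let ?\<sigma> = "quiver_cocycle (Qsub N q1 q3) q"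
    let ?w = "gword 1 js []" and ?x = "[(0, 1)] :: fword"
    interpret P: vertex_pair fdeg "torus ?\<sigma> (word_lattice ?w)" "torus ?\<sigma> (word_lattice ?x)"
      "cre (N + 1) (word_coeff pos u ?w)" "ann (N + 1) (word_coeff neg v ?w)"
      "cre (N + 1) (word_coeff pos u ?x)" "ann (N + 1) (word_coeff neg v ?x)"
      by (intro vertex_pair.intro vertex_pair_axioms.intro vertex_torus cre_commute ann_commute)
    have tm: "torus ?\<sigma> g * torus ?\<sigma> h = csc (?\<sigma> g h) * torus ?\<sigma> (g + h)" for g h
      by (rule torus_mult) (simp add: quiver_cocycle_bimult[OF nonzero(4)] mult_ac)
    have c: "(\<Sum>r<N + 1. word_coeff neg v ?w n r * word_coeff pos u ?x n r) = \<zeta> n"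
      "(\<Sum>r<N + 1. word_coeff neg v ?x n r * word_coeff pos u ?w n r) = \<zeta>' n" if n: "n > 0" for n
    proof -
      have nz: "of_nat n \<noteq> (0::complex)" using n by simp
      show "(\<Sum>r<N + 1. word_coeff neg v ?w n r * word_coeff pos u ?x n r) = \<zeta> n"
        "(\<Sum>r<N + 1. word_coeff neg v ?x n r * word_coeff pos u ?w n r) = \<zeta>' n"
        by (rule iffD1[OF mult_left_cancel[OF nz]], simp only: contractions[OF js n] len pole_contractions[OF k] z[OF n])+
    qed
    have e': "torus ?\<sigma> (word_lattice ?x) * torus ?\<sigma> (word_lattice ?w)
        = csc (tau k ^ card (poles k)) * torus ?\<sigma> (word_lattice ?w + word_lattice ?x)"
      using tm[of "word_lattice ?x" "word_lattice ?w"] cocycle_words(2)[OF js] k unfolding len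
      by (simp only: add.commute simp_thms)
    have e: "torus ?\<sigma> (word_lattice ?w) * torus ?\<sigma> (word_lattice ?x)
        = csc ((1 / tau k) ^ card (poles k)) * torus ?\<sigma> (word_lattice ?w + word_lattice ?x)"
      using tm[of "word_lattice ?w" "word_lattice ?x"] cocycle_words(1)[OF js] k unfolding len
      by (simp only: simp_thms)
    have dc: "ann (N + 1) (word_coeff neg v ?w) n * cre (N + 1) (word_coeff pos u ?x) m
       = cre (N + 1) (word_coeff pos u ?x) m * ann (N + 1) (word_coeff neg v ?w) n + (if n = m then csc (\<zeta> n) else 0)"
      "ann (N + 1) (word_coeff neg v ?x) n * cre (N + 1) (word_coeff pos u ?w) m
       = cre (N + 1) (word_coeff pos u ?w) m * ann (N + 1) (word_coeff neg v ?x) n + (if n = m then csc (\<zeta>' n) else 0)"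
      if "m > 0" "n > 0" for m n
      by (simp_all only: ann_cre c[OF that(2)])
    have "X ?w m * X ?x p - X ?x p * X ?w m =
      (\<Sum>s\<in>poles k. csc (rho s powi m) * (csc (r s) * vertex_op (torus ?\<sigma> (word_lattice ?w + word_lattice ?x))
        (\<lambda>n. csc (pos n (rho s)) * cre (N + 1) (word_coeff pos u ?w) n + cre (N + 1) (word_coeff pos u ?x) n)
        (\<lambda>n. csc (neg n (rho s)) * ann (N + 1) (word_coeff neg v ?w) n + ann (N + 1) (word_coeff neg v ?x) n) (m + p)))"
      unfolding Xcur_vertex_op
      by (rule P.vertex_op_commutator[OF torus_cre torus_ann torus_cre torus_ann e e' homogeneous_torus dc F F' fin rho_nonzero res])
    \<comment> \<open>At a pole the two currents merge into one word, in which everything before the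
      final \<open>X_0\<close> is rescaled by \<open>b\<close>.\<close>
    moreover have "vertex_op (torus ?\<sigma> (word_lattice ?w + word_lattice ?x))
        (\<lambda>n. csc (pos n b) * cre (N + 1) (word_coeff pos u ?w) n + cre (N + 1) (word_coeff pos u ?x) n)
        (\<lambda>n. csc (neg n b) * ann (N + 1) (word_coeff neg v ?w) n + ann (N + 1) (word_coeff neg v ?x) n)
        = X (gword b js ?x)" for b
    proof -
      have "word_lattice (gword b js ?x) = word_lattice ?w + word_lattice ?x"
        by (simp only: gword_def word_lattice_simps add_0_right)
      then show ?thesis
        unfolding Xcur_vertex_op cre_ann_linear
        by (simp only:) (rule vertex_op_cong, rule cre_cong, rule gword_coeff[OF pos_neg_mult(1,2), symmetric],
          rule ann_cong, rule gword_coeff[OF pos_neg_mult(3,4), symmetric])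
    qed
    ultimately show ?thesis by simp
  qed
  then show ?thesis by blast
qed

end

section \<open>The embedding\<close>

lemma alg_gen_mono:
  assumes "\<And>s. s \<in> G \<Longrightarrow> s \<in> alg_gen H" "a \<in> alg_gen G"
  shows "a \<in> alg_gen H"
  using assms(2) by induction (auto intro: alg_gen.intros assms(1))

text \<open>\<open>completion_mult\<close> asks for homogeneous generators. Elements of the two
  algebras need not be homogeneous, but the tensor product is also generated by their
  generators.\<close>

lemma alg_gen_tensor:
  "alg_gen (tensL ` alg_gen G \<union> tensR ` alg_gen H) = alg_gen (tensL ` G \<union> tensR ` H)"
proof (intro equalityI subsetI)
  have "tensL a \<in> alg_gen (tensL ` G \<union> tensR ` H)" if "a \<in> alg_gen G" for a
    using that by induction (auto simp: tensL_hom intro: alg_gen.intros)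
  moreover have "tensR a \<in> alg_gen (tensL ` G \<union> tensR ` H)" if "a \<in> alg_gen H" for a
    using that by induction (auto simp: tensR_hom intro: alg_gen.intros)
  ultimately show "x \<in> alg_gen (tensL ` G \<union> tensR ` H)"
    if "x \<in> alg_gen (tensL ` alg_gen G \<union> tensR ` alg_gen H)" for x
    by (intro alg_gen_mono[OF _ that]) auto
  show "x \<in> alg_gen (tensL ` alg_gen G \<union> tensR ` alg_gen H)" if "x \<in> alg_gen (tensL ` G \<union> tensR ` H)" for x
    by (rule alg_gen_mono[OF _ that]) (auto intro: alg_gen.intros)
qed

lemma csc_current_mult:
  assumes "lfin (\<lambda>j. tensR (B (m - j)) * tensL (G j))"
  shows "csc r * current_mult (\<lambda>m. tensR (B m)) (\<lambda>m. tensL (G m)) m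
    = current_mult (\<lambda>m. tensR (csc r * B m)) (\<lambda>m. tensL (G m)) m"
  unfolding current_mult_def osum_mult_left[OF assms, symmetric] by (simp add: tensR_hom mult.assoc)

lemma rescale_one_current: "rescale a one_current = one_current"
  by (auto simp: fun_eq_iff rescale_def one_current_def)

lemma length_strict_lists:
  assumes "js \<in> strict_lists 1 N"
  shows "length js \<le> N" "length js = N \<longleftrightarrow> js = [1..<N + 1]"
proof -
  have js: "sorted js" "distinct js" "set js \<subseteq> {1..N}"
    using assms by (auto simp: strict_lists_def strict_sorted_iff)
  have c: "card (set js) = length js" by (rule distinct_card[OF js(2)])
  show "length js \<le> N" using card_mono[OF _ js(3)] c by simp
  have full: "js = [1..<N + 1]" if "length js = N"
  proof (rule sorted_distinct_set_unique[OF js(1,2)])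
    have "set js = {1..N}" by (rule card_subset_eq[OF _ js(3)]) (simp_all add: c that)
    then show "set js = set [1..<N + 1]"
      by (simp only: set_upt atLeastLessThanSuc_atLeastAtMost Suc_eq_plus1[symmetric])
  qed (simp_all del: upt_Suc)
  show "length js = N \<longleftrightarrow> js = [1..<N + 1]"
  proof
    show "length js = N" if "js = [1..<N + 1]" unfolding that by simp
  qed (rule full)
qed

lemma upt_strict_list: "k \<le> N \<Longrightarrow> [1..<k + 1] \<in> strict_lists 1 N"
  by (auto simp: strict_lists_def strict_sorted_iff simp del: upt_Suc)

lemma strict_lists_nil: "[] \<in> strict_lists a b"
  by (simp add: strict_lists_def)

lemma strict_lists_subset: "js \<in> strict_lists a b \<Longrightarrow> set js \<subseteq> {a..b}"
  by (simp add: strict_lists_def)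

context intertwiner begin

abbreviation W :: "nat \<Rightarrow> fock current" where "W \<equiv> Wcur N s3 ul vl"
abbreviation Gp :: "fock current" where "Gp \<equiv> Gplus N q q1 q3 u v"
abbreviation Gm :: "fock current" where "Gm \<equiv> Gminus N q q1 q3 u v"

definition heis_gens :: "fock lop set" where
  "heis_gens = {torus (bichar 3 (heis_param N q)) g | g. keys g \<subseteq> {..<3}}
     \<union> {mulY s n | s n. s < 2 \<and> n > 0} \<union> {derY s n | s n. s < 2 \<and> n > 0}"

lemma heis2_gens: "heis2 3 (heis_param N q) = alg_gen heis_gens"
  by (simp add: heis2_def heis_gens_def)

lemma heis_gens_osc:
  assumes "n > 0"
  shows "cre 2 f n \<in> alg_gen heis_gens" "ann 2 f n \<in> alg_gen heis_gens"
  unfolding cre_def ann_def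
  by (intro alg_gen_sum alg_gen.mult alg_gen.scalar alg_gen.gen; use assms in \<open>auto simp: heis_gens_def\<close>)+

lemma right_zero_gens:
  assumes w: "fst ` set w \<subseteq> {0..N + 1}"
  shows "right_zero w \<in> alg_gen heis_gens"
proof -
  have "lookup (theta2 N (word_lattice w)) i = 0" if "i \<ge> 3" for i
  proof -
    have "N + 4 + 2 * (i - 3) \<notin> fst ` set w" using w by fastforce
    then show ?thesis using that lookup_word_lattice by (simp add: lookup_theta theta2_fun_def)
  qed
  then have "keys (theta2 N (word_lattice w)) \<subseteq> {..<3}"
    by (metis in_keys_iff lessThan_iff not_le subsetI)
  then show ?thesis unfolding right_zero_def
    by (intro alg_gen.gen) (auto simp: heis_gens_def)
qed

lemma vertex_right: "vertex fdeg (right_zero w) (cre 2 f) (ann 2 f')" "vertex fdeg (csc r * right_zero w) (cre 2 f) (ann 2 f')"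
  unfolding right_zero_def by (rule vertex_torus, rule vertex_left)

lemma right_cur_current_in:
  assumes w: "fst ` set w \<subseteq> {0..N + 1}"
  shows "current_in (\<lambda>m. csc r * right_cur w m) (heis2_completed 3 (heis_param N q))"
    "current_in (right_cur w) (heis2_completed 3 (heis_param N q))"
proof -
  have "current_in (vertex_op (csc r * right_zero w) (cre 2 (word_coeff pos (\<lambda>i n. right_part N (xu n) i) w))
     (ann 2 (word_coeff neg (\<lambda>i n. right_part N (xv n) i) w))) (completion fdeg (alg_gen heis_gens))" for r
    by (rule vertex.current_in_vertex_op[OF vertex_right(2)])
       (intro alg_gen.mult alg_gen.scalar right_zero_gens[OF w] heis_gens_osc | assumption)+
  then have *: "current_in (\<lambda>m. csc r * right_cur w m) (heis2_completed 3 (heis_param N q))" for r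
    unfolding right_cur_def csc_vertex_op[OF vertex_right(1)] heis2_gens .
  show "current_in (\<lambda>m. csc r * right_cur w m) (heis2_completed 3 (heis_param N q))" by (rule *)
  show "current_in (right_cur w) (heis2_completed 3 (heis_param N q))" using *[of 1] by simp
qed

lemma Gplus_words: "Gp m = (\<Sum>js\<in>strict_lists 1 N. X (gword 1 js []) m)"
proof -
  have g: "gword 1 js [] = (N + 1, 1) # yword N q3 js" for js
    by (auto simp: gword_def scale_word_def intro!: map_idI)
  show ?thesis unfolding Gplus_def g
    using sum_miura[of N N "\<lambda>w. X ((N + 1, 1) # w) m"] by simp
qed

lemma W_words:
  "W k = rescale (s3 powi (1 - int k)) (\<lambda>m. \<Sum>js | js \<in> strict_lists 1 N \<and> length js = k. Lcur N s3 ul vl (lword q3 js) m)"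
proof -
  have "{js. sorted_wrt (<) js \<and> set js \<subseteq> {1..N} \<and> length js = k} = {js. js \<in> strict_lists 1 N \<and> length js = k}"
    by (auto simp: strict_lists_def)
  then show ?thesis unfolding Wcur_def s3
    by (intro arg_cong[of _ _ "rescale _"] ext sum.cong) (auto simp: lword_def)
qed

lemma rescale_W:
  "rescale (s3 powi (int k - 1)) (W k) m = (\<Sum>js | js \<in> strict_lists 1 N \<and> length js = k. Lcur N s3 ul vl (lword q3 js) m)"
proof -
  have "s3 powi (int k - 1) * s3 powi (1 - int k) = 1"
    using nonzero(5) by (simp flip: power_int_add)
  then have "(s3 powi (int k - 1)) powi (- m) * (s3 powi (1 - int k)) powi (- m) = 1"
    by (simp flip: power_int_mult_distrib)
  then show ?thesis unfolding W_words rescale_def mult.assoc[symmetric] csc_mult by simp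
qed

lemma homogeneous_W: "homogeneous fdeg m (W k m)"
  unfolding W_words rescale_def Lcur_vertex_op
  by (intro homogeneous_csc_mult homogeneous_sum vertex.deg_vertex_op[OF vertex_left])

lemma W_trivial:
  assumes "k = 0 \<or> k = N"
  shows "W k = one_current"
proof -
  obtain js where js: "{js. js \<in> strict_lists 1 N \<and> length js = k} = {js}" "js = [] \<or> js = [1..<N + 1]"
  proof (cases "k = 0")
    case True
    then have "{js. js \<in> strict_lists 1 N \<and> length js = k} = {[]}" by (auto simp: strict_lists_nil)
    then show thesis using that by blast
  next
    case False
    then have "{js. js \<in> strict_lists 1 N \<and> length js = k} = {[1..<N + 1]}"
      using assms length_strict_lists(2)[where N = N] upt_strict_list[of N N] by (auto simp del: upt_Suc)
    then show thesis using that by blast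
  qed
  have "set js \<subseteq> {1..N}" using js(2) by auto
  then have "Lcur N s3 ul vl (lword q3 js) = one_current"
    using left_cur_Lcur[of js "[]"] left_cur_trivial[OF js(2), of "[]" 1] by simp
  then show ?thesis unfolding W_words js(1) by (simp add: rescale_one_current)
qed

lemma W_mem: "k \<le> N \<Longrightarrow> rescale a (W k) m \<in> Wprin N s3 ul vl"
proof -
  assume k: "k \<le> N"
  have "W k m \<in> Wprin N s3 ul vl"
  proof (cases "k = 0")
    case True
    then show ?thesis by (simp add: W_trivial one_current_def Wprin_def)
  next
    case False
    then show ?thesis unfolding Wprin_def by (intro alg_gen.gen) (use k in auto)
  qed
  then show ?thesis unfolding Wprin_def rescale_def by (intro alg_gen.mult alg_gen.scalar)
qed

text \<open>The right current common to all words of length \<open>k\<close> is pulled out of the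
  sum; the left currents add up to \<open>W k\<close> with its rescaling undone.\<close>

lemma \<phi>_length:
  assumes tail: "tail \<in> {[], [(0, 1)]}" and k: "k \<le> N"
  defines "R \<equiv> right_cur (gword 1 [1..<k + 1] tail)"
  shows "(\<Sum>js | js \<in> strict_lists 1 N \<and> length js = k. \<phi> (X (gword 1 js tail) m))
      = current_mult (\<lambda>m. tensR (R m)) (\<lambda>m. tensL (rescale (s3 powi (int k - 1)) (W k) m)) m"
    and "lfin (\<lambda>j. tensR (R (m - j)) * tensL (rescale (s3 powi (int k - 1)) (W k) j))"
proof -
  let ?J = "{js. js \<in> strict_lists 1 N \<and> length js = k}"
  have R: "right_cur (gword 1 js tail) = R" "left_cur (gword 1 js tail) = Lcur N s3 ul vl (lword q3 js)"
    "fst ` set (gword 1 js tail) \<subseteq> {0..N + 1}" if "js \<in> ?J" for js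
  proof -
    have js: "set js \<subseteq> {1..N}" "length js = k" using that by (auto dest: strict_lists_subset)
    show "right_cur (gword 1 js tail) = R" unfolding R_def
      by (rule right_cur_length[OF js(1)]) (use k js(2) in auto)
    show "left_cur (gword 1 js tail) = Lcur N s3 ul vl (lword q3 js)" by (rule left_cur_Lcur[OF js(1) tail])
    show "fst ` set (gword 1 js tail) \<subseteq> {0..N + 1}" by (rule gword_vertices[OF js(1) tail])
  qed
  have lf: "lfin (\<lambda>j. tensR (R (m - j)) * tensL (Lcur N s3 ul vl (lword q3 js) j))" if "js \<in> ?J" for js
    using \<phi>_Xcur(2)[OF R(3)[OF that], of m] unfolding R(1,2)[OF that] .
  have split: "tensR (R (m - j)) * tensL (rescale (s3 powi (int k - 1)) (W k) j)
      = (\<Sum>js\<in>?J. tensR (R (m - j)) * tensL (Lcur N s3 ul vl (lword q3 js) j))" for j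
    unfolding rescale_W tens_sum sum_distrib_left ..
  show "lfin (\<lambda>j. tensR (R (m - j)) * tensL (rescale (s3 powi (int k - 1)) (W k) j))"
    unfolding split by (rule lfin_sum(1)[OF lf])
  have "(\<Sum>js\<in>?J. \<phi> (X (gword 1 js tail) m)) = (\<Sum>js\<in>?J. osum (\<lambda>j. tensR (R (m - j)) * tensL (Lcur N s3 ul vl (lword q3 js) j)))"
    by (intro sum.cong refl) (simp only: \<phi>_Xcur(1)[OF R(3)] R(1,2) current_mult_def)
  also have "\<dots> = osum (\<lambda>j. tensR (R (m - j)) * tensL (rescale (s3 powi (int k - 1)) (W k) j))"
    unfolding split by (rule lfin_sum(2)[OF lf, symmetric])
  finally show "(\<Sum>js\<in>?J. \<phi> (X (gword 1 js tail) m))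
      = current_mult (\<lambda>m. tensR (R m)) (\<lambda>m. tensL (rescale (s3 powi (int k - 1)) (W k) m)) m"
    by (simp only: current_mult_def)
qed

lemma \<phi>_Gplus:
  "\<phi> (Gp m) = (\<Sum>k=0..N. current_mult (\<lambda>m. tensR (right_cur (gword 1 [1..<k + 1] []) m))
     (\<lambda>m. tensL (rescale (s3 powi (int k - 1)) (W k) m)) m)"
proof -
  have "\<phi> (Gp m) = (\<Sum>js\<in>strict_lists 1 N. \<phi> (X (gword 1 js []) m))"
    by (simp only: Gplus_words \<phi>_sum)
  also have "\<dots> = (\<Sum>k=0..N. \<Sum>js | js \<in> strict_lists 1 N \<and> length js = k. \<phi> (X (gword 1 js []) m))"
    by (rule sum.group[symmetric]) (use length_strict_lists(1) in \<open>auto simp: finite_strict_lists\<close>)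
  also have "\<dots> = (\<Sum>k=0..N. current_mult (\<lambda>m. tensR (right_cur (gword 1 [1..<k + 1] []) m))
     (\<lambda>m. tensL (rescale (s3 powi (int k - 1)) (W k) m)) m)"
    by (intro sum.cong refl \<phi>_length(1)) auto
  finally show ?thesis .
qed

lemma \<phi>_Gminus: "\<phi> (Gm m) = tensR (right_cur [(0, 1)] m)"
proof -
  have "left_cur [(0, 1)] = vertex_op (torus (\<lambda>_ _. 1) 0) (\<lambda>n. 0) (\<lambda>n. 0)"
    unfolding left_cur_def using tail_lattice[of "[(0, 1)]"]
    by (simp only: csc_one mult_1 insert_iff simp_thms, intro vertex_op_cong)
       (simp_all add: cre_def ann_def word_coeff_def left_part_def csc_zero)
  then have l: "left_cur [(0, 1)] = one_current"
    by (auto simp: fun_eq_iff vertex_op_zero one_current_def torus_zero)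
  have "\<phi> (X [(0, 1)] m) = tensR (right_cur [(0, 1)] m)"
    by (subst \<phi>_Xcur(1)) (simp_all only: l current_mult_one, simp)
  then show ?thesis by (simp only: Gminus_def)
qed

lemma \<phi>_trivial_word:
  assumes js: "js = [] \<or> js = [1..<N + 1]" and tail: "tail \<in> {[], [(0, 1)]}"
  shows "\<phi> (csc r * X (gword b js tail) m) = tensR (csc r * right_cur (gword b js tail) m)"
proof -
  have "set js \<subseteq> {1..N}" using js by auto
  then have "\<phi> (X (gword b js tail) m) = tensR (right_cur (gword b js tail) m)"
    by (simp only: \<phi>_Xcur(1)[OF gword_vertices[OF _ tail]] left_cur_trivial[OF js tail] current_mult_one)
  then show ?thesis by (simp only: \<phi>_hom tensR_hom)
qed

text \<open>Only the images of generators need inspection, since the target is closed under sums and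
  products by homogeneity of its generators.\<close>

lemma embedding:
  "algebra_embedding \<phi> (Wsub N q q1 q3 u v) (completed_tensor fdeg fdeg (Wprin N s3 ul vl) (heis2 3 (heis_param N q)))"
proof -
  let ?G = "{W k m | k m. 1 \<le> k \<and> k \<le> N}"
  let ?T = "completed_tensor fdeg fdeg (Wprin N s3 ul vl) (heis2 3 (heis_param N q))"
  let ?S = "tensL ` ?G \<union> tensR ` heis_gens"
  have T: "?T = completion (deg_prod fdeg fdeg) (alg_gen ?S)"
    unfolding completed_tensor_def heis2_gens Wprin_def alg_gen_tensor deg_prod_def ..
  have hom: "\<exists>d. homogeneous (deg_prod fdeg fdeg) d s" if "s \<in> ?S" for s
    using that unfolding heis_gens_def
    by (fast intro: tens_homogeneous homogeneous_W homogeneous_torus homogeneous_mulY homogeneous_derY)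
  have "\<phi> a \<in> ?T" if "a \<in> Wsub N q q1 q3 u v" for a
    using that unfolding Wsub_def
  proof induction
    case (scalar c)
    show ?case unfolding T \<phi>_hom by (intro completion_alg_gen alg_gen.scalar)
  next
    case (gen s)
    then consider m where "s = Gp m" | m where "s = Gm m" by blast
    then show ?case
    proof cases
      case 1
      have "current_mult (\<lambda>m. tensR (right_cur (gword 1 [1..<k + 1] []) m))
          (\<lambda>m. tensL (rescale (s3 powi (int k - 1)) (W k) m)) m \<in> ?T" if k: "k \<le> N" for k
      proof -
        have w: "fst ` set (gword 1 [1..<k + 1] []) \<subseteq> {0..N + 1}"
          by (rule gword_vertices) (use k in auto)
        show ?thesis unfolding right_cur_def heis2_gens
        proof (rule current_mult_vertex_op(2)[OF vertex_right(1)])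
          show "rescale (s3 powi (int k - 1)) (W k) j \<in> Wprin N s3 ul vl" for j by (rule W_mem[OF k])
          show "homogeneous fdeg j (rescale (s3 powi (int k - 1)) (W k) j)" for j
            unfolding rescale_def by (intro homogeneous_csc_mult homogeneous_W)
        qed (intro right_zero_gens[OF w] heis_gens_osc | assumption)+
      qed
      then show ?thesis unfolding 1 \<phi>_Gplus unfolding T by (intro completion_sum) auto
    next
      case 2
      have "right_cur [(0, 1)] m \<in> completion fdeg (alg_gen heis_gens)"
        using right_cur_current_in(2)[of "[(0, 1)]"] by (simp add: current_in_def heis2_gens)
      then show ?thesis unfolding 2 \<phi>_Gminus heis2_gens by (rule tensR_completion)
    qed
  next
    case (add a b)
    then show ?case unfolding T \<phi>_hom by (intro completion_add)
  next
    case (mult a b)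
    then show ?case unfolding T \<phi>_hom by (intro completion_mult[OF hom])
  qed
  then show ?thesis unfolding algebra_embedding_def
    by (auto simp: \<phi>_hom intro: inj_on_subset[OF inj_\<phi>])
qed

text \<open>The candidates for all higher generators at once, with \<open>n = N\<close> standing for
  \<open>K_N\<^sup>+\<close>: the words with a pole at \<open>rho n\<close>, evaluated there and
  weighted by their residues.\<close>

definition higher :: "(nat \<Rightarrow> nat \<Rightarrow> complex) \<Rightarrow> nat \<Rightarrow> fock current" where
  "higher r n M = (\<Sum>js | js \<in> strict_lists 1 N \<and> n \<in> poles (length js).
     csc (r (length js) n) * X (gword (rho n) js [(0, 1)]) M)"

lemma commutator_expansion:
  "\<exists>r. \<forall>m p. Gp m * Gm p - Gm p * Gp m = (\<Sum>n\<in>{1..N}. csc (rho n powi m) * higher r n (m + p))"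
proof -
  have "\<forall>k. \<exists>r. k \<le> N \<longrightarrow> (\<forall>js m p. set js \<subseteq> {1..N} \<longrightarrow> length js = k \<longrightarrow>
    X (gword 1 js []) m * X [(0, 1)] p - X [(0, 1)] p * X (gword 1 js []) m =
    (\<Sum>s\<in>poles k. csc (rho s powi m) * (csc (r s) * X (gword (rho s) js [(0, 1)]) (m + p))))"
    using word_commutator by blast
  from choice[OF this] obtain r where r: "\<forall>k. k \<le> N \<longrightarrow> (\<forall>js m p. set js \<subseteq> {1..N} \<longrightarrow> length js = k \<longrightarrow>
    X (gword 1 js []) m * X [(0, 1)] p - X [(0, 1)] p * X (gword 1 js []) m =
    (\<Sum>s\<in>poles k. csc (rho s powi m) * (csc (r k s) * X (gword (rho s) js [(0, 1)]) (m + p))))" ..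
  have "Gp m * Gm p - Gm p * Gp m = (\<Sum>n\<in>{1..N}. csc (rho n powi m) * higher r n (m + p))" for m p
  proof -
    let ?t = "\<lambda>js s. csc (rho s powi m) * (csc (r (length js) s) * X (gword (rho s) js [(0, 1)]) (m + p))"
    have "Gp m * Gm p - Gm p * Gp m = (\<Sum>js\<in>strict_lists 1 N.
        X (gword 1 js []) m * X [(0, 1)] p - X [(0, 1)] p * X (gword 1 js []) m)"
      by (simp only: Gplus_words Gminus_def sum_distrib_left sum_distrib_right sum_subtractf)
    also have "\<dots> = (\<Sum>js\<in>strict_lists 1 N. \<Sum>s\<in>{s \<in> {1..N}. s \<in> poles (length js)}. ?t js s)"
    proof (intro sum.cong refl)
      fix js assume js: "js \<in> strict_lists 1 N"
      have "{s \<in> {1..N}. s \<in> poles (length js)} = poles (length js)" using N by (auto simp: poles_def)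
      then show "X (gword 1 js []) m * X [(0, 1)] p - X [(0, 1)] p * X (gword 1 js []) m =
          (\<Sum>s\<in>{s \<in> {1..N}. s \<in> poles (length js)}. ?t js s)"
        using r length_strict_lists(1)[OF js] strict_lists_subset[OF js] by simp
    qed
    also have "\<dots> = (\<Sum>s\<in>{1..N}. \<Sum>js\<in>{js \<in> strict_lists 1 N. s \<in> poles (length js)}. ?t js s)"
      by (rule sum.swap_restrict) (simp_all add: finite_strict_lists)
    also have "\<dots> = (\<Sum>n\<in>{1..N}. csc (rho n powi m) * higher r n (m + p))"
      by (simp only: higher_def sum_distrib_left)
    finally show ?thesis .
  qed
  then show ?thesis by blast
qed

lemma higher_generators_iff:
  "higher_generators N q2 q3 Gp Gm K KN \<longleftrightarrow> (\<forall>m p. Gp m * Gm p - Gm p * Gp m =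
     (\<Sum>n\<in>{1..N}. csc (rho n powi m) * (if n < N then K n else KN) (m + p)))"
proof -
  have I: "{1..N} = insert N {1..N - 1}" using N by auto
  have "(\<Sum>n\<in>{1..N}. csc (rho n powi m) * (if n < N then K n else KN) (m + p)) =
     (\<Sum>n=1..N - 1. csc ((q3 powi (2 - int n)) powi m) * K n (m + p))
       + csc ((q2 * q3 powi (2 - int N)) powi m) * KN (m + p)" for m p
  proof -
    have "(\<Sum>n=1..N - 1. csc (rho n powi m) * (if n < N then K n else KN) (m + p))
        = (\<Sum>n=1..N - 1. csc ((q3 powi (2 - int n)) powi m) * K n (m + p))"
      using N by (intro sum.cong refl) (auto simp: rho_def)
    moreover have "N \<notin> {1..N - 1}" using N by auto
    ultimately show ?thesis unfolding I by (simp add: rho_def add.commute)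
  qed
  then show ?thesis unfolding higher_generators_def by simp
qed

text \<open>Along the pairs of modes \<open>(i, M - i)\<close> the commutators are combinations of
  the fixed elements \<open>D x M\<close> with coefficients \<open>rho x ^ i\<close>, and
  interpolation isolates one of them. As \<open>c\<close> and \<open>d\<close> depend on neither
  \<open>D\<close> nor \<open>C\<close>, the formula gives both uniqueness and membership in the
  algebra.\<close>

lemma mode_extraction:
  assumes n: "n \<in> {1..N}"
  shows "\<exists>c d. \<forall>D C. (\<forall>m p. C m p = (\<Sum>x\<in>{1..N}. csc (rho x powi m) * (D x :: fock current) (m + p))) \<longrightarrow>
    (\<forall>M. D n M = (\<Sum>i\<le>(d::nat). csc (c i) * C (int i) (M - int i)))"
proof -
  obtain c :: "nat \<Rightarrow> complex" and d where c: "\<forall>x\<in>{1..N}. (\<Sum>i\<le>d. c i * rho x ^ i) = (if x = n then 1 else 0)"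
    using delta_coefficients[OF _ inj_rho n] by auto
  have "D n M = (\<Sum>i\<le>d. csc (c i) * C (int i) (M - int i))"
    if C: "\<forall>m p. C m p = (\<Sum>x\<in>{1..N}. csc (rho x powi m) * (D x :: fock current) (m + p))" for D C M
  proof -
    have "(\<Sum>i\<le>d. csc (c i) * C (int i) (M - int i)) = (\<Sum>i\<le>d. \<Sum>x\<in>{1..N}. csc (c i * rho x ^ i) * D x M)"
      by (simp only: C[rule_format] sum_distrib_left mult.assoc[symmetric] csc_mult power_int_of_nat) simp
    also have "\<dots> = (\<Sum>x\<in>{1..N}. csc (\<Sum>i\<le>d. c i * rho x ^ i) * D x M)"
      by (subst sum.swap) (simp only: csc_sum sum_distrib_right)
    also have "\<dots> = (\<Sum>x\<in>{1..N}. if x = n then D x M else 0)"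
      by (intro sum.cong refl) (simp add: c csc_zero)
    also have "\<dots> = D n M" using n by simp
    finally show ?thesis ..
  qed
  then show ?thesis by blast
qed

lemma higher_unique:
  assumes D: "\<And>m p. Gp m * Gm p - Gm p * Gp m = (\<Sum>x\<in>{1..N}. csc (rho x powi m) * (D x :: fock current) (m + p))"
    and r: "\<And>m p. Gp m * Gm p - Gm p * Gp m = (\<Sum>x\<in>{1..N}. csc (rho x powi m) * higher r x (m + p))"
    and n: "n \<in> {1..N}"
  shows "D n M = higher r n M" "D n M \<in> Wsub N q q1 q3 u v"
proof -
  obtain c d where c: "\<forall>D C. (\<forall>m p. C m p = (\<Sum>x\<in>{1..N}. csc (rho x powi m) * (D x :: fock current) (m + p))) \<longrightarrow>
    (\<forall>M. D n M = (\<Sum>i\<le>(d::nat). csc (c i) * C (int i) (M - int i)))"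
    using mode_extraction[OF n] by blast
  let ?C = "\<lambda>m p. Gp m * Gm p - Gm p * Gp m"
  have d: "D n M = (\<Sum>i\<le>d. csc (c i) * ?C (int i) (M - int i))"
    using c[rule_format, of ?C D] D by blast
  moreover have "higher r n M = (\<Sum>i\<le>d. csc (c i) * ?C (int i) (M - int i))"
    using c[rule_format, of ?C "higher r"] r by blast
  ultimately show "D n M = higher r n M" by simp
  show "D n M \<in> Wsub N q q1 q3 u v" unfolding d Wsub_def
    by (intro alg_gen_sum alg_gen.mult alg_gen.scalar alg_gen_diff alg_gen.gen) auto
qed

lemma \<phi>_higher_one: "\<phi> (higher r 1 M) = tensR (csc (r 0 1) * right_cur (gword (rho 1) [] [(0, 1)]) M)"
proof -
  have "{js. js \<in> strict_lists 1 N \<and> 1 \<in> poles (length js)} = {[]}"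
    using N by (auto simp: poles_def strict_lists_nil split: if_splits)
  then have "higher r 1 M = csc (r 0 1) * X (gword (rho 1) [] [(0, 1)]) M" unfolding higher_def by simp
  then show ?thesis by (simp only: \<phi>_trivial_word insert_iff simp_thms)
qed

lemma \<phi>_higher_last:
  "\<phi> (higher r N M) = tensR (csc (r N N) * right_cur (gword (rho N) [1..<N + 1] [(0, 1)]) M)"
proof -
  have "{js. js \<in> strict_lists 1 N \<and> N \<in> poles (length js)} = {[1..<N + 1]}"
    using N length_strict_lists upt_strict_list[of N N] by (force simp: poles_def split: if_splits)
  then have "higher r N M = csc (r N N) * X (gword (rho N) [1..<N + 1] [(0, 1)]) M"
    unfolding higher_def by (simp del: upt_Suc)
  then show ?thesis by (simp only: \<phi>_trivial_word insert_iff simp_thms)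
qed

lemma \<phi>_higher_two:
  assumes "N \<ge> 3"
  shows "\<phi> (higher r 2 M) = tensR (csc (r 0 2) * right_cur (gword (rho 2) [] [(0, 1)]) M)
    + current_mult (\<lambda>m. tensR (csc (r 1 2) * right_cur (gword 1 [1..<1 + 1] [(0, 1)]) m)) (\<lambda>m. tensL (W 1 m)) M"
proof -
  let ?J = "{js. js \<in> strict_lists 1 N \<and> length js = 1}"
  have J: "{js. js \<in> strict_lists 1 N \<and> 2 \<in> poles (length js)} = insert [] ?J"
  proof (intro equalityI subsetI)
    fix js assume "js \<in> {js. js \<in> strict_lists 1 N \<and> 2 \<in> poles (length js)}"
    then have "js \<in> strict_lists 1 N" "length js = 0 \<or> length js = 1"
      using assms by (auto simp: poles_def le_Suc_eq split: if_splits)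
    then show "js \<in> insert [] ?J" by auto
  qed (use assms in \<open>auto simp: poles_def strict_lists_nil\<close>)
  \<comment> \<open>The second pole lies at \<open>z = w\<close>: the words of length one are not
    rescaled and add up to \<open>W 1\<close> itself.\<close>
  have rho: "rho 2 = 1" using assms by (simp add: rho_def)
  have one: "rescale (s3 powi (int 1 - 1)) (W 1) = W 1" by (simp add: fun_eq_iff rescale_def)
  have "higher r 2 M = csc (r 0 2) * X (gword (rho 2) [] [(0, 1)]) M + csc (r 1 2) * (\<Sum>js\<in>?J. X (gword 1 js [(0, 1)]) M)"
  proof -
    have "finite ?J" by (rule finite_subset[OF _ finite_strict_lists[of 1 N]]) auto
    moreover have "[] \<notin> ?J" by simp
    moreover have "(\<Sum>js\<in>?J. csc (r (length js) 2) * X (gword (rho 2) js [(0, 1)]) M) = (\<Sum>js\<in>?J. csc (r 1 2) * X (gword 1 js [(0, 1)]) M)"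
      by (rule sum.cong) (auto simp: rho)
    ultimately show ?thesis unfolding higher_def J
      by (simp only: sum.insert sum_distrib_left list.size simp_thms)
  qed
  then have "\<phi> (higher r 2 M) = \<phi> (csc (r 0 2) * X (gword (rho 2) [] [(0, 1)]) M)
      + csc (r 1 2) * (\<Sum>js\<in>?J. \<phi> (X (gword 1 js [(0, 1)]) M))"
    by (simp only: \<phi>_hom \<phi>_sum)
  also have "\<phi> (csc (r 0 2) * X (gword (rho 2) [] [(0, 1)]) M) = tensR (csc (r 0 2) * right_cur (gword (rho 2) [] [(0, 1)]) M)"
    by (rule \<phi>_trivial_word) auto
  also have "csc (r 1 2) * (\<Sum>js\<in>?J. \<phi> (X (gword 1 js [(0, 1)]) M)) =
      current_mult (\<lambda>m. tensR (csc (r 1 2) * right_cur (gword 1 [1..<1 + 1] [(0, 1)]) m)) (\<lambda>m. tensL (W 1 m)) M"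
    using \<phi>_length[of "[(0, 1)]" 1 M] assms unfolding one by (simp only: csc_current_mult insert_iff simp_thms)
  finally show ?thesis .
qed

end

theorem theorem4p15:
  fixes N :: nat and q q1 q2 q3 s3 :: complex
    and u v ul vl :: "nat \<Rightarrow> nat \<Rightarrow> nat \<Rightarrow> complex"
  assumes "N \<ge> 2"
    and "generic_parameters q1 q2 q3"
    and "q\<^sup>2 = q2" and "s3\<^sup>2 = q3"
    and "quiver_realization (Qsub N q1 q3) q (N + 1) u v"
    and "lambda_realization N q1 q2 q3 ul vl"
  shows "let Gp = Gplus N q q1 q3 u v; Gm = Gminus N q q1 q3 u v; W = Wcur N s3 ul vl in
    W 0 = one_current \<and> W N = one_current \<and>
    (\<exists>K KN. higher_generators N q2 q3 Gp Gm K KN) \<and>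
    (\<exists>(d :: nat) (p :: nat \<Rightarrow> nat \<Rightarrow> complex) (\<phi> :: fock lop \<Rightarrow> (fock \<times> fock) lop).
      (\<forall>i j. p i j \<noteq> 0) \<and>
      algebra_embedding \<phi> (Wsub N q q1 q3 u v)
        (completed_tensor fdeg fdeg (Wprin N s3 ul vl) (heis2 d p)) \<and>
      (\<exists>A. current_in A (heis2_completed d p) \<and> (\<forall>m. \<phi> (Gm m) = tensR (A m))) \<and>
      (\<exists>A. (\<forall>k\<le>N. current_in (A k) (heis2_completed d p)) \<and>
        (\<forall>m. \<phi> (Gp m) = (\<Sum>k=0..N. current_mult (tensR \<circ> A k)
          (tensL \<circ> rescale (s3 powi (int k - 1)) (W k)) m))) \<and>
      (\<forall>K KN. higher_generators N q2 q3 Gp Gm K KN \<longrightarrow>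
        (\<forall>n\<in>{1..N - 1}. \<forall>m. K n m \<in> Wsub N q q1 q3 u v) \<and>
        (\<forall>m. KN m \<in> Wsub N q q1 q3 u v) \<and>
        (\<exists>B. current_in B (heis2_completed d p) \<and> (\<forall>m. \<phi> (K 1 m) = tensR (B m))) \<and>
        (\<exists>B. current_in B (heis2_completed d p) \<and> (\<forall>m. \<phi> (KN m) = tensR (B m))) \<and>
        (N \<ge> 3 \<longrightarrow> (\<exists>B0 B1. current_in B0 (heis2_completed d p) \<and>
          current_in B1 (heis2_completed d p) \<and>
          (\<forall>m. \<phi> (K 2 m) =
            tensR (B0 m) + current_mult (tensR \<circ> B1) (tensL \<circ> W 1) m)))))"
  using realization_exists[OF assms(1-3,5,6)]
proof (elim exE conjE)
  fix xu xv M M' :: "nat \<Rightarrow> nat \<Rightarrow> nat \<Rightarrow> complex"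
  assume MM': "\<forall>n r t. r < N + 1 \<longrightarrow> t < N + 1 \<longrightarrow> (\<Sum>s<N + 1. M n r s * M' n s t) = (if r = t then 1 else 0)"
    and M'M: "\<forall>n r t. r < N + 1 \<longrightarrow> t < N + 1 \<longrightarrow> (\<Sum>s<N + 1. M' n r s * M n s t) = (if r = t then 1 else 0)"
    and Mu: "\<forall>n>0. \<forall>j\<in>{0..N + 1}. \<forall>s<N + 1. (\<Sum>r<N + 1. M n s r * u j n r) = both_parts N (\<lambda>a. ul a n) (xu n) j s"
    and vM: "\<forall>n>0. \<forall>i\<in>{0..N + 1}. \<forall>s<N + 1. (\<Sum>r<N + 1. v i n r * M' n r s) = both_parts N (\<lambda>a. vl a n) (xv n) i s"
  obtain p p' :: "fock lop" where p: "p * p' = 1" "p' * p = 1"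
    and pc: "\<And>f n. p * cre (N + 1) f n * p' = cre (N + 1) (\<lambda>n s. \<Sum>r<N + 1. M n s r * f n r) n"
    and pa: "\<And>f n. p * ann (N + 1) f n * p' = ann (N + 1) (\<lambda>n s. \<Sum>r<N + 1. f n r * M' n r s) n"
    and pt: "\<And>\<sigma> g. p * torus \<sigma> g * p' = torus \<sigma> g"
    by (rule change_of_variables[of "N + 1" M M', OF MM'[rule_format] M'M[rule_format]]) (assumption | rule that)+
  interpret intertwiner N q q1 q2 q3 s3 u v ul vl xu xv p p'
  proof
    fix n :: nat and w :: fword assume n: "n > 0" and w: "fst ` set w \<subseteq> {0..N + 1}"
    show "p * cre (N + 1) (word_coeff pos u w) n * p' =
        cre (N + 1) (word_coeff pos (\<lambda>i n. both_parts N (\<lambda>a. ul a n) (xu n) i) w) n"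
      unfolding pc
    proof (rule cre_cong)
      fix s assume s: "s < N + 1"
      have "(\<Sum>r<N + 1. M n s r * word_coeff pos u w n r) = word_coeff pos (\<lambda>i n s. \<Sum>r<N + 1. M n s r * u i n r) w n s"
        unfolding sum_word_coeff by (simp only: word_coeff_def)
      also have "\<dots> = word_coeff pos (\<lambda>i n. both_parts N (\<lambda>a. ul a n) (xu n) i) w n s"
        by (rule word_coeff_cong) (rule Mu[rule_format, OF n subsetD[OF w] s])
      finally show "(\<Sum>r<N + 1. M n s r * word_coeff pos u w n r) = \<dots>" .
    qed
    show "p * ann (N + 1) (word_coeff neg v w) n * p' =
        ann (N + 1) (word_coeff neg (\<lambda>i n. both_parts N (\<lambda>a. vl a n) (xv n) i) w) n"
      unfolding pa
    proof (rule ann_cong)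
      fix s assume s: "s < N + 1"
      have "(\<Sum>r<N + 1. word_coeff neg v w n r * M' n r s) = word_coeff neg (\<lambda>i n s. \<Sum>r<N + 1. v i n r * M' n r s) w n s"
        unfolding sum_word_coeff by (simp only: word_coeff_def)
      also have "\<dots> = word_coeff neg (\<lambda>i n. both_parts N (\<lambda>a. vl a n) (xv n) i) w n s"
        by (rule word_coeff_cong) (rule vM[rule_format, OF n subsetD[OF w] s])
      finally show "(\<Sum>r<N + 1. word_coeff neg v w n r * M' n r s) = \<dots>" .
    qed
  next
    fix n i j assume "n > (0::nat)" "i \<in> {0..N + 1}" "j \<in> {0..N + 1}"
    then show "(\<Sum>r<N + 1. v i n r * u j n r) = Cmat (Qsub N q1 q3) q n i j / of_nat n"
      using assms(5) unfolding quiver_realization_def by (simp add: Qsub_def)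
  qed (use assms p pt in \<open>auto simp: lambda_realization_def\<close>)
  obtain r where r: "\<And>m p. Gp m * Gm p - Gm p * Gp m = (\<Sum>n\<in>{1..N}. csc (rho n powi m) * higher r n (m + p))"
    using commutator_expansion by blast
  let ?H = "heis2_completed 3 (heis_param N q)"
  have ex: "\<exists>K KN. higher_generators N q2 q3 Gp Gm K KN"
  proof (intro exI)
    show "higher_generators N q2 q3 Gp Gm (higher r) (higher r N)"
      unfolding higher_generators_iff r by (intro allI sum.cong refl) auto
  qed
  have Gm: "\<exists>A. current_in A ?H \<and> (\<forall>m. \<phi> (Gm m) = tensR (A m))"
    using right_cur_current_in(2)[of "[(0, 1)]"] \<phi>_Gminus by auto
  have w: "fst ` set (gword b [1..<k + 1] tail) \<subseteq> {0..N + 1}" if "k \<le> N" "tail \<in> {[], [(0, 1)]}" for b k tail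
    by (rule gword_vertices[OF _ that(2)]) (use that(1) in auto)
  have Gp: "\<exists>A. (\<forall>k\<le>N. current_in (A k) ?H) \<and> (\<forall>m. \<phi> (Gp m) = (\<Sum>k=0..N. current_mult (tensR \<circ> A k)
          (tensL \<circ> rescale (s3 powi (int k - 1)) (W k)) m))"
  proof (intro exI[of _ "\<lambda>k. right_cur (gword 1 [1..<k + 1] [])"] conjI allI impI)
    show "current_in (right_cur (gword 1 [1..<k + 1] [])) ?H" if "k \<le> N" for k
      by (rule right_cur_current_in(2)[OF w[OF that]]) simp
  qed (simp only: \<phi>_Gplus o_def)
  have K: "(\<forall>n\<in>{1..N - 1}. \<forall>m. K n m \<in> Wsub N q q1 q3 u v) \<and>
        (\<forall>m. KN m \<in> Wsub N q q1 q3 u v) \<and>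
        (\<exists>B. current_in B ?H \<and> (\<forall>m. \<phi> (K 1 m) = tensR (B m))) \<and>
        (\<exists>B. current_in B ?H \<and> (\<forall>m. \<phi> (KN m) = tensR (B m))) \<and>
        (N \<ge> 3 \<longrightarrow> (\<exists>B0 B1. current_in B0 ?H \<and> current_in B1 ?H \<and>
          (\<forall>m. \<phi> (K 2 m) = tensR (B0 m) + current_mult (tensR \<circ> B1) (tensL \<circ> W 1) m)))"
    if "higher_generators N q2 q3 Gp Gm K KN" for K KN
  proof -
    \<comment> \<open>The given currents are an arbitrary solution of the commutator identity.
      Appending \<open>KN\<close> as the member with index \<open>N\<close> makes them comparable
      with \<open>higher r\<close> by uniqueness.\<close>
    define D where "D n = (if n < N then K n else KN)" for n
    have D: "Gp m * Gm p - Gm p * Gp m = (\<Sum>n\<in>{1..N}. csc (rho n powi m) * D n (m + p))" for m p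
      using that unfolding higher_generators_iff D_def by blast
    note H = higher_unique[of D r, OF D r]
    have KD: "K n = D n" if "n < N" for n using that by (simp add: D_def)
    have KND: "KN = D N" by (simp add: D_def)
    have wn: "fst ` set (gword b [] [(0, 1)]) \<subseteq> {0..N + 1}" for b using w[of 0 "[(0, 1)]" b] by simp
    have "\<exists>B. current_in B ?H \<and> (\<forall>m. \<phi> (K 1 m) = tensR (B m))"
    proof (intro exI conjI allI)
      show "current_in (\<lambda>m. csc (r 0 1) * right_cur (gword (rho 1) [] [(0, 1)]) m) ?H"
        by (rule right_cur_current_in(1)[OF wn])
      have "K 1 m = higher r 1 m" for m using N by (simp add: KD H(1))
      then show "\<phi> (K 1 m) = tensR (csc (r 0 1) * right_cur (gword (rho 1) [] [(0, 1)]) m)" for m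
        by (simp only: \<phi>_higher_one)
    qed
    moreover have "\<exists>B. current_in B ?H \<and> (\<forall>m. \<phi> (KN m) = tensR (B m))"
    proof (intro exI conjI allI)
      show "current_in (\<lambda>m. csc (r N N) * right_cur (gword (rho N) [1..<N + 1] [(0, 1)]) m) ?H"
        by (rule right_cur_current_in(1)[OF w]) auto
      have "KN m = higher r N m" for m using N by (simp add: KND H(1))
      then show "\<phi> (KN m) = tensR (csc (r N N) * right_cur (gword (rho N) [1..<N + 1] [(0, 1)]) m)" for m
        by (simp only: \<phi>_higher_last)
    qed
    moreover have "\<exists>B0 B1. current_in B0 ?H \<and> current_in B1 ?H \<and>
          (\<forall>m. \<phi> (K 2 m) = tensR (B0 m) + current_mult (tensR \<circ> B1) (tensL \<circ> W 1) m)" if N3: "N \<ge> 3"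
    proof (intro exI conjI allI)
      show "current_in (\<lambda>m. csc (r 0 2) * right_cur (gword (rho 2) [] [(0, 1)]) m) ?H"
        by (rule right_cur_current_in(1)[OF wn])
      show "current_in (\<lambda>m. csc (r 1 2) * right_cur (gword 1 [1..<1 + 1] [(0, 1)]) m) ?H"
        by (rule right_cur_current_in(1)[OF w]) (use N in auto)
      show "\<phi> (K 2 m) = tensR (csc (r 0 2) * right_cur (gword (rho 2) [] [(0, 1)]) m)
          + current_mult (tensR \<circ> (\<lambda>m. csc (r 1 2) * right_cur (gword 1 [1..<1 + 1] [(0, 1)]) m)) (tensL \<circ> W 1) m" for m
      proof -
        have "K 2 m = higher r 2 m" using N3 by (simp add: KD H(1))
        then show ?thesis by (simp only: \<phi>_higher_two[OF N3] o_def)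
      qed
    qed
    moreover have "\<forall>n\<in>{1..N - 1}. \<forall>m. K n m \<in> Wsub N q q1 q3 u v"
      using H(2) N by (auto simp: KD)
    moreover have "\<forall>m. KN m \<in> Wsub N q q1 q3 u v" using H(2)[of N] N by (auto simp: KND)
    ultimately show ?thesis by blast
  qed
  have p: "\<forall>i j. heis_param N q i j \<noteq> 0" using nonzero(4) by (simp add: heis_param_def)
  have W: "W 0 = one_current" "W N = one_current" by (simp_all add: W_trivial)
  \<comment> \<open>The zero modes of the Heisenberg algebra form a torus of rank 3, its directions
    being the right components of \<open>X_0\<close>, of any \<open>Y_j\<close>, and of
    \<open>X_{N+1}\<close>.\<close>
  show ?thesis unfolding Let_def
    by (rule conjI[OF W(1)], rule conjI[OF W(2)], rule conjI[OF ex], rule exI[of _ 3], rule exI[of _ "heis_param N q"],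
      rule exI[of _ \<phi>], rule conjI[OF p], rule conjI[OF embedding], rule conjI[OF Gm], rule conjI[OF Gp],
      intro allI impI, rule K)
qed

end
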